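(* Fix integers $d,n>0$. For a prime power $q$ let $a_0,\ldots,a_{n-1}$ be independent random variables uniformly distributed on $\mathbb{F}_q[t]_{\le d}$, let $f=X^{q^n}+a_{n-1}X^{q^{n-1}}+\cdots+a_0X$, and let $G_f$ be the Galois group of $f$ over $\mathbb{F}_q(t)$, viewed as a subgroup of $\mathrm{GL}_n(q)$ via its action on the roots. Then $$\lim_{q\to\infty}\mathrm{Prob}(G_f=\mathrm{GL}_n(q))=1,$$ where $q$ ranges over prime powers.
   Context: $\mathbb{F}_q[t]_{\le d}$ is the set of polynomials of degree at most $d$. When $a_0\ne0$, the roots $Z(f)$ of $f$ form an $n$-dimensional $\mathbb{F}_q$-vector space on which $G_f$ acts faithfully and $\mathbb{F}_q$-linearly, giving $G_f\leqslant\mathrm{GL}(Z(f))\cong\mathrm{GL}_n(q)$. *)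

theory Defs
  imports
    "HOL-Algebra.Algebraic_Closure"
    "HOL-Algebra.Generated_Fields"
    "HOL-Algebra.Bij"
    "HOL-Number_Theory.Prime_Powers"
    "HOL-Probability.Product_PMF"
begin

text \<open>
  A finite field cannot be a type here, because its order varies inside the statement. So all the
  fields live inside one record: \<open>L\<close> is an algebraic closure of \<open>K = F(t)\<close>, where \<open>F\<close> is
  a field with \<open>q\<close> elements and \<open>t\<close> is transcendental over \<open>F\<close>. This determines
  \<open>(L, K, F, t)\<close> up to isomorphism.
\<close>

locale rational_function_field_closure = algebraic_closure L K
  for L :: "('k, 'm) ring_scheme" (structure) and K :: "'k set" +
  fixes F :: "'k set" and t :: 'k and q :: nat
  assumes constants: "subfield F L"
    and card_constants: "finite F" "card F = q"
    and variable: "t \<in> carrier L" "(transcendental over F) t"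
    and generated: "K = generate_field L (insert t F)"

context ring
begin

text \<open>The set $F[t]_{\le d}$, as a subset of the ambient field. The zero polynomial \<open>[]\<close> has
  degree 0 in the list representation, so it is included.\<close>

definition polys_upto :: "'a set \<Rightarrow> 'a \<Rightarrow> nat \<Rightarrow> 'a set"
  where "polys_upto F t d = {eval p t | p. p \<in> carrier (F[X]) \<and> Polynomials.degree p \<le> d}"

definition additive_poly :: "'a set \<Rightarrow> nat \<Rightarrow> nat \<Rightarrow> (nat \<Rightarrow> 'a) \<Rightarrow> 'a list"
  where "additive_poly K q n a =
    X [^]\<^bsub>K[X]\<^esub> (q ^ n) \<oplus>\<^bsub>K[X]\<^esub>
    (\<Oplus>\<^bsub>K[X]\<^esub> i \<in> {..<n}. poly_of_const (a i) \<otimes>\<^bsub>K[X]\<^esub> X [^]\<^bsub>K[X]\<^esub> (q ^ i))"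

definition zero_set :: "'a list \<Rightarrow> 'a set"
  where "zero_set f = {x. is_root f x}"

definition splitting_field :: "'a set \<Rightarrow> 'a list \<Rightarrow> 'a set"
  where "splitting_field K f = generate_field R (K \<union> zero_set f)"

text \<open>The automorphisms of the splitting field of \<open>f\<close> that fix \<open>K\<close> pointwise. This is meant for
  polynomials \<open>f\<close> over \<open>K\<close> that split in the ambient field.\<close>

definition galois_group :: "'a set \<Rightarrow> 'a list \<Rightarrow> ('a \<Rightarrow> 'a) monoid"
  where "galois_group K f =
    (let E = splitting_field K f in
      BijGroup E
        \<lparr>carrier := {\<sigma> \<in> Bij E \<inter> ring_hom (R\<lparr>carrier := E\<rparr>) (R\<lparr>carrier := E\<rparr>). \<forall>x\<in>K. \<sigma> x = x}\<rparr>)"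

text \<open>\<open>V\<close> is an \<open>F\<close>-subspace of the ambient ring. The elements of the group are extensional
  functions, that is, they are \<open>undefined\<close> outside \<open>V\<close>.\<close>

definition general_linear_group :: "'a set \<Rightarrow> 'a set \<Rightarrow> ('a \<Rightarrow> 'a) monoid"
  where "general_linear_group F V =
    BijGroup V
      \<lparr>carrier := {\<phi> \<in> Bij V. (\<forall>u\<in>V. \<forall>v\<in>V. \<phi> (u \<oplus> v) = \<phi> u \<oplus> \<phi> v) \<and>
                             (\<forall>c\<in>F. \<forall>v\<in>V. \<phi> (c \<otimes> v) = c \<otimes> \<phi> v)}\<rparr>"

text \<open>The permutation group on the roots of \<open>f\<close> induced by the Galois group.\<close>

definition galois_image :: "'a set \<Rightarrow> 'a list \<Rightarrow> ('a \<Rightarrow> 'a) set"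
  where "galois_image K f = (\<lambda>\<sigma>. restrict \<sigma> (zero_set f)) ` carrier (galois_group K f)"

text \<open>The event $G_f = \mathrm{GL}_n(q)$. If \<open>a 0\<close> is zero, the root space of \<open>f\<close> has dimension
  less than \<open>n\<close>, so that case is excluded explicitly; otherwise $\mathrm{GL}_n(q)$ is the group of
  all \<open>F\<close>-linear bijections of the root space.\<close>

definition galois_group_is_GL :: "'a set \<Rightarrow> 'a set \<Rightarrow> nat \<Rightarrow> nat \<Rightarrow> (nat \<Rightarrow> 'a) \<Rightarrow> bool"
  where "galois_group_is_GL K F q n a \<longleftrightarrow>
    a 0 \<noteq> \<zero> \<and>
    galois_image K (additive_poly K q n a) =
      carrier (general_linear_group F (zero_set (additive_poly K q n a)))"

text \<open>The law of \<open>n\<close> independent, uniformly distributed coefficients in $F[t]_{\le d}$. The value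
  \<open>\<zero>\<close> at indices \<open>i \<ge> n\<close> is immaterial.\<close>

definition random_coeffs :: "'a set \<Rightarrow> 'a \<Rightarrow> nat \<Rightarrow> nat \<Rightarrow> (nat \<Rightarrow> 'a) pmf"
  where "random_coeffs F t d n = Pi_pmf {..<n} \<zero> (\<lambda>_. pmf_of_set (polys_upto F t d))"

end

end

(*
  Let V be the space of roots of f. Specializing t to a constant tau turns f into an additive
  polynomial over F_q with coefficients a_i(tau); if its linear coefficient is nonzero, the
  Frobenius map y |-> y^q on its roots is conjugate, as an F_q-linear map, to the action on V of an
  element of G_f. To see this without ramification theory, expand the roots of f in power series
  in t - tau: the Frobenius map on the coefficients of the series permutes these expansions.

  If sum a_i(tau) X^i + X^n is the minimal polynomial of a generator of the multiplicative group
  of the field with q^n elements, this element is a Singer cycle S of V. If instead the polynomial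
  is (X - lam) h(X / lam), where h is the minimal polynomial of such a generator for q^(n-1), the
  element has an eigenvector p and, up to the scalar lam, is a Singer cycle on a complementary
  hyperplane. Powers of the two elements are all the scalars and all the homologies
  with center p and that hyperplane as axis. Conjugating by S gives such homologies for every center.
  For q > 5 some center then has two axes: otherwise the axis of P contains Q iff the axis of Q
  contains P, and a computation in a plane forces c^2 = -1 for every scalar c other than 0, 1, -1.
  Two axes produce transvections, and S carries them to every center. Composing a given element of
  GL(V) with such maps enlarges its fixed space step by step, so it belongs to the group. This
  replaces the classification of the linear groups that contain a Singer cycle.

  For random coefficients the vectors (a_i(tau)) are pairwise independent as tau varies, since d > 0,
  and uniform on F_q^n. The proportion of vectors of either kind is at least a constant
  over log q, by phi(N) >= N / (log2 N + 1). Chebyshev's inequality over the q values of tau shows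
  that both kinds occur with probability 1 - O(log q / q).
*)
theory Submission
  imports Defs "HOL-Algebra.Multiplicative_Group" "HOL-Number_Theory.Totient" "HOL-Real_Asymp.Real_Asymp"
begin

text \<open>Each constant tau yields its element only up to an identification of V with the roots of
  the specialized polynomial, and the identifications for different tau are unrelated. So the
  position of p and its hyperplane relative to S is unknown, and all that may be used of S is its
  transitivity on nonzero vectors. Both kinds are needed: S alone generates a cyclic group, and the
  second kind fixes the line of p. For n = 1 the scalars are all of GL(V) and the first kind
  suffices. A single tau is only known to hit either kind with probability of order 1 / log q; hence
  the use of all q values and of the second moment. The kinds are counted through their roots: a
  generator of a finite field is a root of a polynomial of the first kind, and one polynomial has at
  most n roots. The nonzero linear coefficient makes the roots of the specialized polynomial
  distinct, so each lifts to exactly one power series. Since there are q^n roots before and after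
  specialization, counting shows that the expansions of the roots are exactly these series.\<close>

section \<open>Linear groups generated by homologies\<close>

text \<open>The space V is an F-subspace of the field R itself, so scaling a vector is
  multiplication in R. By \<open>G_cong\<close>, G contains every function that agrees on V with one
  of its members; products and powers therefore need no restriction to V. Finiteness of V takes the
  place of a dimension.\<close>

locale linear_group = field R for R (structure) +
  fixes F V :: "'a set" and G :: "('a \<Rightarrow> 'a) set"
  assumes subfield_F: "subfield F R"
    and finite_V: "finite V" and V_carrier: "V \<subseteq> carrier R" and zero_V: "\<zero> \<in> V"
    and add_V: "x \<in> V \<Longrightarrow> y \<in> V \<Longrightarrow> x \<oplus> y \<in> V"
    and smult_V: "c \<in> F \<Longrightarrow> x \<in> V \<Longrightarrow> c \<otimes> x \<in> V"
    and G_closed: "g \<in> G \<Longrightarrow> x \<in> V \<Longrightarrow> g x \<in> V"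
    and G_add: "g \<in> G \<Longrightarrow> x \<in> V \<Longrightarrow> y \<in> V \<Longrightarrow> g (x \<oplus> y) = g x \<oplus> g y"
    and G_smult: "g \<in> G \<Longrightarrow> c \<in> F \<Longrightarrow> x \<in> V \<Longrightarrow> g (c \<otimes> x) = c \<otimes> g x"
    and G_comp: "g \<in> G \<Longrightarrow> h \<in> G \<Longrightarrow> (\<lambda>x. g (h x)) \<in> G"
    and G_inv: "g \<in> G \<Longrightarrow> \<exists>h\<in>G. \<forall>x\<in>V. h (g x) = x \<and> g (h x) = x"
    and G_cong: "g \<in> G \<Longrightarrow> (\<And>x. x \<in> V \<Longrightarrow> h x = g x) \<Longrightarrow> h \<in> G"
    and G_id: "(\<lambda>x. x) \<in> G"
begin

section \<open>Functionals, dilations and homologies\<close>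

definition functional :: "('a \<Rightarrow> 'a) \<Rightarrow> bool" where
  "functional \<psi> \<longleftrightarrow> (\<forall>x\<in>V. \<psi> x \<in> F) \<and> (\<forall>x\<in>V. \<forall>y\<in>V. \<psi> (x \<oplus> y) = \<psi> x \<oplus> \<psi> y)
     \<and> (\<forall>c\<in>F. \<forall>x\<in>V. \<psi> (c \<otimes> x) = c \<otimes> \<psi> x)"

text \<open>One formula for two kinds of maps with center p: a transvection if
  \<open>\<psi> p = \<zero>\<close>, otherwise a homology with factor
  \<open>\<one> \<oplus> \<psi> p\<close>, provided that this factor is not zero.\<close>

definition dilation :: "'a \<Rightarrow> ('a \<Rightarrow> 'a) \<Rightarrow> 'a \<Rightarrow> 'a" where
  "dilation p \<psi> x = x \<oplus> \<psi> x \<otimes> p"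

text \<open>The whole group of homologies with center p and axis the kernel of \<phi> has to lie in
  G: the dilation for c fixes the axis and multiplies p by c. The normalization
  \<open>\<phi> p = \<one>\<close> makes the functional unique for a given axis, so that axes can be
  compared as functionals.\<close>

definition homology :: "'a \<Rightarrow> ('a \<Rightarrow> 'a) \<Rightarrow> bool" where
  "homology p \<phi> \<longleftrightarrow> p \<in> V \<and> functional \<phi> \<and> \<phi> p = \<one>
     \<and> (\<forall>c\<in>F. c \<noteq> \<zero> \<longrightarrow> dilation p (\<lambda>x. (c \<ominus> \<one>) \<otimes> \<phi> x) \<in> G)"

lemma F_closed [simp]:
  "c \<in> F \<Longrightarrow> c \<in> carrier R" "\<zero> \<in> F" "\<one> \<in> F"
  "c \<in> F \<Longrightarrow> d \<in> F \<Longrightarrow> c \<oplus> d \<in> F" "c \<in> F \<Longrightarrow> d \<in> F \<Longrightarrow> c \<otimes> d \<in> F"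
  "c \<in> F \<Longrightarrow> \<ominus> c \<in> F" "c \<in> F \<Longrightarrow> d \<in> F \<Longrightarrow> c \<ominus> d \<in> F"
  using subringE[OF subfieldE(1)[OF subfield_F]] subfieldE(3)[OF subfield_F]
  by (auto simp: a_minus_def)

lemma F_inv: "c \<in> F \<Longrightarrow> c \<noteq> \<zero> \<Longrightarrow> inv c \<in> F" "c \<in> F \<Longrightarrow> c \<noteq> \<zero> \<Longrightarrow> c \<otimes> inv c = \<one>"
  "c \<in> F \<Longrightarrow> c \<noteq> \<zero> \<Longrightarrow> inv c \<otimes> c = \<one>"
  using subfield_m_inv[OF subfield_F, of c] by auto

lemma V_closed [simp]: "x \<in> V \<Longrightarrow> x \<in> carrier R"
  using V_carrier by auto

lemma V_minus: "x \<in> V \<Longrightarrow> y \<in> V \<Longrightarrow> x \<ominus> y \<in> V"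
proof -
  assume x: "x \<in> V" and y: "y \<in> V"
  have "x \<oplus> (\<ominus> \<one>) \<otimes> y \<in> V" using x y by (intro add_V smult_V) auto
  thus ?thesis using x y by (simp add: a_minus_def l_minus)
qed

lemma functionalD:
  assumes "functional \<psi>"
  shows "x \<in> V \<Longrightarrow> \<psi> x \<in> F" "x \<in> V \<Longrightarrow> y \<in> V \<Longrightarrow> \<psi> (x \<oplus> y) = \<psi> x \<oplus> \<psi> y"
    "c \<in> F \<Longrightarrow> x \<in> V \<Longrightarrow> \<psi> (c \<otimes> x) = c \<otimes> \<psi> x"
  using assms by (auto simp: functional_def)

lemma functional_zero: "functional \<psi> \<Longrightarrow> \<psi> \<zero> = \<zero>"
  using functionalD(3)[of \<psi> "\<zero>" "\<zero>"] functionalD(1)[of \<psi> "\<zero>"] zero_V by auto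

lemma functional_minus:
  assumes "functional \<psi>" "x \<in> V" "y \<in> V" shows "\<psi> (x \<ominus> y) = \<psi> x \<ominus> \<psi> y"
proof -
  have "\<psi> (x \<ominus> y) = \<psi> (x \<oplus> (\<ominus> \<one>) \<otimes> y)"
    using assms by (simp add: a_minus_def l_minus)
  also have "\<dots> = \<psi> x \<oplus> (\<ominus> \<one>) \<otimes> \<psi> y"
    using assms by (simp add: functionalD smult_V)
  finally show ?thesis using functionalD(1)[OF assms(1)] assms by (simp add: a_minus_def l_minus)
qed

lemma functional_comb:
  assumes "functional \<psi>" "functional \<xi>" "c \<in> F" "d \<in> F"
  shows "functional (\<lambda>x. c \<otimes> \<psi> x \<oplus> d \<otimes> \<xi> x)"
  unfolding functional_def
proof (intro conjI ballI)
  fix x y assume xy: "x \<in> V" "y \<in> V"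
  note cl = xy assms(3,4) functionalD(1)[OF assms(1)] functionalD(1)[OF assms(2)]
  show "c \<otimes> \<psi> x \<oplus> d \<otimes> \<xi> x \<in> F" using cl by simp
  show "c \<otimes> \<psi> (x \<oplus> y) \<oplus> d \<otimes> \<xi> (x \<oplus> y) = c \<otimes> \<psi> x \<oplus> d \<otimes> \<xi> x \<oplus> (c \<otimes> \<psi> y \<oplus> d \<otimes> \<xi> y)"
    using cl assms by (simp add: functionalD(2) r_distr a_ac)
next
  fix e x assume ex: "e \<in> F" "x \<in> V"
  note cl = ex assms(3,4) functionalD(1)[OF assms(1)] functionalD(1)[OF assms(2)]
  show "c \<otimes> \<psi> (e \<otimes> x) \<oplus> d \<otimes> \<xi> (e \<otimes> x) = e \<otimes> (c \<otimes> \<psi> x \<oplus> d \<otimes> \<xi> x)"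
    using cl assms by (simp add: functionalD(3) r_distr m_ac)
qed

lemma functional_comp:
  assumes "functional \<psi>" "g \<in> G" shows "functional (\<lambda>x. \<psi> (g x))"
  using assms(1) G_add[OF assms(2)] G_smult[OF assms(2)] G_closed[OF assms(2)]
  by (auto simp: functional_def)

lemma functional_scale: "functional \<psi> \<Longrightarrow> c \<in> F \<Longrightarrow> functional (\<lambda>x. c \<otimes> \<psi> x)"
  unfolding functional_def by (auto simp: r_distr m_ac)

lemma dilation_conj:
  assumes "dilation p \<psi> \<in> G" "functional \<psi>" "p \<in> V" "g \<in> G" "h \<in> G"
    and inv: "\<And>x. x \<in> V \<Longrightarrow> h (g x) = x" "\<And>x. x \<in> V \<Longrightarrow> g (h x) = x"
  shows "dilation (g p) (\<lambda>x. \<psi> (h x)) \<in> G"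
proof (rule G_cong)
  show "(\<lambda>x. g ((\<lambda>x. dilation p \<psi> (h x)) x)) \<in> G"
    using G_comp[OF assms(4) G_comp[OF assms(1,5)]] .
  fix x assume x: "x \<in> V"
  then have hx: "h x \<in> V" by (rule G_closed[OF assms(5)])
  have \<psi>h: "\<psi> (h x) \<in> F" using functionalD(1)[OF assms(2) hx] .
  have "g (h x \<oplus> \<psi> (h x) \<otimes> p) = g (h x) \<oplus> \<psi> (h x) \<otimes> g p"
    using G_add[OF assms(4) hx smult_V[OF \<psi>h assms(3)]] G_smult[OF assms(4) \<psi>h assms(3)] by simp
  thus "dilation (g p) (\<lambda>x. \<psi> (h x)) x = g (dilation p \<psi> (h x))"
    unfolding dilation_def using inv(2)[OF x] by simp
qed

lemma homology_conj:
  assumes "homology p \<phi>" "g \<in> G" "h \<in> G"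
    and inv: "\<And>x. x \<in> V \<Longrightarrow> h (g x) = x" "\<And>x. x \<in> V \<Longrightarrow> g (h x) = x"
  shows "homology (g p) (\<lambda>x. \<phi> (h x))"
proof -
  have p: "p \<in> V" "functional \<phi>" "\<phi> p = \<one>"
    and D: "\<And>c. c \<in> F \<Longrightarrow> c \<noteq> \<zero> \<Longrightarrow> dilation p (\<lambda>x. (c \<ominus> \<one>) \<otimes> \<phi> x) \<in> G"
    using assms by (auto simp: homology_def)
  have "dilation (g p) (\<lambda>x. (c \<ominus> \<one>) \<otimes> \<phi> (h x)) \<in> G" if "c \<in> F" "c \<noteq> \<zero>" for c
    using dilation_conj[OF D[OF that] _ p(1) assms(2,3) inv] functional_scale[OF p(2)] that by auto
  moreover have "functional (\<lambda>x. \<phi> (h x))" using functional_comp[OF p(2) assms(3)] .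
  moreover have "g p \<in> V" "\<phi> (h (g p)) = \<one>" using p assms(2) G_closed inv by simp_all
  ultimately show ?thesis unfolding homology_def by blast
qed

lemma homology_nonzero: "homology p \<phi> \<Longrightarrow> p \<in> V - {\<zero>}"
  unfolding homology_def using functional_zero[of \<phi>] by auto

text \<open>A^2 - B^2 equals A (A + c B) - B (c A + B). In the application A and B are the values at
  p and q of the axis functional of p + q, and the two vanishing terms say that p + q and p + c q
  lie on each other's axes.\<close>

lemma polar_identities:
  assumes car: "A \<in> carrier R" "B \<in> carrier R" and sum: "A \<oplus> B = \<one>"
    and c: "c \<in> carrier R" and 1: "A \<oplus> c \<otimes> B = \<zero>" and 2: "c \<otimes> A \<oplus> B = \<zero>"
  shows "A = B"
proof -
  have "(A \<ominus> B) \<otimes> (A \<oplus> B) = A \<otimes> (A \<oplus> c \<otimes> B) \<ominus> B \<otimes> (c \<otimes> A \<oplus> B)"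
    using car c by algebra
  also have "\<dots> = \<zero>" unfolding 1 2 using car by algebra
  finally have "A \<ominus> B = \<zero>" using sum car by simp
  thus ?thesis using car by simp
qed

text \<open>With A = 1/2 this is the identity ((c - 1)/2)^2 + ((c + 1)/2)^2 = (c^2 + 1)/2. Doubling
  replaces division by two, and \<open>A \<oplus> A = \<one>\<close>, which rules out characteristic
  two, cancels the factor two at the end.\<close>

lemma sum_squares_double:
  assumes "A \<in> carrier R" "c \<in> carrier R" "A \<oplus> A = \<one>"
    and s: "s = (c \<ominus> \<one>) \<otimes> A" and r: "r = \<one> \<oplus> s"
    and 0: "s \<otimes> s \<oplus> r \<otimes> r = \<zero>"
  shows "c \<otimes> c = \<ominus> \<one>"
proof -
  have car: "s \<in> carrier R" "r \<in> carrier R" using assms by auto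
  have ss: "s \<oplus> s = c \<ominus> \<one>"
  proof -
    have "s \<oplus> s = (c \<ominus> \<one>) \<otimes> (A \<oplus> A)" unfolding s using assms(1,2) by algebra
    thus ?thesis using assms(2,3) by simp
  qed
  have rr: "r \<oplus> r = c \<oplus> \<one>"
  proof -
    have "r \<oplus> r = \<one> \<oplus> \<one> \<oplus> (s \<oplus> s)" unfolding r using car by algebra
    also have "\<dots> = c \<oplus> \<one>" unfolding ss using assms(2) by algebra
    finally show ?thesis .
  qed
  have "(s \<oplus> s) \<otimes> (s \<oplus> s) \<oplus> (r \<oplus> r) \<otimes> (r \<oplus> r) =
     (s \<otimes> s \<oplus> r \<otimes> r) \<oplus> (s \<otimes> s \<oplus> r \<otimes> r) \<oplus> ((s \<otimes> s \<oplus> r \<otimes> r) \<oplus> (s \<otimes> s \<oplus> r \<otimes> r))"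
    using car by (simp add: r_distr l_distr a_ac)
  hence "(c \<ominus> \<one>) \<otimes> (c \<ominus> \<one>) \<oplus> (c \<oplus> \<one>) \<otimes> (c \<oplus> \<one>) = \<zero>" unfolding 0 ss rr by simp
  moreover have "(c \<ominus> \<one>) \<otimes> (c \<ominus> \<one>) \<oplus> (c \<oplus> \<one>) \<otimes> (c \<oplus> \<one>) =
      (c \<otimes> c \<oplus> \<one>) \<oplus> (c \<otimes> c \<oplus> \<one>)" using assms(2) by algebra
  ultimately have z: "(c \<otimes> c \<oplus> \<one>) \<oplus> (c \<otimes> c \<oplus> \<one>) = \<zero>" by simp
  have "c \<otimes> c \<oplus> \<one> = (A \<oplus> A) \<otimes> (c \<otimes> c \<oplus> \<one>)" using assms(1-3) by simp
  also have "\<dots> = A \<otimes> ((c \<otimes> c \<oplus> \<one>) \<oplus> (c \<otimes> c \<oplus> \<one>))" using assms(1,2) by algebra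
  also have "\<dots> = \<zero>" unfolding z using assms(1) by simp
  finally have e: "c \<otimes> c \<oplus> \<one> = \<zero>" .
  have "c \<otimes> c = (c \<otimes> c \<oplus> \<one>) \<ominus> \<one>" using assms(2) by algebra
  also have "\<dots> = \<ominus> \<one>" unfolding e by algebra
  finally show ?thesis .
qed

text \<open>X^2 + 1 has at most two roots in a field; together with 0, 1 and -1 these are five
  elements. This is the origin of the condition q > 5.\<close>

lemma card_square_roots_minus_one:
  assumes "finite F" "\<And>c. c \<in> F \<Longrightarrow> c \<noteq> \<zero> \<Longrightarrow> c \<noteq> \<one> \<Longrightarrow> c \<noteq> \<ominus> \<one> \<Longrightarrow> c \<otimes> c = \<ominus> \<one>"
  shows "card F \<le> 5"
proof (cases "F \<subseteq> {\<zero>, \<one>, \<ominus> \<one>}")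
  case True
  hence "card F \<le> card {\<zero>, \<one>, \<ominus> \<one>}" by (intro card_mono) auto
  also have "\<dots> \<le> 5" by (auto simp: card_insert_if)
  finally show ?thesis .
next
  case False
  then obtain c0 where c0: "c0 \<in> F" "c0 \<noteq> \<zero>" "c0 \<noteq> \<one>" "c0 \<noteq> \<ominus> \<one>" by auto
  have "F \<subseteq> {\<zero>, \<one>, \<ominus> \<one>, c0, \<ominus> c0}"
  proof
    fix c assume c: "c \<in> F"
    show "c \<in> {\<zero>, \<one>, \<ominus> \<one>, c0, \<ominus> c0}"
    proof (rule ccontr)
      assume n: "c \<notin> {\<zero>, \<one>, \<ominus> \<one>, c0, \<ominus> c0}"
      have car: "c \<in> carrier R" "c0 \<in> carrier R" using c c0 by auto
      have "(c \<ominus> c0) \<otimes> (c \<oplus> c0) = c \<otimes> c \<ominus> c0 \<otimes> c0" using car by algebra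
      also have "\<dots> = \<zero>" using assms(2)[OF c] assms(2)[OF c0] n by (simp add: a_minus_def l_neg)
      finally have "c \<ominus> c0 = \<zero> \<or> c \<oplus> c0 = \<zero>" using car by (simp add: integral_iff)
      thus False using n car minus_equality[of c c0] by auto
    qed
  qed
  hence "card F \<le> card {\<zero>, \<one>, \<ominus> \<one>, c0, \<ominus> c0}" by (intro card_mono) auto
  also have "\<dots> \<le> 5" by (auto simp: card_insert_if)
  finally show ?thesis .
qed

text \<open>If the axis \<open>\<phi>\<close> of a center is unique, then \<open>Q\<close> lies on the axis of \<open>P\<close> iff \<open>P\<close> lies on the axis of
  \<open>Q\<close>; applied to points of a plane this gives \<open>c\<^sup>2 = -1\<close> for all scalars other than \<open>0\<close>, \<open>1\<close>, \<open>-1\<close>.\<close>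

lemma exists_two_axes:
  assumes card_F: "finite F" "card F > 5"
    and trans: "\<And>x y. x \<in> V - {\<zero>} \<Longrightarrow> y \<in> V - {\<zero>} \<Longrightarrow> \<exists>g\<in>G. g x = y"
    and scalar: "\<And>c. c \<in> F \<Longrightarrow> c \<noteq> \<zero> \<Longrightarrow> (\<lambda>x. c \<otimes> x) \<in> G"
    and hom0: "homology p0 \<phi>0" and q0: "q0 \<in> V - {\<zero>}" "\<phi>0 q0 = \<zero>"
  shows "\<exists>p \<phi>1 \<phi>2. homology p \<phi>1 \<and> homology p \<phi>2 \<and> (\<exists>x\<in>V. \<phi>1 x \<noteq> \<phi>2 x)"
proof (rule ccontr)
  assume "\<not> ?thesis"
  hence uniq: "\<And>p \<phi>1 \<phi>2 x. homology p \<phi>1 \<Longrightarrow> homology p \<phi>2 \<Longrightarrow> x \<in> V \<Longrightarrow> \<phi>1 x = \<phi>2 x"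
    by blast
  have ex: "\<exists>\<phi>. homology p \<phi>" if p: "p \<in> V - {\<zero>}" for p
  proof -
    obtain g where g: "g \<in> G" "g p0 = p" using trans[OF homology_nonzero[OF hom0] p] by auto
    obtain h where h: "h \<in> G" "\<forall>x\<in>V. h (g x) = x \<and> g (h x) = x" using G_inv[OF g(1)] by auto
    show ?thesis using homology_conj[OF hom0 g(1) h(1)] h(2) g(2) by auto
  qed
  define \<Phi> where "\<Phi> p = (SOME \<phi>. homology p \<phi>)" for p
  have \<Phi>: "homology p (\<Phi> p)" if "p \<in> V - {\<zero>}" for p
    using ex[OF that] unfolding \<Phi>_def by (rule someI_ex)
  have fn: "functional (\<Phi> p)" if "p \<in> V - {\<zero>}" for p
    using \<Phi>[OF that] by (simp add: homology_def)
  have \<Phi>1: "\<Phi> p p = \<one>" if "p \<in> V - {\<zero>}" for p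
    using \<Phi>[OF that] by (simp add: homology_def)
  \<comment> \<open>Conjugating by g turns homologies with center p into homologies with center g p,
    so uniqueness of axes makes \<Phi> equivariant. Scalars belong to G, so this also covers
    multiples of p.\<close>
  have equiv: "\<Phi> (g p) (g x) = \<Phi> p x" if gpx: "g \<in> G" "p \<in> V - {\<zero>}" "x \<in> V" for g p x
  proof -
    obtain h where h: "h \<in> G" "\<forall>x\<in>V. h (g x) = x \<and> g (h x) = x" using G_inv[OF gpx(1)] by auto
    note that = gpx
    have hm: "homology (g p) (\<lambda>x. \<Phi> p (h x))"
      using homology_conj[OF \<Phi>[OF that(2)] that(1) h(1)] h(2) by auto
    have "\<Phi> (g p) (g x) = \<Phi> p (h (g x))"
      using uniq[OF \<Phi>[OF homology_nonzero[OF hm]] hm] G_closed that by auto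
    thus ?thesis using h that by auto
  qed
  have Dil: "dilation p (\<lambda>x. (c \<ominus> \<one>) \<otimes> \<Phi> p x) \<in> G" if "p \<in> V - {\<zero>}" "c \<in> F" "c \<noteq> \<zero>" for p c
    using \<Phi>[OF that(1)] that by (simp add: homology_def)
  have cl: "\<Phi> p x \<in> F" if "p \<in> V - {\<zero>}" "x \<in> V" for p x
    using functionalD(1)[OF fn[OF that(1)] that(2)] .
  have car: "\<Phi> p x \<in> carrier R" if "p \<in> V - {\<zero>}" "x \<in> V" for p x
    using cl[OF that] by simp
  have dil_axis: "dilation p (\<lambda>x. (c \<ominus> \<one>) \<otimes> \<Phi> p x) x = x" if "\<Phi> p x = \<zero>" "p \<in> V" "x \<in> V" "c \<in> F" for p c x
    using that by (simp add: dilation_def)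
  have dil_center: "dilation p (\<lambda>x. (c \<ominus> \<one>) \<otimes> \<Phi> p x) p = c \<otimes> p" if "p \<in> V - {\<zero>}" "c \<in> F" for p c
  proof -
    have "p \<in> carrier R" "c \<in> carrier R" using that by auto
    thus ?thesis using \<Phi>1[OF that(1)] by (simp add: dilation_def) algebra
  qed
  obtain c1 where c1: "c1 \<in> F" "c1 \<noteq> \<zero>" "c1 \<noteq> \<one>"
  proof -
    have "\<not> F \<subseteq> {\<zero>, \<one>}"
      using card_mono[of "{\<zero>, \<one>}" F] card_F by (auto simp: card_insert_if split: if_splits)
    thus ?thesis using that by auto
  qed
  \<comment> \<open>A homology with center p and factor c1 fixes q, which lies on the axis of p, and
    multiplies p by c1. Equivariance gives (c1 - 1) \<open>\<Phi> q p\<close> = 0.\<close>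
  have perp_sym: "\<Phi> q p = \<zero>" if p: "p \<in> V - {\<zero>}" and q: "q \<in> V - {\<zero>}" and pq: "\<Phi> p q = \<zero>" for p q
  proof -
    have "\<Phi> q (c1 \<otimes> p) = \<Phi> q p"
      using equiv[OF Dil[OF p c1(1,2)] q, of p] dil_axis[OF pq] dil_center[OF p c1(1)] p q c1 by simp
    hence "c1 \<otimes> \<Phi> q p = \<Phi> q p" using fn[OF q] p c1 by (simp add: functionalD(3))
    hence "(c1 \<ominus> \<one>) \<otimes> \<Phi> q p = \<zero>" using car[OF q, of p] p c1 
      by (simp add: a_minus_def l_distr l_minus r_neg)
    thus ?thesis using c1 car[OF q, of p] p by (simp add: integral_iff)
  qed
  define p where "p = p0"
  define q where "q = q0"
  have p: "p \<in> V - {\<zero>}" using homology_nonzero[OF hom0] by (simp add: p_def)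
  have q: "q \<in> V - {\<zero>}" using q0 by (simp add: q_def)
  have pq: "\<Phi> p q = \<zero>" using uniq[OF \<Phi>[OF p] hom0[folded p_def], of q] q q0 by (simp add: q_def)
  have qp: "\<Phi> q p = \<zero>" using perp_sym[OF p q pq] .
  have nz: "p \<oplus> c \<otimes> q \<in> V - {\<zero>}" if c: "c \<in> F" for c
  proof -
    have "\<Phi> p (p \<oplus> c \<otimes> q) = \<one>"
      using functionalD[OF fn[OF p]] p q c pq \<Phi>1[OF p] by (simp add: smult_V)
    moreover have "p \<oplus> c \<otimes> q \<in> V" using p q c by (auto intro: add_V smult_V)
    ultimately show ?thesis using functional_zero[OF fn[OF p]] by auto
  qed
  have nz1: "p \<oplus> q \<in> V - {\<zero>}" using nz[of "\<one>"] q by auto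
  define A where "A = \<Phi> (p \<oplus> q) p"
  define B where "B = \<Phi> (p \<oplus> q) q"
  have AB: "A \<in> F" "B \<in> F" unfolding A_def B_def using cl[OF nz1] p q by auto
  have "\<Phi> (p \<oplus> q) (p \<oplus> q) = A \<oplus> B"
    unfolding A_def B_def using functionalD(2)[OF fn[OF nz1]] p q by auto
  hence sum: "A \<oplus> B = \<one>" using \<Phi>1[OF nz1] by simp
  \<comment> \<open>The homology with center q and factor c fixes p, since p lies on the axis of q,
    and carries p + q to p + c q. The axis of p + c q is therefore known from that of p + q.\<close>
  have E1: "\<Phi> (p \<oplus> c \<otimes> q) p = A" and E2: "c \<otimes> \<Phi> (p \<oplus> c \<otimes> q) q = B" if c: "c \<in> F" "c \<noteq> \<zero>" for c
  proof -
    let ?g = "dilation q (\<lambda>x. (c \<ominus> \<one>) \<otimes> \<Phi> q x)"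
    have g: "?g \<in> G" using Dil[OF q c] .
    have gp: "?g p = p" using dil_axis[OF qp] p q c by auto
    have gq: "?g q = c \<otimes> q" using dil_center[OF q c(1)] .
    have gpq: "?g (p \<oplus> q) = p \<oplus> c \<otimes> q" using G_add[OF g, of p q] p q gp gq by auto
    show "\<Phi> (p \<oplus> c \<otimes> q) p = A" using equiv[OF g nz1, of p] p gp gpq by (simp add: A_def)
    show "c \<otimes> \<Phi> (p \<oplus> c \<otimes> q) q = B"
      using equiv[OF g nz1, of q] q gq gpq functionalD(3)[OF fn[OF nz[OF c(1)]] c(1), of q] by (simp add: B_def)
  qed
  have A0: "A \<noteq> \<zero>"
  proof
    assume "A = \<zero>"
    hence "\<Phi> p (p \<oplus> q) = \<zero>" using perp_sym[OF nz1 p] by (simp add: A_def)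
    thus False using functionalD(2)[OF fn[OF p], of p q] p q \<Phi>1[OF p] pq by simp
  qed
  have B0: "B \<noteq> \<zero>"
  proof
    assume "B = \<zero>"
    hence "\<Phi> q (p \<oplus> q) = \<zero>" using perp_sym[OF nz1 q] by (simp add: B_def)
    thus False using functionalD(2)[OF fn[OF q], of p q] p q \<Phi>1[OF q] qp by simp
  qed
  have AeqB: "A = B"
  proof -
    \<comment> \<open>With this c the point p + c q lies on the axis of p + q; by symmetry p + q
      lies on the axis of p + c q, which is the second relation.\<close>
    define c where "c = \<ominus> (A \<otimes> inv B)"
    have ib: "inv B \<in> F" "B \<otimes> inv B = \<one>" using F_inv AB B0 by auto
    have c: "c \<in> F" using AB ib by (simp add: c_def)
    have "c \<otimes> B = \<ominus> (A \<otimes> (B \<otimes> inv B))" unfolding c_def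
      using F_closed(1)[OF AB(1)] F_closed(1)[OF AB(2)] F_closed(1)[OF ib(1)] by algebra
    hence cB: "c \<otimes> B = \<ominus> A" using ib AB by simp
    have c0: "c \<noteq> \<zero>"
    proof
      assume "c = \<zero>"
      hence "\<ominus> A = \<zero>" using cB AB by simp
      thus False using A0 AB by (simp add: add.inv_eq_1_iff)
    qed
    have 1: "A \<oplus> c \<otimes> B = \<zero>" unfolding cB using AB by (simp add: r_neg)
    have "\<Phi> (p \<oplus> q) (p \<oplus> c \<otimes> q) = A \<oplus> c \<otimes> B"
      using functionalD[OF fn[OF nz1]] p q c by (simp add: A_def B_def smult_V)
    hence "\<Phi> (p \<oplus> c \<otimes> q) (p \<oplus> q) = \<zero>" using perp_sym[OF nz1 nz[OF c]] 1 by simp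
    hence "A \<oplus> \<Phi> (p \<oplus> c \<otimes> q) q = \<zero>"
      using functionalD(2)[OF fn[OF nz[OF c]], of p q] p q E1[OF c c0] by simp
    hence "c \<otimes> (A \<oplus> \<Phi> (p \<oplus> c \<otimes> q) q) = \<zero>" using c by simp
    hence 2: "c \<otimes> A \<oplus> B = \<zero>"
      using E2[OF c c0] c AB car[OF nz[OF c], of q] q by (simp add: r_distr)
    show ?thesis using polar_identities[OF _ _ sum _ 1 2] AB c by simp
  qed
  \<comment> \<open>The homology k with center p + q and factor c carries the pair p, q to r p + s q
    and s p + r q. These must again lie on each other's axes. Since 2 r = c + 1 is not zero, one may
    divide by r; with e = s / r the condition becomes e^2 = -1, that is s^2 + r^2 = 0.\<close>
  have sq: "c \<otimes> c = \<ominus> \<one>" if c: "c \<in> F" "c \<noteq> \<zero>" "c \<noteq> \<one>" "c \<noteq> \<ominus> \<one>" for c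
  proof -
    let ?k = "dilation (p \<oplus> q) (\<lambda>x. (c \<ominus> \<one>) \<otimes> \<Phi> (p \<oplus> q) x)"
    have k: "?k \<in> G" using Dil[OF nz1 c(1,2)] .
    define s where "s = (c \<ominus> \<one>) \<otimes> A"
    define r where "r = \<one> \<oplus> s"
    have sr: "s \<in> F" "r \<in> F" using AB c by (auto simp: s_def r_def)
    have pqc: "p \<in> carrier R" "q \<in> carrier R" "s \<in> carrier R" "r \<in> carrier R" "A \<in> carrier R" "c \<in> carrier R"
      using p q sr AB c by auto
    have AA: "A \<oplus> A = \<one>" using sum AeqB by simp
    have kp: "?k p = r \<otimes> p \<oplus> s \<otimes> q"
      unfolding dilation_def A_def[symmetric] s_def[symmetric] r_def using pqc by algebra
    have kq: "?k q = s \<otimes> p \<oplus> r \<otimes> q"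
      unfolding dilation_def B_def[symmetric] AeqB[symmetric] s_def[symmetric] r_def using pqc by algebra
    have s0: "s \<noteq> \<zero>" using c A0 pqc by (simp add: s_def integral_iff)
    have rr: "r \<oplus> r = c \<oplus> \<one>"
    proof -
      have "r \<oplus> r = \<one> \<oplus> \<one> \<oplus> (c \<ominus> \<one>) \<otimes> (A \<oplus> A)" unfolding r_def s_def using pqc by algebra
      also have "\<dots> = c \<oplus> \<one>" unfolding AA using pqc by algebra
      finally show ?thesis .
    qed
    have r0: "r \<noteq> \<zero>"
    proof
      assume "r = \<zero>"
      hence "c \<oplus> \<one> = \<zero>" using rr by simp
      thus False using c pqc minus_equality[of c "\<one>"] by simp
    qed
    define e where "e = inv r \<otimes> s"
    have ir: "inv r \<in> F" "r \<otimes> inv r = \<one>" "inv r \<otimes> r = \<one>" using F_inv sr r0 by auto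
    have e: "e \<in> F" using ir sr by (simp add: e_def)
    have e0: "e \<noteq> \<zero>"
    proof
      assume "e = \<zero>"
      hence "r \<otimes> (inv r \<otimes> s) = \<zero>" using sr by (simp add: e_def)
      thus False using sr ir s0 by (simp add: m_assoc[symmetric])
    qed
    have re: "r \<otimes> e = s" unfolding e_def using sr ir by (simp add: m_assoc[symmetric])
    have kp': "?k p = r \<otimes> (p \<oplus> e \<otimes> q)" 
      unfolding kp using pqc e ir sr by (simp add: r_distr m_assoc[symmetric] re)
    have kq': "?k q = r \<otimes> (e \<otimes> p \<oplus> q)"
      unfolding kq using pqc e ir sr by (simp add: r_distr m_assoc[symmetric] re)
    have inV: "e \<otimes> p \<oplus> q \<in> V" using p q e by (auto intro: add_V smult_V)
    have "\<Phi> (r \<otimes> (p \<oplus> e \<otimes> q)) (r \<otimes> (e \<otimes> p \<oplus> q)) = \<zero>"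
      using equiv[OF k p, of q] q pq kp' kq' by simp
    hence "\<Phi> (p \<oplus> e \<otimes> q) (e \<otimes> p \<oplus> q) = \<zero>"
      using equiv[OF scalar[OF sr(2) r0] nz[OF e] inV] by simp
    hence "e \<otimes> A \<oplus> \<Phi> (p \<oplus> e \<otimes> q) q = \<zero>"
      using functionalD[OF fn[OF nz[OF e]]] p q e E1[OF e e0] by (simp add: smult_V)
    hence "e \<otimes> (e \<otimes> A \<oplus> \<Phi> (p \<oplus> e \<otimes> q) q) = \<zero>" using e by simp
    hence "e \<otimes> (e \<otimes> A) \<oplus> A = \<zero>"
      using E2[OF e e0] AeqB e AB car[OF nz[OF e], of q] q by (simp add: r_distr)
    moreover have "(r \<otimes> e) \<otimes> (r \<otimes> e) \<oplus> r \<otimes> r = (r \<otimes> r) \<otimes> (inv A \<otimes> (e \<otimes> (e \<otimes> A) \<oplus> A))"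
    proof -
      have iA: "inv A \<otimes> A = \<one>" "inv A \<in> carrier R" using F_inv AB A0 by auto
      have "(r \<otimes> r) \<otimes> (inv A \<otimes> (e \<otimes> (e \<otimes> A) \<oplus> A)) = (r \<otimes> r) \<otimes> ((inv A \<otimes> A) \<otimes> (e \<otimes> e \<oplus> \<one>))"
        using pqc e iA(2) F_closed(1)[OF e] by algebra
      also have "\<dots> = (r \<otimes> e) \<otimes> (r \<otimes> e) \<oplus> r \<otimes> r"
        unfolding iA using pqc F_closed(1)[OF e] by algebra
      finally show ?thesis by simp
    qed
    ultimately have "s \<otimes> s \<oplus> r \<otimes> r = \<zero>" using re F_inv AB A0 pqc by simp
    from sum_squares_double[OF pqc(5,6) AA s_def r_def this] show ?thesis .
  qed
  show False using card_square_roots_minus_one[OF card_F(1) sq] card_F by simp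
qed

section \<open>Centers with enough dilations\<close>

text \<open>When \<open>\<psi> p = -1\<close>, the map \<open>x + \<psi> x p\<close> is not injective.\<close>

definition rich_center :: "'a \<Rightarrow> ('a \<Rightarrow> 'a) set \<Rightarrow> bool" where
  "rich_center p B \<longleftrightarrow> (\<forall>\<psi>\<in>B. functional \<psi>)
     \<and> (\<forall>\<psi>\<in>B. \<forall>\<xi>\<in>B. \<forall>c\<in>F. \<forall>d\<in>F. (\<lambda>x. c \<otimes> \<psi> x \<oplus> d \<otimes> \<xi> x) \<in> B)
     \<and> (\<forall>x\<in>V - {\<zero>}. \<exists>\<psi>\<in>B. \<psi> x \<noteq> \<zero>)
     \<and> (\<forall>\<psi>\<in>B. \<psi> p \<noteq> \<ominus> \<one> \<longrightarrow> dilation p \<psi> \<in> G)"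

lemma rich_center_transport:
  assumes "rich_center p B" "p \<in> V" "g \<in> G"
  shows "\<exists>B'. rich_center (g p) B'"
proof -
  obtain h where h: "h \<in> G" "\<forall>x\<in>V. h (g x) = x \<and> g (h x) = x" using G_inv[OF assms(3)] by auto
  define B' where "B' = (\<lambda>\<psi> x. \<psi> (h x)) ` B"
  have B: "\<And>\<psi>. \<psi> \<in> B \<Longrightarrow> functional \<psi>"
    "\<And>\<psi> \<xi> c d. \<psi> \<in> B \<Longrightarrow> \<xi> \<in> B \<Longrightarrow> c \<in> F \<Longrightarrow> d \<in> F \<Longrightarrow> (\<lambda>x. c \<otimes> \<psi> x \<oplus> d \<otimes> \<xi> x) \<in> B"
    "\<And>x. x \<in> V - {\<zero>} \<Longrightarrow> \<exists>\<psi>\<in>B. \<psi> x \<noteq> \<zero>"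
    "\<And>\<psi>. \<psi> \<in> B \<Longrightarrow> \<psi> p \<noteq> \<ominus> \<one> \<Longrightarrow> dilation p \<psi> \<in> G"
    using assms(1) unfolding rich_center_def by blast+
  have "rich_center (g p) B'" unfolding rich_center_def
  proof (intro conjI ballI impI)
    fix \<psi> assume "\<psi> \<in> B'"
    thus "functional \<psi>" using functional_comp[OF B(1) h(1)] by (auto simp: B'_def)
  next
    fix \<psi> \<xi> c d assume "\<psi> \<in> B'" "\<xi> \<in> B'" and cd: "c \<in> F" "d \<in> F"
    then obtain \<psi>' \<xi>' where "\<psi>' \<in> B" "\<xi>' \<in> B" "\<psi> = (\<lambda>x. \<psi>' (h x))" "\<xi> = (\<lambda>x. \<xi>' (h x))"
      by (auto simp: B'_def)
    thus "(\<lambda>x. c \<otimes> \<psi> x \<oplus> d \<otimes> \<xi> x) \<in> B'"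
      unfolding B'_def using B(2)[of \<psi>' \<xi>' c d] cd
      by (intro image_eqI[where x = "\<lambda>x. c \<otimes> \<psi>' x \<oplus> d \<otimes> \<xi>' x"]) auto
  next
    fix x assume x: "x \<in> V - {\<zero>}"
    have "h x \<noteq> \<zero>"
    proof
      assume "h x = \<zero>"
      hence "g \<zero> = x" using h x by auto
      moreover have "g \<zero> = \<zero>" using G_smult[OF assms(3), of "\<zero>" "\<zero>"] G_closed[OF assms(3) zero_V] zero_V by auto
      ultimately show False using x by auto
    qed
    moreover have "h x \<in> V" using G_closed[OF h(1)] x by auto
    ultimately obtain \<psi> where "\<psi> \<in> B" "\<psi> (h x) \<noteq> \<zero>" using B(3)[of "h x"] by auto
    thus "\<exists>\<psi>\<in>B'. \<psi> x \<noteq> \<zero>" by (auto simp: B'_def)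
  next
    fix \<psi> assume "\<psi> \<in> B'" and ne: "\<psi> (g p) \<noteq> \<ominus> \<one>"
    then obtain \<psi>' where \<psi>': "\<psi>' \<in> B" "\<psi> = (\<lambda>x. \<psi>' (h x))" by (auto simp: B'_def)
    have "\<psi>' p \<noteq> \<ominus> \<one>" using ne h assms(2) by (auto simp: \<psi>'(2))
    from dilation_conj[OF B(4)[OF \<psi>'(1) this] B(1)[OF \<psi>'(1)] assms(2,3) h(1)] h(2)
    show "dilation (g p) \<psi> \<in> G" by (auto simp: \<psi>'(2))
  qed
  thus ?thesis by auto
qed

text \<open>The difference of two axes of p is the functional of a transvection with center p. The
  functionals A of such transvections form a space that is stable under the stabilizer of p, and
  transitivity of this stabilizer on the kernel of \<open>\<phi>0\<close> lets A separate the points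
  there. Adding \<open>\<phi>0\<close> itself gives a separating space B, whose dilations are
  products of a homology and a transvection.\<close>

lemma exists_rich_center:
  assumes card_F: "finite F" "card F > 5"
    and p: "homology p \<phi>0" and h1: "homology p \<phi>1" and h2: "homology p \<phi>2"
    and ne: "z \<in> V" "\<phi>1 z \<noteq> \<phi>2 z"
    and stab: "\<And>x y. x \<in> V - {\<zero>} \<Longrightarrow> y \<in> V - {\<zero>} \<Longrightarrow> \<phi>0 x = \<zero> \<Longrightarrow> \<phi>0 y = \<zero> \<Longrightarrow> \<exists>g\<in>G. g p = p \<and> g x = y"
  shows "\<exists>B. rich_center p B"
proof -
  have pV: "p \<in> V" "p \<in> carrier R" and fn0: "functional \<phi>0" and fn1: "functional \<phi>1" and fn2: "functional \<phi>2"
    and p1: "\<phi>0 p = \<one>" "\<phi>1 p = \<one>" "\<phi>2 p = \<one>"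
    using p h1 h2 by (auto simp: homology_def)
  define A where "A = {\<psi>. functional \<psi> \<and> \<psi> p = \<zero> \<and> (\<forall>d\<in>F. dilation p (\<lambda>x. d \<otimes> \<psi> x) \<in> G)}"
  have Afn: "functional \<psi>" if "\<psi> \<in> A" for \<psi> using that by (simp add: A_def)
  have D_comp: "dilation p (\<lambda>x. \<psi> x \<oplus> \<xi> x) \<in> G"
    if "dilation p \<psi> \<in> G" "dilation p \<xi> \<in> G" "functional \<psi>" "functional \<xi>" "\<psi> p = \<zero>" for \<psi> \<xi>
  proof (rule G_cong[OF G_comp[OF that(1,2)]])
    fix x assume x: "x \<in> V"
    have cl: "\<psi> x \<in> F" "\<xi> x \<in> F" "x \<in> carrier R" using x functionalD(1) that by auto
    have "\<psi> (x \<oplus> \<xi> x \<otimes> p) = \<psi> x"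
      using functionalD[OF that(3)] x cl that pV by (simp add: smult_V)
    thus "dilation p (\<lambda>x. \<psi> x \<oplus> \<xi> x) x = dilation p \<psi> (dilation p \<xi> x)"
      using x cl pV by (simp add: dilation_def l_distr a_ac)
  qed
  have A_comb: "(\<lambda>x. c \<otimes> \<psi> x \<oplus> d \<otimes> \<xi> x) \<in> A" if "\<psi> \<in> A" "\<xi> \<in> A" "c \<in> F" "d \<in> F" for \<psi> \<xi> c d
  proof -
    have f: "functional \<psi>" "functional \<xi>" "\<psi> p = \<zero>" "\<xi> p = \<zero>" using that by (auto simp: A_def)
    have "dilation p (\<lambda>x. e \<otimes> (c \<otimes> \<psi> x \<oplus> d \<otimes> \<xi> x)) \<in> G" if e: "e \<in> F" for e
    proof (rule G_cong)
      show "dilation p (\<lambda>x. (e \<otimes> c) \<otimes> \<psi> x \<oplus> (e \<otimes> d) \<otimes> \<xi> x) \<in> G"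
        using \<open>\<psi> \<in> A\<close> \<open>\<xi> \<in> A\<close> \<open>c \<in> F\<close> \<open>d \<in> F\<close> e f
        by (intro D_comp functional_scale) (auto simp: A_def)
      fix x assume "x \<in> V"
      thus "dilation p (\<lambda>x. e \<otimes> (c \<otimes> \<psi> x \<oplus> d \<otimes> \<xi> x)) x = dilation p (\<lambda>x. (e \<otimes> c) \<otimes> \<psi> x \<oplus> (e \<otimes> d) \<otimes> \<xi> x) x"
        using functionalD(1)[OF f(1)] functionalD(1)[OF f(2)] e \<open>c \<in> F\<close> \<open>d \<in> F\<close>
        by (simp add: dilation_def r_distr m_assoc)
    qed
    thus ?thesis using functional_comb[OF f(1,2) that(3,4)] f that by (auto simp: A_def)
  qed
  have A_inv: "(\<lambda>x. \<psi> (g x)) \<in> A" if \<psi>: "\<psi> \<in> A" and g: "g \<in> G" "g p = p" for \<psi> g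
  proof -
    obtain h where h: "h \<in> G" "\<forall>x\<in>V. h (g x) = x \<and> g (h x) = x" using G_inv[OF g(1)] by auto
    have hp: "h p = p" using h g pV by metis
    have "dilation p (\<lambda>x. d \<otimes> \<psi> (g x)) \<in> G" if d: "d \<in> F" for d
      using dilation_conj[of p "\<lambda>x. d \<otimes> \<psi> x" h g] \<psi> d functional_scale[OF Afn[OF \<psi>] d] pV h g hp
      by (auto simp: A_def)
    thus ?thesis using \<psi> functional_comp[OF Afn[OF \<psi>] g(1)] g by (auto simp: A_def)
  qed
  define \<psi>0 where "\<psi>0 x = \<phi>1 x \<ominus> \<phi>2 x" for x
  have fn\<psi>0: "functional \<psi>0"
  proof -
    have "functional (\<lambda>x. \<one> \<otimes> \<phi>1 x \<oplus> (\<ominus> \<one>) \<otimes> \<phi>2 x)" by (intro functional_comb fn1 fn2) auto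
    thus ?thesis using functionalD(1)[OF fn1] functionalD(1)[OF fn2]
      by (auto simp: functional_def \<psi>0_def a_minus_def l_minus smult_V add_V)
  qed
  have \<psi>0A: "\<psi>0 \<in> A"
  proof -
    \<comment> \<open>A homology with factor 1/c about the axis \<open>\<phi>2\<close>, followed by
      one with factor c about \<open>\<phi>1\<close>, fixes p and is the dilation with functional (c
      - 1) \<open>\<psi>0\<close>; so d = c - 1.\<close>
    have 1: "dilation p (\<lambda>x. d \<otimes> \<psi>0 x) \<in> G" if d: "d \<in> F" "d \<noteq> \<ominus> \<one>" for d
    proof -
      define c where "c = d \<oplus> \<one>"
      have c: "c \<in> F" "c \<noteq> \<zero>" using d minus_equality[of d "\<one>"] by (auto simp: c_def)
      have ic: "inv c \<in> F" "inv c \<noteq> \<zero>" "inv c \<otimes> c = \<one>" "c \<otimes> inv c = \<one>" using F_inv[OF c] c by auto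
      note g1 = h1[unfolded homology_def] and g2 = h2[unfolded homology_def]
      have D1: "dilation p (\<lambda>x. (c \<ominus> \<one>) \<otimes> \<phi>1 x) \<in> G" using g1 c by blast
      have D2: "dilation p (\<lambda>x. (inv c \<ominus> \<one>) \<otimes> \<phi>2 x) \<in> G" using g2 ic by blast
      show ?thesis
      proof (rule G_cong[OF G_comp[OF D1 D2]])
        fix x assume x: "x \<in> V"
        have cl: "\<phi>1 x \<in> carrier R" "\<phi>2 x \<in> carrier R" "x \<in> carrier R" "c \<in> carrier R" "inv c \<in> carrier R"
          using x functionalD(1)[OF fn1 x] functionalD(1)[OF fn2 x] c ic by auto
        have dc: "d = c \<ominus> \<one>" unfolding c_def using F_closed(1)[OF d(1)] by algebra
        have e: "\<phi>1 (x \<oplus> ((inv c \<ominus> \<one>) \<otimes> \<phi>2 x) \<otimes> p) = \<phi>1 x \<oplus> (inv c \<ominus> \<one>) \<otimes> \<phi>2 x"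
          using functionalD[OF fn1] functionalD(1)[OF fn2 x] x ic pV p1 by (simp add: smult_V)
        have "x \<oplus> ((inv c \<ominus> \<one>) \<otimes> \<phi>2 x) \<otimes> p \<oplus> ((c \<ominus> \<one>) \<otimes> (\<phi>1 x \<oplus> (inv c \<ominus> \<one>) \<otimes> \<phi>2 x)) \<otimes> p
          = x \<oplus> ((c \<ominus> \<one>) \<otimes> \<phi>1 x \<oplus> (c \<otimes> inv c \<ominus> c) \<otimes> \<phi>2 x) \<otimes> p"
          using cl pV(2) by algebra
        also have "\<dots> = x \<oplus> ((c \<ominus> \<one>) \<otimes> (\<phi>1 x \<ominus> \<phi>2 x)) \<otimes> p" unfolding ic(4) using cl pV(2) by algebra
        finally show "dilation p (\<lambda>x. d \<otimes> \<psi>0 x) x =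
           dilation p (\<lambda>x. (c \<ominus> \<one>) \<otimes> \<phi>1 x) (dilation p (\<lambda>x. (inv c \<ominus> \<one>) \<otimes> \<phi>2 x) x)"
          unfolding dilation_def e dc \<psi>0_def by simp
      qed
    qed
    have "dilation p (\<lambda>x. d \<otimes> \<psi>0 x) \<in> G" if d: "d \<in> F" for d
    proof (cases "d = \<ominus> \<one>")
      case True
      \<comment> \<open>The value d = -1 would require c = 0. It is written as the sum of e and -1 -
        e, neither of which is -1, and the two transvections are composed.\<close>
      have "\<not> F \<subseteq> {\<zero>, \<ominus> \<one>}"
        using card_mono[of "{\<zero>, \<ominus> \<one>}" F] card_F by (auto simp: card_insert_if split: if_splits)
      then obtain e where e: "e \<in> F" "e \<noteq> \<zero>" "e \<noteq> \<ominus> \<one>" by auto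
      have e2: "\<ominus> \<one> \<ominus> e \<noteq> \<ominus> \<one>"
      proof
        assume a: "\<ominus> \<one> \<ominus> e = \<ominus> \<one>"
        have "e = \<ominus> \<one> \<ominus> (\<ominus> \<one> \<ominus> e)" using F_closed(1)[OF e(1)] by algebra
        also have "\<dots> = \<zero>" unfolding a by algebra
        finally show False using e by simp
      qed
      have \<psi>p: "\<psi>0 p = \<zero>" by (simp add: \<psi>0_def p1 a_minus_def r_neg)
      have "dilation p (\<lambda>x. e \<otimes> \<psi>0 x \<oplus> (\<ominus> \<one> \<ominus> e) \<otimes> \<psi>0 x) \<in> G"
        using e e2 \<psi>p by (intro D_comp 1 functional_scale fn\<psi>0) auto
      thus ?thesis
      proof (rule G_cong)
        fix x assume x: "x \<in> V"
        have "e \<in> carrier R" "\<psi>0 x \<in> carrier R" using e functionalD(1)[OF fn\<psi>0 x] by auto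
        hence "e \<otimes> \<psi>0 x \<oplus> (\<ominus> \<one> \<ominus> e) \<otimes> \<psi>0 x = (\<ominus> \<one>) \<otimes> \<psi>0 x" by algebra
        thus "dilation p (\<lambda>x. d \<otimes> \<psi>0 x) x = dilation p (\<lambda>x. e \<otimes> \<psi>0 x \<oplus> (\<ominus> \<one> \<ominus> e) \<otimes> \<psi>0 x) x"
          by (simp add: dilation_def True)
      qed
    qed (use 1 d in auto)
    thus ?thesis using fn\<psi>0 by (simp add: A_def \<psi>0_def p1 a_minus_def r_neg)
  qed
  have sepA: "\<phi>0 x \<noteq> \<zero> \<or> (\<exists>\<psi>\<in>A. \<psi> x \<noteq> \<zero>)" if x: "x \<in> V - {\<zero>}" for x
  proof (rule ccontr)
    assume "\<not> ?thesis"
    hence x0: "\<phi>0 x = \<zero>" and all: "\<And>\<psi>. \<psi> \<in> A \<Longrightarrow> \<psi> x = \<zero>" by auto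
    \<comment> \<open>The projection of z along p to the kernel of \<open>\<phi>0\<close>. As
      \<open>\<psi>0\<close> vanishes at p, it takes the same nonzero value at y as at z, and some
      element of the stabilizer of p carries x to y.\<close>
    define y where "y = z \<ominus> \<phi>0 z \<otimes> p"
    have zF: "\<phi>0 z \<in> F" using functionalD(1)[OF fn0 ne(1)] .
    have yV: "y \<in> V" unfolding y_def using zF pV ne by (intro V_minus smult_V) auto
    have y0: "\<phi>0 y = \<zero>" unfolding y_def
      using functional_minus[OF fn0 ne(1) smult_V[OF zF pV(1)]] functionalD(3)[OF fn0 zF pV(1)] zF p1
      by (simp add: a_minus_def r_neg)
    have "\<psi>0 y = \<psi>0 z" unfolding y_def
      using functional_minus[OF fn\<psi>0 ne(1) smult_V[OF zF pV(1)]] functionalD(3)[OF fn\<psi>0 zF pV(1)]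
        zF functionalD(1)[OF fn\<psi>0 ne(1)] p1
      by (simp add: \<psi>0_def a_minus_def r_neg)
    moreover have "\<psi>0 z \<noteq> \<zero>"
      using ne functionalD(1)[OF fn1 ne(1)] functionalD(1)[OF fn2 ne(1)] by (simp add: \<psi>0_def)
    ultimately have y1: "\<psi>0 y \<noteq> \<zero>" by simp
    hence "y \<noteq> \<zero>" using functional_zero[OF fn\<psi>0] by auto
    then obtain g where g: "g \<in> G" "g p = p" "g x = y" using stab[of x y] x x0 y0 yV by auto
    show False using all[OF A_inv[OF \<psi>0A g(1,2)]] g y1 by simp
  qed
  define B where "B = {\<psi>. functional \<psi> \<and> (\<exists>\<alpha>\<in>A. \<exists>k\<in>F. \<forall>x\<in>V. \<psi> x = \<alpha> x \<oplus> k \<otimes> \<phi>0 x)}"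
  have zeroA: "(\<lambda>x. \<zero> \<otimes> \<psi>0 x \<oplus> \<zero> \<otimes> \<psi>0 x) \<in> A" using A_comb[OF \<psi>0A \<psi>0A] by auto
  have "rich_center p B" unfolding rich_center_def
  proof (intro conjI ballI impI)
    fix \<psi> assume "\<psi> \<in> B"
    thus "functional \<psi>" by (simp add: B_def)
  next
    fix \<psi> \<xi> c d assume a: "\<psi> \<in> B" "\<xi> \<in> B" "c \<in> F" "d \<in> F"
    obtain \<alpha> k where k: "\<alpha> \<in> A" "k \<in> F" "\<forall>x\<in>V. \<psi> x = \<alpha> x \<oplus> k \<otimes> \<phi>0 x" using a by (auto simp: B_def)
    obtain \<beta> l where l: "\<beta> \<in> A" "l \<in> F" "\<forall>x\<in>V. \<xi> x = \<beta> x \<oplus> l \<otimes> \<phi>0 x" using a by (auto simp: B_def)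
    have "c \<otimes> \<psi> x \<oplus> d \<otimes> \<xi> x = (c \<otimes> \<alpha> x \<oplus> d \<otimes> \<beta> x) \<oplus> (c \<otimes> k \<oplus> d \<otimes> l) \<otimes> \<phi>0 x" if x: "x \<in> V" for x
    proof -
      have "\<alpha> x \<in> carrier R" "\<beta> x \<in> carrier R" "\<phi>0 x \<in> carrier R" "c \<in> carrier R" "d \<in> carrier R" "k \<in> carrier R" "l \<in> carrier R"
        using functionalD(1)[OF Afn[OF k(1)] x] functionalD(1)[OF Afn[OF l(1)] x] functionalD(1)[OF fn0 x] a k l by auto
      thus ?thesis using k(3) l(3) x by simp algebra
    qed
    hence eq: "\<forall>x\<in>V. (\<lambda>x. c \<otimes> \<psi> x \<oplus> d \<otimes> \<xi> x) x = (\<lambda>x. c \<otimes> \<alpha> x \<oplus> d \<otimes> \<beta> x) x \<oplus> (c \<otimes> k \<oplus> d \<otimes> l) \<otimes> \<phi>0 x"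
      by simp
    moreover have "functional (\<lambda>x. c \<otimes> \<psi> x \<oplus> d \<otimes> \<xi> x)" using a by (intro functional_comb) (auto simp: B_def)
    moreover have "c \<otimes> k \<oplus> d \<otimes> l \<in> F" using a k l by simp
    ultimately show "(\<lambda>x. c \<otimes> \<psi> x \<oplus> d \<otimes> \<xi> x) \<in> B"
      unfolding B_def mem_Collect_eq
      by (intro conjI bexI[OF _ A_comb[OF k(1) l(1) a(3,4)]] bexI[where x = "c \<otimes> k \<oplus> d \<otimes> l"])
  next
    fix x assume x: "x \<in> V - {\<zero>}"
    have 0: "\<phi>0 \<in> B" unfolding B_def using fn0 functionalD(1)[OF fn0] functionalD(1)[OF fn\<psi>0]
      by (auto intro!: bexI[OF _ zeroA] bexI[of _ "\<one>"])
    have 1: "\<psi> \<in> B" if "\<psi> \<in> A" for \<psi>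
      unfolding B_def using Afn[OF that] functionalD(1)[OF fn0] functionalD(1)[OF Afn[OF that]]
      by (auto intro!: bexI[OF _ that] bexI[of _ "\<zero>"])
    show "\<exists>\<psi>\<in>B. \<psi> x \<noteq> \<zero>" using sepA[OF x] 0 1 by auto
  next
    fix \<psi> assume \<psi>: "\<psi> \<in> B" "\<psi> p \<noteq> \<ominus> \<one>"
    obtain \<alpha> k where k: "\<alpha> \<in> A" "k \<in> F" "\<forall>x\<in>V. \<psi> x = \<alpha> x \<oplus> k \<otimes> \<phi>0 x" using \<psi> by (auto simp: B_def)
    have "\<psi> p = k" using k pV p1 by (auto simp: A_def)
    \<comment> \<open>The factor by which the dilation multiplies p; it is not zero because
      \<open>\<psi> p\<close> is not -1. The transvection for \<alpha> / c followed by the homology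
      with factor c is the required dilation.\<close>
    define c where "c = k \<oplus> \<one>"
    have c: "c \<in> F" "c \<noteq> \<zero>" using k \<psi> \<open>\<psi> p = k\<close> minus_equality[of k "\<one>"] by (auto simp: c_def)
    have ic: "inv c \<in> F" "c \<otimes> inv c = \<one>" using F_inv[OF c] by auto
    have D1: "dilation p (\<lambda>x. (c \<ominus> \<one>) \<otimes> \<phi>0 x) \<in> G" using p[unfolded homology_def] c by blast
    have D2: "dilation p (\<lambda>x. inv c \<otimes> \<alpha> x) \<in> G" using k ic by (simp add: A_def)
    show "dilation p \<psi> \<in> G"
    proof (rule G_cong[OF G_comp[OF D1 D2]])
      fix x assume x: "x \<in> V"
      have \<alpha>F: "\<alpha> x \<in> F" using functionalD(1)[OF Afn[OF k(1)] x] .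
      have cl: "\<alpha> x \<in> carrier R" "\<phi>0 x \<in> carrier R" "x \<in> carrier R" "c \<in> carrier R" "inv c \<in> carrier R" "k \<in> carrier R"
        using x functionalD(1)[OF fn0 x] \<alpha>F c ic k by auto
      have ck: "k = c \<ominus> \<one>" unfolding c_def using cl(6) by algebra
      have e: "\<phi>0 (x \<oplus> (inv c \<otimes> \<alpha> x) \<otimes> p) = \<phi>0 x \<oplus> inv c \<otimes> \<alpha> x"
        using functionalD[OF fn0] \<alpha>F x ic pV p1 by (simp add: smult_V)
      have "x \<oplus> (inv c \<otimes> \<alpha> x) \<otimes> p \<oplus> ((c \<ominus> \<one>) \<otimes> (\<phi>0 x \<oplus> inv c \<otimes> \<alpha> x)) \<otimes> p
        = x \<oplus> ((c \<otimes> inv c) \<otimes> \<alpha> x \<oplus> (c \<ominus> \<one>) \<otimes> \<phi>0 x) \<otimes> p" using cl pV(2) by algebra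
      thus "dilation p \<psi> x = dilation p (\<lambda>x. (c \<ominus> \<one>) \<otimes> \<phi>0 x) (dilation p (\<lambda>x. inv c \<otimes> \<alpha> x) x)"
        unfolding dilation_def e using k(3) x cl by (simp add: ic ck)
    qed
  qed
  thus ?thesis by auto
qed

text \<open>Duality without bases: a subspace is the set of common zeros of the functionals in B
  that vanish on it. The induction runs over a finite generating set W, for which U itself is taken
  at the end.\<close>

lemma functionals_separate_subspace:
  assumes fn: "\<And>\<psi>. \<psi> \<in> B \<Longrightarrow> functional \<psi>"
    and comb: "\<And>\<psi> \<xi> c d. \<psi> \<in> B \<Longrightarrow> \<xi> \<in> B \<Longrightarrow> c \<in> F \<Longrightarrow> d \<in> F \<Longrightarrow> (\<lambda>x. c \<otimes> \<psi> x \<oplus> d \<otimes> \<xi> x) \<in> B"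
    and sep: "\<And>x. x \<in> V - {\<zero>} \<Longrightarrow> \<exists>\<psi>\<in>B. \<psi> x \<noteq> \<zero>"
    and U: "U \<subseteq> V" "\<zero> \<in> U" "\<And>x y. x \<in> U \<Longrightarrow> y \<in> U \<Longrightarrow> x \<oplus> y \<in> U" "\<And>c x. c \<in> F \<Longrightarrow> x \<in> U \<Longrightarrow> c \<otimes> x \<in> U"
    and x: "x \<in> V" "x \<notin> U"
  shows "\<exists>\<psi>\<in>B. (\<forall>u\<in>U. \<psi> u = \<zero>) \<and> \<psi> x \<noteq> \<zero>"
proof -
  have "x \<in> U" if "finite W" "W \<subseteq> U" "x \<in> V" "\<forall>\<psi>\<in>B. (\<forall>w\<in>W. \<psi> w = \<zero>) \<longrightarrow> \<psi> x = \<zero>" for W x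
    using that
  proof (induction W arbitrary: x)
    case empty
    thus ?case using sep[of x] U(2) by (cases "x = \<zero>") auto
  next
    case (insert u W)
    show ?case
    proof (cases "\<forall>\<psi>\<in>B. (\<forall>w\<in>W. \<psi> w = \<zero>) \<longrightarrow> \<psi> u = \<zero>")
      case True
      thus ?thesis using insert by auto
    next
      case False
      then obtain \<psi>0 where \<psi>0: "\<psi>0 \<in> B" "\<forall>w\<in>W. \<psi>0 w = \<zero>" "\<psi>0 u \<noteq> \<zero>" by auto
      have uV: "u \<in> V" "u \<in> U" using insert.prems U by auto
      have F0: "\<psi>0 u \<in> F" "\<psi>0 x \<in> F" using functionalD(1)[OF fn[OF \<psi>0(1)]] uV insert.prems by auto
      define i where "i = inv (\<psi>0 u)"
      have i: "i \<in> F" "\<psi>0 u \<otimes> i = \<one>" "i \<otimes> \<psi>0 u = \<one>" using F_inv[OF F0(1) \<psi>0(3)] by (auto simp: i_def)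
      define c where "c = i \<otimes> \<psi>0 x"
      have c: "c \<in> F" using i F0 by (simp add: c_def)
      \<comment> \<open>The multiple of u is chosen so that \<open>\<psi>0\<close> vanishes at x'. A
        functional \<psi> that vanishes on W is corrected by a multiple of \<open>\<psi>0\<close> so
        that it vanishes at u too; its value at x' is the value of the corrected functional at x,
        hence zero.\<close>
      define x' where "x' = x \<ominus> c \<otimes> u"
      have x'V: "x' \<in> V" unfolding x'_def using c uV insert.prems by (intro V_minus smult_V) auto
      have "\<psi> x' = \<zero>" if \<psi>: "\<psi> \<in> B" "\<forall>w\<in>W. \<psi> w = \<zero>" for \<psi>
      proof -
        have F1: "\<psi> u \<in> F" "\<psi> x \<in> F" using functionalD(1)[OF fn[OF \<psi>(1)]] uV insert.prems by auto
        define \<xi> where "\<xi> = (\<lambda>x. \<one> \<otimes> \<psi> x \<oplus> (\<ominus> (\<psi> u \<otimes> i)) \<otimes> \<psi>0 x)"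
        have car: "\<psi> u \<in> carrier R" "\<psi> x \<in> carrier R" "\<psi>0 u \<in> carrier R" "\<psi>0 x \<in> carrier R" "i \<in> carrier R"
          using F0 F1 i by auto
        have "\<xi> \<in> B" unfolding \<xi>_def using \<psi> \<psi>0 F1 i by (intro comb) auto
        moreover have "\<forall>w\<in>W. \<xi> w = \<zero>" using \<psi> \<psi>0 car by (auto simp: \<xi>_def)
        moreover have "\<xi> u = \<psi> u \<ominus> \<psi> u \<otimes> (i \<otimes> \<psi>0 u)" unfolding \<xi>_def using car by algebra
        hence "\<xi> u = \<zero>" using car i by (simp add: a_minus_def r_neg)
        ultimately have "\<xi> x = \<zero>" using insert.prems by auto
        moreover have "\<psi> x' = \<psi> x \<ominus> c \<otimes> \<psi> u" unfolding x'_def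
          using functional_minus[OF fn[OF \<psi>(1)]] functionalD(3)[OF fn[OF \<psi>(1)]] c uV insert.prems by (simp add: smult_V)
        moreover have "\<psi> x \<ominus> c \<otimes> \<psi> u = \<xi> x" unfolding \<xi>_def c_def using car by algebra
        ultimately show ?thesis by simp
      qed
      hence "x' \<in> U" using insert.IH[of x'] insert.prems x'V by auto
      moreover have "x = x' \<oplus> c \<otimes> u" unfolding x'_def using V_closed[OF insert.prems(2)] V_closed[OF uV(1)] F_closed(1)[OF c] by algebra
      ultimately show ?thesis using U(3,4) uV c by auto
    qed
  qed
  from this[of U x] show ?thesis using U(1) x finite_V finite_subset by blast
qed

text \<open>Composing \<open>\<gamma>\<close> with an element \<open>g\<close> of \<open>G\<close> that maximizes the number of fixed points gives the identity:
  if \<open>y\<close> is not fixed, a dilation with center \<open>y - g \<gamma> y\<close> fixes \<open>y\<close> in addition.\<close>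

lemma rich_centers_imp_all_linear:
  assumes rich: "\<And>p. p \<in> V - {\<zero>} \<Longrightarrow> \<exists>B. rich_center p B"
    and \<gamma>: "bij_betw \<gamma> V V" "\<And>x y. x \<in> V \<Longrightarrow> y \<in> V \<Longrightarrow> \<gamma> (x \<oplus> y) = \<gamma> x \<oplus> \<gamma> y"
      "\<And>c x. c \<in> F \<Longrightarrow> x \<in> V \<Longrightarrow> \<gamma> (c \<otimes> x) = c \<otimes> \<gamma> x"
  shows "\<gamma> \<in> G"
proof -
  define fix_set where "fix_set g = {x \<in> V. g (\<gamma> x) = x}" for g
  have "\<exists>g. g \<in> G \<and> (\<forall>h. h \<in> G \<longrightarrow> card (fix_set h) \<le> card (fix_set g))"
    by (rule ex_has_greatest_nat[where b = "Suc (card V)" and P = "\<lambda>g. g \<in> G", OF G_id])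
      (auto simp: fix_set_def less_Suc_eq_le intro!: card_mono finite_V)
  then obtain g where g: "g \<in> G" and max: "\<And>h. h \<in> G \<Longrightarrow> card (fix_set h) \<le> card (fix_set g)" by auto
  have \<gamma>V: "\<gamma> x \<in> V" if "x \<in> V" for x using \<gamma>(1) that by (auto simp: bij_betw_def)
  define g' where "g' x = g (\<gamma> x)" for x
  have g'V: "g' x \<in> V" if "x \<in> V" for x using G_closed[OF g \<gamma>V[OF that]] by (simp add: g'_def)
  have g'_add: "g' (x \<oplus> y) = g' x \<oplus> g' y" if "x \<in> V" "y \<in> V" for x y
    using that \<gamma> G_add[OF g] \<gamma>V by (simp add: g'_def)
  have g'_smult: "g' (c \<otimes> x) = c \<otimes> g' x" if "c \<in> F" "x \<in> V" for c x
    using that \<gamma> G_smult[OF g] \<gamma>V by (simp add: g'_def)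
  obtain h where h: "h \<in> G" "\<forall>x\<in>V. h (g x) = x \<and> g (h x) = x" using G_inv[OF g] by auto
  show ?thesis
  proof (cases "fix_set g = V")
    case True
    show ?thesis
    proof (rule G_cong[OF h(1)])
      fix x assume x: "x \<in> V"
      have "g (\<gamma> x) = x" using True x by (auto simp: fix_set_def)
      thus "\<gamma> x = h x" using h \<gamma>V[OF x] by metis
    qed
  next
    case False
    then obtain y where y: "y \<in> V" "g' y \<noteq> y" by (auto simp: fix_set_def g'_def)
    define U where "U = fix_set g"
    have U_iff: "x \<in> U \<longleftrightarrow> x \<in> V \<and> g' x = x" for x by (auto simp: U_def fix_set_def g'_def)
    define p where "p = y \<ominus> g' y"
    have pV: "p \<in> V" unfolding p_def using y g'V by (intro V_minus) auto
    have p0: "p \<noteq> \<zero>" unfolding p_def using y g'V by auto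
    obtain B where B: "rich_center p B" using rich pV p0 by auto
    have fn: "\<And>\<psi>. \<psi> \<in> B \<Longrightarrow> functional \<psi>"
      and comb: "\<And>\<psi> \<xi> c d. \<psi> \<in> B \<Longrightarrow> \<xi> \<in> B \<Longrightarrow> c \<in> F \<Longrightarrow> d \<in> F \<Longrightarrow> (\<lambda>x. c \<otimes> \<psi> x \<oplus> d \<otimes> \<xi> x) \<in> B"
      and sep: "\<And>x. x \<in> V - {\<zero>} \<Longrightarrow> \<exists>\<psi>\<in>B. \<psi> x \<noteq> \<zero>"
      and dil: "\<And>\<psi>. \<psi> \<in> B \<Longrightarrow> \<psi> p \<noteq> \<ominus> \<one> \<Longrightarrow> dilation p \<psi> \<in> G"
      using B unfolding rich_center_def by blast+
    have zf: "g' \<zero> = \<zero>" using g'_smult[of "\<zero>" "\<zero>"] zero_V g'V[OF zero_V] by auto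
    have inj: "x = z" if "x \<in> V" "z \<in> V" "g' x = g' z" for x z
    proof -
      have "\<gamma> x = \<gamma> z" using h \<gamma>V that unfolding g'_def by metis
      thus ?thesis using \<gamma>(1) that by (auto simp: bij_betw_def inj_on_def)
    qed
    have yU: "y \<notin> U" "g' y \<notin> U" using y inj[OF g'V[OF y(1)] y(1)] by (auto simp: U_iff)
    have subU: "U \<subseteq> V" "\<zero> \<in> U" "\<And>x z. x \<in> U \<Longrightarrow> z \<in> U \<Longrightarrow> x \<oplus> z \<in> U" "\<And>c x. c \<in> F \<Longrightarrow> x \<in> U \<Longrightarrow> c \<otimes> x \<in> U"
      using zero_V zf add_V smult_V g'_add g'_smult by (auto simp: U_iff)
    have sepU: "\<exists>\<psi>\<in>B. (\<forall>u\<in>U. \<psi> u = \<zero>) \<and> \<psi> x \<noteq> \<zero>" if "x \<in> V" "x \<notin> U" for x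
      by (rule functionals_separate_subspace[OF _ _ _ subU that]) (fact fn comb sep)+
    obtain \<psi>1 where \<psi>1: "\<psi>1 \<in> B" "\<forall>u\<in>U. \<psi>1 u = \<zero>" "\<psi>1 y \<noteq> \<zero>"
      using sepU[OF y(1) yU(1)] by auto
    obtain \<psi>2 where \<psi>2: "\<psi>2 \<in> B" "\<forall>u\<in>U. \<psi>2 u = \<zero>" "\<psi>2 (g' y) \<noteq> \<zero>"
      using sepU[OF g'V[OF y(1)] yU(2)] by auto
    have cl: "\<psi>1 z \<in> F" "\<psi>2 z \<in> F" if "z \<in> V" for z
      using functionalD(1)[OF fn[OF \<psi>1(1)]] functionalD(1)[OF fn[OF \<psi>2(1)]] that by auto
    \<comment> \<open>If \<open>\<psi>1\<close> is nonzero only at y and \<open>\<psi>2\<close> only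
      at g' y, then their sum is nonzero at both.\<close>
    have "\<exists>\<psi>\<in>B. (\<forall>u\<in>U. \<psi> u = \<zero>) \<and> \<psi> y \<noteq> \<zero> \<and> \<psi> (g' y) \<noteq> \<zero>"
    proof (cases "\<psi>1 (g' y) \<noteq> \<zero> \<or> \<psi>2 y \<noteq> \<zero>")
      case True thus ?thesis using \<psi>1 \<psi>2 by auto
    next
      case False
      have "(\<lambda>x. \<one> \<otimes> \<psi>1 x \<oplus> \<one> \<otimes> \<psi>2 x) \<in> B" by (intro comb \<psi>1 \<psi>2) auto
      thus ?thesis using False \<psi>1 \<psi>2 cl[OF y(1)] cl[OF g'V[OF y(1)]]
        by (intro bexI[where x = "\<lambda>x. \<one> \<otimes> \<psi>1 x \<oplus> \<one> \<otimes> \<psi>2 x"]) auto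
    qed
    then obtain \<psi>3 where \<psi>3: "\<psi>3 \<in> B" "\<forall>u\<in>U. \<psi>3 u = \<zero>" "\<psi>3 y \<noteq> \<zero>" "\<psi>3 (g' y) \<noteq> \<zero>" by auto
    have cl3: "\<psi>3 z \<in> F" if "z \<in> V" for z using functionalD(1)[OF fn[OF \<psi>3(1)]] that by auto
    define i where "i = inv (\<psi>3 (g' y))"
    have i: "i \<in> F" "i \<otimes> \<psi>3 (g' y) = \<one>" "i \<noteq> \<zero>"
      using F_inv[OF cl3[OF g'V[OF y(1)]] \<psi>3(4)] cl3[OF g'V[OF y(1)]] by (auto simp: i_def)
    \<comment> \<open>Scaled to be 1 at g' y, so that the dilation carries g' y to g' y + p = y.
      Since \<open>\<psi> p\<close> is \<open>\<psi> y\<close> - 1, the forbidden value -1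
      corresponds exactly to \<open>\<psi> y\<close> = 0.\<close>
    define \<psi> where "\<psi> = (\<lambda>x. i \<otimes> \<psi>3 x \<oplus> \<zero> \<otimes> \<psi>3 x)"
    have \<psi>B: "\<psi> \<in> B" unfolding \<psi>_def using i by (intro comb \<psi>3(1)) auto
    have \<psi>eq: "\<psi> z = i \<otimes> \<psi>3 z" if "z \<in> V" for z using cl3[OF that] i by (simp add: \<psi>_def)
    have \<psi>U: "\<psi> u = \<zero>" if "u \<in> U" for u using \<psi>3(2) that subU(1) i by (auto simp: \<psi>eq)
    have \<psi>y: "\<psi> y \<noteq> \<zero>" "\<psi> (g' y) = \<one>"
      using \<psi>3 i y cl3[OF y(1)] g'V[OF y(1)] by (auto simp: \<psi>eq integral_iff)
    have "\<psi> p = \<psi> y \<ominus> \<one>" unfolding p_def using functional_minus[OF fn[OF \<psi>B] y(1) g'V[OF y(1)]] \<psi>y by simp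
    moreover have "\<psi> y \<in> carrier R" using functionalD(1)[OF fn[OF \<psi>B] y(1)] by simp
    ultimately have "\<psi> p \<noteq> \<ominus> \<one>" using \<psi>y(1) by (auto simp: a_minus_def)
    hence D: "dilation p \<psi> \<in> G" using dil[OF \<psi>B] by simp
    let ?k = "\<lambda>x. dilation p \<psi> (g x)"
    have kG: "?k \<in> G" by (rule G_comp[OF D g])
    have "fix_set g \<subseteq> fix_set ?k"
    proof
      fix x assume "x \<in> fix_set g"
      hence "x \<in> V" "g (\<gamma> x) = x" "\<psi> x = \<zero>" using \<psi>U[of x] by (auto simp: U_def fix_set_def)
      thus "x \<in> fix_set ?k" using pV by (simp add: fix_set_def dilation_def)
    qed
    moreover have "y \<in> fix_set ?k - fix_set g"
    proof -
      have "g' y \<oplus> \<one> \<otimes> p = y" unfolding p_def using V_closed[OF y(1)] V_closed[OF g'V[OF y(1)]] by algebra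
      thus ?thesis using y \<psi>y yU by (simp add: fix_set_def dilation_def U_def g'_def)
    qed
    ultimately have "fix_set g \<subset> fix_set ?k" by auto
    hence "card (fix_set g) < card (fix_set ?k)"
      using finite_V by (intro psubset_card_mono) (auto simp: fix_set_def)
    thus ?thesis using max[OF kG] by simp
  qed
qed

section \<open>Orbits of a Singer cycle\<close>

lemma G_funpow: "g \<in> G \<Longrightarrow> (g ^^ j) \<in> G"
proof (induction j)
  case 0 thus ?case using G_cong[OF G_id] by auto
next
  case (Suc j) thus ?case using G_comp[OF Suc.prems Suc.IH] by (simp add: comp_def)
qed

lemma G_zero: "g \<in> G \<Longrightarrow> g \<zero> = \<zero>"
  using G_smult[of g "\<zero>" "\<zero>"] G_closed[of g "\<zero>"] zero_V by auto

text \<open>A power of \<open>s\<close> that multiplies one vector of a cyclic orbit by \<open>c\<close> does so on the whole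
  orbit, because powers of \<open>s\<close> commute.\<close>

lemma funpow_scalar_on_orbit:
  assumes "s \<in> G" "c \<in> F" "v \<in> V" "(s ^^ j) v = c \<otimes> v"
  shows "(s ^^ j) ((s ^^ i) v) = c \<otimes> (s ^^ i) v"
proof -
  have "(s ^^ j) ((s ^^ i) v) = (s ^^ i) ((s ^^ j) v)"
    by (metis add.commute comp_apply funpow_add)
  thus ?thesis using assms G_smult[OF G_funpow[OF assms(1)] assms(2,3)] by simp
qed

text \<open>A single vector decides: the power of s that takes v to c v acts as c on the orbit of v,
  and this orbit contains all nonzero vectors.\<close>

lemma singer_imp_scalars:
  assumes s: "s \<in> G" "\<And>x y. x \<in> V - {\<zero>} \<Longrightarrow> y \<in> V - {\<zero>} \<Longrightarrow> \<exists>j. (s ^^ j) x = y"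
    and c: "c \<in> F" "c \<noteq> \<zero>"
  shows "(\<lambda>x. c \<otimes> x) \<in> G"
proof (cases "V = {\<zero>}")
  case True
  show ?thesis by (rule G_cong[OF G_id]) (use True c in auto)
next
  case False
  then obtain v where v: "v \<in> V - {\<zero>}" using zero_V by auto
  have "c \<otimes> v \<in> V - {\<zero>}" using v c smult_V by (auto simp: integral_iff)
  then obtain j where j: "(s ^^ j) v = c \<otimes> v" using s(2)[OF v] by blast
  show ?thesis
  proof (rule G_cong[OF G_funpow[OF s(1), of j]])
    fix x assume x: "x \<in> V"
    show "c \<otimes> x = (s ^^ j) x"
    proof (cases "x = \<zero>")
      case True
      thus ?thesis using G_zero[OF G_funpow[OF s(1)]] c by simp
    next
      case False
      then obtain i where "(s ^^ i) v = x" using s(2)[OF v] x by auto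
      thus ?thesis using funpow_scalar_on_orbit[OF s(1) c(1) _ j, of i] v by auto
    qed
  qed
qed

text \<open>The case of dimension one, where a linear bijection is a scalar and the Singer cycle
  supplies all scalars.\<close>

theorem singer_imp_all_linear_line:
  assumes s: "s \<in> G" "\<And>x y. x \<in> V - {\<zero>} \<Longrightarrow> y \<in> V - {\<zero>} \<Longrightarrow> \<exists>j. (s ^^ j) x = y"
    and line: "p \<in> V - {\<zero>}" "\<And>x. x \<in> V \<Longrightarrow> \<exists>c\<in>F. x = c \<otimes> p"
    and \<gamma>: "bij_betw \<gamma> V V" "\<And>c x. c \<in> F \<Longrightarrow> x \<in> V \<Longrightarrow> \<gamma> (c \<otimes> x) = c \<otimes> \<gamma> x"
  shows "\<gamma> \<in> G"
proof -
  have "\<gamma> p \<in> V" using \<gamma>(1) line(1) by (auto simp: bij_betw_def)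
  then obtain c where c: "c \<in> F" "\<gamma> p = c \<otimes> p" using line(2) by blast
  have "\<gamma> \<zero> = \<zero>" using \<gamma>(2)[of "\<zero>" "\<zero>"] zero_V bij_betwE[OF \<gamma>(1)] by auto
  hence "\<gamma> p \<noteq> \<zero>" using \<gamma>(1) line(1) zero_V unfolding bij_betw_def inj_on_def by auto
  hence "c \<noteq> \<zero>" using c line(1) by auto
  show ?thesis
  proof (rule G_cong[OF singer_imp_scalars[OF s c(1) \<open>c \<noteq> \<zero>\<close>]])
    fix x assume "x \<in> V"
    then obtain d where "d \<in> F" "x = d \<otimes> p" using line(2) by blast
    thus "\<gamma> x = c \<otimes> x" using \<gamma>(2)[of d p] line(1) c by (simp add: m_lcomm)
  qed
qed

text \<open>The element of the second kind is lam w, where w fixes p and permutes the nonzero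
  vectors of the axis cyclically. It is used twice: powers of w combined with scalars are the
  homologies of p, and w makes the stabilizer of p transitive on the nonzero vectors of the axis, as
  \<open>exists_rich_center\<close> demands.\<close>

theorem singer_and_homology_imp_all_linear:
  assumes card_F: "finite F" "card F > 5"
    and s: "s \<in> G" "\<And>x y. x \<in> V - {\<zero>} \<Longrightarrow> y \<in> V - {\<zero>} \<Longrightarrow> \<exists>j. (s ^^ j) x = y"
    and \<phi>: "functional \<phi>" "p \<in> V" "\<phi> p = \<one>" "h0 \<in> V - {\<zero>}" "\<phi> h0 = \<zero>"
    and w: "lam \<in> F" "lam \<noteq> \<zero>" "(\<lambda>x. lam \<otimes> w x) \<in> G" "\<And>x. x \<in> V \<Longrightarrow> w x \<in> V" "w p = p"
      "\<And>x y. x \<in> V - {\<zero>} \<Longrightarrow> y \<in> V - {\<zero>} \<Longrightarrow> \<phi> x = \<zero> \<Longrightarrow> \<phi> y = \<zero> \<Longrightarrow> \<exists>j. (w ^^ j) x = y"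
    and \<gamma>: "bij_betw \<gamma> V V" "\<And>x y. x \<in> V \<Longrightarrow> y \<in> V \<Longrightarrow> \<gamma> (x \<oplus> y) = \<gamma> x \<oplus> \<gamma> y"
      "\<And>c x. c \<in> F \<Longrightarrow> x \<in> V \<Longrightarrow> \<gamma> (c \<otimes> x) = c \<otimes> \<gamma> x"
  shows "\<gamma> \<in> G"
proof -
  have trans: "\<exists>g\<in>G. g x = y" if "x \<in> V - {\<zero>}" "y \<in> V - {\<zero>}" for x y
    using s(2)[OF that] G_funpow[OF s(1)] by blast
  have scalar: "(\<lambda>x. c \<otimes> x) \<in> G" if "c \<in> F" "c \<noteq> \<zero>" for c
    using s that by (rule singer_imp_scalars)
  have il: "inv lam \<in> F" "inv lam \<noteq> \<zero>" "inv lam \<otimes> lam = \<one>" using F_inv[OF w(1,2)] w by auto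
  have wG: "w \<in> G"
  proof (rule G_cong[OF G_comp[OF scalar[OF il(1,2)] w(3)]])
    fix x assume "x \<in> V"
    thus "w x = inv lam \<otimes> (lam \<otimes> w x)" using w(1,4) il by (simp add: m_assoc[symmetric])
  qed
  have wp: "(w ^^ j) p = p" for j by (induction j) (auto simp: w(5))
  have hom: "homology p \<phi>" unfolding homology_def
  proof (intro conjI ballI impI \<phi>)
    fix c assume c: "c \<in> F" "c \<noteq> \<zero>"
    have ic: "inv c \<in> F" "inv c \<noteq> \<zero>" "c \<otimes> inv c = \<one>" using F_inv[OF c] c by auto
    have "inv c \<otimes> h0 \<in> V - {\<zero>}" using \<phi>(4) ic smult_V by (auto simp: integral_iff)
    moreover have "\<phi> (inv c \<otimes> h0) = \<zero>" using functionalD(3)[OF \<phi>(1) ic(1)] \<phi>(4,5) ic by auto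
    \<comment> \<open>By commutation w^j is 1/c on the whole axis, and it fixes p. Hence c w^j fixes
      the axis and multiplies p by c.\<close>
    ultimately obtain j where j: "(w ^^ j) h0 = inv c \<otimes> h0" using w(6)[OF \<phi>(4)] \<phi>(5) by blast
    show "dilation p (\<lambda>x. (c \<ominus> \<one>) \<otimes> \<phi> x) \<in> G"
    proof (rule G_cong[OF G_comp[OF scalar[OF c] G_funpow[OF wG, of j]]])
      fix x assume x: "x \<in> V"
      define h where "h = x \<ominus> \<phi> x \<otimes> p"
      have F: "\<phi> x \<in> F" using functionalD(1)[OF \<phi>(1) x] .
      have hV: "h \<in> V" unfolding h_def using x F \<phi>(2) by (intro V_minus smult_V)
      have h\<phi>: "\<phi> h = \<zero>" unfolding h_def
        using functional_minus[OF \<phi>(1) x smult_V[OF F \<phi>(2)]] functionalD(3)[OF \<phi>(1) F \<phi>(2)] F \<phi>(3)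
        by (simp add: a_minus_def r_neg)
      have car: "x \<in> carrier R" "\<phi> x \<in> carrier R" "p \<in> carrier R" "h \<in> carrier R" "c \<in> carrier R"
        using x F \<phi>(2) hV c by auto
      have xh: "x = h \<oplus> \<phi> x \<otimes> p" unfolding h_def using car by algebra
      have "(w ^^ j) h = inv c \<otimes> h"
      proof (cases "h = \<zero>")
        case True thus ?thesis using G_zero[OF G_funpow[OF wG]] ic by simp
      next
        case False
        then obtain i where "(w ^^ i) h0 = h" using w(6)[OF \<phi>(4) _ \<phi>(5) h\<phi>] hV by auto
        thus ?thesis using funpow_scalar_on_orbit[OF wG ic(1) _ j, of i] \<phi>(4) by auto
      qed
      hence "(w ^^ j) x = inv c \<otimes> h \<oplus> \<phi> x \<otimes> p"
        using xh G_add[OF G_funpow[OF wG] hV smult_V[OF F \<phi>(2)], of j]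
          G_smult[OF G_funpow[OF wG] F \<phi>(2), of j] wp by simp
      hence "c \<otimes> (w ^^ j) x = (c \<otimes> inv c) \<otimes> h \<oplus> c \<otimes> \<phi> x \<otimes> p"
        using car F_closed(1)[OF ic(1)] by algebra
      also have "\<dots> = x \<oplus> ((c \<ominus> \<one>) \<otimes> \<phi> x) \<otimes> p" unfolding ic(3) h_def using car(1,2,3,5) by algebra
      finally show "dilation p (\<lambda>x. (c \<ominus> \<one>) \<otimes> \<phi> x) x = c \<otimes> (w ^^ j) x" by (simp add: dilation_def)
    qed
  qed
  obtain p1 \<phi>1 \<phi>2 z where ax: "homology p1 \<phi>1" "homology p1 \<phi>2" "z \<in> V" "\<phi>1 z \<noteq> \<phi>2 z"
    using exists_two_axes[OF card_F trans scalar hom \<phi>(4,5)] by blast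
  \<comment> \<open>The center with two axes is some unknown p1. Its axes are carried to p, because
    p is where a transitive stabilizer is available.\<close>
  obtain g where g: "g \<in> G" "g p1 = p"
    using trans[OF homology_nonzero[OF ax(1)] homology_nonzero[OF hom]] by auto
  obtain h where h: "h \<in> G" "\<forall>x\<in>V. h (g x) = x \<and> g (h x) = x" using G_inv[OF g(1)] by auto
  have h': "\<And>x. x \<in> V \<Longrightarrow> h (g x) = x" "\<And>x. x \<in> V \<Longrightarrow> g (h x) = x" using h by auto
  have gz: "g z \<in> V" "h (g z) = z" using G_closed[OF g(1) ax(3)] h' ax(3) by auto
  have "\<exists>B. rich_center p B"
  proof (rule exists_rich_center[OF card_F hom])
    show "homology p (\<lambda>x. \<phi>1 (h x))" "homology p (\<lambda>x. \<phi>2 (h x))"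
      using homology_conj[OF ax(1) g(1) h(1) h'] homology_conj[OF ax(2) g(1) h(1) h'] g(2) by auto
    show "g z \<in> V" "\<phi>1 (h (g z)) \<noteq> \<phi>2 (h (g z))" using gz ax by auto
    show "\<exists>g\<in>G. g p = p \<and> g x = y"
      if "x \<in> V - {\<zero>}" "y \<in> V - {\<zero>}" "\<phi> x = \<zero>" "\<phi> y = \<zero>" for x y
      using w(6)[OF that] wp G_funpow[OF wG] by blast
  qed
  then obtain B where B: "rich_center p B" by auto
  have "\<exists>B. rich_center y B" if y: "y \<in> V - {\<zero>}" for y
  proof -
    obtain k where k: "k \<in> G" "k p = y" using trans[OF homology_nonzero[OF hom] y] by auto
    show ?thesis using rich_center_transport[OF B \<phi>(2) k(1)] k(2) by simp
  qed
  thus ?thesis by (rule rich_centers_imp_all_linear[OF _ \<gamma>])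
qed

end

section \<open>Additive polynomials in characteristic \<open>p\<close>\<close>

lemma (in cring) binomial_formula:
  assumes [simp]: "x \<in> carrier R" "y \<in> carrier R"
  shows "(x \<oplus> y) [^] (n::nat) = (\<Oplus>k\<in>{..n}. add_pow R (n choose k) (x [^] k \<otimes> y [^] (n - k)))"
proof (induction n)
  case 0
  show ?case by simp
next
  case (Suc n)
  let ?S = "\<lambda>k. add_pow R (n choose k) (x [^] k \<otimes> y [^] (n - k))"
  have "(x \<oplus> y) [^] Suc n = (\<Oplus>k\<in>{..n}. ?S k) \<otimes> x \<oplus> (\<Oplus>k\<in>{..n}. ?S k) \<otimes> y"
    using Suc by (simp add: r_distr)
  also have "(\<Oplus>k\<in>{..n}. ?S k) \<otimes> x = (\<Oplus>k\<in>{..n}. add_pow R (n choose k) (x [^] Suc k \<otimes> y [^] (n - k)))"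
    by (subst finsum_ldistr) (auto intro!: finsum_cong' simp: add_pow_ldistr add_pow_rdistr m_ac)
  also have "(\<Oplus>k\<in>{..n}. ?S k) \<otimes> y = (\<Oplus>k\<in>{..n}. add_pow R (n choose k) (x [^] k \<otimes> y [^] (Suc n - k)))"
    by (subst finsum_ldistr) (auto intro!: finsum_cong' simp: add_pow_ldistr add_pow_rdistr m_ac Suc_diff_le)
  also have "\<dots> = (\<Oplus>k\<in>{..Suc n}. add_pow R (n choose k) (x [^] k \<otimes> y [^] (Suc n - k)))"
    by (subst finsum_Suc) (auto simp: binomial_eq_0 Pi_def)
  also have "\<dots> = (\<Oplus>k\<in>{..n}. add_pow R (n choose Suc k) (x [^] Suc k \<otimes> y [^] (n - k))) \<oplus> y [^] Suc n"
    by (subst finsum_Suc2) (auto simp: Pi_def)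
  finally have "(x \<oplus> y) [^] Suc n =
      ((\<Oplus>k\<in>{..n}. add_pow R (n choose k) (x [^] Suc k \<otimes> y [^] (n - k))) \<oplus>
      (\<Oplus>k\<in>{..n}. add_pow R (n choose Suc k) (x [^] Suc k \<otimes> y [^] (n - k)))) \<oplus> y [^] Suc n"
    by (simp add: a_assoc Pi_def)
  also have "(\<Oplus>k\<in>{..n}. add_pow R (n choose k) (x [^] Suc k \<otimes> y [^] (n - k))) \<oplus>
      (\<Oplus>k\<in>{..n}. add_pow R (n choose Suc k) (x [^] Suc k \<otimes> y [^] (n - k))) =
      (\<Oplus>k\<in>{..n}. add_pow R (Suc n choose Suc k) (x [^] Suc k \<otimes> y [^] (n - k)))"
    by (subst finsum_addf[symmetric]) (auto intro!: finsum_cong' simp: Pi_def add.nat_pow_mult)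
  also have "\<dots> \<oplus> y [^] Suc n = (\<Oplus>k\<in>{..Suc n}. add_pow R (Suc n choose k) (x [^] k \<otimes> y [^] (Suc n - k)))"
    by (subst finsum_Suc2) (auto simp: Pi_def)
  finally show ?case .
qed

text \<open>Rings instead of fields, because the Frobenius map is needed on the polynomial ring (for
  simplicity of roots) and on the ring of power series (for lifting) as well as on L.\<close>

locale char_cring = cring R for R (structure) +
  fixes p :: nat
  assumes prime_p: "prime p" and char_p: "add_pow R p \<one> = \<zero>"
begin

lemma add_pow_multiple_p:
  assumes "x \<in> carrier R" "p dvd m" shows "add_pow R m x = \<zero>"
proof -
  obtain k where k: "m = p * k" using assms by auto
  have "add_pow R p x = add_pow R p \<one> \<otimes> x" using assms by (simp add: add_pow_ldistr)
  hence "add_pow R p x = \<zero>" using assms by (simp add: char_p)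
  thus ?thesis using assms add.nat_pow_pow[of x k p] by (simp add: k)
qed

lemma frobenius_add_prime:
  assumes [simp]: "x \<in> carrier R" "y \<in> carrier R"
  shows "(x \<oplus> y) [^] p = x [^] p \<oplus> y [^] p"
proof -
  obtain m where m: "p = Suc (Suc m)"
    using le_Suc_ex[OF prime_ge_2_nat[OF prime_p]] by auto
  have "(x \<oplus> y) [^] p = (\<Oplus>k\<in>{..p}. add_pow R (p choose k) (x [^] k \<otimes> y [^] (p - k)))"
    by (rule binomial_formula) auto
  also have "\<dots> = x [^] p \<oplus> (\<Oplus>k\<in>{..Suc m}. add_pow R (p choose k) (x [^] k \<otimes> y [^] (p - k)))"
    unfolding m by (subst finsum_Suc) (auto simp: Pi_def)
  also have "(\<Oplus>k\<in>{..Suc m}. add_pow R (p choose k) (x [^] k \<otimes> y [^] (p - k))) =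
     (\<Oplus>k\<in>{..m}. add_pow R (p choose Suc k) (x [^] Suc k \<otimes> y [^] (p - Suc k))) \<oplus> y [^] p"
    by (subst finsum_Suc2) (auto simp: Pi_def)
  also have "(\<Oplus>k\<in>{..m}. add_pow R (p choose Suc k) (x [^] Suc k \<otimes> y [^] (p - Suc k))) = (\<Oplus>k\<in>{..m}. \<zero>)"
  proof (intro finsum_cong')
    fix k assume "k \<in> {..m}"
    hence "p dvd (p choose Suc k)" using prime_p m by (intro dvd_choose_prime) auto
    thus "add_pow R (p choose Suc k) (x [^] Suc k \<otimes> y [^] (p - Suc k)) = \<zero>"
      by (intro add_pow_multiple_p) auto
  qed auto
  finally show ?thesis by simp
qed

lemma frobenius_add:
  assumes [simp]: "x \<in> carrier R" "y \<in> carrier R"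
  shows "(x \<oplus> y) [^] (p ^ e) = x [^] (p ^ e) \<oplus> y [^] (p ^ e)"
proof (induction e)
  case (Suc e)
  have "z [^] (p ^ Suc e) = (z [^] (p ^ e)) [^] p" if "z \<in> carrier R" for z
    using that by (simp add: nat_pow_pow mult.commute)
  thus ?case using Suc frobenius_add_prime by simp
qed simp

end

context ring
begin

text \<open>Defined in an arbitrary ring, so that the same expression is a value at a root, a
  polynomial when x is the variable, and a power series when the coefficients are series.\<close>

definition additive_eval :: "nat \<Rightarrow> nat \<Rightarrow> (nat \<Rightarrow> 'a) \<Rightarrow> 'a \<Rightarrow> 'a" where
  "additive_eval q n b x = x [^] (q ^ n) \<oplus> (\<Oplus>i\<in>{..<n}. b i \<otimes> x [^] (q ^ i))"

definition additive_zeros :: "nat \<Rightarrow> nat \<Rightarrow> (nat \<Rightarrow> 'a) \<Rightarrow> 'a set" where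
  "additive_zeros q n b = {x \<in> carrier R. additive_eval q n b x = \<zero>}"

lemma additive_eval_closed [simp]:
  "(\<And>i. i < n \<Longrightarrow> b i \<in> carrier R) \<Longrightarrow> x \<in> carrier R \<Longrightarrow> additive_eval q n b x \<in> carrier R"
  unfolding additive_eval_def by (intro a_closed finsum_closed) auto

end

text \<open>This naturality is what moves roots along all maps of the proof: evaluation of
  polynomials, constant terms of series, expansions, Frobenius maps and automorphisms.\<close>

lemma (in ring_hom_cring) hom_additive_eval:
  assumes "\<And>i. i < n \<Longrightarrow> b i \<in> carrier R" "x \<in> carrier R"
  shows "h (R.additive_eval q n b x) = S.additive_eval q n (\<lambda>i. h (b i)) (h x)"
proof -
  have "h (\<Oplus>i\<in>{..<n}. b i \<otimes> x [^] (q ^ i)) = (\<Oplus>\<^bsub>S\<^esub>i\<in>{..<n}. h (b i) \<otimes>\<^bsub>S\<^esub> h x [^]\<^bsub>S\<^esub> (q ^ i))"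
    using assms by (subst hom_finsum) (auto intro!: S.finsum_cong')
  moreover have "(\<Oplus>i\<in>{..<n}. b i \<otimes> x [^] (q ^ i)) \<in> carrier R"
    using assms by (intro R.finsum_closed) auto
  ultimately show ?thesis using assms by (simp add: R.additive_eval_def S.additive_eval_def)
qed

context char_cring
begin

lemma additive_eval_add:
  assumes b: "\<And>i. i < n \<Longrightarrow> b i \<in> carrier R" and q: "q = p ^ e"
    and [simp]: "x \<in> carrier R" "y \<in> carrier R"
  shows "additive_eval q n b (x \<oplus> y) = additive_eval q n b x \<oplus> additive_eval q n b y"
proof -
  have pw: "(x \<oplus> y) [^] (q ^ i) = x [^] (q ^ i) \<oplus> y [^] (q ^ i)" for i
    unfolding q power_mult[symmetric] by (rule frobenius_add) auto
  have "(\<Oplus>i\<in>{..<n}. b i \<otimes> (x \<oplus> y) [^] (q ^ i)) =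
      (\<Oplus>i\<in>{..<n}. b i \<otimes> x [^] (q ^ i)) \<oplus> (\<Oplus>i\<in>{..<n}. b i \<otimes> y [^] (q ^ i))"
  proof -
    have "(\<Oplus>i\<in>{..<n}. b i \<otimes> (x \<oplus> y) [^] (q ^ i)) = (\<Oplus>i\<in>{..<n}. b i \<otimes> x [^] (q ^ i) \<oplus> b i \<otimes> y [^] (q ^ i))"
      by (rule finsum_cong') (use b in \<open>auto simp: pw r_distr\<close>)
    also have "\<dots> = (\<Oplus>i\<in>{..<n}. b i \<otimes> x [^] (q ^ i)) \<oplus> (\<Oplus>i\<in>{..<n}. b i \<otimes> y [^] (q ^ i))"
      by (rule finsum_addf) (use b in auto)
    finally show ?thesis .
  qed
  moreover have "(\<Oplus>i\<in>{..<n}. b i \<otimes> x [^] (q ^ i)) \<in> carrier R" "(\<Oplus>i\<in>{..<n}. b i \<otimes> y [^] (q ^ i)) \<in> carrier R"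
    using b by (auto intro!: finsum_closed)
  ultimately show ?thesis unfolding additive_eval_def pw by (simp add: a_ac)
qed

lemma additive_eval_smult:
  assumes b: "\<And>i. i < n \<Longrightarrow> b i \<in> carrier R"
    and [simp]: "x \<in> carrier R" "c \<in> carrier R" and c: "c [^] q = c"
  shows "additive_eval q n b (c \<otimes> x) = c \<otimes> additive_eval q n b x"
proof -
  have cp: "c [^] (q ^ i) = c" for i
    by (induction i) (simp_all add: nat_pow_pow[symmetric] c mult.commute)
  have pw: "(c \<otimes> x) [^] (q ^ i) = c \<otimes> x [^] (q ^ i)" for i
    by (simp add: nat_pow_distrib cp)
  have "(\<Oplus>i\<in>{..<n}. b i \<otimes> (c \<otimes> x) [^] (q ^ i)) = c \<otimes> (\<Oplus>i\<in>{..<n}. b i \<otimes> x [^] (q ^ i))"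
    using b by (subst finsum_rdistr) (auto intro!: finsum_cong' simp: pw m_ac)
  moreover have "(\<Oplus>i\<in>{..<n}. b i \<otimes> x [^] (q ^ i)) \<in> carrier R"
    using b by (auto intro!: finsum_closed)
  ultimately show ?thesis unfolding additive_eval_def pw by (simp add: r_distr)
qed

lemma additive_zeros_add:
  assumes "\<And>i. i < n \<Longrightarrow> b i \<in> carrier R" "q = p ^ e"
    "x \<in> additive_zeros q n b" "y \<in> additive_zeros q n b"
  shows "x \<oplus> y \<in> additive_zeros q n b"
  using assms(3,4) additive_eval_add[OF assms(1,2)] assms(1) by (auto simp: additive_zeros_def)

lemma additive_zeros_smult:
  assumes "\<And>i. i < n \<Longrightarrow> b i \<in> carrier R" "c \<in> carrier R" "c [^] q = c" "x \<in> additive_zeros q n b"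
  shows "c \<otimes> x \<in> additive_zeros q n b"
  using assms by (auto simp: additive_zeros_def additive_eval_smult)

lemma additive_zeros_zero:
  assumes "\<And>i. i < n \<Longrightarrow> b i \<in> carrier R" "q > 0"
  shows "\<zero> \<in> additive_zeros q n b"
proof -
  have "(\<Oplus>i\<in>{..<n}. b i \<otimes> \<zero> [^] (q ^ i)) = (\<Oplus>i\<in>{..<n}. \<zero>)"
    using assms by (intro finsum_cong') (auto simp: nat_pow_zero)
  thus ?thesis using assms by (simp add: additive_zeros_def additive_eval_def nat_pow_zero)
qed

end

section \<open>Roots of additive polynomials\<close>

lemma (in domain) eval_poly_of_const:
  assumes "a \<in> carrier R" "x \<in> carrier R" shows "eval (poly_of_const a) x = a"
  using assms by (auto simp: poly_of_const_def)

lemma (in domain) eval_additive_poly: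
  assumes K: "subring K R" and a: "\<And>i. i < n \<Longrightarrow> a i \<in> K" and x: "x \<in> carrier R"
  shows "eval (additive_poly K q n a) x = additive_eval q n a x"
    and "additive_poly K q n a \<in> carrier (K[X])"
proof -
  interpret UP: domain "K[X]" using univ_poly_is_domain[OF K] .
  interpret h: ring_hom_cring "K[X]" R "\<lambda>p. eval p x" using eval_cring_hom[OF K x] .
  have aR: "i < n \<Longrightarrow> a i \<in> carrier R" for i using a subringE(1)[OF K] by auto
  have c: "poly_of_const (a i) \<in> carrier (K[X])" if "i < n" for i
    using ring_hom_closed[OF canonical_embedding_is_hom[OF K]] a[OF that] by auto
  have X: "X \<in> carrier (K[X])" using var_closed[OF K] by simp
  have f: "additive_poly K q n a = UP.additive_eval q n (\<lambda>i. poly_of_const (a i)) X"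
    by (simp add: additive_poly_def UP.additive_eval_def)
  show "additive_poly K q n a \<in> carrier (K[X])" unfolding f using c X by auto
  have "eval (additive_poly K q n a) x = additive_eval q n (\<lambda>i. eval (poly_of_const (a i)) x) (eval X x)"
    unfolding f using c X by (rule h.hom_additive_eval)
  also have "\<dots> = additive_eval q n a x"
    unfolding additive_eval_def using aR x
    by (simp add: eval_var eval_poly_of_const cong: finsum_cong)
  finally show "eval (additive_poly K q n a) x = additive_eval q n a x" .
qed

lemma (in domain) length_additive_poly:
  assumes K: "subring K R" and a: "\<And>i. i < n \<Longrightarrow> a i \<in> K" and q: "q \<ge> 2"
  shows "length (additive_poly K q n a) = Suc (q ^ n)"
proof -
  interpret UP: domain "K[X]" using univ_poly_is_domain[OF K] .
  have X: "X \<in> carrier (K[X])" using var_closed[OF K] by simp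
  have c: "poly_of_const (a i) \<in> carrier (K[X])" if "i < n" for i
    using ring_hom_closed[OF canonical_embedding_is_hom[OF K]] a[OF that] by auto
  let ?t = "\<lambda>i. poly_of_const (a i) \<otimes>\<^bsub>K[X]\<^esub> X [^]\<^bsub>K[X]\<^esub> (q ^ i)"
  have tl: "length (?t i) \<le> Suc (q ^ i)" if i: "i < n" for i
  proof (cases "a i = \<zero>")
    case True
    hence "poly_of_const (a i) = \<zero>\<^bsub>K[X]\<^esub>" by (simp add: poly_of_const_def univ_poly_zero)
    hence "?t i = \<zero>\<^bsub>K[X]\<^esub>" using X by simp
    thus ?thesis by (simp add: univ_poly_zero)
  next
    case False
    hence "?t i = monom (a i) (q ^ i)"
      using monom_eq_var_pow[OF K, of "a i" "q ^ i"] a[OF i] subringE(1)[OF K] by (auto simp: poly_of_const_def)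
    thus ?thesis by (simp add: monom_def)
  qed
  \<comment> \<open>Lists of coefficients have length degree plus one. The terms of index below m
    have degree at most q^(m-1), and q^(m-1) + 1 is at most q^m because q is at least 2; so the
    leading term is not disturbed.\<close>
  have s: "length (\<Oplus>\<^bsub>K[X]\<^esub> i \<in> {..<m}. ?t i) \<le> q ^ m" if "m \<le> n" for m
    using that
  proof (induction m)
    case 0 show ?case by (simp add: univ_poly_zero)
  next
    case (Suc m)
    have "(\<Oplus>\<^bsub>K[X]\<^esub> i \<in> {..<Suc m}. ?t i) = ?t m \<oplus>\<^bsub>K[X]\<^esub> (\<Oplus>\<^bsub>K[X]\<^esub> i \<in> {..<m}. ?t i)"
      unfolding lessThan_Suc using Suc.prems c X by (subst UP.finsum_insert) auto
    hence "length (\<Oplus>\<^bsub>K[X]\<^esub> i \<in> {..<Suc m}. ?t i) \<le> max (length (?t m)) (length (\<Oplus>\<^bsub>K[X]\<^esub> i \<in> {..<m}. ?t i))"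
      using poly_add_length_le by (simp add: univ_poly_add)
    also have "\<dots> \<le> Suc (q ^ m)" using tl[of m] Suc by auto
    also have "\<dots> \<le> q ^ Suc m"
    proof -
      have "q ^ m \<ge> 1" using q by simp
      hence "Suc (q ^ m) \<le> 2 * q ^ m" by simp
      also have "\<dots> \<le> q * q ^ m" using q by (intro mult_right_mono) auto
      finally show ?thesis by simp
    qed
    finally show ?case .
  qed
  have XN: "X [^]\<^bsub>K[X]\<^esub> (q ^ n) = monom \<one> (q ^ n)" using unitary_monom_eq_var_pow[OF K] by simp
  have "(\<Oplus>\<^bsub>K[X]\<^esub> i \<in> {..<n}. ?t i) \<in> carrier (K[X])" using c X by (intro UP.finsum_closed) auto
  moreover have "X [^]\<^bsub>K[X]\<^esub> (q ^ n) \<in> carrier (K[X])" using X by simp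
  ultimately show ?thesis
    unfolding additive_poly_def univ_poly_add
    using s[of n] poly_add_length_eq[OF K, of "X [^]\<^bsub>K[X]\<^esub> (q ^ n)" "\<Oplus>\<^bsub>K[X]\<^esub> i \<in> {..<n}. ?t i"]
    by (simp add: univ_poly_carrier XN) (simp add: monom_def)
qed

lemma (in domain) zero_set_additive_poly:
  assumes "subring K R" "\<And>i. i < n \<Longrightarrow> a i \<in> K" "q \<ge> 2"
  shows "zero_set (additive_poly K q n a) = additive_zeros q n a"
proof -
  have "additive_poly K q n a \<noteq> []" using length_additive_poly[OF assms] by fastforce
  moreover have "eval (additive_poly K q n a) x = additive_eval q n a x" if "x \<in> carrier R" for x
    using assms that by (intro eval_additive_poly(1))
  ultimately show ?thesis by (auto simp: zero_set_def is_root_def additive_zeros_def)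
qed

lemma (in domain) poly_ring_char:
  assumes "prime p" "add_pow R p \<one> = \<zero>"
  shows "char_cring (poly_ring R) p"
proof -
  interpret UP: domain "poly_ring R" using univ_poly_is_domain[OF carrier_is_subring] .
  interpret h: ring_hom_ring R "poly_ring R" poly_of_const
    using canonical_embedding_ring_hom[OF carrier_is_subring] by simp
  have "add_pow (poly_ring R) k (poly_of_const \<one>) = poly_of_const (add_pow R k \<one>)" for k :: nat
  proof (induction k)
    case 0 show ?case by (simp add: add_pow_def)
  next
    case (Suc k)
    have "\<one> [^]\<^bsub>add_monoid R\<^esub> k \<in> carrier R" using add.nat_pow_closed[of "\<one>" k] by (simp add: add_pow_def)
    thus ?case using Suc by (simp add: add_pow_def)
  qed
  hence "add_pow (poly_ring R) p \<one>\<^bsub>poly_ring R\<^esub> = \<zero>\<^bsub>poly_ring R\<^esub>"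
    using assms(2) h.hom_one h.hom_zero by metis
  thus ?thesis using assms(1) by unfold_locales auto
qed

text \<open>Additivity gives \<open>f(X) = f(X - u) = b\<^sub>0 (X - u) + (X - u)\<^sup>2 w\<close> at a root \<open>u\<close>, so all
  roots are simple when \<open>b\<^sub>0 \<noteq> 0\<close>.\<close>

lemma (in domain) alg_mult_additive_poly:
  assumes p: "prime p" "add_pow R p \<one> = \<zero>" and q: "q = p ^ e" "q \<ge> 2" and n: "n > 0"
    and b: "\<And>i. i < n \<Longrightarrow> b i \<in> carrier R" "b 0 \<noteq> \<zero>"
    and u: "u \<in> carrier R" "additive_eval q n b u = \<zero>"
  shows "alg_mult (additive_poly (carrier R) q n b) u \<le> 1"
proof (rule ccontr)
  assume gt: "\<not> ?thesis"
  let ?P = "poly_ring R"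
  let ?f = "additive_poly (carrier R) q n b"
  interpret UP: domain ?P using univ_poly_is_domain[OF carrier_is_subring] .
  interpret UC: char_cring ?P p using poly_ring_char[OF p] .
  interpret h: ring_hom_ring R ?P poly_of_const
    using canonical_embedding_ring_hom[OF carrier_is_subring] by simp
  interpret hc: ring_hom_cring R ?P poly_of_const by unfold_locales (simp add: h.homh)
  interpret ev: ring_hom_cring ?P R "\<lambda>p. eval p u" using eval_cring_hom[OF carrier_is_subring u(1)] .
  have X: "X \<in> carrier ?P" using var_closed[OF carrier_is_subring] by simp
  define Y where "Y = X \<ominus>\<^bsub>?P\<^esub> poly_of_const u"
  have Y: "Y \<in> carrier ?P" unfolding Y_def using X u by simp
  have Yu: "eval Y u = \<zero>"
    unfolding Y_def using X u by (simp add: a_minus_def eval_var eval_poly_of_const UP.minus_eq r_neg)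
  let ?b = "\<lambda>i. poly_of_const (b i)"
  have cb: "?b i \<in> carrier ?P" if "i < n" for i using b that by simp
  have f: "?f = UP.additive_eval q n ?b X"
    by (simp add: additive_poly_def UP.additive_eval_def)
  have XY: "X = Y \<oplus>\<^bsub>?P\<^esub> poly_of_const u"
    unfolding Y_def using X u by (simp add: a_minus_def UP.a_assoc UP.l_neg)
  have "UP.additive_eval q n ?b (poly_of_const u) = \<zero>\<^bsub>?P\<^esub>"
    using hc.hom_additive_eval[of n b u q] b u by simp
  hence fY: "?f = UP.additive_eval q n ?b Y"
    unfolding f XY using UC.additive_eval_add[where b = ?b and n = n and x = Y and y = "poly_of_const u", OF cb q(1) Y] u Y cb by simp
  obtain m where m: "n = Suc m" using n by (cases n) auto
  have pow2: "\<exists>w\<in>carrier ?P. Y [^]\<^bsub>?P\<^esub> (q ^ Suc i) = (Y \<otimes>\<^bsub>?P\<^esub> Y) \<otimes>\<^bsub>?P\<^esub> w" for i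
  proof -
    have "q ^ Suc i \<ge> 2" using q(2) self_le_power[of q "Suc i"] by linarith
    then obtain j where j: "q ^ Suc i = 2 + j" using le_Suc_ex by blast
    have "Y [^]\<^bsub>?P\<^esub> (2 + j) = Y [^]\<^bsub>?P\<^esub> (2::nat) \<otimes>\<^bsub>?P\<^esub> Y [^]\<^bsub>?P\<^esub> j"
      using Y by (simp add: UP.nat_pow_mult)
    thus ?thesis using j Y by (auto simp: numeral_2_eq_2 intro!: bexI[of _ "Y [^]\<^bsub>?P\<^esub> j"])
  qed
  have tail: "\<exists>w\<in>carrier ?P. (\<Oplus>\<^bsub>?P\<^esub>i\<in>{..<k}. ?b (Suc i) \<otimes>\<^bsub>?P\<^esub> Y [^]\<^bsub>?P\<^esub> (q ^ Suc i)) = (Y \<otimes>\<^bsub>?P\<^esub> Y) \<otimes>\<^bsub>?P\<^esub> w"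
    if "k \<le> m" for k using that
  proof (induction k)
    case 0 show ?case using Y by (auto intro!: bexI[of _ "\<zero>\<^bsub>?P\<^esub>"])
  next
    case (Suc k)
    then obtain w where w: "w \<in> carrier ?P"
      "(\<Oplus>\<^bsub>?P\<^esub>i\<in>{..<k}. ?b (Suc i) \<otimes>\<^bsub>?P\<^esub> Y [^]\<^bsub>?P\<^esub> (q ^ Suc i)) = (Y \<otimes>\<^bsub>?P\<^esub> Y) \<otimes>\<^bsub>?P\<^esub> w" by auto
    obtain v where v: "v \<in> carrier ?P" "Y [^]\<^bsub>?P\<^esub> (q ^ Suc k) = (Y \<otimes>\<^bsub>?P\<^esub> Y) \<otimes>\<^bsub>?P\<^esub> v" using pow2[of k] by auto
    have bk: "?b (Suc k) \<in> carrier ?P" using cb Suc.prems m by auto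
    have "(\<Oplus>\<^bsub>?P\<^esub>i\<in>{..<Suc k}. ?b (Suc i) \<otimes>\<^bsub>?P\<^esub> Y [^]\<^bsub>?P\<^esub> (q ^ Suc i)) =
       ?b (Suc k) \<otimes>\<^bsub>?P\<^esub> Y [^]\<^bsub>?P\<^esub> (q ^ Suc k) \<oplus>\<^bsub>?P\<^esub> (\<Oplus>\<^bsub>?P\<^esub>i\<in>{..<k}. ?b (Suc i) \<otimes>\<^bsub>?P\<^esub> Y [^]\<^bsub>?P\<^esub> (q ^ Suc i))"
      unfolding lessThan_Suc using Suc.prems cb Y m by (subst UP.finsum_insert) auto
    also have "\<dots> = (Y \<otimes>\<^bsub>?P\<^esub> Y) \<otimes>\<^bsub>?P\<^esub> (?b (Suc k) \<otimes>\<^bsub>?P\<^esub> v \<oplus>\<^bsub>?P\<^esub> w)"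
      unfolding w(2) v(2) using bk v(1) w(1) Y by (simp add: UP.r_distr UP.m_ac)
    finally show ?case using bk v(1) w(1) by (intro bexI[of _ "?b (Suc k) \<otimes>\<^bsub>?P\<^esub> v \<oplus>\<^bsub>?P\<^esub> w"]) auto
  qed
  obtain w where w: "w \<in> carrier ?P"
     "(\<Oplus>\<^bsub>?P\<^esub>i\<in>{..<m}. ?b (Suc i) \<otimes>\<^bsub>?P\<^esub> Y [^]\<^bsub>?P\<^esub> (q ^ Suc i)) = (Y \<otimes>\<^bsub>?P\<^esub> Y) \<otimes>\<^bsub>?P\<^esub> w"
    using tail[of m] by auto
  obtain v where v: "v \<in> carrier ?P" "Y [^]\<^bsub>?P\<^esub> (q ^ n) = (Y \<otimes>\<^bsub>?P\<^esub> Y) \<otimes>\<^bsub>?P\<^esub> v" using pow2[of m] m by auto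
  have "(\<Oplus>\<^bsub>?P\<^esub>i\<in>{..<n}. ?b i \<otimes>\<^bsub>?P\<^esub> Y [^]\<^bsub>?P\<^esub> (q ^ i)) =
     (\<Oplus>\<^bsub>?P\<^esub>i\<in>{..<m}. ?b (Suc i) \<otimes>\<^bsub>?P\<^esub> Y [^]\<^bsub>?P\<^esub> (q ^ Suc i)) \<oplus>\<^bsub>?P\<^esub> ?b 0 \<otimes>\<^bsub>?P\<^esub> Y"
  proof (cases m)
    case 0
    thus ?thesis using m cb[of 0] Y by (simp add: lessThan_Suc)
  next
    case (Suc m')
    have "{..<n} = {..Suc m'}" "{..<m} = {..m'}" using m Suc by auto
    thus ?thesis using cb Y m Suc by (simp only:) (subst UP.finsum_Suc2, auto simp: Pi_def)
  qed
  hence fY': "?f = (Y \<otimes>\<^bsub>?P\<^esub> Y) \<otimes>\<^bsub>?P\<^esub> v \<oplus>\<^bsub>?P\<^esub> ((Y \<otimes>\<^bsub>?P\<^esub> Y) \<otimes>\<^bsub>?P\<^esub> w \<oplus>\<^bsub>?P\<^esub> ?b 0 \<otimes>\<^bsub>?P\<^esub> Y)"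
    unfolding fY UP.additive_eval_def v(2) w(2)[symmetric] by simp
  have fc: "?f \<in> carrier ?P" using eval_additive_poly(2)[OF carrier_is_subring, of n b u q] b u by simp
  \<comment> \<open>Multiplicities of roots refer to the coefficient list of X - u.\<close>
  have Y': "[\<one>, \<ominus> u] = Y"
  proof -
    have "polynomial (carrier R) [\<one>, \<ominus> u]" using u by (auto simp: polynomial_def)
    hence 1: "[\<one>, \<ominus> u] \<in> carrier ?P" by (simp add: univ_poly_carrier)
    have "[\<one>, \<ominus> u] = poly_of_const \<one> \<otimes>\<^bsub>?P\<^esub> X \<oplus>\<^bsub>?P\<^esub> poly_of_const (\<ominus> u)"
      using eval_rewrite[OF carrier_is_subring 1] X u by simp
    thus ?thesis unfolding Y_def using X u by (simp add: a_minus_def UP.minus_eq)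
  qed
  have "([\<one>, \<ominus> u] [^]\<^bsub>?P\<^esub> (2::nat)) pdivides ?f"
    using le_alg_mult_imp_pdivides[OF u(1) fc, of 2] gt by simp
  then obtain z where z: "z \<in> carrier ?P" "?f = (Y \<otimes>\<^bsub>?P\<^esub> Y) \<otimes>\<^bsub>?P\<^esub> z"
    using Y unfolding Y' pdivides_def factor_def by (auto simp: numeral_2_eq_2)
  have b0: "?b 0 \<in> carrier ?P" using cb n by simp
  \<comment> \<open>Cancelling one factor Y from the comparison of the two expressions exhibits the
    constant b 0 as a multiple of Y, which vanishes at u.\<close>
  have "Y \<otimes>\<^bsub>?P\<^esub> ?b 0 = Y \<otimes>\<^bsub>?P\<^esub> (Y \<otimes>\<^bsub>?P\<^esub> (z \<ominus>\<^bsub>?P\<^esub> v \<ominus>\<^bsub>?P\<^esub> w))"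
  proof -
    have "Y \<otimes>\<^bsub>?P\<^esub> ?b 0 = ((Y \<otimes>\<^bsub>?P\<^esub> Y) \<otimes>\<^bsub>?P\<^esub> v \<oplus>\<^bsub>?P\<^esub> ((Y \<otimes>\<^bsub>?P\<^esub> Y) \<otimes>\<^bsub>?P\<^esub> w \<oplus>\<^bsub>?P\<^esub> ?b 0 \<otimes>\<^bsub>?P\<^esub> Y))
        \<ominus>\<^bsub>?P\<^esub> (Y \<otimes>\<^bsub>?P\<^esub> Y) \<otimes>\<^bsub>?P\<^esub> v \<ominus>\<^bsub>?P\<^esub> (Y \<otimes>\<^bsub>?P\<^esub> Y) \<otimes>\<^bsub>?P\<^esub> w"
      using Y b0 v(1) w(1) by algebra
    also have "\<dots> = (Y \<otimes>\<^bsub>?P\<^esub> Y) \<otimes>\<^bsub>?P\<^esub> z \<ominus>\<^bsub>?P\<^esub> (Y \<otimes>\<^bsub>?P\<^esub> Y) \<otimes>\<^bsub>?P\<^esub> v \<ominus>\<^bsub>?P\<^esub> (Y \<otimes>\<^bsub>?P\<^esub> Y) \<otimes>\<^bsub>?P\<^esub> w"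
      using z(2) fY' by simp
    also have "\<dots> = Y \<otimes>\<^bsub>?P\<^esub> (Y \<otimes>\<^bsub>?P\<^esub> (z \<ominus>\<^bsub>?P\<^esub> v \<ominus>\<^bsub>?P\<^esub> w))" using Y z(1) v(1) w(1) by algebra
    finally show ?thesis .
  qed
  moreover have "Y \<noteq> \<zero>\<^bsub>?P\<^esub>" unfolding Y'[symmetric] by (simp add: univ_poly_zero)
  ultimately have "?b 0 = Y \<otimes>\<^bsub>?P\<^esub> (z \<ominus>\<^bsub>?P\<^esub> v \<ominus>\<^bsub>?P\<^esub> w)"
    using Y b0 z(1) v(1) w(1) by (simp add: UP.m_lcancel)
  hence "eval (?b 0) u = \<zero>" using Y z(1) v(1) w(1) Yu by simp
  thus False using b n u by (simp add: eval_poly_of_const)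
qed

text \<open>The polynomial has degree q^n, splits, and has simple roots. This count stands in for
  dimension theory: spaces of roots are compared below by cardinality only.\<close>

theorem (in algebraically_closed) card_additive_zeros:
  assumes p: "prime p" "add_pow L p \<one> = \<zero>" and q: "q = p ^ e" "q \<ge> 2" and n: "n > 0"
    and b: "\<And>i. i < n \<Longrightarrow> b i \<in> carrier L" "b 0 \<noteq> \<zero>"
  shows "card (additive_zeros q n b) = q ^ n" "finite (additive_zeros q n b)"
proof -
  let ?f = "additive_poly (carrier L) q n b"
  have fc: "?f \<in> carrier (poly_ring L)" using eval_additive_poly(2)[OF carrier_is_subring, of n b "\<zero>" q] b by simp
  have Z: "additive_zeros q n b = {x. is_root ?f x}"
    using zero_set_additive_poly[OF carrier_is_subring b(1) q(2)] by (simp add: zero_set_def)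
  also have "\<dots> = set_mset (roots ?f)" using roots_mem_iff_is_root[OF fc] by auto
  finally have Z': "additive_zeros q n b = set_mset (roots ?f)" .
  show "finite (additive_zeros q n b)" unfolding Z' by simp
  have "count (roots ?f) u = 1" if "u \<in># roots ?f" for u
  proof -
    have "u \<in> carrier L" "additive_eval q n b u = \<zero>" using that Z' by (auto simp: additive_zeros_def)
    hence "alg_mult ?f u \<le> 1" using alg_mult_additive_poly[where b = b, OF p q n b] by simp
    thus ?thesis using that alg_mult_eq_count_roots[OF fc] by (metis One_nat_def le_antisym Suc_leI count_greater_zero_iff)
  qed
  hence "size (roots ?f) = card (set_mset (roots ?f))" by (simp add: size_multiset_overloaded_eq)
  moreover have "size (roots ?f) = q ^ n"
    using roots_over_carrier[OF fc] length_additive_poly[OF carrier_is_subring b(1) q(2)] by (simp add: splitted_def)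
  ultimately show "card (additive_zeros q n b) = q ^ n" unfolding Z' by simp
qed

section \<open>Formal power series\<close>

definition series :: "('a, 'm) ring_scheme \<Rightarrow> (nat \<Rightarrow> 'a) ring" where
  "series R = \<lparr>carrier = {f. \<forall>n. f n \<in> carrier R},
     monoid.mult = (\<lambda>f g n. \<Oplus>\<^bsub>R\<^esub>i\<in>{..n}. f i \<otimes>\<^bsub>R\<^esub> g (n - i)),
     one = (\<lambda>n. if n = 0 then \<one>\<^bsub>R\<^esub> else \<zero>\<^bsub>R\<^esub>),
     zero = (\<lambda>n. \<zero>\<^bsub>R\<^esub>), add = (\<lambda>f g n. f n \<oplus>\<^bsub>R\<^esub> g n)\<rparr>"

definition series_const :: "('a, 'm) ring_scheme \<Rightarrow> 'a \<Rightarrow> nat \<Rightarrow> 'a" where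
  "series_const R c = (\<lambda>n. if n = 0 then c else \<zero>\<^bsub>R\<^esub>)"

definition series_var :: "('a, 'm) ring_scheme \<Rightarrow> nat \<Rightarrow> 'a" where
  "series_var R = (\<lambda>n. if n = 1 then \<one>\<^bsub>R\<^esub> else \<zero>\<^bsub>R\<^esub>)"

lemma series_carrier: "f \<in> carrier (series R) \<longleftrightarrow> (\<forall>n. f n \<in> carrier R)"
  by (simp add: series_def)

lemma series_closed: "f \<in> carrier (series R) \<Longrightarrow> f n \<in> carrier R"
  by (simp add: series_carrier)

lemma series_mult: "(f \<otimes>\<^bsub>series R\<^esub> g) n = (\<Oplus>\<^bsub>R\<^esub>i\<in>{..n}. f i \<otimes>\<^bsub>R\<^esub> g (n - i))"
  and series_one: "\<one>\<^bsub>series R\<^esub> n = (if n = 0 then \<one>\<^bsub>R\<^esub> else \<zero>\<^bsub>R\<^esub>)"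
  and series_zero: "\<zero>\<^bsub>series R\<^esub> n = \<zero>\<^bsub>R\<^esub>"
  and series_add: "(f \<oplus>\<^bsub>series R\<^esub> g) n = f n \<oplus>\<^bsub>R\<^esub> g n"
  by (simp_all add: series_def)

context cring
begin

lemma truncation_in_up:
  "f \<in> carrier (series R) \<Longrightarrow> (\<lambda>i. if i \<le> N then f i else \<zero>) \<in> carrier (UP R)"
  unfolding UP_def by (auto simp: series_carrier intro!: mem_upI exI[of _ N] bound.intro)

lemma add_self_cancel: "x \<in> carrier R \<Longrightarrow> d \<in> carrier R \<Longrightarrow> x = x \<oplus> d \<Longrightarrow> d = \<zero>"
  using add.l_cancel[of x d "\<zero>"] by simp

text \<open>The coefficient of index \<open>n\<close> in a product only sees coefficients of index at most \<open>n\<close>, so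
  the ring laws are inherited from polynomials by truncation.\<close>

lemma series_mult_truncate:
  assumes "f \<in> carrier (series R)" "g \<in> carrier (series R)" "n \<le> N"
  shows "(f \<otimes>\<^bsub>series R\<^esub> g) n =
     ((\<lambda>i. if i \<le> N then f i else \<zero>) \<otimes>\<^bsub>UP R\<^esub> (\<lambda>i. if i \<le> N then g i else \<zero>)) n"
proof -
  let ?f = "\<lambda>i. if i \<le> N then f i else \<zero>"
  let ?g = "\<lambda>i. if i \<le> N then g i else \<zero>"
  have "(?f \<otimes>\<^bsub>UP R\<^esub> ?g) n = (\<Oplus>i\<in>{..n}. ?f i \<otimes> ?g (n - i))"
    using truncation_in_up[OF assms(1), of N] truncation_in_up[OF assms(2), of N] unfolding UP_def by simp
  also have "\<dots> = (\<Oplus>i\<in>{..n}. f i \<otimes> g (n - i))"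
    by (rule finsum_cong') (use assms(3) series_closed[OF assms(1)] series_closed[OF assms(2)] in auto)
  finally show ?thesis by (simp add: series_mult)
qed

lemma series_cring: "cring (series R)"
proof -
  interpret U: UP_cring R "UP R" by unfold_locales auto
  let ?S = "series R"
  let ?t = "\<lambda>N f i. if i \<le> N then f i else \<zero>"
  have mc: "f \<otimes>\<^bsub>?S\<^esub> g \<in> carrier ?S" if "f \<in> carrier ?S" "g \<in> carrier ?S" for f g
    using series_closed[OF that(1)] series_closed[OF that(2)]
    by (auto simp: series_carrier series_mult intro!: finsum_closed)
  have up_mult: "(p \<otimes>\<^bsub>UP R\<^esub> r) n = (\<Oplus>i\<in>{..n}. p i \<otimes> r (n - i))"
    if "p \<in> carrier (UP R)" "r \<in> carrier (UP R)" for p r n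
    using that unfolding UP_def by simp
  show ?thesis
  proof (rule cringI)
    show "abelian_group ?S"
    proof (rule abelian_groupI)
      fix f assume f: "f \<in> carrier ?S"
      show "\<exists>g\<in>carrier ?S. g \<oplus>\<^bsub>?S\<^esub> f = \<zero>\<^bsub>?S\<^esub>"
        using f by (intro bexI[of _ "\<lambda>n. \<ominus> f n"]) (auto simp: series_def l_neg)
    qed (auto simp: series_def a_ac)
    show "comm_monoid ?S"
    proof (rule comm_monoidI)
      show "\<one>\<^bsub>?S\<^esub> \<in> carrier ?S" by (simp add: series_carrier series_one)
      fix f g h assume f: "f \<in> carrier ?S" and g: "g \<in> carrier ?S" and h: "h \<in> carrier ?S"
      show "f \<otimes>\<^bsub>?S\<^esub> g \<in> carrier ?S" using mc[OF f g] .
      show "f \<otimes>\<^bsub>?S\<^esub> g = g \<otimes>\<^bsub>?S\<^esub> f"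
        using U.UP_m_comm[OF truncation_in_up[OF f] truncation_in_up[OF g]]
        by (intro ext) (simp add: series_mult_truncate[OF f g order_refl] series_mult_truncate[OF g f order_refl])
      show "(f \<otimes>\<^bsub>?S\<^esub> g) \<otimes>\<^bsub>?S\<^esub> h = f \<otimes>\<^bsub>?S\<^esub> (g \<otimes>\<^bsub>?S\<^esub> h)"
      proof
        fix n
        note t = truncation_in_up[OF f, of n] truncation_in_up[OF g, of n] truncation_in_up[OF h, of n]
        have "((f \<otimes>\<^bsub>?S\<^esub> g) \<otimes>\<^bsub>?S\<^esub> h) n = ((?t n f \<otimes>\<^bsub>UP R\<^esub> ?t n g) \<otimes>\<^bsub>UP R\<^esub> ?t n h) n"
          unfolding series_mult[of R "f \<otimes>\<^bsub>?S\<^esub> g"] up_mult[OF U.UP_mult_closed[OF t(1,2)] t(3)]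
        proof (rule finsum_cong')
          show "(\<lambda>i. (?t n f \<otimes>\<^bsub>UP R\<^esub> ?t n g) i \<otimes> ?t n h (n - i)) \<in> {..n} \<rightarrow> carrier R"
            using series_closed[OF mc[OF f g]] series_closed[OF h]
            by (auto simp: series_mult_truncate[OF f g, symmetric])
        qed (auto simp: series_mult_truncate[OF f g, of _ n])
        also have "\<dots> = (?t n f \<otimes>\<^bsub>UP R\<^esub> (?t n g \<otimes>\<^bsub>UP R\<^esub> ?t n h)) n" using U.UP_m_assoc[OF t] by simp
        also have "\<dots> = (f \<otimes>\<^bsub>?S\<^esub> (g \<otimes>\<^bsub>?S\<^esub> h)) n"
          unfolding series_mult[of R f] up_mult[OF t(1) U.UP_mult_closed[OF t(2,3)]]
        proof (rule finsum_cong')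
          show "(\<lambda>i. f i \<otimes> (g \<otimes>\<^bsub>?S\<^esub> h) (n - i)) \<in> {..n} \<rightarrow> carrier R"
            using series_closed[OF mc[OF g h]] series_closed[OF f] by auto
        qed (auto simp: series_mult_truncate[OF g h, of _ n])
        finally show "((f \<otimes>\<^bsub>?S\<^esub> g) \<otimes>\<^bsub>?S\<^esub> h) n = (f \<otimes>\<^bsub>?S\<^esub> (g \<otimes>\<^bsub>?S\<^esub> h)) n" .
      qed
    next
      fix f assume f: "f \<in> carrier ?S"
      show "\<one>\<^bsub>?S\<^esub> \<otimes>\<^bsub>?S\<^esub> f = f"
      proof
        fix n
        have "(\<one>\<^bsub>?S\<^esub> \<otimes>\<^bsub>?S\<^esub> f) n = (\<Oplus>i\<in>{..n}. if 0 = i then f (n - i) else \<zero>)"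
          unfolding series_mult using series_closed[OF f] by (intro finsum_cong') (auto simp: series_one)
        also have "\<dots> = f n" using add.finprod_singleton[of 0 "{..n}" "\<lambda>i. f (n - i)"] series_closed[OF f] by simp
        finally show "(\<one>\<^bsub>?S\<^esub> \<otimes>\<^bsub>?S\<^esub> f) n = f n" .
      qed
    qed
    fix f g h assume f: "f \<in> carrier ?S" and g: "g \<in> carrier ?S" and h: "h \<in> carrier ?S"
    show "(f \<oplus>\<^bsub>?S\<^esub> g) \<otimes>\<^bsub>?S\<^esub> h = f \<otimes>\<^bsub>?S\<^esub> h \<oplus>\<^bsub>?S\<^esub> g \<otimes>\<^bsub>?S\<^esub> h"
    proof
      fix n
      have "((f \<oplus>\<^bsub>?S\<^esub> g) \<otimes>\<^bsub>?S\<^esub> h) n = (\<Oplus>i\<in>{..n}. f i \<otimes> h (n - i) \<oplus> g i \<otimes> h (n - i))"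
        unfolding series_mult using series_closed[OF f] series_closed[OF g] series_closed[OF h]
        by (intro finsum_cong') (auto simp: series_add l_distr)
      also have "\<dots> = (\<Oplus>i\<in>{..n}. f i \<otimes> h (n - i)) \<oplus> (\<Oplus>i\<in>{..n}. g i \<otimes> h (n - i))"
        by (rule finsum_addf) (use series_closed[OF f] series_closed[OF g] series_closed[OF h] in auto)
      finally show "((f \<oplus>\<^bsub>?S\<^esub> g) \<otimes>\<^bsub>?S\<^esub> h) n = (f \<otimes>\<^bsub>?S\<^esub> h \<oplus>\<^bsub>?S\<^esub> g \<otimes>\<^bsub>?S\<^esub> h) n"
        by (simp add: series_add series_mult)
    qed
  qed
qed

lemma series_const_closed [simp]: "c \<in> carrier R \<Longrightarrow> series_const R c \<in> carrier (series R)"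
  by (simp add: series_carrier series_const_def)

lemma series_var_closed [simp]: "series_var R \<in> carrier (series R)"
  by (simp add: series_carrier series_var_def)

lemma series_const_mult:
  assumes "c \<in> carrier R" "f \<in> carrier (series R)"
  shows "(series_const R c \<otimes>\<^bsub>series R\<^esub> f) n = c \<otimes> f n"
proof -
  have "(series_const R c \<otimes>\<^bsub>series R\<^esub> f) n = (\<Oplus>i\<in>{..n}. if 0 = i then c \<otimes> f (n - i) else \<zero>)"
    unfolding series_mult using assms(1) series_closed[OF assms(2)] by (intro finsum_cong') (auto simp: series_const_def)
  also have "\<dots> = c \<otimes> f n"
    using add.finprod_singleton[of 0 "{..n}" "\<lambda>i. c \<otimes> f (n - i)"] assms(1) series_closed[OF assms(2)] by simp
  finally show ?thesis .
qed

lemma series_const_hom: "series_const R \<in> ring_hom R (series R)"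
proof (rule ring_hom_memI)
  fix x y assume "x \<in> carrier R" "y \<in> carrier R"
  thus "series_const R (x \<otimes> y) = series_const R x \<otimes>\<^bsub>series R\<^esub> series_const R y"
    by (intro ext) (simp add: series_const_mult, simp add: series_const_def)
qed (auto simp: series_const_def series_add series_one series_carrier fun_eq_iff)

lemma series_mult_0: "f \<in> carrier (series R) \<Longrightarrow> g \<in> carrier (series R) \<Longrightarrow> (f \<otimes>\<^bsub>series R\<^esub> g) 0 = f 0 \<otimes> g 0"
  by (simp add: series_mult series_carrier)

lemma series_constant_term_hom: "(\<lambda>f. f 0) \<in> ring_hom (series R) R"
  by (rule ring_hom_memI) (simp_all add: series_mult_0 series_add series_one series_closed[where n = 0])

text \<open>Used with the q-th power map. The result is the Frobenius map on coefficients, which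
  fixes the variable, unlike the q-th power in the ring of series.\<close>

lemma series_map_hom:
  assumes "\<phi> \<in> ring_hom R R" shows "(\<lambda>f n. \<phi> (f n)) \<in> ring_hom (series R) (series R)"
proof -
  interpret \<phi>: ring_hom_cring R R \<phi> by unfold_locales (rule assms)
  show ?thesis
  proof (rule ring_hom_memI)
    fix f g assume f: "f \<in> carrier (series R)" and g: "g \<in> carrier (series R)"
    show "(\<lambda>n. \<phi> ((f \<otimes>\<^bsub>series R\<^esub> g) n)) = (\<lambda>n. \<phi> (f n)) \<otimes>\<^bsub>series R\<^esub> (\<lambda>n. \<phi> (g n))"
    proof
      fix n
      have "\<phi> (\<Oplus>i\<in>{..n}. f i \<otimes> g (n - i)) = (\<Oplus>i\<in>{..n}. \<phi> (f i \<otimes> g (n - i)))"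
        using series_closed[OF f] series_closed[OF g] by (subst \<phi>.hom_finsum) (auto simp: comp_def)
      also have "\<dots> = (\<Oplus>i\<in>{..n}. \<phi> (f i) \<otimes> \<phi> (g (n - i)))"
        by (rule finsum_cong') (use series_closed[OF f] series_closed[OF g] in auto)
      finally show "\<phi> ((f \<otimes>\<^bsub>series R\<^esub> g) n) = ((\<lambda>n. \<phi> (f n)) \<otimes>\<^bsub>series R\<^esub> (\<lambda>n. \<phi> (g n))) n"
        by (simp add: series_mult)
    qed
  qed (auto simp: series_carrier series_add series_one)
qed

lemma series_finsum_coeff:
  assumes "\<And>i. i \<in> A \<Longrightarrow> f i \<in> carrier (series R)"
  shows "(\<Oplus>\<^bsub>series R\<^esub>i\<in>A. f i) n = (\<Oplus>i\<in>A. f i n)"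
proof -
  interpret S: cring "series R" by (rule series_cring)
  show ?thesis using assms
  proof (induction A rule: infinite_finite_induct)
    case (infinite A)
    thus ?case by (simp add: series_zero)
  next
    case empty
    show ?case by (simp add: series_zero)
  next
    case (insert x A)
    have c: "f i n \<in> carrier R" if "i \<in> insert x A" for i using series_closed[OF insert.prems[OF that]] .
    have "(\<Oplus>\<^bsub>series R\<^esub>i\<in>insert x A. f i) = f x \<oplus>\<^bsub>series R\<^esub> (\<Oplus>\<^bsub>series R\<^esub>i\<in>A. f i)"
      by (rule S.finsum_insert) (use insert in auto)
    moreover have "(\<Oplus>i\<in>insert x A. f i n) = f x n \<oplus> (\<Oplus>i\<in>A. f i n)"
      by (rule finsum_insert) (use insert c in auto)
    ultimately show ?case using insert by (simp add: series_add)
  qed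
qed

text \<open>Orders add and lowest coefficients multiply. This yields integrality, and it shows that
  powers of a series of positive order have no influence on its leading term.\<close>

lemma series_mult_order:
  assumes "f \<in> carrier (series R)" "g \<in> carrier (series R)"
    and "\<And>j. j < a \<Longrightarrow> f j = \<zero>" "\<And>j. j < b \<Longrightarrow> g j = \<zero>"
  shows "j < a + b \<Longrightarrow> (f \<otimes>\<^bsub>series R\<^esub> g) j = \<zero>"
    and "(f \<otimes>\<^bsub>series R\<^esub> g) (a + b) = f a \<otimes> g b"
proof -
  assume j: "j < a + b"
  have "(f \<otimes>\<^bsub>series R\<^esub> g) j = (\<Oplus>i\<in>{..j}. \<zero>)" unfolding series_mult
  proof (intro finsum_cong')
    fix i assume "i \<in> {..j}"
    hence "i < a \<or> j - i < b" using j by auto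
    thus "f i \<otimes> g (j - i) = \<zero>" using assms(3,4) series_closed[OF assms(1)] series_closed[OF assms(2)] by auto
  qed auto
  thus "(f \<otimes>\<^bsub>series R\<^esub> g) j = \<zero>" by simp
next
  have "(f \<otimes>\<^bsub>series R\<^esub> g) (a + b) = (\<Oplus>i\<in>{..a+b}. if a = i then f i \<otimes> g (a + b - i) else \<zero>)"
    unfolding series_mult
  proof (intro finsum_cong')
    fix i assume "i \<in> {..a+b}"
    hence "a \<noteq> i \<Longrightarrow> i < a \<or> a + b - i < b" by auto
    thus "f i \<otimes> g (a + b - i) = (if a = i then f i \<otimes> g (a + b - i) else \<zero>)"
      using assms(3,4) series_closed[OF assms(1)] series_closed[OF assms(2)] by auto
  qed (use series_closed[OF assms(1)] series_closed[OF assms(2)] in auto)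
  also have "\<dots> = f a \<otimes> g b"
    using add.finprod_singleton[of a "{..a+b}" "\<lambda>i. f i \<otimes> g (a + b - i)"]
      series_closed[OF assms(1)] series_closed[OF assms(2)] by simp
  finally show "(f \<otimes>\<^bsub>series R\<^esub> g) (a + b) = f a \<otimes> g b" .
qed

lemma series_pow_order:
  assumes f: "f \<in> carrier (series R)" "\<And>j. j < a \<Longrightarrow> f j = \<zero>"
  shows "j < a * m \<Longrightarrow> (f [^]\<^bsub>series R\<^esub> (m::nat)) j = \<zero>"
proof (induction m arbitrary: j)
  case (Suc m)
  interpret S: cring "series R" by (rule series_cring)
  have "f [^]\<^bsub>series R\<^esub> m \<in> carrier (series R)" using f by simp
  from series_mult_order(1)[where a = "a * m" and b = a, OF this f(1)] Suc f(2) show ?case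
    by (simp add: add.commute)
qed simp

end

lemma (in domain) series_domain: "domain (series R)"
proof -
  interpret S: cring "series R" by (rule series_cring)
  show ?thesis
  proof (unfold_locales)
    show "\<one>\<^bsub>series R\<^esub> \<noteq> \<zero>\<^bsub>series R\<^esub>"
    proof
      assume "\<one>\<^bsub>series R\<^esub> = \<zero>\<^bsub>series R\<^esub>"
      hence "\<one>\<^bsub>series R\<^esub> 0 = \<zero>\<^bsub>series R\<^esub> 0" by simp
      thus False by (simp add: series_one series_zero)
    qed
    fix f g assume fg: "f \<otimes>\<^bsub>series R\<^esub> g = \<zero>\<^bsub>series R\<^esub>" and f: "f \<in> carrier (series R)" and g: "g \<in> carrier (series R)"
    show "f = \<zero>\<^bsub>series R\<^esub> \<or> g = \<zero>\<^bsub>series R\<^esub>"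
    proof (rule ccontr)
      assume "\<not> ?thesis"
      then obtain i j where "f i \<noteq> \<zero>" "g j \<noteq> \<zero>" by (auto simp: fun_eq_iff series_zero)
      define a where "a = (LEAST i. f i \<noteq> \<zero>)"
      define b where "b = (LEAST i. g i \<noteq> \<zero>)"
      have a: "f a \<noteq> \<zero>" "\<And>k. k < a \<Longrightarrow> f k = \<zero>"
        unfolding a_def using LeastI[of "\<lambda>i. f i \<noteq> \<zero>", OF \<open>f i \<noteq> \<zero>\<close>] not_less_Least by blast+
      have b: "g b \<noteq> \<zero>" "\<And>k. k < b \<Longrightarrow> g k = \<zero>"
        unfolding b_def using LeastI[of "\<lambda>i. g i \<noteq> \<zero>", OF \<open>g j \<noteq> \<zero>\<close>] not_less_Least by blast+
      have "f a \<otimes> g b = \<zero>" using series_mult_order(2)[OF f g a(2) b(2)] fg by (simp add: series_zero)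
      thus False using a(1) b(1) series_closed[OF f] series_closed[OF g] by (simp add: integral_iff)
    qed
  qed
qed

lemma (in char_cring) series_char_cring: "char_cring (series R) p"
proof -
  interpret S: cring "series R" by (rule series_cring)
  have "add_pow (series R) k \<one>\<^bsub>series R\<^esub> = series_const R (add_pow R k \<one>)" for k :: nat
    by (induction k) (simp_all add: add_pow_def series_const_def series_add series_one series_zero fun_eq_iff)
  hence "add_pow (series R) p \<one>\<^bsub>series R\<^esub> = \<zero>\<^bsub>series R\<^esub>"
    by (simp add: char_p series_const_def series_zero fun_eq_iff)
  thus ?thesis using prime_p by unfold_locales auto
qed

lemma (in char_cring) frobenius_hom: "(\<lambda>x. x [^] (p ^ e)) \<in> ring_hom R R"
  by (rule ring_hom_memI) (auto simp: nat_pow_distrib frobenius_add)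

section \<open>Lifting the roots of an additive polynomial to power series\<close>

text \<open>The coefficients of the polynomial are themselves series. Since \<open>a 0 0\<close> is
  the linear coefficient after specialization, its being nonzero means that the specialized
  polynomial has simple roots.\<close>

locale additive_lift = field R + char_cring R p for R (structure) and p +
  fixes q e n :: nat and a :: "nat \<Rightarrow> nat \<Rightarrow> 'a"
  assumes q: "q = p ^ e" "q \<ge> 2" and n: "n > 0"
    and a_closed': "i < n \<Longrightarrow> a i \<in> carrier (series R)" and a_0: "a 0 0 \<noteq> \<zero>"
begin

sublocale S: domain "series R" by (rule series_domain)
sublocale SC: char_cring "series R" p by (rule series_char_cring)

abbreviation "T \<equiv> S.additive_eval q n a"

lemma T_closed: "y \<in> carrier (series R) \<Longrightarrow> T y \<in> carrier (series R)"
  using a_closed' by simp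

lemma T_add: "x \<in> carrier (series R) \<Longrightarrow> y \<in> carrier (series R) \<Longrightarrow> T (x \<oplus>\<^bsub>series R\<^esub> y) = T x \<oplus>\<^bsub>series R\<^esub> T y"
  using SC.additive_eval_add[of n a q e x y] a_closed' q by simp

text \<open>A series d of order k > 0 has powers d^(q^i), i > 0, of order at least 2 k. Up to index
  k only the linear term of T contributes, and there it acts as multiplication by
  \<open>a 0 0\<close>.\<close>

lemma T_order:
  assumes d: "d \<in> carrier (series R)" "\<And>j. j < k \<Longrightarrow> d j = \<zero>" and k: "k > 0"
  shows "j < k \<Longrightarrow> T d j = \<zero>" and "T d k = a 0 0 \<otimes> d k"
proof -
  have hi: "(d [^]\<^bsub>series R\<^esub> (q ^ i)) j = \<zero>" if "i > 0" "j \<le> k" for i j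
  proof (rule series_pow_order[OF d(1) d(2)])
    have "q ^ i \<ge> 2" using q(2) that self_le_power[of q i] by linarith
    hence "k * 2 \<le> k * q ^ i" by (intro mult_left_mono) auto
    thus "j < k * q ^ i" using that k by linarith
  qed
  have trm: "(a i \<otimes>\<^bsub>series R\<^esub> d [^]\<^bsub>series R\<^esub> (q ^ i)) j = (if 0 = i then (a 0 \<otimes>\<^bsub>series R\<^esub> d) j else \<zero>)"
    if "i < n" "j \<le> k" for i j
  proof (cases "i = 0")
    case False
    have "(a i \<otimes>\<^bsub>series R\<^esub> d [^]\<^bsub>series R\<^esub> (q ^ i)) j = \<zero>"
      by (rule series_mult_order(1)[where a = 0 and b = "Suc k"])
        (use a_closed' d hi[of i] False that in auto)
    thus ?thesis using False by simp
  qed (use d in auto)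
  have T: "T d j = (a 0 \<otimes>\<^bsub>series R\<^esub> d) j" if j: "j \<le> k" for j
  proof -
    have ad: "a 0 \<otimes>\<^bsub>series R\<^esub> d \<in> carrier (series R)" using a_closed' n d by simp
    have "(\<Oplus>\<^bsub>series R\<^esub>i\<in>{..<n}. a i \<otimes>\<^bsub>series R\<^esub> d [^]\<^bsub>series R\<^esub> (q ^ i)) j =
        (\<Oplus>i\<in>{..<n}. (a i \<otimes>\<^bsub>series R\<^esub> d [^]\<^bsub>series R\<^esub> (q ^ i)) j)"
      by (rule series_finsum_coeff) (use a_closed' d in auto)
    also have "\<dots> = (\<Oplus>i\<in>{..<n}. if 0 = i then (a 0 \<otimes>\<^bsub>series R\<^esub> d) j else \<zero>)"
      by (rule finsum_cong') (use trm j series_closed[OF ad] in auto)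
    also have "\<dots> = (a 0 \<otimes>\<^bsub>series R\<^esub> d) j"
      using add.finprod_singleton[of 0 "{..<n}" "\<lambda>i. (a 0 \<otimes>\<^bsub>series R\<^esub> d) j"] n series_closed[OF ad] by simp
    finally show ?thesis unfolding S.additive_eval_def using hi[OF n j] ad series_closed[OF ad]
      by (simp add: series_add)
  qed
  show "T d j = \<zero>" if "j < k"
    unfolding T[OF less_imp_le[OF that]]
    by (rule series_mult_order(1)[where a = 0 and b = k]) (use a_closed' n d that in auto)
  show "T d k = a 0 0 \<otimes> d k"
    unfolding T[OF order_refl] using series_mult_order(2)[of "a 0" d 0 k] a_closed' n d by simp
qed

text \<open>Hensel lifting, simplified by additivity: changing a coefficient of y changes T y by the
  value of T at the correction, with no cross terms.\<close>

lemma root_lift_exists: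
  assumes y0: "y0 \<in> carrier R" "additive_eval q n (\<lambda>i. a i 0) y0 = \<zero>"
  shows "\<exists>y\<in>carrier (series R). y 0 = y0 \<and> T y = \<zero>\<^bsub>series R\<^esub>"
proof -
  define good where "good k y \<longleftrightarrow> y \<in> carrier (series R) \<and> y 0 = y0 \<and> (\<forall>j\<le>k. T y j = \<zero>)" for k y
  interpret h0: ring_hom_cring "series R" R "\<lambda>f. f 0" by unfold_locales (rule series_constant_term_hom)
  have base: "good 0 (series_const R y0)"
    using h0.hom_additive_eval[of n a "series_const R y0" q] a_closed' y0
    by (simp add: good_def) (simp add: series_const_def)
  have step: "\<exists>z. good (Suc k) z \<and> (\<forall>j\<le>k. z j = y j)" if y: "good k y" for k y
  proof -
    have yc: "y \<in> carrier (series R)" using y by (simp add: good_def)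
    \<comment> \<open>Newton step: adding c at index k + 1 changes T y there by \<open>a 0 0\<close>
      times c and leaves the lower indices alone.\<close>
    define c where "c = \<ominus> (inv (a 0 0) \<otimes> T y (Suc k))"
    have a0: "a 0 0 \<in> carrier R" "inv (a 0 0) \<in> carrier R" "a 0 0 \<otimes> inv (a 0 0) = \<one>"
      using series_closed[OF a_closed'[OF n]] a_0 field_Units by auto
    have Tc: "T y (Suc k) \<in> carrier R" by (rule series_closed[OF T_closed[OF yc]])
    have c: "c \<in> carrier R" unfolding c_def using a0 Tc by simp
    have ac: "a 0 0 \<otimes> c = \<ominus> T y (Suc k)"
    proof -
      have "a 0 0 \<otimes> c = \<ominus> ((a 0 0 \<otimes> inv (a 0 0)) \<otimes> T y (Suc k))"
        unfolding c_def using a0(1,2) Tc by algebra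
      thus ?thesis using a0 Tc by simp
    qed
    define d where "d = (\<lambda>j. if j = Suc k then c else \<zero>)"
    have d: "d \<in> carrier (series R)" using c by (simp add: d_def series_carrier)
    have "T (y \<oplus>\<^bsub>series R\<^esub> d) j = \<zero>" if j: "j \<le> Suc k" for j
    proof (cases "j = Suc k")
      case True
      thus ?thesis using T_add[OF yc d] T_order(2)[OF d, of "Suc k"] ac Tc by (simp add: series_add d_def r_neg)
    next
      case False
      thus ?thesis using T_add[OF yc d] T_order(1)[OF d, of "Suc k" j] y j by (simp add: series_add d_def good_def)
    qed
    moreover have "(y \<oplus>\<^bsub>series R\<^esub> d) j = y j" if "j \<le> k" for j using that series_closed[OF yc] by (simp add: series_add d_def)
    moreover have "d 0 = \<zero>" by (simp add: d_def)
    ultimately show ?thesis using y d by (intro exI[of _ "y \<oplus>\<^bsub>series R\<^esub> d"]) (auto simp: good_def)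
  qed
  obtain Y where Y: "\<And>k. good k (Y k)" "\<And>k j. j \<le> k \<Longrightarrow> Y (Suc k) j = Y k j"
    using dependent_nat_choice[of good "\<lambda>k y z. \<forall>j\<le>k. z j = y j"] base step by metis
  have agree: "Y (k + l) j = Y k j" if "j \<le> k" for k l j
    using that by (induction l) (auto simp: Y(2))
  \<comment> \<open>The limit of the approximations, taken along the diagonal. It agrees with Y k up
    to index k, so T y and T (Y k) agree up to index k as well.\<close>
  define y where "y k = Y k k" for k
  have yY: "y j = Y k j" if "j \<le> k" for j k using agree[of j j "k - j"] that by (simp add: y_def)
  have Yc: "Y k \<in> carrier (series R)" for k using Y(1) by (simp add: good_def)
  have yc: "y \<in> carrier (series R)" using series_closed[OF Yc] by (simp add: series_carrier y_def)
  have "T y k = \<zero>" for k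
  proof -
    define d where "d = y \<ominus>\<^bsub>series R\<^esub> Y k"
    have d: "d \<in> carrier (series R)" using yc Yc by (simp add: d_def)
    have yd: "y = Y k \<oplus>\<^bsub>series R\<^esub> d" unfolding d_def using yc Yc by (simp add: S.minus_eq S.a_lcomm S.r_neg)
    have dz: "d j = \<zero>" if "j < Suc k" for j
    proof -
      have "y j = Y k j \<oplus> d j" using yd by (metis series_add)
      moreover have "y j = Y k j" using yY that by simp
      ultimately show ?thesis using series_closed[OF d] series_closed[OF Yc]
        by (intro add_self_cancel[of "Y k j"]) auto
    qed
    have "T y k = T (Y k) k \<oplus> T d k" using T_add[OF Yc d, of k] yd by (metis series_add)
    thus ?thesis using Y(1)[of k] T_order(1)[where k = "Suc k" and j = k, OF d dz] by (simp add: good_def)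
  qed
  hence "T y = \<zero>\<^bsub>series R\<^esub>" by (simp add: series_zero fun_eq_iff)
  moreover have "y 0 = y0" using Y(1)[of 0] by (simp add: y_def good_def)
  ultimately show ?thesis using yc by auto
qed

text \<open>Lifting gives surjectivity. For injectivity, the difference of two roots with equal
  constant terms is a root of positive order; if it were nonzero, \<open>a 0 0\<close> times its
  lowest coefficient would vanish.\<close>

lemma constant_term_bij:
  "bij_betw (\<lambda>y. y 0) (S.additive_zeros q n a) (additive_zeros q n (\<lambda>i. a i 0))"
proof -
  interpret h0: ring_hom_cring "series R" R "\<lambda>f. f 0" by unfold_locales (rule series_constant_term_hom)
  have ker: "y = \<zero>\<^bsub>series R\<^esub>" if y: "y \<in> carrier (series R)" "T y = \<zero>\<^bsub>series R\<^esub>" "y 0 = \<zero>" for y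
  proof (rule ccontr)
    assume "y \<noteq> \<zero>\<^bsub>series R\<^esub>"
    then obtain i where i: "y i \<noteq> \<zero>" by (auto simp: fun_eq_iff series_zero)
    define k where "k = (LEAST i. y i \<noteq> \<zero>)"
    have k: "y k \<noteq> \<zero>" "\<And>j. j < k \<Longrightarrow> y j = \<zero>"
      unfolding k_def using LeastI[of "\<lambda>i. y i \<noteq> \<zero>", OF i] not_less_Least by blast+
    have "k > 0" using k y by (cases k) auto
    hence "a 0 0 \<otimes> y k = \<zero>" using T_order(2)[OF y(1) k(2)] y(2) by (simp add: series_zero)
    thus False using a_0 k(1) series_closed[OF y(1)] series_closed[OF a_closed'[OF n]] by (simp add: integral_iff)
  qed
  have inj: "x = y" if x: "x \<in> S.additive_zeros q n a" and y: "y \<in> S.additive_zeros q n a" and "x 0 = y 0" for x y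
  proof -
    have c: "x \<in> carrier (series R)" "y \<in> carrier (series R)" "T x = \<zero>\<^bsub>series R\<^esub>" "T y = \<zero>\<^bsub>series R\<^esub>"
      using x y by (auto simp: S.additive_zeros_def)
    define d where "d = x \<ominus>\<^bsub>series R\<^esub> y"
    have d: "d \<in> carrier (series R)" using c by (simp add: d_def)
    have xd: "x = y \<oplus>\<^bsub>series R\<^esub> d" unfolding d_def using c by (simp add: S.minus_eq S.a_lcomm S.r_neg)
    have "T d = \<zero>\<^bsub>series R\<^esub>" using T_add[OF c(2) d] c T_closed[OF d] unfolding xd[symmetric] by simp
    moreover have "d 0 = \<zero>"
    proof -
      have "x 0 = y 0 \<oplus> d 0" by (subst xd) (simp add: series_add)
      thus ?thesis using \<open>x 0 = y 0\<close> series_closed[OF d, of 0] series_closed[OF c(2), of 0]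
        by (intro add_self_cancel[of "y 0"]) auto
    qed
    ultimately have "d = \<zero>\<^bsub>series R\<^esub>" using ker d by simp
    thus ?thesis using xd c by simp
  qed
  have into: "y 0 \<in> additive_zeros q n (\<lambda>i. a i 0)" if "y \<in> S.additive_zeros q n a" for y
    using that h0.hom_additive_eval[of n a y q] a_closed'
    by (auto simp: S.additive_zeros_def additive_zeros_def series_zero)
  have onto: "\<exists>y\<in>S.additive_zeros q n a. y 0 = y0" if "y0 \<in> additive_zeros q n (\<lambda>i. a i 0)" for y0
    using root_lift_exists[of y0] that by (auto simp: S.additive_zeros_def additive_zeros_def)
  show ?thesis unfolding bij_betw_def inj_on_def
    using inj into onto by (auto simp: image_iff) metis
qed

end

section \<open>Extending ring homomorphisms\<close>

text \<open>In this section polynomials are taken in \<open>UP\<close>, whose evaluation goes along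
  a homomorphism into another ring. This is the form needed to send elements of L to power
  series.\<close>

lemma (in UP_domain) card_roots_le_deg:
  assumes "finite W" "f \<in> carrier P" "f \<noteq> \<zero>\<^bsub>P\<^esub>" "W \<subseteq> carrier R" "\<And>a. a \<in> W \<Longrightarrow> UnivPoly.eval R R id a f = \<zero>"
  shows "card W \<le> deg R f"
  using assms
proof (induction W arbitrary: f rule: finite_induct)
  case (insert a W)
  have a: "a \<in> carrier R" using insert.prems by auto
  have nt: "carrier R \<noteq> {\<zero>}" by (metis R.one_zeroI R.zero_not_one)
  obtain g where g: "g \<in> carrier P"
    and f: "f = (up_ring.monom P \<one>\<^bsub>R\<^esub> 1 \<ominus>\<^bsub>P\<^esub> up_ring.monom P a 0) \<otimes>\<^bsub>P\<^esub> g \<oplus>\<^bsub>P\<^esub> up_ring.monom P (UnivPoly.eval R R id a f) 0"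
    using remainder_theorem[OF insert.prems(1) a nt] by auto
  have lin: "f = (up_ring.monom P \<one>\<^bsub>R\<^esub> 1 \<ominus>\<^bsub>P\<^esub> up_ring.monom P a 0) \<otimes>\<^bsub>P\<^esub> g"
    using f g a insert.prems(4)[of a] by simp
  have deg: "deg R (up_ring.monom P \<one>\<^bsub>R\<^esub> 1 \<ominus>\<^bsub>P\<^esub> up_ring.monom P a 0) = 1" using deg_minus_monom[OF a nt] .
  have nz: "up_ring.monom P \<one>\<^bsub>R\<^esub> 1 \<ominus>\<^bsub>P\<^esub> up_ring.monom P a 0 \<noteq> \<zero>\<^bsub>P\<^esub>" using deg_nzero_nzero deg by auto
  have g0: "g \<noteq> \<zero>\<^bsub>P\<^esub>" using insert.prems(2) a lin by auto
  have degf: "deg R f = Suc (deg R g)" using deg_mult[OF nz g0 _ g] deg a by (simp add: lin)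
  have "card W \<le> deg R g"
  proof (rule insert.IH[OF g g0])
    show "W \<subseteq> carrier R" using insert.prems by auto
    fix b assume b: "b \<in> W"
    hence bc: "b \<in> carrier R" "b \<noteq> a" using insert by auto
    have "(b \<ominus> a) \<otimes> UnivPoly.eval R R id b g = UnivPoly.eval R R id b f"
      unfolding lin using a bc g by (simp add: evalRR_simps)
    also have "\<dots> = \<zero>" using insert.prems(4)[of b] b by blast
    finally show "UnivPoly.eval R R id b g = \<zero>"
      using a bc g by (simp add: R.integral_iff evalRR_simps)
  qed
  thus ?case using insert.hyps degf by simp
qed simp

text \<open>The evaluation of \<open>P\<close> at \<open>w\<close> along an injective \<open>\<eta>\<close> is the evaluation of the polynomial with
  coefficients \<open>\<eta> (P i)\<close>, which has the degree of \<open>P\<close>.\<close>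

lemma card_roots_le_deg_hom:
  assumes A: "cring A" and S: "domain S" and \<eta>: "\<eta> \<in> ring_hom A S"
    and inj: "\<And>x. x \<in> carrier A \<Longrightarrow> \<eta> x = \<zero>\<^bsub>S\<^esub> \<Longrightarrow> x = \<zero>\<^bsub>A\<^esub>"
    and P: "P \<in> carrier (UP A)" "P \<noteq> \<zero>\<^bsub>UP A\<^esub>"
    and W: "finite W" "W \<subseteq> carrier S" "\<And>w. w \<in> W \<Longrightarrow> UnivPoly.eval A S \<eta> w P = \<zero>\<^bsub>S\<^esub>"
  shows "card W \<le> deg A P"
proof -
  interpret A: cring A by (rule A)
  interpret S: domain S by (rule S)
  interpret UA: UP_cring A "UP A" by unfold_locales auto
  interpret US: UP_domain S "UP S" by unfold_locales auto
  interpret \<eta>: ring_hom_cring A S \<eta> by unfold_locales (rule \<eta>)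
  define Q where "Q = (\<lambda>i. \<eta> (up_ring.coeff (UP A) P i))"
  have cc: "up_ring.coeff (UP A) P i \<in> carrier A" for i using P(1) by simp
  have Qup: "Q \<in> up S"
  proof (rule mem_upI)
    show "Q i \<in> carrier S" for i using cc by (simp add: Q_def)
    have "bound \<zero>\<^bsub>S\<^esub> (deg A P) Q"
    proof (rule bound.intro)
      fix m assume "deg A P < m"
      show "Q m = \<zero>\<^bsub>S\<^esub>" unfolding Q_def UA.deg_aboveD[OF \<open>deg A P < m\<close> P(1)] by simp
    qed
    thus "\<exists>n. bound \<zero>\<^bsub>S\<^esub> n Q" by blast
  qed
  hence Q: "Q \<in> carrier (UP S)" unfolding UP_def by simp
  have cQ: "up_ring.coeff (UP S) Q i = Q i" for i using Qup unfolding UP_def by simp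
  have lc: "up_ring.coeff (UP A) P (deg A P) \<noteq> \<zero>\<^bsub>A\<^esub>" using UA.lcoeff_nonzero2[OF P] .
  hence Qd: "Q (deg A P) \<noteq> \<zero>\<^bsub>S\<^esub>" using inj[OF cc] unfolding Q_def by blast
  have degQ: "deg S Q = deg A P"
  proof (rule antisym)
    show "deg S Q \<le> deg A P"
    proof (rule US.deg_aboveI[OF _ Q])
      show "up_ring.coeff (UP S) Q m = \<zero>\<^bsub>S\<^esub>" if "deg A P < m" for m
        unfolding cQ unfolding Q_def UA.deg_aboveD[OF that P(1)] by simp
    qed
    show "deg A P \<le> deg S Q" by (rule US.deg_belowI[OF _ Q]) (use Qd cQ in simp)
  qed
  have Q0: "Q \<noteq> \<zero>\<^bsub>UP S\<^esub>" using Qd unfolding UP_def by auto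
  have "UnivPoly.eval S S id w Q = UnivPoly.eval A S \<eta> w P" for w
    unfolding UnivPoly.eval_def using Q P by (simp add: degQ cQ) (simp add: Q_def)
  hence "card W \<le> deg S Q" using W by (intro US.card_roots_le_deg[OF W(1) Q Q0]) auto
  thus ?thesis using degQ by simp
qed

text \<open>The ring A[v] is the image of evaluation at v, and the extension takes P(v) to P(w).
  Condition \<open>wd\<close> says that relations of v are relations of w, so a choice of P does not
  matter.\<close>

lemma (in domain) hom_extend_by_element:
  fixes S :: "('s, 'n) ring_scheme"
  assumes A: "subring A R" and S: "domain S" and \<eta>: "\<eta> \<in> ring_hom (R\<lparr>carrier := A\<rparr>) S"
    and v: "v \<in> carrier R" and w: "w \<in> carrier S"
    and wd: "\<And>P. P \<in> carrier (UP (R\<lparr>carrier := A\<rparr>)) \<Longrightarrow> UnivPoly.eval (R\<lparr>carrier := A\<rparr>) R id v P = \<zero> \<Longrightarrow>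
      UnivPoly.eval (R\<lparr>carrier := A\<rparr>) S \<eta> w P = \<zero>\<^bsub>S\<^esub>"
  shows "\<exists>A' \<eta>'. subring A' R \<and> A \<subseteq> A' \<and> v \<in> A' \<and> \<eta>' \<in> ring_hom (R\<lparr>carrier := A'\<rparr>) S
    \<and> (\<forall>x\<in>A. \<eta>' x = \<eta> x) \<and> \<eta>' v = w"
proof -
  let ?A = "R\<lparr>carrier := A\<rparr>"
  interpret A: domain ?A by (rule subring_is_domain[OF A])
  interpret S: domain S by (rule S)
  interpret U: UP_cring ?A "UP ?A" by unfold_locales auto
  have AR: "A \<subseteq> carrier R" using subringE(1)[OF A] .
  have idh: "id \<in> ring_hom ?A R" by (rule ring_hom_memI) (use AR in auto)
  interpret EL: UP_pre_univ_prop ?A R id "UP ?A"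
    by (rule UP_pre_univ_propI) (unfold_locales, rule idh)
  interpret ES: UP_pre_univ_prop ?A S \<eta> "UP ?A"
    by (rule UP_pre_univ_propI) (unfold_locales, rule \<eta>)
  let ?l = "UnivPoly.eval ?A R id v"
  let ?s = "UnivPoly.eval ?A S \<eta> w"
  interpret l: ring_hom_cring "UP ?A" R ?l
    by unfold_locales (rule EL.eval_ring_hom[OF v])
  interpret s: ring_hom_cring "UP ?A" S ?s
    by unfold_locales (rule ES.eval_ring_hom[OF w])
  define A' where "A' = ?l ` carrier (UP ?A)"
  define \<eta>' where "\<eta>' x = ?s (SOME P. P \<in> carrier (UP ?A) \<and> ?l P = x)" for x
  have key: "\<eta>' (?l P) = ?s P" if P: "P \<in> carrier (UP ?A)" for P
  proof -
    define Q where "Q = (SOME Q. Q \<in> carrier (UP ?A) \<and> ?l Q = ?l P)"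
    have Q: "Q \<in> carrier (UP ?A)" "?l Q = ?l P"
      unfolding Q_def using someI_ex[of "\<lambda>Q. Q \<in> carrier (UP ?A) \<and> ?l Q = ?l P"] P by blast+
    have "?l (Q \<ominus>\<^bsub>UP ?A\<^esub> P) = \<zero>" using Q P by (simp add: a_minus_def r_neg)
    hence "?s (Q \<ominus>\<^bsub>UP ?A\<^esub> P) = \<zero>\<^bsub>S\<^esub>" using wd Q P by simp
    hence "?s Q \<ominus>\<^bsub>S\<^esub> ?s P = \<zero>\<^bsub>S\<^esub>" using Q P by (simp add: a_minus_def)
    hence "?s Q = ?s P" using Q P by simp
    thus ?thesis unfolding \<eta>'_def Q_def .
  qed
  have sub: "subring A' R" unfolding A'_def
    by (rule ring_hom_ring.img_is_subring[OF ring_hom_ringI2[OF U.UP_ring ring_axioms l.homh]])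
      (rule ring.carrier_is_subring[OF U.UP_ring])
  have inA: "x \<in> A'" "\<eta>' x = \<eta> x" if x: "x \<in> A" for x
  proof -
    have m: "up_ring.monom (UP ?A) x 0 \<in> carrier (UP ?A)" using x by simp
    have "?l (up_ring.monom (UP ?A) x 0) = x" using EL.eval_const[OF v] x by simp
    moreover have "?s (up_ring.monom (UP ?A) x 0) = \<eta> x" using ES.eval_const[OF w] x by simp
    ultimately show "x \<in> A'" "\<eta>' x = \<eta> x" using key[OF m] m unfolding A'_def by (metis imageI)+
  qed
  have vA: "v \<in> A'" "\<eta>' v = w"
  proof -
    have m: "up_ring.monom (UP ?A) \<one>\<^bsub>?A\<^esub> 1 \<in> carrier (UP ?A)" by (rule U.monom_closed[OF A.one_closed])
    have "?l (up_ring.monom (UP ?A) \<one>\<^bsub>?A\<^esub> 1) = v" using EL.eval_monom1[OF v] by simp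
    moreover have "?s (up_ring.monom (UP ?A) \<one>\<^bsub>?A\<^esub> 1) = w" using ES.eval_monom1[OF w] by simp
    ultimately show "v \<in> A'" "\<eta>' v = w" using key[OF m] m unfolding A'_def by (metis imageI)+
  qed
  have hom: "\<eta>' \<in> ring_hom (R\<lparr>carrier := A'\<rparr>) S"
  proof (rule ring_hom_memI)
    fix x assume "x \<in> carrier (R\<lparr>carrier := A'\<rparr>)"
    then obtain P where P: "P \<in> carrier (UP ?A)" "x = ?l P" by (auto simp: A'_def)
    show "\<eta>' x \<in> carrier S" using P key by simp
    fix y assume "y \<in> carrier (R\<lparr>carrier := A'\<rparr>)"
    then obtain Q where Q: "Q \<in> carrier (UP ?A)" "y = ?l Q" by (auto simp: A'_def)
    show "\<eta>' (x \<otimes>\<^bsub>R\<lparr>carrier := A'\<rparr>\<^esub> y) = \<eta>' x \<otimes>\<^bsub>S\<^esub> \<eta>' y"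
      using key[of "P \<otimes>\<^bsub>UP ?A\<^esub> Q"] key P Q by simp
    show "\<eta>' (x \<oplus>\<^bsub>R\<lparr>carrier := A'\<rparr>\<^esub> y) = \<eta>' x \<oplus>\<^bsub>S\<^esub> \<eta>' y"
      using key[of "P \<oplus>\<^bsub>UP ?A\<^esub> Q"] key P Q by simp
  next
    show "\<eta>' \<one>\<^bsub>R\<lparr>carrier := A'\<rparr>\<^esub> = \<one>\<^bsub>S\<^esub>"
      using inA(2)[of "\<one>"] subringE(3)[OF A] ring_hom_one[OF \<eta>] by simp
  qed
  show ?thesis using sub inA vA hom by blast
qed

text \<open>As A is only a subring, m is merely of least degree among the nonzero polynomials that
  vanish at v, and m divides such polynomials up to a nonzero constant of A. In a f = m Q the degree
  of Q is below the number of roots in W, so some w in W is a root of m. Every relation of v is then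
  one of w, because \<eta> is injective and S is a domain.\<close>

lemma (in domain) hom_extend_by_algebraic_element:
  fixes S :: "('s, 'n) ring_scheme"
  assumes A: "subring A R" and S: "domain S" and \<eta>: "\<eta> \<in> ring_hom (R\<lparr>carrier := A\<rparr>) S"
    and inj: "\<And>x. x \<in> A \<Longrightarrow> \<eta> x = \<zero>\<^bsub>S\<^esub> \<Longrightarrow> x = \<zero>"
    and v: "v \<in> carrier R"
    and f: "f \<in> carrier (UP (R\<lparr>carrier := A\<rparr>))" "f \<noteq> \<zero>\<^bsub>UP (R\<lparr>carrier := A\<rparr>)\<^esub>"
      "UnivPoly.eval (R\<lparr>carrier := A\<rparr>) R id v f = \<zero>"
    and W: "finite W" "W \<subseteq> carrier S" "deg (R\<lparr>carrier := A\<rparr>) f \<le> card W"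
      "\<And>w. w \<in> W \<Longrightarrow> UnivPoly.eval (R\<lparr>carrier := A\<rparr>) S \<eta> w f = \<zero>\<^bsub>S\<^esub>"
  shows "\<exists>A' \<eta>'. subring A' R \<and> A \<subseteq> A' \<and> v \<in> A' \<and> \<eta>' \<in> ring_hom (R\<lparr>carrier := A'\<rparr>) S
    \<and> (\<forall>x\<in>A. \<eta>' x = \<eta> x)"
proof -
  let ?A = "R\<lparr>carrier := A\<rparr>"
  interpret A: domain ?A by (rule subring_is_domain[OF A])
  interpret S: domain S by (rule S)
  interpret U: UP_domain ?A "UP ?A" by unfold_locales auto
  have AR: "A \<subseteq> carrier R" using subringE(1)[OF A] .
  have idh: "id \<in> ring_hom ?A R" by (rule ring_hom_memI) (use AR in auto)
  interpret EL: UP_pre_univ_prop ?A R id "UP ?A"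
    by (rule UP_pre_univ_propI) (unfold_locales, rule idh)
  interpret ES: UP_pre_univ_prop ?A S \<eta> "UP ?A"
    by (rule UP_pre_univ_propI) (unfold_locales, rule \<eta>)
  let ?l = "UnivPoly.eval ?A R id v"
  interpret l: ring_hom_cring "UP ?A" R ?l
    by unfold_locales (rule EL.eval_ring_hom[OF v])
  let ?s = "UnivPoly.eval ?A S \<eta>"
  have shom: "ring_hom_cring (UP ?A) S (?s w)" if "w \<in> carrier S" for w
    by unfold_locales (rule ES.eval_ring_hom[OF that])
  have \<eta>c: "\<eta> x \<in> carrier S" if "x \<in> A" for x using ring_hom_closed[OF \<eta>] that by simp
  have smult: "a \<odot>\<^bsub>UP ?A\<^esub> Q = up_ring.monom (UP ?A) a 0 \<otimes>\<^bsub>UP ?A\<^esub> Q" if "a \<in> A" "Q \<in> carrier (UP ?A)" for a Q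
    using U.monom_mult_is_smult[of a Q] that by simp
  define D where "D m \<longleftrightarrow> m \<in> carrier (UP ?A) \<and> m \<noteq> \<zero>\<^bsub>UP ?A\<^esub> \<and> ?l m = \<zero>" for m
  obtain m where m: "D m" and min: "\<And>m'. D m' \<Longrightarrow> deg ?A m \<le> deg ?A m'"
    using ex_has_least_nat[of D f "deg ?A"] f D_def by blast
  have mc: "m \<in> carrier (UP ?A)" "m \<noteq> \<zero>\<^bsub>UP ?A\<^esub>" "?l m = \<zero>" using m by (auto simp: D_def)
  define c where "c = up_ring.coeff (UP ?A) m (deg ?A m)"
  have c: "c \<in> A" "c \<noteq> \<zero>"
    using U.coeff_closed[OF mc(1), of "deg ?A m"] U.lcoeff_nonzero2[OF mc(1,2)] by (auto simp: c_def)
  \<comment> \<open>Pseudo-division by m: the constant a is a power of its leading coefficient. The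
    remainder vanishes at v and has smaller degree, so it is zero by the choice of m.\<close>
  have pdiv: "\<exists>Q a. Q \<in> carrier (UP ?A) \<and> a \<in> A \<and> a \<noteq> \<zero> \<and> up_ring.monom (UP ?A) a 0 \<otimes>\<^bsub>UP ?A\<^esub> P = m \<otimes>\<^bsub>UP ?A\<^esub> Q"
    if P: "P \<in> carrier (UP ?A)" "?l P = \<zero>" for P
  proof -
    obtain Q r k where Q: "Q \<in> carrier (UP ?A)" "r \<in> carrier (UP ?A)"
      "(c [^]\<^bsub>?A\<^esub> (k::nat)) \<odot>\<^bsub>UP ?A\<^esub> P = m \<otimes>\<^bsub>UP ?A\<^esub> Q \<oplus>\<^bsub>UP ?A\<^esub> r"
      "r = \<zero>\<^bsub>UP ?A\<^esub> \<or> deg ?A r < deg ?A m"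
      using U.long_div_theorem[OF mc(1) P(1) mc(2)] unfolding c_def by blast
    define a where "a = c [^]\<^bsub>?A\<^esub> k"
    have a: "a \<in> A" "a \<noteq> \<zero>"
    proof -
      have "c [^]\<^bsub>?A\<^esub> j \<in> A \<and> c [^]\<^bsub>?A\<^esub> j \<noteq> \<zero>" for j :: nat
      proof (induction j)
        case (Suc j)
        thus ?case using c AR subringE(6)[OF A] integral[of "c [^]\<^bsub>?A\<^esub> j" c] by auto
      qed (use subringE(3)[OF A] in auto)
      thus "a \<in> A" "a \<noteq> \<zero>" by (auto simp: a_def)
    qed
    have eq: "up_ring.monom (UP ?A) a 0 \<otimes>\<^bsub>UP ?A\<^esub> P = m \<otimes>\<^bsub>UP ?A\<^esub> Q \<oplus>\<^bsub>UP ?A\<^esub> r"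
      using Q(3) smult[OF a(1) P(1)] by (simp add: a_def)
    have ma: "up_ring.monom (UP ?A) a 0 \<in> carrier (UP ?A)" using a by simp
    have "?l (up_ring.monom (UP ?A) a 0 \<otimes>\<^bsub>UP ?A\<^esub> P) = \<zero>" using P ma by simp
    hence "?l r = \<zero>" unfolding eq using mc Q(1,2) by simp
    hence "r = \<zero>\<^bsub>UP ?A\<^esub>" using min[of r] Q(2,4) unfolding D_def by (meson leD)
    thus ?thesis using eq a Q mc by (intro exI[of _ Q] exI[of _ a]) simp
  qed
  have ev_const: "?s w (up_ring.monom (UP ?A) a 0) = \<eta> a" if "w \<in> carrier S" "a \<in> A" for w a
    using ES.eval_const[OF that(1)] that by simp
  have "\<exists>w\<in>W. ?s w m = \<zero>\<^bsub>S\<^esub>"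
  proof (rule ccontr)
    assume no: "\<not> ?thesis"
    obtain Q a where Q: "Q \<in> carrier (UP ?A)" "a \<in> A" "a \<noteq> \<zero>"
      "up_ring.monom (UP ?A) a 0 \<otimes>\<^bsub>UP ?A\<^esub> f = m \<otimes>\<^bsub>UP ?A\<^esub> Q" using pdiv[OF f(1,3)] by blast
    have ma: "up_ring.monom (UP ?A) a 0 \<in> carrier (UP ?A)" using Q by simp
    have ma0: "up_ring.monom (UP ?A) a 0 \<noteq> \<zero>\<^bsub>UP ?A\<^esub>"
    proof
      assume "up_ring.monom (UP ?A) a 0 = \<zero>\<^bsub>UP ?A\<^esub>"
      hence "?l (up_ring.monom (UP ?A) a 0) = \<zero>" by simp
      thus False using EL.eval_const[OF v, of a] Q by simp
    qed
    have Q0: "Q \<noteq> \<zero>\<^bsub>UP ?A\<^esub>"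
    proof
      assume "Q = \<zero>\<^bsub>UP ?A\<^esub>"
      hence "up_ring.monom (UP ?A) a 0 \<otimes>\<^bsub>UP ?A\<^esub> f = \<zero>\<^bsub>UP ?A\<^esub>" using Q(4) mc by simp
      thus False using U.UP_integral[OF _ ma f(1)] ma0 f by simp
    qed
    have roots: "?s w Q = \<zero>\<^bsub>S\<^esub>" if w: "w \<in> W" for w
    proof -
      have wS: "w \<in> carrier S" using w W by auto
      interpret s: ring_hom_cring "UP ?A" S "?s w" by (rule shom[OF wS])
      have "?s w m \<otimes>\<^bsub>S\<^esub> ?s w Q = ?s w (up_ring.monom (UP ?A) a 0 \<otimes>\<^bsub>UP ?A\<^esub> f)" unfolding Q(4) using mc Q by simp
      also have "\<dots> = \<zero>\<^bsub>S\<^esub>" using ma f W(4)[OF w] s.hom_closed[OF ma] by simp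
      finally show ?thesis using no w mc Q by (auto simp: S.integral_iff)
    qed
    have "card W \<le> deg ?A Q"
      by (rule card_roots_le_deg_hom[OF A.is_cring S \<eta> _ Q(1) Q0 W(1,2) roots]) (use inj in auto)
    moreover have "deg ?A m + deg ?A Q = deg ?A f"
      using U.deg_mult[OF mc(2) Q0 mc(1) Q(1)] U.deg_mult[OF ma0 f(2) ma f(1)] Q by simp
    \<comment> \<open>Positive degree of m is what leaves Q with fewer than \<open>card W\<close>
      roots.\<close>
    moreover have "deg ?A m \<noteq> 0"
    proof
      assume d0: "deg ?A m = 0"
      have "m = up_ring.monom (UP ?A) c 0" using U.deg_zero_impl_monom[OF mc(1) d0] by (simp add: c_def d0)
      hence "?l m = c" using EL.eval_const[OF v, of c] c by simp
      thus False using mc c by simp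
    qed
    ultimately show False using W(3) by simp
  qed
  then obtain w where w: "w \<in> W" "?s w m = \<zero>\<^bsub>S\<^esub>" by auto
  have wS: "w \<in> carrier S" using w W by auto
  interpret s: ring_hom_cring "UP ?A" S "?s w" by (rule shom[OF wS])
  have "?s w P = \<zero>\<^bsub>S\<^esub>" if P: "P \<in> carrier (UP ?A)" "?l P = \<zero>" for P
  proof -
    obtain Q a where Q: "Q \<in> carrier (UP ?A)" "a \<in> A" "a \<noteq> \<zero>"
      "up_ring.monom (UP ?A) a 0 \<otimes>\<^bsub>UP ?A\<^esub> P = m \<otimes>\<^bsub>UP ?A\<^esub> Q" using pdiv[OF P] by blast
    have ma: "up_ring.monom (UP ?A) a 0 \<in> carrier (UP ?A)" using Q by simp
    have "\<eta> a \<otimes>\<^bsub>S\<^esub> ?s w P = ?s w (up_ring.monom (UP ?A) a 0 \<otimes>\<^bsub>UP ?A\<^esub> P)"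
      using ma P ev_const[OF wS Q(2)] by simp
    also have "\<dots> = \<zero>\<^bsub>S\<^esub>" unfolding Q(4) using mc Q w by simp
    finally show ?thesis using inj[OF Q(2)] Q(3) \<eta>c[OF Q(2)] P by (auto simp: S.integral_iff)
  qed
  from hom_extend_by_element[OF A S \<eta> v wS this] show ?thesis by blast
qed

lemma (in field) generate_field_fractions:
  assumes B: "subring B R" and E: "E = generate_field R H" "H \<subseteq> B" and x: "x \<in> E"
  shows "x \<in> carrier R \<and> (\<exists>d\<in>B. d \<noteq> \<zero> \<and> d \<otimes> x \<in> B)"
proof -
  have BR: "\<And>x. x \<in> B \<Longrightarrow> x \<in> carrier R" using subringE(1)[OF B] by auto
  have Bm: "\<And>x y. x \<in> B \<Longrightarrow> y \<in> B \<Longrightarrow> x \<otimes> y \<in> B" and Ba: "\<And>x y. x \<in> B \<Longrightarrow> y \<in> B \<Longrightarrow> x \<oplus> y \<in> B"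
    and Bn: "\<And>x. x \<in> B \<Longrightarrow> \<ominus> x \<in> B" and B1: "\<one> \<in> B"
    using subringE[OF B] by auto
  define Fr where "Fr x \<longleftrightarrow> x \<in> carrier R \<and> (\<exists>d\<in>B. d \<noteq> \<zero> \<and> d \<otimes> x \<in> B)" for x
  have FrE: "Fr x" if "x \<in> E" for x
    using that unfolding E(1)
  proof (induction rule: generate_field.induct)
    case one thus ?case unfolding Fr_def using B1 by (intro conjI bexI[of _ "\<one>"]) auto
  next
    case (incl h)
    thus ?case unfolding Fr_def using B1 E(2) BR by (intro conjI bexI[of _ "\<one>"]) auto
  next
    case (a_inv h)
    then obtain d where "h \<in> carrier R" "d \<in> B" "d \<noteq> \<zero>" "d \<otimes> h \<in> B" by (auto simp: Fr_def)
    thus ?case unfolding Fr_def using Bn BR by (intro conjI bexI[of _ d]) (auto simp: r_minus)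
  next
    case (m_inv h)
    then obtain d where d: "h \<in> carrier R" "d \<in> B" "d \<noteq> \<zero>" "d \<otimes> h \<in> B" by (auto simp: Fr_def)
    have hi: "inv h \<in> carrier R" "h \<otimes> inv h = \<one>" using d m_inv field_Units by auto
    have "(d \<otimes> h) \<otimes> inv h = d" using d hi BR by (simp add: m_assoc)
    thus ?case unfolding Fr_def using d m_inv hi BR[OF d(2)] by (intro conjI bexI[of _ "d \<otimes> h"]) (auto simp: integral_iff)
  next
    case (eng_add x y)
    then obtain d e where d: "x \<in> carrier R" "d \<in> B" "d \<noteq> \<zero>" "d \<otimes> x \<in> B"
      and e: "y \<in> carrier R" "e \<in> B" "e \<noteq> \<zero>" "e \<otimes> y \<in> B" by (auto simp: Fr_def)
    have "d \<otimes> e \<otimes> (x \<oplus> y) = e \<otimes> (d \<otimes> x) \<oplus> d \<otimes> (e \<otimes> y)" using d e BR[OF d(2)] BR[OF e(2)] by algebra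
    thus ?case unfolding Fr_def using d e Bm Ba BR by (intro conjI bexI[of _ "d \<otimes> e"]) (auto simp: integral_iff)
  next
    case (eng_mult x y)
    then obtain d e where d: "x \<in> carrier R" "d \<in> B" "d \<noteq> \<zero>" "d \<otimes> x \<in> B"
      and e: "y \<in> carrier R" "e \<in> B" "e \<noteq> \<zero>" "e \<otimes> y \<in> B" by (auto simp: Fr_def)
    have "d \<otimes> e \<otimes> (x \<otimes> y) = (d \<otimes> x) \<otimes> (e \<otimes> y)" using d e BR[OF d(2)] BR[OF e(2)] by algebra
    thus ?case unfolding Fr_def using d e Bm BR by (intro conjI bexI[of _ "d \<otimes> e"]) (auto simp: integral_iff)
  qed
  show ?thesis using FrE[OF x] unfolding Fr_def .
qed

text \<open>The value at x is \<rho>(d x) / \<rho>(d) for any denominator d of x. The relation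
  \<open>rel\<close> states this without fixing d; injectivity of \<rho> keeps \<rho>(d) nonzero and
  makes the value independent of d.\<close>

lemma (in field) hom_extend_to_fractions:
  assumes B: "subring B R" and \<rho>: "\<rho> \<in> ring_hom (R\<lparr>carrier := B\<rparr>) R"
    and inj: "\<And>x. x \<in> B \<Longrightarrow> \<rho> x = \<zero> \<Longrightarrow> x = \<zero>" and E: "E = generate_field R H" "H \<subseteq> B"
  shows "\<exists>\<rho>'. \<rho>' \<in> ring_hom (R\<lparr>carrier := E\<rparr>) R \<and> (\<forall>x\<in>H. \<rho>' x = \<rho> x)"
proof -
  have BR: "\<And>x. x \<in> B \<Longrightarrow> x \<in> carrier R" using subringE(1)[OF B] by auto
  have Bm: "\<And>x y. x \<in> B \<Longrightarrow> y \<in> B \<Longrightarrow> x \<otimes> y \<in> B" and Ba: "\<And>x y. x \<in> B \<Longrightarrow> y \<in> B \<Longrightarrow> x \<oplus> y \<in> B"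
    and Bn: "\<And>x. x \<in> B \<Longrightarrow> \<ominus> x \<in> B" and B1: "\<one> \<in> B"
    using subringE[OF B] by auto
  have \<rho>m: "\<And>x y. x \<in> B \<Longrightarrow> y \<in> B \<Longrightarrow> \<rho> (x \<otimes> y) = \<rho> x \<otimes> \<rho> y"
    and \<rho>a: "\<And>x y. x \<in> B \<Longrightarrow> y \<in> B \<Longrightarrow> \<rho> (x \<oplus> y) = \<rho> x \<oplus> \<rho> y"
    and \<rho>c: "\<And>x. x \<in> B \<Longrightarrow> \<rho> x \<in> carrier R" and \<rho>1: "\<rho> \<one> = \<one>"
    using ring_hom_mult[OF \<rho>] ring_hom_add[OF \<rho>] ring_hom_closed[OF \<rho>] ring_hom_one[OF \<rho>] by auto
  define Fr where "Fr x \<longleftrightarrow> x \<in> carrier R \<and> (\<exists>d\<in>B. d \<noteq> \<zero> \<and> d \<otimes> x \<in> B)" for x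
  define rel where "rel x z \<longleftrightarrow> z \<in> carrier R \<and> (\<exists>d\<in>B. d \<noteq> \<zero> \<and> d \<otimes> x \<in> B \<and> \<rho> d \<otimes> z = \<rho> (d \<otimes> x))" for x z
  have FrE: "Fr x" if "x \<in> E" for x
    using generate_field_fractions[OF B E that] by (simp add: Fr_def)
  have ex: "\<exists>z. rel x z" if Fx: "Fr x" for x
  proof -
    obtain d where d: "x \<in> carrier R" "d \<in> B" "d \<noteq> \<zero>" "d \<otimes> x \<in> B" using Fx by (auto simp: Fr_def)
    have "\<rho> d \<noteq> \<zero>" using inj d by auto
    hence i: "inv (\<rho> d) \<in> carrier R" "\<rho> d \<otimes> inv (\<rho> d) = \<one>" using \<rho>c[OF d(2)] field_Units by auto
    have "\<rho> d \<otimes> (inv (\<rho> d) \<otimes> \<rho> (d \<otimes> x)) = \<rho> (d \<otimes> x)"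
      using i \<rho>c[OF d(2)] \<rho>c[OF d(4)] by (simp add: m_assoc[symmetric])
    thus ?thesis unfolding rel_def using d i \<rho>c[OF d(4)]
      by (intro exI[of _ "inv (\<rho> d) \<otimes> \<rho> (d \<otimes> x)"] conjI bexI[of _ d]) auto
  qed
  have uniq: "z = z'" if r: "rel x z" "rel x z'" and x: "x \<in> carrier R" for x z z'
  proof -
    obtain d where d: "z \<in> carrier R" "d \<in> B" "d \<noteq> \<zero>" "d \<otimes> x \<in> B" "\<rho> d \<otimes> z = \<rho> (d \<otimes> x)" using r by (auto simp: rel_def)
    obtain e where e: "z' \<in> carrier R" "e \<in> B" "e \<noteq> \<zero>" "e \<otimes> x \<in> B" "\<rho> e \<otimes> z' = \<rho> (e \<otimes> x)" using r by (auto simp: rel_def)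
    note c = \<rho>c[OF d(2)] \<rho>c[OF e(2)] d(1) e(1)
    have s: "e \<otimes> (d \<otimes> x) = d \<otimes> (e \<otimes> x)" using BR[OF d(2)] BR[OF e(2)] x by (simp add: m_lcomm)
    have "(\<rho> d \<otimes> \<rho> e) \<otimes> z = \<rho> e \<otimes> (\<rho> d \<otimes> z)" using c by (simp add: m_ac)
    also have "\<dots> = \<rho> (e \<otimes> (d \<otimes> x))" unfolding d(5) using \<rho>m[OF e(2) d(4)] by simp
    also have "\<dots> = \<rho> d \<otimes> (\<rho> e \<otimes> z')" unfolding s e(5) using \<rho>m[OF d(2) e(4)] by simp
    also have "\<dots> = (\<rho> d \<otimes> \<rho> e) \<otimes> z'" using c by (simp add: m_ac)
    finally have eq: "(\<rho> d \<otimes> \<rho> e) \<otimes> z = (\<rho> d \<otimes> \<rho> e) \<otimes> z'" .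
    have "\<rho> d \<otimes> \<rho> e \<noteq> \<zero>" using c inj[OF d(2)] inj[OF e(2)] d(3) e(3) by (auto simp: integral_iff)
    thus ?thesis using eq c m_lcancel[of "\<rho> d \<otimes> \<rho> e" z z'] by simp
  qed
  define \<rho>' where "\<rho>' x = (SOME z. rel x z)" for x
  have rel': "rel x (\<rho>' x)" if "x \<in> E" for x using someI_ex[OF ex[OF FrE[OF that]]] by (simp add: \<rho>'_def)
  have ER: "x \<in> carrier R" if "x \<in> E" for x using FrE[OF that] by (simp add: Fr_def)
  have eqI: "\<rho>' x = z" if "x \<in> E" "rel x z" for x z using uniq[OF rel'[OF that(1)] that(2) ER[OF that(1)]] .
  have HE: "x \<in> E" if "x \<in> H" for x using that unfolding E(1) by (rule generate_field.incl)
  have onB: "\<rho>' x = \<rho> x" if "x \<in> E" "x \<in> B" for x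
    using that \<rho>c \<rho>1 B1 BR by (intro eqI) (auto simp: rel_def intro!: bexI[of _ "\<one>"])
  have "\<rho>' \<in> ring_hom (R\<lparr>carrier := E\<rparr>) R"
  proof (rule ring_hom_memI)
    fix x assume "x \<in> carrier (R\<lparr>carrier := E\<rparr>)"
    hence x: "x \<in> E" by simp
    show "\<rho>' x \<in> carrier R" using rel'[OF x] by (simp add: rel_def)
    fix y assume "y \<in> carrier (R\<lparr>carrier := E\<rparr>)"
    hence y: "y \<in> E" by simp
    obtain d where d: "\<rho>' x \<in> carrier R" "d \<in> B" "d \<noteq> \<zero>" "d \<otimes> x \<in> B" "\<rho> d \<otimes> \<rho>' x = \<rho> (d \<otimes> x)"
      using rel'[OF x] by (auto simp: rel_def)
    obtain e where e: "\<rho>' y \<in> carrier R" "e \<in> B" "e \<noteq> \<zero>" "e \<otimes> y \<in> B" "\<rho> e \<otimes> \<rho>' y = \<rho> (e \<otimes> y)"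
      using rel'[OF y] by (auto simp: rel_def)
    note c = BR[OF d(2)] BR[OF e(2)] ER[OF x] ER[OF y]
    note c' = \<rho>c[OF d(2)] \<rho>c[OF e(2)] d(1) e(1)
    have de: "d \<otimes> e \<in> B" "d \<otimes> e \<noteq> \<zero>" using d e Bm c by (auto simp: integral_iff)
    have s: "d \<otimes> e \<otimes> (x \<oplus> y) = e \<otimes> (d \<otimes> x) \<oplus> d \<otimes> (e \<otimes> y)" using c by algebra
    have "\<rho> (d \<otimes> e \<otimes> (x \<oplus> y)) = \<rho> e \<otimes> (\<rho> d \<otimes> \<rho>' x) \<oplus> \<rho> d \<otimes> (\<rho> e \<otimes> \<rho>' y)"
      unfolding s d(5) e(5) using \<rho>a[OF Bm[OF e(2) d(4)] Bm[OF d(2) e(4)]] \<rho>m[OF e(2) d(4)] \<rho>m[OF d(2) e(4)] by simp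
    also have "\<dots> = (\<rho> d \<otimes> \<rho> e) \<otimes> (\<rho>' x \<oplus> \<rho>' y)" using c' by algebra
    finally have "rel (x \<oplus> y) (\<rho>' x \<oplus> \<rho>' y)" unfolding rel_def
      using de s Ba Bm d e \<rho>m[OF d(2) e(2)] c' by (intro conjI bexI[of _ "d \<otimes> e"]) auto
    thus "\<rho>' (x \<oplus>\<^bsub>R\<lparr>carrier := E\<rparr>\<^esub> y) = \<rho>' x \<oplus> \<rho>' y"
      using eqI[of "x \<oplus> y"] generate_field.eng_add[OF x[unfolded E(1)] y[unfolded E(1)]] by (simp add: E(1))
    have s: "d \<otimes> e \<otimes> (x \<otimes> y) = (d \<otimes> x) \<otimes> (e \<otimes> y)" using c by algebra
    have "\<rho> (d \<otimes> e \<otimes> (x \<otimes> y)) = (\<rho> d \<otimes> \<rho>' x) \<otimes> (\<rho> e \<otimes> \<rho>' y)"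
      unfolding s d(5) e(5) using \<rho>m[OF d(4) e(4)] by simp
    also have "\<dots> = (\<rho> d \<otimes> \<rho> e) \<otimes> (\<rho>' x \<otimes> \<rho>' y)" using c' by algebra
    finally have "rel (x \<otimes> y) (\<rho>' x \<otimes> \<rho>' y)" unfolding rel_def
      using de s Bm d e \<rho>m[OF d(2) e(2)] c' by (intro conjI bexI[of _ "d \<otimes> e"]) auto
    thus "\<rho>' (x \<otimes>\<^bsub>R\<lparr>carrier := E\<rparr>\<^esub> y) = \<rho>' x \<otimes> \<rho>' y"
      using eqI[of "x \<otimes> y"] generate_field.eng_mult[OF x[unfolded E(1)] y[unfolded E(1)]] by (simp add: E(1))
  next
    have "\<one> \<in> E" unfolding E(1) by (rule generate_field.one)
    thus "\<rho>' \<one>\<^bsub>R\<lparr>carrier := E\<rparr>\<^esub> = \<one>" using onB[OF _ B1] \<rho>1 by simp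
  qed
  moreover have "\<forall>x\<in>H. \<rho>' x = \<rho> x" using onB HE E(2) by auto
  ultimately show ?thesis by blast
qed

section \<open>Frobenius elements\<close>

lemma (in ring) additive_eval_cong:
  assumes "\<And>i. i < n \<Longrightarrow> b i = c i" "\<And>i. i < n \<Longrightarrow> c i \<in> carrier R" "x \<in> carrier R"
  shows "additive_eval q n b x = additive_eval q n c x"
proof -
  have "(\<Oplus>i\<in>{..<n}. b i \<otimes> x [^] (q ^ i)) = (\<Oplus>i\<in>{..<n}. c i \<otimes> x [^] (q ^ i))"
    by (rule finsum_cong') (use assms in auto)
  thus ?thesis by (simp add: additive_eval_def)
qed

lemma (in ring) additive_zeros_cong:
  assumes "\<And>i. i < n \<Longrightarrow> b i = c i" "\<And>i. i < n \<Longrightarrow> c i \<in> carrier R"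
  shows "additive_zeros q n b = additive_zeros q n c"
  unfolding additive_zeros_def using additive_eval_cong[OF assms] by auto

lemma (in ring) eval_coeff_list:
  assumes "\<And>i. i < k \<Longrightarrow> c i \<in> carrier R" "x \<in> carrier R"
  shows "eval (map c (rev [0..<k])) x = (\<Oplus>i\<in>{..<k}. c i \<otimes> x [^] i)"
  using assms(1)
proof (induction k)
  case (Suc k)
  have "(\<Oplus>i\<in>{..<Suc k}. c i \<otimes> x [^] i) = c k \<otimes> x [^] k \<oplus> (\<Oplus>i\<in>{..<k}. c i \<otimes> x [^] i)"
    unfolding lessThan_Suc using Suc.prems assms(2) by (subst finsum_insert) auto
  thus ?case using Suc by simp
qed simp

lemma (in cring) series_var_pow:
  "(series_var R [^]\<^bsub>series R\<^esub> (i::nat)) m = (if m = i then \<one> else \<zero>)"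
proof -
  interpret S: cring "series R" by (rule series_cring)
  show ?thesis
  proof (induction i arbitrary: m)
    case 0 show ?case by (simp add: series_one)
  next
    case (Suc i)
    have c: "series_var R [^]\<^bsub>series R\<^esub> i \<in> carrier (series R)" by simp
    have z: "(series_var R [^]\<^bsub>series R\<^esub> i) j = \<zero>" if "j < i" for j using Suc that by simp
    have v: "series_var R j = \<zero>" if "j < 1" for j using that by (simp add: series_var_def)
    have "(series_var R [^]\<^bsub>series R\<^esub> i \<otimes>\<^bsub>series R\<^esub> series_var R) m =
       (\<Oplus>j\<in>{..m}. if i = j then series_var R (m - j) else \<zero>)"
      unfolding series_mult using Suc series_closed[OF series_var_closed] by (intro finsum_cong') auto
    also have "\<dots> = (if i \<le> m then series_var R (m - i) else \<zero>)"
    proof (cases "i \<le> m")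
      case True
      thus ?thesis using add.finprod_singleton[of i "{..m}" "\<lambda>j. series_var R (m - j)"]
          series_closed[OF series_var_closed] by simp
    next
      case False
      hence "(\<Oplus>j\<in>{..m}. if i = j then series_var R (m - j) else \<zero>) = (\<Oplus>j\<in>{..m}. \<zero>)"
        by (intro finsum_cong') auto
      thus ?thesis using False by simp
    qed
    also have "\<dots> = (if m = Suc i then \<one> else \<zero>)" by (auto simp: series_var_def)
    finally show ?case by simp
  qed
qed

section \<open>Expansions in powers of t - \<tau>\<close>

locale rational_function_setup = rational_function_field_closure L K F t q
  for L :: "('k, 'm) ring_scheme" (structure) and K F :: "'k set" and t :: 'k and q :: nat +
  fixes p e :: nat
  assumes prime_p': "prime p" and q_pow: "q = p ^ e"
begin

lemma F_carrier: "c \<in> F \<Longrightarrow> c \<in> carrier L"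
  using subfieldE(3)[OF constants] by auto

lemma F_subring: "subring F L" by (rule subfieldE(1)[OF constants])

lemma F_ops: "\<zero> \<in> F" "\<one> \<in> F" "c \<in> F \<Longrightarrow> d \<in> F \<Longrightarrow> c \<oplus> d \<in> F" "c \<in> F \<Longrightarrow> d \<in> F \<Longrightarrow> c \<otimes> d \<in> F"
  "c \<in> F \<Longrightarrow> \<ominus> c \<in> F"
  using subringE[OF F_subring] by auto

lemma q_ge_2: "q \<ge> 2"
proof -
  have "card {\<zero>, \<one>} \<le> card F" using card_constants F_ops by (intro card_mono) auto
  thus ?thesis using card_constants by simp
qed

text \<open>The additive group of F has order q = p^e, so p^e annihilates 1. In a domain a power of
  p 1 can vanish only if p 1 does.\<close>

lemma char_p': "add_pow L p \<one> = \<zero>"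
proof -
  interpret FF: field "L\<lparr>carrier := F\<rparr>" by (rule subfield_iff(2)[OF constants])
  have "\<one> [^]\<^bsub>add_monoid (L\<lparr>carrier := F\<rparr>)\<^esub> Coset.order (add_monoid (L\<lparr>carrier := F\<rparr>)) = \<zero>"
    using group.pow_order_eq_1[OF FF.a_group, of "\<one>"] F_ops by simp
  moreover have "Coset.order (add_monoid (L\<lparr>carrier := F\<rparr>)) = q" using card_constants by (simp add: Coset.order_def)
  moreover have "\<one> [^]\<^bsub>add_monoid (L\<lparr>carrier := F\<rparr>)\<^esub> m = add_pow L m \<one>" for m :: nat
    by (simp add: add_pow_def nat_pow_def)
  ultimately have z: "add_pow L (p ^ e) \<one> = \<zero>" using q_pow by simp
  have mult: "add_pow L (m * k) \<one> = add_pow L m \<one> \<otimes> add_pow L k \<one>" for m k :: nat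
    using add.nat_pow_pow[of "\<one>" m k] add_pow_ldistr[of "\<one>" "add_pow L k \<one>" m] add.nat_pow_pow[of "\<one>" k m]
    by (simp add: mult.commute)
  have "add_pow L (p ^ j) \<one> = \<zero> \<Longrightarrow> add_pow L p \<one> = \<zero>" for j
    by (induction j) (auto simp: mult integral_iff)
  thus ?thesis using z by blast
qed

sublocale char_cring L p
  by unfold_locales (rule prime_p', rule char_p')

lemma F_frobenius: "c \<in> F \<Longrightarrow> c [^] q = c"
proof (cases "c = \<zero>")
  case True thus ?thesis using q_ge_2 by (simp add: nat_pow_zero)
next
  case False
  assume c: "c \<in> F"
  interpret FF: field "L\<lparr>carrier := F\<rparr>" by (rule subfield_iff(2)[OF constants])
  have fin: "finite (carrier (L\<lparr>carrier := F\<rparr>))" using card_constants by simp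
  have "Coset.order (Multiplicative_Group.mult_of (L\<lparr>carrier := F\<rparr>)) = q - 1"
    using FF.order_mult_of[OF fin] card_constants by (simp add: Coset.order_def)
  hence "c [^]\<^bsub>Multiplicative_Group.mult_of (L\<lparr>carrier := F\<rparr>)\<^esub> (q - 1) = \<one>"
    using group.pow_order_eq_1[OF FF.field_mult_group, of c] c False by simp
  hence "c [^] (q - 1) = \<one>" by (simp add: nat_pow_def)
  moreover have "c [^] Suc (q - 1) = c [^] (q - 1) \<otimes> c" by simp
  ultimately show ?thesis using q_ge_2 F_carrier[OF c] by simp
qed

lemma t_carrier: "t \<in> carrier L" using variable by simp

lemma shifted_variable_transcendental:
  assumes \<tau>: "\<tau> \<in> F" shows "(transcendental over F) (t \<ominus> \<tau>)"
proof (rule ccontr)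
  let ?A = "{x \<in> carrier L. (algebraic over F) x}"
  assume "\<not> ?thesis"
  hence 1: "t \<ominus> \<tau> \<in> ?A" using t_carrier F_carrier[OF \<tau>] by (simp add: over_def)
  have 2: "\<tau> \<in> ?A" using algebraic_self[OF F_subring \<tau>] F_carrier[OF \<tau>] by simp
  have "(t \<ominus> \<tau>) \<oplus> \<tau> \<in> ?A"
    using subringE(7)[OF subfieldE(1)[OF subfield_of_algebraics[OF constants]] 1 2] .
  moreover have "(t \<ominus> \<tau>) \<oplus> \<tau> = t" using t_carrier F_carrier[OF \<tau>] by algebra
  ultimately show False using variable(2) by (simp add: over_def)
qed

lemma shifted_variable_no_relation:
  fixes d :: nat
  assumes \<tau>: "\<tau> \<in> F" and c: "\<And>i. i \<le> d \<Longrightarrow> c i \<in> F"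
    and 0: "(\<Oplus>i\<in>{..d}. c i \<otimes> (t \<ominus> \<tau>) [^] i) = \<zero>" and i: "i \<le> d"
  shows "c i = \<zero>"
proof (rule ccontr)
  assume "c i \<noteq> \<zero>"
  \<comment> \<open>A coefficient list must start with a nonzero entry, so the relation is cut off
    at its last nonzero coefficient before transcendence is applied.\<close>
  define m where "m = Max {j. j \<le> d \<and> c j \<noteq> \<zero>}"
  have fin: "finite {j. j \<le> d \<and> c j \<noteq> \<zero>}" by simp
  have m: "m \<le> d" "c m \<noteq> \<zero>" using Max_in[OF fin] i \<open>c i \<noteq> \<zero>\<close> unfolding m_def by blast+
  have top: "c j = \<zero>" if "m < j" "j \<le> d" for j using Max_ge[OF fin, of j] that by (fastforce simp: m_def)
  let ?x = "t \<ominus> \<tau>"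
  have x: "?x \<in> carrier L" using t_carrier F_carrier[OF \<tau>] by simp
  have cc: "j \<le> d \<Longrightarrow> c j \<in> carrier L" for j using c F_carrier by auto
  let ?l = "map c (rev [0..<Suc m])"
  have "(\<Oplus>i\<in>{..d}. c i \<otimes> ?x [^] i) = (\<Oplus>i\<in>{..m}. c i \<otimes> ?x [^] i)"
    using m(1) cc x top by (intro add.finprod_mono_neutral_cong_left[symmetric]) auto
  also have "\<dots> = eval ?l ?x"
    using eval_coeff_list[of "Suc m" c ?x] cc m(1) x by (simp add: lessThan_Suc_atMost)
  finally have ev: "eval ?l ?x = \<zero>" using 0 by simp
  have "polynomial F ?l" unfolding polynomial_def using c m by auto
  hence "?l \<in> carrier (F[X])" by (simp add: univ_poly_carrier)
  from eval_transcendental[OF shifted_variable_transcendental[OF \<tau>] this ev] show False by simp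
qed

text \<open>A series \<open>\<eta> x\<close> is the expansion of \<open>x\<close> in powers of \<open>t - \<tau>\<close>, at a place over \<open>t = \<tau>\<close>.\<close>

definition expansion :: "'k \<Rightarrow> 'k set \<Rightarrow> ('k \<Rightarrow> nat \<Rightarrow> 'k) \<Rightarrow> bool" where
  "expansion \<tau> A \<eta> \<longleftrightarrow> subring A L \<and> F \<subseteq> A \<and> t \<ominus> \<tau> \<in> A \<and> \<eta> \<in> ring_hom (L\<lparr>carrier := A\<rparr>) (series L)
     \<and> (\<forall>c\<in>F. \<eta> c = series_const L c) \<and> \<eta> (t \<ominus> \<tau>) = series_var L"

text \<open>The starting point is the ring generated by F and t - \<tau>. No nonzero polynomial
  vanishes at t - \<tau>, so it may be sent to the variable of the series.\<close>

lemma expansion_exists: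
  assumes \<tau>: "\<tau> \<in> F" shows "\<exists>A \<eta>. expansion \<tau> A \<eta>"
proof -
  let ?F = "L\<lparr>carrier := F\<rparr>"
  interpret S: domain "series L" by (rule series_domain)
  interpret FD: domain ?F by (rule subring_is_domain[OF F_subring])
  interpret U: UP_cring ?F "UP ?F" by unfold_locales auto
  have sc: "series_const L \<in> ring_hom ?F (series L)"
    using series_const_hom F_carrier by (auto simp: ring_hom_def Pi_def)
  interpret sc: ring_hom_cring ?F "series L" "series_const L" by unfold_locales (rule sc)
  interpret ES: UP_pre_univ_prop ?F "series L" "series_const L" "UP ?F"
    by (rule UP_pre_univ_propI) (unfold_locales, rule sc)
  have x: "t \<ominus> \<tau> \<in> carrier L" using t_carrier F_carrier[OF \<tau>] by simp
  have "\<exists>A' \<eta>'. subring A' L \<and> F \<subseteq> A' \<and> t \<ominus> \<tau> \<in> A' \<and> \<eta>' \<in> ring_hom (L\<lparr>carrier := A'\<rparr>) (series L)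
    \<and> (\<forall>x\<in>F. \<eta>' x = series_const L x) \<and> \<eta>' (t \<ominus> \<tau>) = series_var L"
  proof (rule hom_extend_by_element)
    show "subring F L" "domain (series L)" "series_const L \<in> ring_hom ?F (series L)"
      "t \<ominus> \<tau> \<in> carrier L" "series_var L \<in> carrier (series L)"
      by (fact F_subring series_domain sc x series_var_closed)+
    fix P assume P: "P \<in> carrier (UP ?F)" and 0: "UnivPoly.eval ?F L id (t \<ominus> \<tau>) P = \<zero>"
    have cF: "up_ring.coeff (UP ?F) P i \<in> F" for i using U.coeff_closed[OF P] by simp
    have "(\<Oplus>i\<in>{..deg ?F P}. up_ring.coeff (UP ?F) P i \<otimes> (t \<ominus> \<tau>) [^] i) = \<zero>"
      using 0 P by (simp add: UnivPoly.eval_def)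
    hence z: "up_ring.coeff (UP ?F) P i = \<zero>" if "i \<le> deg ?F P" for i
      using shifted_variable_no_relation[where c = "up_ring.coeff (UP ?F) P" and d = "deg ?F P", OF \<tau> cF _ that] by blast
    have "P = \<zero>\<^bsub>UP ?F\<^esub>"
      using z[OF order_refl] U.lcoeff_nonzero2[OF P] by auto
    thus "UnivPoly.eval ?F (series L) (series_const L) (series_var L) P = \<zero>\<^bsub>series L\<^esub>"
      using ring_hom_zero[OF ES.eval_ring_hom[OF series_var_closed] U.UP_ring S.ring_axioms] by simp
  qed
  thus ?thesis unfolding expansion_def by blast
qed

lemma expansionD:
  assumes "expansion \<tau> A \<eta>"
  shows "subring A L" "c \<in> F \<Longrightarrow> c \<in> A" "t \<ominus> \<tau> \<in> A" "\<eta> \<in> ring_hom (L\<lparr>carrier := A\<rparr>) (series L)"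
    "c \<in> F \<Longrightarrow> \<eta> c = series_const L c" "\<eta> (t \<ominus> \<tau>) = series_var L"
    "x \<in> A \<Longrightarrow> x \<in> carrier L"
  using assms subringE(1)[of A L] by (auto simp: expansion_def)

lemma expansion_hom:
  assumes "expansion \<tau> A \<eta>"
  shows "ring_hom_cring (L\<lparr>carrier := A\<rparr>) (series L) \<eta>" "ring_hom_cring (L\<lparr>carrier := A\<rparr>) L id"
proof -
  interpret A: domain "L\<lparr>carrier := A\<rparr>" by (rule subring_is_domain[OF expansionD(1)[OF assms]])
  interpret S: domain "series L" by (rule series_domain)
  show "ring_hom_cring (L\<lparr>carrier := A\<rparr>) (series L) \<eta>" by unfold_locales (rule expansionD(4)[OF assms])
  show "ring_hom_cring (L\<lparr>carrier := A\<rparr>) L id"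
    by unfold_locales (rule ring_hom_memI, use expansionD(7)[OF assms] in auto)
qed

text \<open>Every element of \<open>L\<close> is algebraic over \<open>K\<close>, so \<open>1 / x\<close> has a denominator \<open>d\<close> in \<open>F[t]\<close>
  relative to \<open>A\<close>; then \<open>\<eta> d = \<eta> x * \<eta> (d / x)\<close> shows \<open>\<eta> x \<noteq> 0\<close>.\<close>

lemma expansion_injective:
  assumes ex: "expansion \<tau> A \<eta>" and \<tau>: "\<tau> \<in> F" and x: "x \<in> A" "\<eta> x = \<zero>\<^bsub>series L\<^esub>"
  shows "x = \<zero>"
proof (rule ccontr)
  assume x0: "x \<noteq> \<zero>"
  note E = expansionD[OF ex]
  interpret S: domain "series L" by (rule series_domain)
  interpret A: domain "L\<lparr>carrier := A\<rparr>" by (rule subring_is_domain[OF E(1)])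
  interpret \<eta>: ring_hom_cring "L\<lparr>carrier := A\<rparr>" "series L" \<eta> by (rule expansion_hom(1)[OF ex])
  interpret idA: ring_hom_cring "L\<lparr>carrier := A\<rparr>" L id by (rule expansion_hom(2)[OF ex])
  let ?F = "L\<lparr>carrier := F\<rparr>"
  let ?u = "t \<ominus> \<tau>"
  interpret FD: domain ?F by (rule subring_is_domain[OF F_subring])
  interpret U: UP_cring ?F "UP ?F" by unfold_locales auto
  have u: "?u \<in> carrier L" using E(3,7) by blast
  have idF: "id \<in> ring_hom ?F L" by (rule ring_hom_memI) (use F_carrier in auto)
  interpret EL: UP_pre_univ_prop ?F L id "UP ?F" by (rule UP_pre_univ_propI) (unfold_locales, rule idF)
  let ?l = "UnivPoly.eval ?F L id ?u"
  interpret l: ring_hom_cring "UP ?F" L ?l by unfold_locales (rule EL.eval_ring_hom[OF u])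
  \<comment> \<open>The ring of polynomials in t over F, presented through t - \<tau>, whose
    expansion is simply the variable.\<close>
  define B where "B = ?l ` carrier (UP ?F)"
  have B: "subring B L" unfolding B_def
    by (rule ring_hom_ring.img_is_subring[OF ring_hom_ringI2[OF U.UP_ring ring_axioms l.homh]])
      (rule ring.carrier_is_subring[OF U.UP_ring])
  have FB: "c \<in> B" if "c \<in> F" for c
    unfolding B_def using EL.eval_const[OF u, of c] that by (intro image_eqI[of _ _ "up_ring.monom (UP ?F) c 0"]) auto
  have uB: "?u \<in> B"
    unfolding B_def using EL.eval_monom1[OF u] by (intro image_eqI[of _ _ "up_ring.monom (UP ?F) \<one>\<^bsub>?F\<^esub> 1"]) (auto simp: F_ops)
  have tB: "t \<in> B"
  proof -
    have "?u \<oplus> \<tau> \<in> B" using subringE(7)[OF B uB FB[OF \<tau>]] .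
    moreover have "?u \<oplus> \<tau> = t" using t_carrier F_carrier[OF \<tau>] by algebra
    ultimately show ?thesis by simp
  qed
  have Bsum: "\<exists>c m. (\<forall>i. c i \<in> F) \<and> y = (\<Oplus>i\<in>{..m::nat}. c i \<otimes> ?u [^] i)" if yB: "y \<in> B" for y
  proof -
    obtain P where P: "P \<in> carrier (UP ?F)" "y = ?l P" using yB by (auto simp: B_def)
    have cF: "up_ring.coeff (UP ?F) P i \<in> F" for i using U.coeff_closed[OF P(1)] by simp
    thus ?thesis using P by (intro exI[of _ "up_ring.coeff (UP ?F) P"] exI[of _ "deg ?F P"]) (simp add: UnivPoly.eval_def)
  qed
  have upow: "?u [^] i \<in> A" for i :: nat
    using E(3) subringE(3,6)[OF E(1)] by (induction i) auto
  \<comment> \<open>An element of B is a sum of c i times powers of t - \<tau>, and the coefficients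
    of its expansion are the c i themselves. So \<eta> is injective on B.\<close>
  have BA: "y \<in> A" and B0: "\<eta> y = \<zero>\<^bsub>series L\<^esub> \<Longrightarrow> y = \<zero>" if "y \<in> B" for y
  proof -
    obtain c m where c: "\<And>i. c i \<in> F" "y = (\<Oplus>i\<in>{..m::nat}. c i \<otimes> ?u [^] i)" using Bsum[OF \<open>y \<in> B\<close>] by blast
    let ?A = "L\<lparr>carrier := A\<rparr>"
    have cu: "c i \<otimes> ?u [^] i \<in> A" for i using subringE(6)[OF E(1) E(2)[OF c(1)] upow] .
    have y: "y = (\<Oplus>\<^bsub>?A\<^esub>i\<in>{..m}. c i \<otimes> ?u [^] i)"
      using idA.hom_finsum[of "\<lambda>i. c i \<otimes> ?u [^] i" "{..m}"] cu c(2) by (simp add: comp_def Pi_def)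
    show "y \<in> A" unfolding y using A.finsum_closed[of "\<lambda>i. c i \<otimes> ?u [^] i" "{..m}"] cu by simp
    assume "\<eta> y = \<zero>\<^bsub>series L\<^esub>"
    have t: "\<eta> (c i \<otimes> ?u [^] i) = series_const L (c i) \<otimes>\<^bsub>series L\<^esub> series_var L [^]\<^bsub>series L\<^esub> i" for i
    proof -
      have "\<eta> (c i \<otimes> ?u [^] i) = \<eta> (c i) \<otimes>\<^bsub>series L\<^esub> \<eta> (?u [^] i)"
        using \<eta>.hom_mult[of "c i" "?u [^] i"] E(2)[OF c(1)] upow by simp
      also have "\<eta> (?u [^] i) = series_var L [^]\<^bsub>series L\<^esub> i"
        using \<eta>.hom_pow[of ?u i] E(3,6) by (simp add: nat_pow_consistent[symmetric])
      finally show ?thesis using E(5)[OF c(1)] by simp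
    qed
    have "\<eta> y = (\<Oplus>\<^bsub>series L\<^esub>i\<in>{..m}. series_const L (c i) \<otimes>\<^bsub>series L\<^esub> series_var L [^]\<^bsub>series L\<^esub> i)"
      unfolding y using \<eta>.hom_finsum[of "\<lambda>i. c i \<otimes> ?u [^] i" "{..m}"] cu by (simp add: comp_def Pi_def t)
    hence co: "(\<eta> y) j = (\<Oplus>i\<in>{..m}. (series_const L (c i) \<otimes>\<^bsub>series L\<^esub> series_var L [^]\<^bsub>series L\<^esub> i) j)" for j
      using series_finsum_coeff[of "{..m}" "\<lambda>i. series_const L (c i) \<otimes>\<^bsub>series L\<^esub> series_var L [^]\<^bsub>series L\<^esub> i" j]
        F_carrier[OF c(1)] by simp
    have "c j = \<zero>" if "j \<le> m" for j
    proof -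
      have "(\<eta> y) j = (\<Oplus>i\<in>{..m}. if j = i then c i else \<zero>)"
        unfolding co using F_carrier[OF c(1)]
        by (intro finsum_cong') (auto simp: series_const_mult series_var_pow)
      also have "\<dots> = c j" using add.finprod_singleton[of j "{..m}" c] that F_carrier[OF c(1)] by simp
      finally show ?thesis using \<open>\<eta> y = \<zero>\<^bsub>series L\<^esub>\<close> by (simp add: series_zero)
    qed
    hence "y = (\<Oplus>i\<in>{..m}. \<zero>)" unfolding c(2) using u by (intro finsum_cong') auto
    thus "y = \<zero>" by simp
  qed
  have xL: "x \<in> carrier L" using E(7) x by simp
  have alg: "subfield (simple_extension K x) L"
    using simple_extension_is_subfield[OF subfield_axioms xL] algebraic_extension[OF xL] by simp
  have den: "\<exists>d\<in>B. d \<noteq> \<zero> \<and> d \<otimes> y \<in> A" if "y \<in> simple_extension K x" for y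
    using that
  proof (induction rule: simple_extension.induct)
    case zero
    show ?case using FB[OF F_ops(2)] subringE(2)[OF E(1)] by (intro bexI[of _ "\<one>"]) auto
  next
    case (lin k1 k2)
    then obtain d1 where d1: "d1 \<in> B" "d1 \<noteq> \<zero>" "d1 \<otimes> k1 \<in> A" by auto
    have k2: "k2 \<in> carrier L" "\<exists>d\<in>B. d \<noteq> \<zero> \<and> d \<otimes> k2 \<in> B"
      using generate_field_fractions[OF B generated _ lin(2)] FB tB by auto
    then obtain d2 where d2: "d2 \<in> B" "d2 \<noteq> \<zero>" "d2 \<otimes> k2 \<in> B" by auto
    have k1: "k1 \<in> carrier L" using lin(1) subringE(1)[OF subfieldE(1)[OF alg]] by auto
    have cl: "d1 \<in> carrier L" "d2 \<in> carrier L" using d1 d2 BA E(7) by auto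
    have "d1 \<otimes> d2 \<otimes> (k1 \<otimes> x \<oplus> k2) = d2 \<otimes> ((d1 \<otimes> k1) \<otimes> x) \<oplus> d1 \<otimes> (d2 \<otimes> k2)"
      using cl k1 k2(1) xL by algebra
    also have "\<dots> \<in> A" using subringE(6,7)[OF E(1)] d1 d2 x BA by auto
    finally show ?case using subringE(6)[OF B] d1 d2 cl by (intro bexI[of _ "d1 \<otimes> d2"]) (auto simp: integral_iff)
  qed
  have "inv x \<in> simple_extension K x"
    using subfield_m_inv(1)[OF alg, of x] simple_extension_mem[OF subfieldE(1)[OF subfield_axioms] xL] x0 by simp
  then obtain d where d: "d \<in> B" "d \<noteq> \<zero>" "d \<otimes> inv x \<in> A" using den by blast
  have i: "inv x \<in> carrier L" "inv x \<otimes> x = \<one>" using x0 xL field_Units by auto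
  have "(d \<otimes> inv x) \<otimes> x = d" using i xL E(7)[OF BA[OF d(1)]] by (simp add: m_assoc)
  hence "\<eta> d = \<eta> (d \<otimes> inv x) \<otimes>\<^bsub>series L\<^esub> \<eta> x" using \<eta>.hom_mult[of "d \<otimes> inv x" x] d x by simp
  hence "\<eta> d = \<zero>\<^bsub>series L\<^esub>" using x \<eta>.hom_closed[of "d \<otimes> inv x"] d by simp
  thus False using B0[OF d(1)] d(2) by simp
qed

end

text \<open>The same polynomial as an element of \<open>UP\<close>. All exponents q^i with i < n lie
  below q^n, so the degree does not exceed the number of roots found by lifting.\<close>

lemma (in UP_cring) additive_polynomial:
  assumes a: "\<And>i. i < n \<Longrightarrow> a i \<in> carrier R" and q: "q \<ge> 2" and nt: "\<one> \<noteq> \<zero>"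
  defines "f \<equiv> ring.additive_eval P q n (\<lambda>i. up_ring.monom P (a i) 0) (up_ring.monom P \<one> 1)"
  shows "f \<in> carrier P" "f \<noteq> \<zero>\<^bsub>P\<^esub>" "deg R f \<le> q ^ n"
proof -
  let ?X = "up_ring.monom P \<one> 1"
  have f: "f = ?X [^]\<^bsub>P\<^esub> (q ^ n) \<oplus>\<^bsub>P\<^esub> (\<Oplus>\<^bsub>P\<^esub>i\<in>{..<n}. up_ring.monom P (a i) 0 \<otimes>\<^bsub>P\<^esub> ?X [^]\<^bsub>P\<^esub> (q ^ i))"
    unfolding f_def by (rule P.additive_eval_def)
  have X: "?X [^]\<^bsub>P\<^esub> m = up_ring.monom P \<one> m" for m :: nat using monom_pow[of "\<one>" 1 m] by simp
  have t: "up_ring.monom P (a i) 0 \<otimes>\<^bsub>P\<^esub> ?X [^]\<^bsub>P\<^esub> (q ^ i) = up_ring.monom P (a i) (q ^ i)" if "i < n" for i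
    unfolding X using monom_mult[of "a i" "\<one>" 0 "q ^ i"] a[OF that] by simp
  have s: "(\<Oplus>\<^bsub>P\<^esub>i\<in>{..<n}. up_ring.monom P (a i) 0 \<otimes>\<^bsub>P\<^esub> ?X [^]\<^bsub>P\<^esub> (q ^ i)) = (\<Oplus>\<^bsub>P\<^esub>i\<in>{..<n}. up_ring.monom P (a i) (q ^ i))"
    by (rule P.finsum_cong') (use t a in auto)
  have sc: "(\<Oplus>\<^bsub>P\<^esub>i\<in>{..<n}. up_ring.monom P (a i) (q ^ i)) \<in> carrier P"
    by (rule P.finsum_closed) (use a in auto)
  show fc: "f \<in> carrier P" unfolding f s unfolding X using sc by simp
  have hi: "up_ring.coeff P (\<Oplus>\<^bsub>P\<^esub>i\<in>{..<n}. up_ring.monom P (a i) (q ^ i)) k = \<zero>" if k: "k \<ge> q ^ n" for k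
  proof -
    have "up_ring.coeff P (\<Oplus>\<^bsub>P\<^esub>i\<in>{..<n}. up_ring.monom P (a i) (q ^ i)) k =
      (\<Oplus>i\<in>{..<n}. up_ring.coeff P (up_ring.monom P (a i) (q ^ i)) k)"
      by (rule coeff_finsum) (use a in auto)
    also have "\<dots> = (\<Oplus>i\<in>{..<n}. \<zero>)"
    proof (rule R.finsum_cong')
      fix i assume i: "i \<in> {..<n}"
      have "q ^ i < q ^ n" using i q by (intro power_strict_increasing) auto
      thus "up_ring.coeff P (up_ring.monom P (a i) (q ^ i)) k = \<zero>" using a i k by simp
    qed auto
    finally show ?thesis by simp
  qed
  have co: "up_ring.coeff P f k = (if k = q ^ n then \<one> else \<zero>)" if "k \<ge> q ^ n" for k
    unfolding f s unfolding X using hi[OF that] sc by simp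
  show "f \<noteq> \<zero>\<^bsub>P\<^esub>" using co[of "q ^ n"] nt by auto
  show "deg R f \<le> q ^ n" by (rule deg_aboveI[OF _ fc]) (use co in auto)
qed

lemma (in field) subfield_hom_inv:
  assumes E: "subfield E R" and h: "h \<in> ring_hom (R\<lparr>carrier := E\<rparr>) R" and x: "x \<in> E" "x \<noteq> \<zero>"
  shows "h x \<noteq> \<zero>" "h (inv x) = inv (h x)"
proof -
  have i: "inv x \<in> E" "x \<otimes> inv x = \<one>" using subfield_m_inv[OF E, of x] x by auto
  have "h x \<otimes> h (inv x) = h (x \<otimes> inv x)" using ring_hom_mult[OF h, of x "inv x"] x i by simp
  also have "\<dots> = \<one>" using ring_hom_one[OF h] i by simp
  finally have hi: "h x \<otimes> h (inv x) = \<one>" .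
  have c: "h x \<in> carrier R" "h (inv x) \<in> carrier R" using ring_hom_closed[OF h] x i by auto
  show "h x \<noteq> \<zero>" using hi c by auto
  show "h (inv x) = inv (h x)" using comm_inv_char[OF c hi] by simp
qed

section \<open>Specialized coefficients and expanded roots\<close>

context rational_function_setup
begin

text \<open>A relation and not a map, since only the transcendence of t makes y depend on x alone.
  Uniqueness is settled later, when \<open>value_at\<close> picks a value.\<close>

definition specializes :: "'k \<Rightarrow> 'k \<Rightarrow> 'k \<Rightarrow> bool" where
  "specializes \<tau> x y \<longleftrightarrow> (\<exists>c d. (\<forall>j. c j \<in> F) \<and> x = (\<Oplus>j\<in>{..d::nat}. c j \<otimes> t [^] j) \<and> y = (\<Oplus>j\<in>{..d}. c j \<otimes> \<tau> [^] j))"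

lemma finsum_in_subring:
  assumes A: "subring A L" and f: "\<And>i. i \<in> I \<Longrightarrow> f i \<in> A"
  shows "(\<Oplus>i\<in>I. f i) \<in> A"
  using f
proof (induction I rule: infinite_finite_induct)
  case (insert x I)
  have "f i \<in> carrier L" if "i \<in> insert x I" for i using insert.prems[OF that] subringE(1)[OF A] by auto
  thus ?case using insert subringE(7)[OF A] by (subst finsum_insert) auto
qed (use subringE(2)[OF A] in auto)

lemma pow_in_subring: "subring A L \<Longrightarrow> x \<in> A \<Longrightarrow> x [^] (i::nat) \<in> A"
  using subringE(3,6)[of A L] by (induction i) auto

lemma specializes_hom:
  assumes A: "subring A L" "F \<subseteq> A" "t \<in> A" and S: "cring S" and h: "h \<in> ring_hom (L\<lparr>carrier := A\<rparr>) S"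
    and x: "x = (\<Oplus>j\<in>{..d::nat}. c j \<otimes> t [^] j)" "\<And>j. c j \<in> F"
  shows "x \<in> A" "h x = (\<Oplus>\<^bsub>S\<^esub>j\<in>{..d}. h (c j) \<otimes>\<^bsub>S\<^esub> h t [^]\<^bsub>S\<^esub> j)"
proof -
  let ?A = "L\<lparr>carrier := A\<rparr>"
  interpret A: domain ?A by (rule subring_is_domain[OF A(1)])
  interpret S: cring S by (rule S)
  interpret h: ring_hom_cring ?A S h by unfold_locales (rule h)
  have ct: "c j \<otimes> t [^] j \<in> A" for j
    using subringE(6)[OF A(1), of "c j" "t [^] j"] pow_in_subring[OF A(1,3), of j] x(2)[of j] A(2) by blast
  have cA: "c j \<in> A" for j using x(2) A(2) by auto
  show "x \<in> A" unfolding x by (rule finsum_in_subring[OF A(1)]) (rule ct)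
  have idA: "id \<in> ring_hom ?A L" by (rule ring_hom_memI) (use subringE(1)[OF A(1)] in auto)
  interpret idA: ring_hom_cring ?A L id by unfold_locales (rule idA)
  have x': "x = (\<Oplus>\<^bsub>?A\<^esub>j\<in>{..d}. c j \<otimes> t [^] j)"
    using idA.hom_finsum[of "\<lambda>j. c j \<otimes> t [^] j" "{..d}"] ct x(1) by (simp add: comp_def Pi_def)
  have "h (c j \<otimes> t [^] j) = h (c j) \<otimes>\<^bsub>S\<^esub> h t [^]\<^bsub>S\<^esub> j" for j
    using h.hom_mult[of "c j" "t [^] j"] h.hom_pow[of t j] cA pow_in_subring[OF A(1,3)] A(3)
    by (simp add: nat_pow_consistent[symmetric])
  thus "h x = (\<Oplus>\<^bsub>S\<^esub>j\<in>{..d}. h (c j) \<otimes>\<^bsub>S\<^esub> h t [^]\<^bsub>S\<^esub> j)"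
    unfolding x' using h.hom_finsum[of "\<lambda>j. c j \<otimes> t [^] j" "{..d}"] ct by (simp add: comp_def Pi_def)
qed

lemma K_subring: "subring K L" by (rule subfieldE(1)[OF subfield_axioms])

lemma F_t_in_K: "F \<subseteq> K" "t \<in> K"
  unfolding generated by (auto intro: generate_field.incl)

lemma specializes_in_K: "specializes \<tau> x y \<Longrightarrow> x \<in> K"
  unfolding specializes_def
  using subringE(6)[OF K_subring] pow_in_subring[OF K_subring F_t_in_K(2)] F_t_in_K(1)
  by (auto intro!: finsum_in_subring[OF K_subring])

lemma specializes_in_F: "\<tau> \<in> F \<Longrightarrow> specializes \<tau> x y \<Longrightarrow> y \<in> F"
  unfolding specializes_def
  using subringE(6)[OF F_subring] pow_in_subring[OF F_subring]
  by (auto intro!: finsum_in_subring[OF F_subring])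

text \<open>A polynomial in t is expanded by substituting \<tau> plus the variable for t. Hence its
  expansion is the same for every \<eta>, its coefficients lie in F and are fixed by the Frobenius
  map, and its constant term is the value at \<tau>.\<close>

lemma expansion_of_coefficients:
  assumes \<tau>: "\<tau> \<in> F" and ex: "expansion \<tau> A \<eta>" and sp: "specializes \<tau> x y"
  shows "x \<in> A" "(\<eta> x) 0 = y" "(\<lambda>m. (\<eta> x) m [^] q) = \<eta> x"
    "expansion \<tau> A' \<eta>' \<Longrightarrow> \<eta>' x = \<eta> x"
proof -
  interpret S: domain "series L" by (rule series_domain)
  obtain c d where c: "\<And>j. c j \<in> F" "x = (\<Oplus>j\<in>{..d::nat}. c j \<otimes> t [^] j)" "y = (\<Oplus>j\<in>{..d}. c j \<otimes> \<tau> [^] j)"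
    using sp by (auto simp: specializes_def)
  define z where "z = (\<Oplus>\<^bsub>series L\<^esub>j\<in>{..d}. series_const L (c j) \<otimes>\<^bsub>series L\<^esub> (series_var L \<oplus>\<^bsub>series L\<^esub> series_const L \<tau>) [^]\<^bsub>series L\<^esub> j)"
  have main: "x \<in> A \<and> \<eta> x = z" if ex: "expansion \<tau> A \<eta>" for A \<eta>
  proof -
    note E = expansionD[OF ex]
    have t: "t = (t \<ominus> \<tau>) \<oplus> \<tau>" using t_carrier F_carrier[OF \<tau>] by algebra
    have tA: "t \<in> A" by (subst t) (rule subringE(7)[OF E(1) E(3) E(2)[OF \<tau>]])
    have "\<eta> t = \<eta> (t \<ominus> \<tau>) \<oplus>\<^bsub>series L\<^esub> \<eta> \<tau>"
      using ring_hom_add[OF E(4), of "t \<ominus> \<tau>" \<tau>] E(2,3) \<tau> t by simp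
    hence \<eta>t: "\<eta> t = series_var L \<oplus>\<^bsub>series L\<^esub> series_const L \<tau>" using E(5)[OF \<tau>] E(6) by simp
    have FA: "F \<subseteq> A" using E(2) by auto
    have "\<eta> x = (\<Oplus>\<^bsub>series L\<^esub>j\<in>{..d}. \<eta> (c j) \<otimes>\<^bsub>series L\<^esub> \<eta> t [^]\<^bsub>series L\<^esub> j)"
      by (rule specializes_hom(2)[OF E(1) FA tA S.is_cring E(4) c(2,1)])
    also have "\<dots> = z" unfolding z_def \<eta>t using E(5)[OF c(1)] by simp
    finally show ?thesis using specializes_hom(1)[OF E(1) FA tA S.is_cring E(4) c(2,1)] by simp
  qed
  have \<eta>x: "\<eta> x = z" using main[OF ex] by simp
  show "x \<in> A" using main[OF ex] by simp
  show "\<eta>' x = \<eta> x" if "expansion \<tau> A' \<eta>'" using main[OF that] \<eta>x by simp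
  have \<tau>': "series_var L \<oplus>\<^bsub>series L\<^esub> series_const L \<tau> \<in> carrier (series L)" using F_carrier[OF \<tau>] by simp
  have term_c: "series_const L (c j) \<otimes>\<^bsub>series L\<^esub> (series_var L \<oplus>\<^bsub>series L\<^esub> series_const L \<tau>) [^]\<^bsub>series L\<^esub> j \<in> carrier (series L)" for j
    using \<tau>' F_carrier[OF c(1)] by simp
  interpret h0: ring_hom_cring "series L" L "\<lambda>f. f 0" by unfold_locales (rule series_constant_term_hom)
  have "z 0 = (\<Oplus>j\<in>{..d}. (series_const L (c j) \<otimes>\<^bsub>series L\<^esub> (series_var L \<oplus>\<^bsub>series L\<^esub> series_const L \<tau>) [^]\<^bsub>series L\<^esub> j) 0)"
    unfolding z_def using h0.hom_finsum[of "\<lambda>j. series_const L (c j) \<otimes>\<^bsub>series L\<^esub> (series_var L \<oplus>\<^bsub>series L\<^esub> series_const L \<tau>) [^]\<^bsub>series L\<^esub> j" "{..d}"] term_c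
    by (simp add: comp_def)
  also have "\<dots> = y" unfolding c(3)
  proof (rule finsum_cong')
    fix j assume "j \<in> {..d}"
    have "(series_const L (c j) \<otimes>\<^bsub>series L\<^esub> (series_var L \<oplus>\<^bsub>series L\<^esub> series_const L \<tau>) [^]\<^bsub>series L\<^esub> j) 0 =
      series_const L (c j) 0 \<otimes> ((series_var L \<oplus>\<^bsub>series L\<^esub> series_const L \<tau>) 0) [^] j"
      using \<tau>' F_carrier[OF c(1)] h0.hom_mult h0.hom_pow by simp
    thus "(series_const L (c j) \<otimes>\<^bsub>series L\<^esub> (series_var L \<oplus>\<^bsub>series L\<^esub> series_const L \<tau>) [^]\<^bsub>series L\<^esub> j) 0 = c j \<otimes> \<tau> [^] j"
      using F_carrier[OF \<tau>] by (simp add: series_add series_const_def series_var_def)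
  qed (use F_carrier c(1) \<tau> in auto)
  finally show "(\<eta> x) 0 = y" using \<eta>x by simp
  define \<Phi> where "\<Phi> = (\<lambda>(f :: nat \<Rightarrow> 'k) m. f m [^] q)"
  interpret \<Phi>: ring_hom_cring "series L" "series L" \<Phi>
    unfolding \<Phi>_def by unfold_locales (rule series_map_hom, use frobenius_hom[of e] q_pow in simp)
  have \<Phi>c: "\<Phi> (series_const L a) = series_const L a" if "a \<in> F" for a
    using F_frobenius[OF that] q_ge_2 by (auto simp: \<Phi>_def series_const_def fun_eq_iff nat_pow_zero)
  have \<Phi>v: "\<Phi> (series_var L) = series_var L"
    using q_ge_2 by (auto simp: \<Phi>_def series_var_def fun_eq_iff nat_pow_zero)
  have "\<Phi> z = (\<Oplus>\<^bsub>series L\<^esub>j\<in>{..d}. \<Phi> (series_const L (c j) \<otimes>\<^bsub>series L\<^esub> (series_var L \<oplus>\<^bsub>series L\<^esub> series_const L \<tau>) [^]\<^bsub>series L\<^esub> j))"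
    unfolding z_def using \<Phi>.hom_finsum[of "\<lambda>j. series_const L (c j) \<otimes>\<^bsub>series L\<^esub> (series_var L \<oplus>\<^bsub>series L\<^esub> series_const L \<tau>) [^]\<^bsub>series L\<^esub> j" "{..d}"] term_c
    by (simp add: comp_def)
  also have "\<dots> = z" unfolding z_def
  proof (rule S.finsum_cong')
    fix j assume "j \<in> {..d}"
    show "\<Phi> (series_const L (c j) \<otimes>\<^bsub>series L\<^esub> (series_var L \<oplus>\<^bsub>series L\<^esub> series_const L \<tau>) [^]\<^bsub>series L\<^esub> j) =
      series_const L (c j) \<otimes>\<^bsub>series L\<^esub> (series_var L \<oplus>\<^bsub>series L\<^esub> series_const L \<tau>) [^]\<^bsub>series L\<^esub> j"
      using F_carrier[OF c(1)] F_carrier[OF \<tau>] \<Phi>c[OF c(1)] \<Phi>c[OF \<tau>] \<Phi>v by simp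
  qed (use term_c in auto)
  finally show "(\<lambda>m. (\<eta> x) m [^] q) = \<eta> x" using \<eta>x by (simp add: \<Phi>_def)
qed

text \<open>The roots are adjoined one at a time. By lifting, the polynomial with expanded
  coefficients has q^n roots among the series, which is its degree, so the extension lemma applies
  whatever ring has been reached. Which series a root is sent to is left open.\<close>

lemma expansion_of_roots:
  assumes \<tau>: "\<tau> \<in> F" and n: "n > 0" and sp: "\<And>i. i < n \<Longrightarrow> specializes \<tau> (a i) (b i)" and b0: "b 0 \<noteq> \<zero>"
    and W: "finite W" "W \<subseteq> additive_zeros q n a"
  shows "\<exists>A \<eta>. expansion \<tau> A \<eta> \<and> W \<subseteq> A"
  using W
proof (induction W rule: finite_induct)
  case empty
  show ?case using expansion_exists[OF \<tau>] by auto
next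
  case (insert v W)
  then obtain A \<eta> where ex: "expansion \<tau> A \<eta>" and WA: "W \<subseteq> A" by auto
  note E = expansionD[OF ex]
  let ?A = "L\<lparr>carrier := A\<rparr>"
  define a' where "a' i = \<eta> (a i)" for i
  have aA: "a i \<in> A" and a'0: "a' i 0 = b i" if "i < n" for i
    using expansion_of_coefficients[OF \<tau> ex sp[OF that]] by (auto simp: a'_def)
  have a'c: "a' i \<in> carrier (series L)" if "i < n" for i
    using ring_hom_closed[OF E(4), of "a i"] aA[OF that] by (simp add: a'_def)
  interpret lift: additive_lift L p q e n a'
    using a'c a'0[OF n] b0 q_pow q_ge_2 n by unfold_locales auto
  interpret A: domain ?A by (rule subring_is_domain[OF E(1)])
  interpret U: UP_cring ?A "UP ?A" by unfold_locales auto
  interpret idA: ring_hom_cring ?A L id by (rule expansion_hom(2)[OF ex])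
  interpret \<eta>: ring_hom_cring ?A "series L" \<eta> by (rule expansion_hom(1)[OF ex])
  interpret EL: UP_pre_univ_prop ?A L id "UP ?A" by (rule UP_pre_univ_propI) (unfold_locales, rule idA.homh)
  interpret ES: UP_pre_univ_prop ?A "series L" \<eta> "UP ?A" by (rule UP_pre_univ_propI) (unfold_locales, rule \<eta>.homh)
  define f where "f = ring.additive_eval (UP ?A) q n (\<lambda>i. up_ring.monom (UP ?A) (a i) 0) (up_ring.monom (UP ?A) \<one>\<^bsub>?A\<^esub> 1)"
  have f: "f \<in> carrier (UP ?A)" "f \<noteq> \<zero>\<^bsub>UP ?A\<^esub>" "deg ?A f \<le> q ^ n"
    using U.additive_polynomial[of n a q] aA q_ge_2 by (simp_all add: f_def)
  have mc: "up_ring.monom (UP ?A) (a i) 0 \<in> carrier (UP ?A)" if "i < n" for i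
    using aA[OF that] by simp
  have mX: "up_ring.monom (UP ?A) \<one>\<^bsub>?A\<^esub> 1 \<in> carrier (UP ?A)" by (rule U.monom_closed[OF A.one_closed])
  have vL: "v \<in> carrier L" "additive_eval q n a v = \<zero>" using insert.prems by (auto simp: additive_zeros_def)
  have aL: "a i \<in> carrier L" if "i < n" for i using aA[OF that] E(7) by auto
  have evL: "UnivPoly.eval ?A L id v f = \<zero>"
  proof -
    interpret l: ring_hom_cring "UP ?A" L "UnivPoly.eval ?A L id v"
      by unfold_locales (rule EL.eval_ring_hom[OF vL(1)])
    have "UnivPoly.eval ?A L id v f = additive_eval q n (\<lambda>i. UnivPoly.eval ?A L id v (up_ring.monom (UP ?A) (a i) 0))
        (UnivPoly.eval ?A L id v (up_ring.monom (UP ?A) \<one>\<^bsub>?A\<^esub> 1))"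
      unfolding f_def using mc mX by (rule l.hom_additive_eval)
    also have "\<dots> = additive_eval q n a v"
      unfolding EL.eval_monom1[OF vL(1)]
      by (rule additive_eval_cong) (use EL.eval_const[OF vL(1)] aA aL vL in auto)
    finally show ?thesis using vL by simp
  qed
  have evS: "UnivPoly.eval ?A (series L) \<eta> w f = lift.S.additive_eval q n a' w" if w: "w \<in> carrier (series L)" for w
  proof -
    interpret s: ring_hom_cring "UP ?A" "series L" "UnivPoly.eval ?A (series L) \<eta> w"
      by unfold_locales (rule ES.eval_ring_hom[OF w])
    have "UnivPoly.eval ?A (series L) \<eta> w f = lift.S.additive_eval q n (\<lambda>i. UnivPoly.eval ?A (series L) \<eta> w (up_ring.monom (UP ?A) (a i) 0))
        (UnivPoly.eval ?A (series L) \<eta> w (up_ring.monom (UP ?A) \<one>\<^bsub>?A\<^esub> 1))"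
      unfolding f_def using mc mX by (rule s.hom_additive_eval)
    also have "\<dots> = lift.S.additive_eval q n a' w"
      unfolding ES.eval_monom1[OF w]
      by (rule lift.S.additive_eval_cong) (use ES.eval_const[OF w] aA a'c w in \<open>auto simp: a'_def\<close>)
    finally show ?thesis .
  qed
  let ?W = "lift.S.additive_zeros q n a'"
  have bF: "b i \<in> carrier L" if "i < n" for i using specializes_in_F[OF \<tau> sp[OF that]] F_carrier by simp
  have cardb: "card (additive_zeros q n (\<lambda>i. a' i 0)) = q ^ n" "finite (additive_zeros q n (\<lambda>i. a' i 0))"
    using card_additive_zeros[OF prime_p' char_p' q_pow q_ge_2 n, of "\<lambda>i. a' i 0"] a'0 bF b0 n by auto
  have W: "finite ?W" "card ?W = q ^ n"
    using bij_betw_finite[OF lift.constant_term_bij] bij_betw_same_card[OF lift.constant_term_bij] cardb by auto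
  have inj: "\<And>x. x \<in> A \<Longrightarrow> \<eta> x = \<zero>\<^bsub>series L\<^esub> \<Longrightarrow> x = \<zero>" using expansion_injective[OF ex \<tau>] by blast
  have "\<exists>A' \<eta>'. subring A' L \<and> A \<subseteq> A' \<and> v \<in> A' \<and> \<eta>' \<in> ring_hom (L\<lparr>carrier := A'\<rparr>) (series L) \<and> (\<forall>x\<in>A. \<eta>' x = \<eta> x)"
  proof (rule hom_extend_by_algebraic_element[OF E(1) series_domain E(4) inj vL(1) f(1,2) evL W(1)])
    show "?W \<subseteq> carrier (series L)" by (auto simp: lift.S.additive_zeros_def)
    show "deg ?A f \<le> card ?W" using f W by simp
    show "UnivPoly.eval ?A (series L) \<eta> w f = \<zero>\<^bsub>series L\<^esub>" if "w \<in> ?W" for w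
      using that evS[of w] by (simp add: lift.S.additive_zeros_def)
  qed
  then obtain A' \<eta>' where A': "subring A' L" "A \<subseteq> A'" "v \<in> A'" "\<eta>' \<in> ring_hom (L\<lparr>carrier := A'\<rparr>) (series L)" "\<forall>x\<in>A. \<eta>' x = \<eta> x"
    by blast
  have "expansion \<tau> A' \<eta>'"
    unfolding expansion_def using A' E(2,3,5,6) by auto
  thus ?case using A' WA by blast
qed

end

section \<open>The Frobenius element of the Galois group\<close>

context rational_function_setup
begin

text \<open>The Frobenius map \<open>\<Phi>\<close> on coefficients of power series permutes the lifted roots, and acts on
  their constant terms, the roots of the specialized polynomial, as \<open>x \<mapsto> x\<^sup>q\<close>. Transported back along
  the expansion it becomes an element of the Galois group.\<close>

theorem frobenius_element:
  assumes \<tau>: "\<tau> \<in> F" and n: "n > 0" and sp: "\<And>i. i < n \<Longrightarrow> specializes \<tau> (a i) (b i)" and b0: "b 0 \<noteq> \<zero>"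
  shows "\<exists>\<rho> \<theta>. \<rho> \<in> carrier (galois_group K (additive_poly K q n a)) \<and>
    bij_betw \<theta> (additive_zeros q n a) (additive_zeros q n b) \<and>
    (\<forall>x\<in>additive_zeros q n a. \<forall>y\<in>additive_zeros q n a. \<theta> (x \<oplus> y) = \<theta> x \<oplus> \<theta> y) \<and>
    (\<forall>c\<in>F. \<forall>x\<in>additive_zeros q n a. \<theta> (c \<otimes> x) = c \<otimes> \<theta> x) \<and>
    (\<forall>x\<in>additive_zeros q n a. \<rho> x \<in> additive_zeros q n a \<and> \<theta> (\<rho> x) = \<theta> x [^] q)"
proof -
  define V where "V = additive_zeros q n a"
  have aK: "a i \<in> K" if "i < n" for i using specializes_in_K[OF sp[OF that]] .
  have KL: "K \<subseteq> carrier L" by (rule subfieldE(3)[OF subfield_axioms])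
  have aL: "a i \<in> carrier L" if "i < n" for i using aK[OF that] KL by auto
  have bF: "b i \<in> F" if "i < n" for i using specializes_in_F[OF \<tau> sp[OF that]] .
  have bL: "b i \<in> carrier L" if "i < n" for i using bF[OF that] F_carrier by simp
  obtain A0 \<eta>0 where ex0: "expansion \<tau> A0 \<eta>0" using expansion_exists[OF \<tau>] by blast
  have a0: "a 0 \<noteq> \<zero>"
  proof
    assume z: "a 0 = \<zero>"
    interpret \<eta>0: ring_hom_cring "L\<lparr>carrier := A0\<rparr>" "series L" \<eta>0 by (rule expansion_hom(1)[OF ex0])
    have "\<eta>0 (a 0) = \<zero>\<^bsub>series L\<^esub>" using \<eta>0.hom_zero z by simp
    hence "b 0 = \<zero>" using expansion_of_coefficients(2)[OF \<tau> ex0 sp[OF n]] by (simp add: series_zero)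
    thus False using b0 by simp
  qed
  have V: "card V = q ^ n" "finite V"
    using card_additive_zeros[OF prime_p' char_p' q_pow q_ge_2 n, of a] aL a0 by (auto simp: V_def)
  obtain A \<eta> where ex: "expansion \<tau> A \<eta>" and VA: "V \<subseteq> A"
    using expansion_of_roots[where a = a and b = b, OF \<tau> n sp b0 V(2)] V_def by blast
  note E = expansionD[OF ex]
  let ?A = "L\<lparr>carrier := A\<rparr>"
  interpret A: domain ?A by (rule subring_is_domain[OF E(1)])
  define a' where "a' i = \<eta> (a i)" for i
  have aA: "a i \<in> A" and a'0: "a' i 0 = b i" and a'q: "(\<lambda>m. a' i m [^] q) = a' i" if "i < n" for i
    using expansion_of_coefficients[OF \<tau> ex sp[OF that]] by (auto simp: a'_def)
  have a'c: "a' i \<in> carrier (series L)" if "i < n" for i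
    using ring_hom_closed[OF E(4), of "a i"] aA[OF that] by (simp add: a'_def)
  interpret lift: additive_lift L p q e n a'
    using a'c a'0[OF n] b0 q_pow q_ge_2 n by unfold_locales auto
  interpret idA: ring_hom_cring ?A L id by (rule expansion_hom(2)[OF ex])
  interpret \<eta>: ring_hom_cring ?A "series L" \<eta> by (rule expansion_hom(1)[OF ex])
  have inj0: "x = \<zero>" if "x \<in> A" "\<eta> x = \<zero>\<^bsub>series L\<^esub>" for x using expansion_injective[OF ex \<tau> that] .
  have inj: "x = y" if xy: "x \<in> A" "y \<in> A" "\<eta> x = \<eta> y" for x y
  proof -
    have d: "x \<ominus> y \<in> A" using subringE(5,7)[OF E(1)] xy by (auto simp: a_minus_def)
    have "\<eta> ((x \<ominus> y) \<oplus> y) = \<eta> (x \<ominus> y) \<oplus>\<^bsub>series L\<^esub> \<eta> y" using \<eta>.hom_add[of "x \<ominus> y" y] d xy by simp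
    moreover have "(x \<ominus> y) \<oplus> y = x" using E(7)[OF xy(1)] E(7)[OF xy(2)] by algebra
    ultimately have "\<eta> y = \<eta> y \<oplus>\<^bsub>series L\<^esub> \<eta> (x \<ominus> y)"
      using xy d \<eta>.hom_closed[of y] \<eta>.hom_closed[of "x \<ominus> y"] by (simp add: lift.S.a_comm)
    hence "\<eta> (x \<ominus> y) = \<zero>\<^bsub>series L\<^esub>"
      using lift.S.add_self_cancel[of "\<eta> y" "\<eta> (x \<ominus> y)"] xy d \<eta>.hom_closed[of y] \<eta>.hom_closed[of "x \<ominus> y"] by simp
    hence "x \<ominus> y = \<zero>" using inj0[OF d] by simp
    thus ?thesis using E(7) xy by simp
  qed
  define V' where "V' = lift.S.additive_zeros q n a'"
  have \<eta>V: "\<eta> v \<in> V'" if v: "v \<in> V" for v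
  proof -
    have vA: "v \<in> A" using VA v by auto
    have ae: "A.additive_eval q n a v = additive_eval q n a v"
      using idA.hom_additive_eval[of n a v q] aA vA by simp
    have "\<eta> (A.additive_eval q n a v) = lift.S.additive_eval q n a' (\<eta> v)"
      using \<eta>.hom_additive_eval[of n a v q] aA vA unfolding a'_def[abs_def] by simp
    moreover have "additive_eval q n a v = \<zero>" using v by (simp add: V_def additive_zeros_def)
    ultimately show ?thesis using ae \<eta>.hom_zero \<eta>.hom_closed[of v] vA by (simp add: V'_def lift.S.additive_zeros_def)
  qed
  have Zb: "additive_zeros q n (\<lambda>i. a' i 0) = additive_zeros q n b"
    by (rule additive_zeros_cong) (use a'0 bL in auto)
  have bijc: "bij_betw (\<lambda>y. y 0) V' (additive_zeros q n b)"
    using lift.constant_term_bij by (simp add: V'_def Zb)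
  have cb: "card (additive_zeros q n b) = q ^ n" "finite (additive_zeros q n b)"
    using card_additive_zeros[OF prime_p' char_p' q_pow q_ge_2 n, of b] bL b0 by auto
  have V'card: "card V' = q ^ n" "finite V'"
    using bij_betw_same_card[OF bijc] bij_betw_finite[OF bijc] cb by auto
  have inj_on_V: "inj_on \<eta> V" using inj VA by (auto simp: inj_on_def)
  \<comment> \<open>Although the images of the roots were chosen arbitrarily, \<eta> is injective
    from q^n roots into q^n lifted roots, so every lifted root is the expansion of a root.\<close>
  have img: "\<eta> ` V = V'"
    using card_subset_eq[OF V'card(2), of "\<eta> ` V"] \<eta>V card_image[OF inj_on_V] V V'card by auto
  define \<theta> where "\<theta> v = \<eta> v 0" for v
  have bij\<theta>: "bij_betw \<theta> V (additive_zeros q n b)"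
    using bij_betw_trans[of \<eta> V V' "\<lambda>y. y 0"] bijc inj_on_V img unfolding bij_betw_def \<theta>_def[abs_def] comp_def by simp
  have \<theta>_add: "\<theta> (x \<oplus> y) = \<theta> x \<oplus> \<theta> y" if "x \<in> V" "y \<in> V" for x y
    using \<eta>.hom_add[of x y] subsetD[OF VA that(1)] subsetD[OF VA that(2)] by (simp add: \<theta>_def series_add)
  have \<theta>_smult: "\<theta> (c \<otimes> x) = c \<otimes> \<theta> x" if "c \<in> F" "x \<in> V" for c x
  proof -
    have "\<eta> (c \<otimes> x) = series_const L c \<otimes>\<^bsub>series L\<^esub> \<eta> x"
      using \<eta>.hom_mult[of c x] E(2,5)[OF that(1)] subsetD[OF VA that(2)] by simp
    thus ?thesis using series_const_mult[of c "\<eta> x" 0] F_carrier[OF that(1)] \<eta>.hom_closed[of x] subsetD[OF VA that(2)]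
      by (simp add: \<theta>_def)
  qed
  define \<Phi> where "\<Phi> = (\<lambda>(f :: nat \<Rightarrow> 'k) m. f m [^] q)"
  interpret \<Phi>: ring_hom_cring "series L" "series L" \<Phi>
    unfolding \<Phi>_def by unfold_locales (rule series_map_hom, use frobenius_hom[of e] q_pow in simp)
  have \<Phi>V: "\<Phi> y \<in> V'" if "y \<in> V'" for y
  proof -
    have y: "y \<in> carrier (series L)" "lift.S.additive_eval q n a' y = \<zero>\<^bsub>series L\<^esub>"
      using that by (auto simp: V'_def lift.S.additive_zeros_def)
    have "\<Phi> (lift.S.additive_eval q n a' y) = lift.S.additive_eval q n (\<lambda>i. \<Phi> (a' i)) (\<Phi> y)"
      by (rule \<Phi>.hom_additive_eval) (use a'c y in auto)
    also have "\<dots> = lift.S.additive_eval q n a' (\<Phi> y)"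
    proof (rule lift.S.additive_eval_cong)
      show "\<Phi> (a' i) = a' i" "a' i \<in> carrier (series L)" if "i < n" for i
        using a'q[OF that] a'c[OF that] by (simp_all add: \<Phi>_def)
      show "\<Phi> y \<in> carrier (series L)" by (rule \<Phi>.hom_closed[OF y(1)])
    qed
    finally show ?thesis using y(2) \<Phi>.hom_closed[OF y(1)] by (simp add: V'_def lift.S.additive_zeros_def)
  qed
  \<comment> \<open>The image of A under \<eta> need not be stable under \<Phi>. B consists of the
    elements whose transformed expansion is again the expansion of an element of A; it is a ring
    that contains F, t and all roots, hence generators of the splitting field.\<close>
  define B where "B = {x \<in> A. \<exists>y\<in>A. \<eta> y = \<Phi> (\<eta> x)}"
  define \<rho>0 where "\<rho>0 x = (SOME y. y \<in> A \<and> \<eta> y = \<Phi> (\<eta> x))" for x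
  have \<rho>0: "\<rho>0 x \<in> A" "\<eta> (\<rho>0 x) = \<Phi> (\<eta> x)" if "x \<in> B" for x
    using that someI_ex[of "\<lambda>y. y \<in> A \<and> \<eta> y = \<Phi> (\<eta> x)"] by (auto simp: B_def \<rho>0_def)
  have \<rho>0_eq: "\<rho>0 x = y" if "x \<in> B" "y \<in> A" "\<eta> y = \<Phi> (\<eta> x)" for x y
    using inj \<rho>0[OF that(1)] that by simp
  have BA: "x \<in> A" if "x \<in> B" for x using that by (simp add: B_def)
  have ops: "x \<otimes> y \<in> B \<and> \<rho>0 (x \<otimes> y) = \<rho>0 x \<otimes> \<rho>0 y" "x \<oplus> y \<in> B \<and> \<rho>0 (x \<oplus> y) = \<rho>0 x \<oplus> \<rho>0 y" if "x \<in> B" "y \<in> B" for x y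
  proof -
    note r = \<rho>0[OF that(1)] \<rho>0[OF that(2)] BA[OF that(1)] BA[OF that(2)]
    have m: "x \<otimes> y \<in> A" "x \<oplus> y \<in> A" "\<rho>0 x \<otimes> \<rho>0 y \<in> A" "\<rho>0 x \<oplus> \<rho>0 y \<in> A"
      using subringE(6,7)[OF E(1)] r by auto
    have "\<eta> (\<rho>0 x \<otimes> \<rho>0 y) = \<Phi> (\<eta> (x \<otimes> y))"
      using \<eta>.hom_mult[of "\<rho>0 x" "\<rho>0 y"] \<eta>.hom_mult[of x y] \<eta>.hom_closed[of x] \<eta>.hom_closed[of y] r by simp
    thus "x \<otimes> y \<in> B \<and> \<rho>0 (x \<otimes> y) = \<rho>0 x \<otimes> \<rho>0 y" using \<rho>0_eq[of "x \<otimes> y"] m by (auto simp: B_def)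
    have "\<eta> (\<rho>0 x \<oplus> \<rho>0 y) = \<Phi> (\<eta> (x \<oplus> y))"
      using \<eta>.hom_add[of "\<rho>0 x" "\<rho>0 y"] \<eta>.hom_add[of x y] \<eta>.hom_closed[of x] \<eta>.hom_closed[of y] r by simp
    thus "x \<oplus> y \<in> B \<and> \<rho>0 (x \<oplus> y) = \<rho>0 x \<oplus> \<rho>0 y" using \<rho>0_eq[of "x \<oplus> y"] m by (auto simp: B_def)
  qed
  have \<Phi>c: "\<Phi> (series_const L c) = series_const L c" if "c \<in> F" for c
    using F_frobenius[OF that] q_ge_2 by (auto simp: \<Phi>_def series_const_def fun_eq_iff nat_pow_zero)
  have \<Phi>v: "\<Phi> (series_var L) = series_var L"
    using q_ge_2 by (auto simp: \<Phi>_def series_var_def fun_eq_iff nat_pow_zero)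
  have fixI: "x \<in> B \<and> \<rho>0 x = x" if "x \<in> A" "\<Phi> (\<eta> x) = \<eta> x" for x
    using that \<rho>0_eq[of x x] by (auto simp: B_def)
  have \<rho>F: "c \<in> B \<and> \<rho>0 c = c" if "c \<in> F" for c using fixI[of c] E(2,5) \<Phi>c that by simp
  have \<rho>u: "t \<ominus> \<tau> \<in> B \<and> \<rho>0 (t \<ominus> \<tau>) = t \<ominus> \<tau>" using fixI E(3,6) \<Phi>v by simp
  have \<rho>t: "t \<in> B \<and> \<rho>0 t = t"
  proof -
    have "(t \<ominus> \<tau>) \<oplus> \<tau> = t" using t_carrier F_carrier[OF \<tau>] by algebra
    thus ?thesis using ops(2)[of "t \<ominus> \<tau>" \<tau>] \<rho>u \<rho>F[OF \<tau>] by auto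
  qed
  have B: "subring B L"
  proof (rule subringI)
    show "B \<subseteq> carrier L" using BA E(7) by auto
    show "\<one> \<in> B" using \<rho>F F_ops by simp
    show "x \<otimes> y \<in> B" "x \<oplus> y \<in> B" if "x \<in> B" "y \<in> B" for x y using ops that by auto
    show "\<ominus> x \<in> B" if "x \<in> B" for x
    proof -
      have "\<ominus> \<one> \<otimes> x \<in> B" using ops(1)[of "\<ominus> \<one>" x] \<rho>F[of "\<ominus> \<one>"] F_ops that by auto
      thus ?thesis using E(7)[OF BA[OF that]] by (simp add: l_minus)
    qed
  qed
  have \<rho>hom: "\<rho>0 \<in> ring_hom (L\<lparr>carrier := B\<rparr>) L"
    by (rule ring_hom_memI) (use ops \<rho>0(1) E(7) \<rho>F F_ops in auto)
  \<comment> \<open>A nonzero coefficient has a nonzero q-th power. With the kernel trivial, the map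
    extends to quotients.\<close>
  have \<rho>inj: "x = \<zero>" if "x \<in> B" "\<rho>0 x = \<zero>" for x
  proof -
    have xc: "\<eta> x \<in> carrier (series L)" using \<eta>.hom_closed[of x] BA[OF that(1)] by simp
    have "\<Phi> (\<eta> x) = \<zero>\<^bsub>series L\<^esub>" using \<rho>0(2)[OF that(1)] that(2) \<eta>.hom_zero by simp
    hence "(\<eta> x) m [^] q = \<zero>" for m by (simp add: \<Phi>_def series_zero fun_eq_iff)
    moreover have "y = \<zero>" if "y \<in> carrier L" "y [^] (k::nat) = \<zero>" for y k
      using that by (induction k) (auto simp: integral_iff)
    ultimately have "(\<eta> x) m = \<zero>" for m using series_closed[OF xc] by blast
    hence "\<eta> x = \<zero>\<^bsub>series L\<^esub>" by (simp add: series_zero fun_eq_iff)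
    thus ?thesis using inj0 BA[OF that(1)] by simp
  qed
  have VB: "v \<in> B \<and> \<rho>0 v \<in> V \<and> \<theta> (\<rho>0 v) = \<theta> v [^] q" if v: "v \<in> V" for v
  proof -
    have "\<Phi> (\<eta> v) \<in> \<eta> ` V" using \<Phi>V[OF \<eta>V[OF v]] img by simp
    then obtain w where w: "w \<in> V" "\<eta> w = \<Phi> (\<eta> v)" by auto
    have vB: "v \<in> B" using w v VA by (auto simp: B_def)
    moreover have "\<rho>0 v = w" using \<rho>0_eq[OF vB, of w] w VA by auto
    ultimately show ?thesis using w by (simp add: \<theta>_def) (simp add: \<Phi>_def)
  qed
  let ?f = "additive_poly K q n a"
  define EE where "EE = splitting_field K ?f"
  have zs: "zero_set ?f = V" using zero_set_additive_poly[OF K_subring aK q_ge_2] by (simp add: V_def)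
  have VL: "V \<subseteq> carrier L" using VA E(7) by auto
  let ?H = "insert t F \<union> V"
  have HL: "?H \<subseteq> carrier L" using VL t_carrier F_carrier by auto
  have KVL: "K \<union> V \<subseteq> carrier L" using VL KL by auto
  \<comment> \<open>Generators inside B are required: K contains quotients, which need not lie in B,
    but it is generated by F and t.\<close>
  have EE: "EE = generate_field L ?H"
  proof (rule antisym)
    have sf: "subfield (generate_field L ?H) L" using generate_field_is_subfield[OF HL] .
    have "K \<subseteq> generate_field L ?H" unfolding generated
      by (rule generate_field_min_subfield1[OF _ sf]) (use t_carrier F_carrier in \<open>auto intro: generate_field.incl\<close>)
    thus "EE \<subseteq> generate_field L ?H" unfolding EE_def splitting_field_def zs
      by (intro generate_field_min_subfield1[OF KVL sf]) (auto intro: generate_field.incl)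
    show "generate_field L ?H \<subseteq> EE" unfolding EE_def splitting_field_def zs
      by (rule generate_field_min_subfield1[OF HL generate_field_is_subfield[OF KVL]])
        (use F_t_in_K in \<open>auto intro: generate_field.incl\<close>)
  qed
  have HB: "?H \<subseteq> B" using \<rho>F \<rho>t VB by auto
  obtain \<rho>1 where \<rho>1: "\<rho>1 \<in> ring_hom (L\<lparr>carrier := EE\<rparr>) L" "\<forall>x\<in>?H. \<rho>1 x = \<rho>0 x"
    using hom_extend_to_fractions[OF B \<rho>hom \<rho>inj EE HB] by blast
  have EEsub: "subfield EE L" unfolding EE by (rule generate_field_is_subfield[OF HL])
  have EEr: "subring EE L" by (rule subfieldE(1)[OF EEsub])
  have EEL: "x \<in> carrier L" if "x \<in> EE" for x using subfieldE(3)[OF EEsub] that by auto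
  have HE: "x \<in> EE" if "x \<in> ?H" for x unfolding EE using that by (rule generate_field.incl)
  have h1: "\<rho>1 \<one> = \<one>" "\<And>x y. x \<in> EE \<Longrightarrow> y \<in> EE \<Longrightarrow> \<rho>1 (x \<otimes> y) = \<rho>1 x \<otimes> \<rho>1 y"
    "\<And>x y. x \<in> EE \<Longrightarrow> y \<in> EE \<Longrightarrow> \<rho>1 (x \<oplus> y) = \<rho>1 x \<oplus> \<rho>1 y" "\<And>x. x \<in> EE \<Longrightarrow> \<rho>1 x \<in> carrier L"
    using ring_hom_one[OF \<rho>1(1)] ring_hom_mult[OF \<rho>1(1)] ring_hom_add[OF \<rho>1(1)] ring_hom_closed[OF \<rho>1(1)] by auto
  have h0: "\<rho>1 \<zero> = \<zero>"
  proof -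
    have z: "\<zero> \<in> EE" by (rule subringE(2)[OF EEr])
    have "\<rho>1 \<zero> = \<rho>1 \<zero> \<oplus> \<rho>1 \<zero>" using h1(3)[OF z z] by simp
    thus ?thesis by (rule add_self_cancel[OF h1(4)[OF z] h1(4)[OF z]])
  qed
  have hneg: "\<rho>1 (\<ominus> x) = \<ominus> \<rho>1 x" if "x \<in> EE" for x
  proof -
    have m: "\<ominus> x \<in> EE" by (rule subringE(5)[OF EEr that])
    have "\<rho>1 (\<ominus> x) \<oplus> \<rho>1 x = \<rho>1 (\<ominus> x \<oplus> x)" by (rule h1(3)[OF m that, symmetric])
    also have "\<dots> = \<zero>" unfolding l_neg[OF EEL[OF that]] by (rule h0)
    finally show ?thesis using minus_equality[OF _ h1(4)[OF that] h1(4)[OF m]] by simp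
  qed
  note hinv = subfield_hom_inv[OF EEsub \<rho>1(1)]
  have into: "\<rho>1 x \<in> EE" if "x \<in> EE" for x
    using that unfolding EE
  proof (induction rule: generate_field.induct)
    case one thus ?case using h1(1) generate_field.one by simp
  next
    case (incl h)
    have "\<rho>1 h \<in> ?H" using incl \<rho>1(2) \<rho>F \<rho>t VB by auto
    thus ?case by (rule generate_field.incl)
  next
    case (a_inv h) thus ?case using hneg[of h] EE generate_field.a_inv by metis
  next
    case (m_inv h)
    have "\<rho>1 (inv h) = inv (\<rho>1 h)" "\<rho>1 h \<noteq> \<zero>" using hinv[of h] m_inv EE by auto
    thus ?case using generate_field.m_inv[OF m_inv.IH] by simp
  next
    case (eng_add x y) thus ?case using h1(3)[of x y] EE generate_field.eng_add by metis
  next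
    case (eng_mult x y) thus ?case using h1(2)[of x y] EE generate_field.eng_mult by metis
  qed
  have inj_on_E: "inj_on \<rho>1 EE"
  proof (rule inj_onI)
    fix x y assume xy: "x \<in> EE" "y \<in> EE" "\<rho>1 x = \<rho>1 y"
    have d: "x \<oplus> \<ominus> y \<in> EE" using subringE(5,7)[OF EEr] xy by auto
    have "\<rho>1 (x \<oplus> \<ominus> y) = \<rho>1 y \<oplus> \<ominus> \<rho>1 y"
      unfolding h1(3)[OF xy(1) subringE(5)[OF EEr xy(2)]] hneg[OF xy(2)] xy(3) ..
    also have "\<dots> = \<zero>" by (rule r_neg[OF h1(4)[OF xy(2)]])
    finally have "\<rho>1 (x \<oplus> \<ominus> y) = \<zero>" .
    hence "x \<oplus> \<ominus> y = \<zero>" using hinv(1)[OF d] by blast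
    thus "x = y" using EEL xy by (simp add: a_minus_def[symmetric])
  qed
  \<comment> \<open>An injective self-map of the finite set of roots is onto. This is what makes the
    map surjective on the splitting field, whose other generators are fixed.\<close>
  have \<rho>V: "\<rho>1 ` V = V"
  proof (rule endo_inj_surj[OF V(2)])
    show "\<rho>1 ` V \<subseteq> V" using VB \<rho>1(2) by auto
    show "inj_on \<rho>1 V" using inj_on_E HE by (auto intro: inj_on_subset)
  qed
  have onto: "\<exists>y\<in>EE. \<rho>1 y = x" if "x \<in> EE" for x
    using that unfolding EE
  proof (induction rule: generate_field.induct)
    case one thus ?case using h1(1) generate_field.one by blast
  next
    case (incl h)
    show ?case
    proof (cases "h \<in> V")
      case True
      then obtain v where "v \<in> V" "\<rho>1 v = h" using \<rho>V by (metis imageE)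
      thus ?thesis by (intro bexI[of _ v]) (auto intro: generate_field.incl)
    next
      case False
      hence "\<rho>1 h = h" using incl \<rho>1(2) \<rho>F \<rho>t by auto
      thus ?thesis using generate_field.incl[OF incl] by blast
    qed
  next
    case (a_inv h)
    then obtain y where y: "y \<in> EE" "\<rho>1 y = h" using EE by auto
    thus ?case using hneg[OF y(1)] subringE(5)[OF EEr y(1)] EE by auto
  next
    case (m_inv h)
    then obtain y where y: "y \<in> EE" "\<rho>1 y = h" using EE by auto
    have y0: "y \<noteq> \<zero>" using y m_inv h0 by auto
    have "inv y \<in> EE" using subfield_m_inv(1)[OF EEsub, of y] y y0 by auto
    thus ?case using hinv(2)[OF y(1) y0] y EE by auto
  next
    case (eng_add x1 x2)
    then obtain y z where y: "y \<in> EE" "\<rho>1 y = x1" and z: "z \<in> EE" "\<rho>1 z = x2" using EE by auto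
    thus ?case using h1(3)[OF y(1) z(1)] subringE(7)[OF EEr y(1) z(1)] EE by auto
  next
    case (eng_mult x1 x2)
    then obtain y z where y: "y \<in> EE" "\<rho>1 y = x1" and z: "z \<in> EE" "\<rho>1 z = x2" using EE by auto
    thus ?case using h1(2)[OF y(1) z(1)] subringE(6)[OF EEr y(1) z(1)] EE by auto
  qed
  have KE: "x \<in> EE \<and> \<rho>1 x = x" if "x \<in> K" for x
    using that unfolding generated
  proof (induction rule: generate_field.induct)
    case one thus ?case using h1(1) subringE(3)[OF EEr] by simp
  next
    case (incl h) thus ?case using \<rho>1(2) \<rho>F \<rho>t HE by auto
  next
    case (a_inv h) thus ?case using hneg[of h] subringE(5)[OF EEr, of h] by simp
  next
    case (m_inv h) thus ?case using hinv(2)[of h] subfield_m_inv(1)[OF EEsub, of h] by simp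
  next
    case (eng_add x y) thus ?case using h1(3)[of x y] subringE(7)[OF EEr, of x y] by simp
  next
    case (eng_mult x y) thus ?case using h1(2)[of x y] subringE(6)[OF EEr, of x y] by simp
  qed
  \<comment> \<open>Elements of the Galois group are undefined outside the splitting field.\<close>
  define \<rho> where "\<rho> = restrict \<rho>1 EE"
  have "bij_betw \<rho> EE EE"
    unfolding \<rho>_def bij_betw_def using inj_on_E into onto by (auto simp: inj_on_def image_iff) metis
  moreover have "\<rho> \<in> ring_hom (L\<lparr>carrier := EE\<rparr>) (L\<lparr>carrier := EE\<rparr>)"
    by (rule ring_hom_memI) (use into h1 subringE(3,6,7)[OF EEr] in \<open>auto simp: \<rho>_def\<close>)
  moreover have "\<forall>x\<in>K. \<rho> x = x" using KE by (simp add: \<rho>_def)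
  ultimately have "\<rho> \<in> carrier (galois_group K ?f)"
    unfolding galois_group_def Let_def EE_def[symmetric] by (simp add: Bij_def \<rho>_def)
  moreover have "\<rho> x \<in> V \<and> \<theta> (\<rho> x) = \<theta> x [^] q" if "x \<in> V" for x
    using VB[OF that] \<rho>1(2) HE that by (simp add: \<rho>_def)
  ultimately show ?thesis using bij\<theta> \<theta>_add \<theta>_smult unfolding V_def[symmetric] by blast
qed

end

section \<open>Cyclic actions of the Frobenius map\<close>

text \<open>For s i = x^i this is the value at x of the monic polynomial of degree n with lower
  coefficients b i; for s i = x^(q^i) it is the value of the additive polynomial with the same
  coefficients. Multiplication by x in the first case corresponds to the Frobenius map in the
  second.\<close>

definition (in ring) linrec :: "nat \<Rightarrow> (nat \<Rightarrow> 'a) \<Rightarrow> (nat \<Rightarrow> 'a) \<Rightarrow> 'a" where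
  "linrec n b s = s n \<oplus> (\<Oplus>i\<in>{..<n}. b i \<otimes> s i)"

lemma (in ring) additive_eval_linrec: "additive_eval q n b x = linrec n b (\<lambda>i. x [^] (q ^ i))"
  by (simp add: additive_eval_def linrec_def)

section \<open>Linear recurrences and generators of finite fields\<close>

context rational_function_setup
begin

lemma F_frobenius_pow: "c \<in> F \<Longrightarrow> c [^] (q ^ i) = c"
proof (induction i)
  case (Suc i)
  have "c [^] (q ^ Suc i) = (c [^] (q ^ i)) [^] q" using F_carrier[OF Suc.prems] by (simp add: nat_pow_pow mult.commute)
  thus ?case using Suc F_frobenius by simp
qed (simp add: F_carrier)

lemma frobenius_q_add: "x \<in> carrier L \<Longrightarrow> y \<in> carrier L \<Longrightarrow> (x \<oplus> y) [^] (q ^ i) = x [^] (q ^ i) \<oplus> y [^] (q ^ i)"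
  unfolding q_pow power_mult[symmetric] by (rule frobenius_add)

text \<open>The graph of the linear correspondence that matches s1 i with s2 i. With equal sequences
  it expresses membership in a span, and it is a map once the s1 i are independent.\<close>

definition spanned :: "nat \<Rightarrow> (nat \<Rightarrow> 'k) \<Rightarrow> (nat \<Rightarrow> 'k) \<Rightarrow> 'k \<Rightarrow> 'k \<Rightarrow> bool" where
  "spanned m s1 s2 x z \<longleftrightarrow> (\<exists>c. (\<forall>i. c i \<in> F) \<and> x = (\<Oplus>i\<in>{..<m}. c i \<otimes> s1 i) \<and> z = (\<Oplus>i\<in>{..<m}. c i \<otimes> s2 i))"

lemma spanned_add:
  assumes s: "\<And>i. s1 i \<in> carrier L" "\<And>i. s2 i \<in> carrier L"
    and "spanned m s1 s2 x z" "spanned m s1 s2 x' z'"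
  shows "spanned m s1 s2 (x \<oplus> x') (z \<oplus> z')"
proof -
  obtain c c' where c: "\<And>i. c i \<in> F" "x = (\<Oplus>i\<in>{..<m}. c i \<otimes> s1 i)" "z = (\<Oplus>i\<in>{..<m}. c i \<otimes> s2 i)"
    and c': "\<And>i. c' i \<in> F" "x' = (\<Oplus>i\<in>{..<m}. c' i \<otimes> s1 i)" "z' = (\<Oplus>i\<in>{..<m}. c' i \<otimes> s2 i)"
    using assms(3,4) unfolding spanned_def by blast
  note cL = F_carrier[OF c(1)] F_carrier[OF c'(1)]
  have "(\<Oplus>i\<in>{..<m}. (c i \<oplus> c' i) \<otimes> s i) = (\<Oplus>i\<in>{..<m}. c i \<otimes> s i) \<oplus> (\<Oplus>i\<in>{..<m}. c' i \<otimes> s i)"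
    if "\<And>i. s i \<in> carrier L" for s
  proof -
    have "(\<Oplus>i\<in>{..<m}. (c i \<oplus> c' i) \<otimes> s i) = (\<Oplus>i\<in>{..<m}. c i \<otimes> s i \<oplus> c' i \<otimes> s i)"
      by (rule finsum_cong') (use cL that in \<open>auto simp: l_distr\<close>)
    also have "\<dots> = (\<Oplus>i\<in>{..<m}. c i \<otimes> s i) \<oplus> (\<Oplus>i\<in>{..<m}. c' i \<otimes> s i)"
      by (rule finsum_addf) (use cL that in auto)
    finally show ?thesis .
  qed
  from this[OF s(1)] this[OF s(2)] show ?thesis
    unfolding spanned_def using c c' F_ops(3) by (intro exI[of _ "\<lambda>i. c i \<oplus> c' i"]) auto
qed

lemma spanned_smult:
  assumes s: "\<And>i. s1 i \<in> carrier L" "\<And>i. s2 i \<in> carrier L"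
    and "spanned m s1 s2 x z" "d \<in> F"
  shows "spanned m s1 s2 (d \<otimes> x) (d \<otimes> z)"
proof -
  obtain c where c: "\<And>i. c i \<in> F" "x = (\<Oplus>i\<in>{..<m}. c i \<otimes> s1 i)" "z = (\<Oplus>i\<in>{..<m}. c i \<otimes> s2 i)"
    using assms(3) unfolding spanned_def by blast
  note cL = F_carrier[OF c(1)] F_carrier[OF assms(4)]
  have "(\<Oplus>i\<in>{..<m}. (d \<otimes> c i) \<otimes> s i) = d \<otimes> (\<Oplus>i\<in>{..<m}. c i \<otimes> s i)"
    if "\<And>i. s i \<in> carrier L" for s
    using cL that by (subst finsum_rdistr) (auto intro!: finsum_cong' simp: m_assoc)
  from this[OF s(1)] this[OF s(2)] show ?thesis
    unfolding spanned_def using c assms(4) F_ops(4) by (intro exI[of _ "\<lambda>i. d \<otimes> c i"]) auto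
qed

lemma spanned_basis:
  assumes s: "\<And>i. s1 i \<in> carrier L" "\<And>i. s2 i \<in> carrier L" and j: "j < m"
  shows "spanned m s1 s2 (s1 j) (s2 j)"
proof -
  have "(\<Oplus>i\<in>{..<m}. (if i = j then \<one> else \<zero>) \<otimes> s i) = s j" if "\<And>i. s i \<in> carrier L" for s
  proof -
    have "(\<Oplus>i\<in>{..<m}. (if i = j then \<one> else \<zero>) \<otimes> s i) = (\<Oplus>i\<in>{..<m}. if j = i then s i else \<zero>)"
      by (rule finsum_cong') (use that in auto)
    thus ?thesis using add.finprod_singleton[of j "{..<m}" s] j that by simp
  qed
  from this[OF s(1)] this[OF s(2)] show ?thesis
    unfolding spanned_def using F_ops by (intro exI[of _ "\<lambda>i. if i = j then \<one> else \<zero>"]) auto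
qed

lemma spanned_zero: "(\<And>i. s1 i \<in> carrier L) \<Longrightarrow> (\<And>i. s2 i \<in> carrier L) \<Longrightarrow> spanned m s1 s2 \<zero> \<zero>"
  unfolding spanned_def
  using F_ops by (intro exI[of _ "\<lambda>i. \<zero>"]) simp

lemma spanned_finsum:
  assumes s: "\<And>i. s1 i \<in> carrier L" "\<And>i. s2 i \<in> carrier L"
    and fg: "\<And>i. i \<in> I \<Longrightarrow> f i \<in> carrier L" "\<And>i. i \<in> I \<Longrightarrow> g i \<in> carrier L"
    and "\<And>i. i \<in> I \<Longrightarrow> spanned m s1 s2 (f i) (g i)"
  shows "spanned m s1 s2 (\<Oplus>i\<in>I. f i) (\<Oplus>i\<in>I. g i)"
  using assms(3-)
proof (induction I rule: infinite_finite_induct)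
  case (insert i I)
  have "(\<Oplus>i\<in>insert i I. f i) = f i \<oplus> (\<Oplus>i\<in>I. f i)" "(\<Oplus>i\<in>insert i I. g i) = g i \<oplus> (\<Oplus>i\<in>I. g i)"
    using insert by (auto intro!: finsum_insert)
  moreover have "spanned m s1 s2 (\<Oplus>i\<in>I. f i) (\<Oplus>i\<in>I. g i)" "spanned m s1 s2 (f i) (g i)"
    using insert by auto
  ultimately show ?case using spanned_add[OF s] by simp
qed (auto simp: spanned_zero[OF s])

text \<open>A and B are linear and advance the two sequences. If the m-th terms are expressed by the
  same coefficients, applying A and B to such an expression and replacing the m-th terms expresses
  the next pair of terms.\<close>

lemma spanned_orbit:
  assumes s: "\<And>i. s1 i \<in> carrier L" "\<And>i. s2 i \<in> carrier L"
    and A: "\<And>x. x \<in> carrier L \<Longrightarrow> A x \<in> carrier L" "\<And>x y. x \<in> carrier L \<Longrightarrow> y \<in> carrier L \<Longrightarrow> A (x \<oplus> y) = A x \<oplus> A y"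
      "\<And>c x. c \<in> F \<Longrightarrow> x \<in> carrier L \<Longrightarrow> A (c \<otimes> x) = c \<otimes> A x" "\<And>i. A (s1 i) = s1 (Suc i)"
    and B: "\<And>x. x \<in> carrier L \<Longrightarrow> B x \<in> carrier L" "\<And>x y. x \<in> carrier L \<Longrightarrow> y \<in> carrier L \<Longrightarrow> B (x \<oplus> y) = B x \<oplus> B y"
      "\<And>c x. c \<in> F \<Longrightarrow> x \<in> carrier L \<Longrightarrow> B (c \<otimes> x) = c \<otimes> B x" "\<And>i. B (s2 i) = s2 (Suc i)"
    and top: "spanned m s1 s2 (s1 m) (s2 m)"
  shows "spanned m s1 s2 (s1 j) (s2 j)"
proof (induction j)
  case 0
  show ?case using top spanned_basis[OF s, of 0 m] by (cases m) auto
next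
  case (Suc j)
  then obtain c where c: "\<And>i. c i \<in> F" "s1 j = (\<Oplus>i\<in>{..<m}. c i \<otimes> s1 i)" "s2 j = (\<Oplus>i\<in>{..<m}. c i \<otimes> s2 i)"
    unfolding spanned_def by blast
  have lin: "D (\<Oplus>i\<in>I. c i \<otimes> u i) = (\<Oplus>i\<in>I. c i \<otimes> u (Suc i))"
    if "finite I" "\<And>i. u i \<in> carrier L" "\<And>i. D (u i) = u (Suc i)"
      "\<And>x. x \<in> carrier L \<Longrightarrow> D x \<in> carrier L" "\<And>x y. x \<in> carrier L \<Longrightarrow> y \<in> carrier L \<Longrightarrow> D (x \<oplus> y) = D x \<oplus> D y"
      "\<And>c x. c \<in> F \<Longrightarrow> x \<in> carrier L \<Longrightarrow> D (c \<otimes> x) = c \<otimes> D x" for D u and I :: "nat set"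
    using that(1)
  proof (induction I rule: finite_induct)
    case empty
    have "D (\<zero> \<otimes> \<zero>) = \<zero> \<otimes> D \<zero>" by (rule that(6)) (auto simp: F_ops)
    thus ?case using that(4)[of "\<zero>"] by simp
  next
    case (insert i I)
    have cl: "\<And>i. c i \<otimes> u i \<in> carrier L" "\<And>i. c i \<otimes> u (Suc i) \<in> carrier L" using F_carrier[OF c(1)] that(2) by auto
    have "(\<Oplus>i\<in>insert i I. c i \<otimes> u i) = c i \<otimes> u i \<oplus> (\<Oplus>i\<in>I. c i \<otimes> u i)"
      "(\<Oplus>i\<in>insert i I. c i \<otimes> u (Suc i)) = c i \<otimes> u (Suc i) \<oplus> (\<Oplus>i\<in>I. c i \<otimes> u (Suc i))"
      using insert cl by (auto intro!: finsum_insert)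
    thus ?case using insert cl that(5)[OF cl(1) finsum_closed, of "\<lambda>i. c i \<otimes> u i" I i] that(6)[OF c(1) that(2)] that(3) by simp
  qed
  have top': "spanned m s1 s2 (s1 (Suc i)) (s2 (Suc i))" if "i < m" for i
    using top spanned_basis[OF s, of "Suc i" m] that by (cases "Suc i = m") auto
  have "spanned m s1 s2 (\<Oplus>i\<in>{..<m}. c i \<otimes> s1 (Suc i)) (\<Oplus>i\<in>{..<m}. c i \<otimes> s2 (Suc i))"
    using s F_carrier[OF c(1)] by (intro spanned_finsum spanned_smult top' c(1)) auto
  moreover have "A (s1 j) = (\<Oplus>i\<in>{..<m}. c i \<otimes> s1 (Suc i))"
    unfolding c(2) by (rule lin[of "{..<m}" s1 A]) (fact finite_lessThan s A)+
  moreover have "B (s2 j) = (\<Oplus>i\<in>{..<m}. c i \<otimes> s2 (Suc i))"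
    unfolding c(3) by (rule lin[of "{..<m}" s2 B]) (fact finite_lessThan s B)+
  ultimately show ?case using A(4) B(4) by simp
qed

lemma card_spanned:
  assumes s: "\<And>i. s i \<in> carrier L"
  shows "finite {x. \<exists>z. spanned m s s' x z}" "card {x. \<exists>z. spanned m s s' x z} \<le> q ^ m"
proof -
  let ?f = "\<lambda>c. (\<Oplus>i\<in>{..<m}. c i \<otimes> s i)"
  have fin: "finite ({..<m} \<rightarrow>\<^sub>E F)" using card_constants by (intro finite_PiE) auto
  have sub: "{x. \<exists>z. spanned m s s' x z} \<subseteq> ?f ` ({..<m} \<rightarrow>\<^sub>E F)"
  proof
    fix x assume "x \<in> {x. \<exists>z. spanned m s s' x z}"
    then obtain c where c: "\<And>i. c i \<in> F" "x = ?f c" unfolding spanned_def by blast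
    have "x = ?f (restrict c {..<m})" unfolding c(2)
      by (rule finsum_cong') (use s F_carrier[OF c(1)] in auto)
    thus "x \<in> ?f ` ({..<m} \<rightarrow>\<^sub>E F)" using c(1) by (intro image_eqI[of _ _ "restrict c {..<m}"]) auto
  qed
  show "finite {x. \<exists>z. spanned m s s' x z}" using finite_subset[OF sub] fin by blast
  have "card {x. \<exists>z. spanned m s s' x z} \<le> card (?f ` ({..<m} \<rightarrow>\<^sub>E F))" by (rule card_mono) (use sub fin in auto)
  also have "\<dots> \<le> card ({..<m} \<rightarrow>\<^sub>E F)" by (rule card_image_le[OF fin])
  also have "\<dots> = q ^ m" using card_constants by (simp add: card_PiE)
  finally show "card {x. \<exists>z. spanned m s s' x z} \<le> q ^ m" .
qed

text \<open>A generator of the multiplicative group of the field with q^n elements inside L,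
  described by its powers alone.\<close>

definition primitive :: "nat \<Rightarrow> 'k \<Rightarrow> bool" where
  "primitive n \<alpha> \<longleftrightarrow> \<alpha> \<in> carrier L \<and> \<alpha> [^] (q ^ n - 1) = \<one> \<and> inj_on (\<lambda>j::nat. \<alpha> [^] j) {..<q ^ n - 1}"

lemma primitive_nonzero:
  assumes "primitive n \<alpha>" "n > 0" shows "\<alpha> \<noteq> \<zero>"
proof
  assume "\<alpha> = \<zero>"
  moreover have "q ^ n - 1 > 0" using q_ge_2 assms(2) self_le_power[of q n] by simp
  ultimately show False using assms(1) by (simp add: primitive_def nat_pow_zero)
qed

lemma mult_by_linear:
  assumes "\<alpha> \<in> carrier L"
  shows "x \<in> carrier L \<Longrightarrow> \<alpha> \<otimes> x \<in> carrier L" "x \<in> carrier L \<Longrightarrow> y \<in> carrier L \<Longrightarrow> \<alpha> \<otimes> (x \<oplus> y) = \<alpha> \<otimes> x \<oplus> \<alpha> \<otimes> y"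
    "c \<in> F \<Longrightarrow> x \<in> carrier L \<Longrightarrow> \<alpha> \<otimes> (c \<otimes> x) = c \<otimes> (\<alpha> \<otimes> x)" "\<alpha> \<otimes> \<alpha> [^] i = \<alpha> [^] Suc i"
  using assms F_carrier by (auto simp: r_distr m_lcomm m_comm)

text \<open>If \<open>\<alpha>\<^sup>m\<close> were a combination of lower powers with \<open>m < n\<close>, all \<open>q\<^sup>n - 1\<close> powers of \<open>\<alpha>\<close> and zero
  would lie in a space with at most \<open>q\<^sup>m\<close> elements.\<close>

lemma primitive_not_spanned:
  assumes \<alpha>: "primitive n \<alpha>" and n: "n > 0" and m: "m < n"
  shows "\<not> spanned m (\<lambda>i. \<alpha> [^] i) (\<lambda>i. \<alpha> [^] i) (\<alpha> [^] m) (\<alpha> [^] m)"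
proof
  assume top: "spanned m (\<lambda>i. \<alpha> [^] i) (\<lambda>i. \<alpha> [^] i) (\<alpha> [^] m) (\<alpha> [^] m)"
  have \<alpha>L: "\<alpha> \<in> carrier L" using \<alpha> by (simp add: primitive_def)
  let ?S = "{x. \<exists>z. spanned m (\<lambda>i. \<alpha> [^] i) (\<lambda>i. \<alpha> [^] i) x z}"
  have all: "spanned m (\<lambda>i. \<alpha> [^] i) (\<lambda>i. \<alpha> [^] i) (\<alpha> [^] j) (\<alpha> [^] j)" for j :: nat
    by (rule spanned_orbit[where A = "\<lambda>x. \<alpha> \<otimes> x" and B = "\<lambda>x. \<alpha> \<otimes> x"])
      (use mult_by_linear[OF \<alpha>L] \<alpha>L top in auto)
  have sub: "insert \<zero> ((\<lambda>j::nat. \<alpha> [^] j) ` {..<q ^ n - 1}) \<subseteq> ?S"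
    using all spanned_zero[of "\<lambda>i. \<alpha> [^] i" "\<lambda>i. \<alpha> [^] i" m] \<alpha>L by auto
  have "\<alpha> [^] j \<noteq> \<zero>" for j :: nat using primitive_nonzero[OF \<alpha> n] \<alpha>L by (induction j) (auto simp: integral_iff)
  hence "\<zero> \<notin> (\<lambda>j::nat. \<alpha> [^] j) ` {..<q ^ n - 1}" by (metis imageE)
  hence "card (insert \<zero> ((\<lambda>j::nat. \<alpha> [^] j) ` {..<q ^ n - 1})) = Suc (q ^ n - 1)"
    using \<alpha> by (simp add: primitive_def card_image)
  also have "\<dots> = q ^ n" using q_ge_2 by simp
  finally have "q ^ n \<le> card ?S" using card_mono[OF card_spanned(1) sub] \<alpha>L by simp
  also have "\<dots> \<le> q ^ m" using card_spanned(2)[of "\<lambda>i. \<alpha> [^] i" m] \<alpha>L by simp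
  also have "\<dots> < q ^ n" using m q_ge_2 by (intro power_strict_increasing) auto
  finally show False by simp
qed

text \<open>Dividing a relation by its last nonzero coefficient would express a power of index below
  n by the lower powers.\<close>

lemma primitive_independent:
  assumes \<alpha>: "primitive n \<alpha>" and n: "n > 0" and c: "\<And>i. c i \<in> F" and 0: "(\<Oplus>i\<in>{..<n}. c i \<otimes> \<alpha> [^] i) = \<zero>"
  shows "\<forall>i<n. c i = \<zero>"
proof (rule ccontr)
  assume "\<not> ?thesis"
  then obtain k where k: "k < n" "c k \<noteq> \<zero>" by auto
  define m where "m = Max {j. j < n \<and> c j \<noteq> \<zero>}"
  have fin: "finite {j. j < n \<and> c j \<noteq> \<zero>}" by simp
  have m: "m < n" "c m \<noteq> \<zero>" using Max_in[OF fin] k unfolding m_def by blast+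
  have top: "c j = \<zero>" if "m < j" "j < n" for j using Max_ge[OF fin, of j] that by (fastforce simp: m_def)
  have \<alpha>L: "\<alpha> \<in> carrier L" using \<alpha> by (simp add: primitive_def)
  note cL = F_carrier[OF c]
  have "(\<Oplus>i\<in>{..<n}. c i \<otimes> \<alpha> [^] i) = (\<Oplus>i\<in>{..<Suc m}. c i \<otimes> \<alpha> [^] i)"
    using m(1) cL \<alpha>L top by (intro add.finprod_mono_neutral_cong_left[symmetric]) auto
  also have "\<dots> = c m \<otimes> \<alpha> [^] m \<oplus> (\<Oplus>i\<in>{..<m}. c i \<otimes> \<alpha> [^] i)"
    unfolding lessThan_Suc using cL \<alpha>L by (subst finsum_insert) auto
  finally have e: "c m \<otimes> \<alpha> [^] m \<oplus> (\<Oplus>i\<in>{..<m}. c i \<otimes> \<alpha> [^] i) = \<zero>" using 0 by simp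
  define s where "s = (\<Oplus>i\<in>{..<m}. c i \<otimes> \<alpha> [^] i)"
  have sL: "s \<in> carrier L" unfolding s_def using cL \<alpha>L by (intro finsum_closed) auto
  have i: "inv (c m) \<in> F" "inv (c m) \<otimes> c m = \<one>" using subfield_m_inv[OF constants, of "c m"] c m by auto
  have "\<alpha> [^] m = (\<ominus> (inv (c m))) \<otimes> s"
  proof -
    have "\<alpha> [^] m = (inv (c m) \<otimes> c m) \<otimes> \<alpha> [^] m" using i \<alpha>L by simp
    also have "\<dots> = inv (c m) \<otimes> (c m \<otimes> \<alpha> [^] m \<oplus> s) \<oplus> (\<ominus> (inv (c m))) \<otimes> s"
    proof -
      have "x \<in> carrier L \<Longrightarrow> y \<in> carrier L \<Longrightarrow> w \<in> carrier L \<Longrightarrow>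
         (x \<otimes> y) \<otimes> w = x \<otimes> (y \<otimes> w \<oplus> s) \<oplus> (\<ominus> x) \<otimes> s" for x y w using sL by algebra
      thus ?thesis using F_carrier[OF i(1)] cL \<alpha>L by simp
    qed
    also have "\<dots> = (\<ominus> (inv (c m))) \<otimes> s" unfolding e[folded s_def] using F_carrier[OF i(1)] sL by simp
    finally show ?thesis .
  qed
  moreover have "spanned m (\<lambda>i. \<alpha> [^] i) (\<lambda>i. \<alpha> [^] i) s s" unfolding spanned_def s_def using c by blast
  hence "spanned m (\<lambda>i. \<alpha> [^] i) (\<lambda>i. \<alpha> [^] i) ((\<ominus> (inv (c m))) \<otimes> s) ((\<ominus> (inv (c m))) \<otimes> s)"
    using \<alpha>L i F_ops(5) by (intro spanned_smult) auto
  ultimately show False using primitive_not_spanned[OF \<alpha> n m(1)] by simp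
qed

definition finite_subfield :: "nat \<Rightarrow> 'k set" where
  "finite_subfield n = {x \<in> carrier L. x [^] (q ^ n) = x}"

text \<open>These are the roots of X^(q^n) - X, an additive polynomial with linear coefficient -1,
  so the general root count applies.\<close>

lemma card_finite_subfield: "n > 0 \<Longrightarrow> finite (finite_subfield n) \<and> card (finite_subfield n) = q ^ n"
proof -
  assume n: "n > 0"
  let ?b = "\<lambda>i::nat. if i = 0 then \<ominus> \<one> else \<zero>"
  have ev: "additive_eval q n ?b x = x [^] (q ^ n) \<ominus> x" if x: "x \<in> carrier L" for x
  proof -
    have "(\<Oplus>i\<in>{..<n}. ?b i \<otimes> x [^] (q ^ i)) = (\<Oplus>i\<in>{..<n}. if 0 = i then \<ominus> x else \<zero>)"
      by (rule finsum_cong') (use x in \<open>auto simp: l_minus\<close>)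
    also have "\<dots> = \<ominus> x" using add.finprod_singleton[of 0 "{..<n}" "\<lambda>_. \<ominus> x"] n x by simp
    finally show ?thesis by (simp add: additive_eval_def a_minus_def)
  qed
  have "additive_zeros q n ?b = finite_subfield n"
    unfolding additive_zeros_def finite_subfield_def by (auto simp: ev)
  moreover have "?b 0 \<noteq> \<zero>" by (simp add: add.inv_eq_1_iff)
  ultimately show ?thesis using card_additive_zeros[OF prime_p' char_p' q_pow q_ge_2 n, of ?b] by auto
qed

lemma primitive_in_finite_subfield:
  assumes "primitive n \<alpha>" "n > 0"
  shows "\<alpha> [^] (q ^ n) = \<alpha>"
proof -
  have "\<alpha> [^] Suc (q ^ n - 1) = \<alpha> [^] (q ^ n - 1) \<otimes> \<alpha>" by simp
  thus ?thesis using assms q_ge_2 by (simp add: primitive_def)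
qed

text \<open>Independence gives q^n distinct combinations of the first n powers, and they lie in a
  set of q^n elements.\<close>

lemma finite_subfield_spanned:
  assumes \<alpha>: "primitive n \<alpha>" and n: "n > 0"
  shows "{x. \<exists>z. spanned n (\<lambda>i. \<alpha> [^] i) s' x z} = finite_subfield n"
proof (rule card_subset_eq)
  have \<alpha>L: "\<alpha> \<in> carrier L" using \<alpha> by (simp add: primitive_def)
  let ?f = "\<lambda>c. (\<Oplus>i\<in>{..<n}. c i \<otimes> \<alpha> [^] i)"
  let ?S = "{x. \<exists>z. spanned n (\<lambda>i. \<alpha> [^] i) s' x z}"
  have S: "?S = ?f ` (UNIV \<rightarrow> F)" unfolding spanned_def image_def by (auto simp: Pi_iff) blast
  show "finite (finite_subfield n)" using card_finite_subfield[OF n] by simp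
  show "?S \<subseteq> finite_subfield n"
  proof
    fix x assume "x \<in> ?S"
    then obtain c where "c \<in> UNIV \<rightarrow> F" "x = ?f c" unfolding S by auto
    hence c: "\<And>i. c i \<in> F" "x = ?f c" by auto
    have ap: "\<alpha> [^] i \<in> finite_subfield n" for i :: nat
      using primitive_in_finite_subfield[OF \<alpha> n] \<alpha>L
      by (simp add: finite_subfield_def) (metis nat_pow_pow mult.commute)
    interpret h: ring_hom_cring L L "\<lambda>x. x [^] (q ^ n)"
      by unfold_locales (use frobenius_hom[of "e * n"] in \<open>simp add: q_pow power_mult\<close>)
    have "x [^] (q ^ n) = (\<Oplus>i\<in>{..<n}. (c i \<otimes> \<alpha> [^] i) [^] (q ^ n))"
      unfolding c(2) using h.hom_finsum[of "\<lambda>i. c i \<otimes> \<alpha> [^] i" "{..<n}"] F_carrier[OF c(1)] \<alpha>L by (simp add: comp_def)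
    also have "\<dots> = x" unfolding c(2)
      by (rule finsum_cong') (use F_carrier[OF c(1)] \<alpha>L F_frobenius_pow[OF c(1)] ap in \<open>auto simp: nat_pow_distrib finite_subfield_def\<close>)
    finally show "x \<in> finite_subfield n"
      using F_carrier[OF c(1)] \<alpha>L c(2) by (simp add: finite_subfield_def)
  qed
  have inj: "inj_on ?f ({..<n} \<rightarrow>\<^sub>E F)"
  proof (rule inj_onI)
    fix c d assume c: "c \<in> {..<n} \<rightarrow>\<^sub>E F" and d: "d \<in> {..<n} \<rightarrow>\<^sub>E F" and eq: "?f c = ?f d"
    define g where "g i = (if i < n then c i \<ominus> d i else \<zero>)" for i
    have cF: "c i \<in> F" "d i \<in> F" if "i < n" for i using c d that by auto
    have gF: "g i \<in> F" for i using cF[of i] F_ops by (auto simp: g_def a_minus_def)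
    have cl: "?f c \<in> carrier L" using cF F_carrier \<alpha>L by (intro finsum_closed) auto
    have "?f c = (\<Oplus>i\<in>{..<n}. d i \<otimes> \<alpha> [^] i \<oplus> g i \<otimes> \<alpha> [^] i)"
    proof (rule finsum_cong')
      fix i assume "i \<in> {..<n}"
      hence "c i \<in> carrier L" "d i \<in> carrier L" "\<alpha> [^] i \<in> carrier L" "g i = c i \<ominus> d i"
        using cF F_carrier \<alpha>L by (auto simp: g_def)
      thus "c i \<otimes> \<alpha> [^] i = d i \<otimes> \<alpha> [^] i \<oplus> g i \<otimes> \<alpha> [^] i" by simp algebra
    qed (use cF F_carrier gF \<alpha>L in auto)
    also have "\<dots> = ?f d \<oplus> ?f g" by (rule finsum_addf) (use cF F_carrier gF \<alpha>L in auto)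
    finally have "?f c = ?f c \<oplus> ?f g" using eq by simp
    moreover have "?f g \<in> carrier L" using gF F_carrier \<alpha>L by (intro finsum_closed) auto
    ultimately have "?f g = \<zero>" using add_self_cancel cl by blast
    from primitive_independent[OF \<alpha> n gF this] have g0: "g i = \<zero>" if "i < n" for i using that by simp
    have "c i = d i" if i: "i < n" for i
      using g0[OF i] F_carrier[OF cF(1)[OF i]] F_carrier[OF cF(2)[OF i]] i by (simp add: g_def)
    thus "c = d" using c d by (intro PiE_ext) auto
  qed
  have "q ^ n = card ({..<n} \<rightarrow>\<^sub>E F)" using card_constants by (simp add: card_PiE)
  also have "\<dots> = card (?f ` ({..<n} \<rightarrow>\<^sub>E F))" using card_image[OF inj] by simp
  also have "\<dots> \<le> card ?S"
  proof (rule card_mono)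
    show "finite ?S" by (rule card_spanned(1)) (use \<alpha>L in auto)
    show "?f ` ({..<n} \<rightarrow>\<^sub>E F) \<subseteq> ?S"
    proof
      fix x assume "x \<in> ?f ` ({..<n} \<rightarrow>\<^sub>E F)"
      then obtain c where c: "c \<in> {..<n} \<rightarrow>\<^sub>E F" "x = ?f c" by auto
      have "x = ?f (\<lambda>i. if i < n then c i else \<zero>)" unfolding c(2)
        by (rule finsum_cong') (use PiE_mem[OF c(1)] F_carrier \<alpha>L in auto)
      moreover have "(\<lambda>i. if i < n then c i else \<zero>) \<in> UNIV \<rightarrow> F" using c(1) F_ops by auto
      ultimately show "x \<in> ?S" unfolding S by (rule image_eqI)
    qed
  qed
  finally show "card ?S = card (finite_subfield n)"
    using card_spanned(2)[of "\<lambda>i. \<alpha> [^] i" n s'] \<alpha>L card_finite_subfield[OF n] by simp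
qed

end

section \<open>The two cyclic actions of the Frobenius map\<close>

context rational_function_setup
begin

lemma linrec_closed: "(\<And>i. i < n \<Longrightarrow> b i \<in> carrier L) \<Longrightarrow> (\<And>i. s i \<in> carrier L) \<Longrightarrow> linrec n b s \<in> carrier L"
  unfolding linrec_def by (intro a_closed finsum_closed) auto

lemma linrec_cong: "(\<And>i. i < n \<Longrightarrow> b i = c i) \<Longrightarrow> (\<And>i. i < n \<Longrightarrow> c i \<in> carrier L) \<Longrightarrow> (\<And>i. i \<le> n \<Longrightarrow> s i = s' i)
    \<Longrightarrow> (\<And>i. s' i \<in> carrier L) \<Longrightarrow> linrec n b s = linrec n c s'"
proof -
  assume a: "\<And>i. i < n \<Longrightarrow> b i = c i" "\<And>i. i < n \<Longrightarrow> c i \<in> carrier L" "\<And>i. i \<le> n \<Longrightarrow> s i = s' i" "\<And>i. s' i \<in> carrier L"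
  have "(\<Oplus>i\<in>{..<n}. b i \<otimes> s i) = (\<Oplus>i\<in>{..<n}. c i \<otimes> s' i)"
    by (rule finsum_cong') (use a in auto)
  thus ?thesis using a(3)[of n] by (simp add: linrec_def)
qed

text \<open>The n-th power is a combination of the first n powers. If the constant coefficient were
  zero, division by \<alpha> would express the power n - 1 by lower ones.\<close>

lemma primitive_minimal_polynomial:
  assumes \<alpha>: "primitive n \<alpha>" and n: "n > 0"
  shows "\<exists>b. (\<forall>i. b i \<in> F) \<and> linrec n b (\<lambda>i. \<alpha> [^] i) = \<zero> \<and> b 0 \<noteq> \<zero>"
proof -
  have \<alpha>L: "\<alpha> \<in> carrier L" using \<alpha> by (simp add: primitive_def)
  have \<alpha>0: "\<alpha> \<noteq> \<zero>" using primitive_nonzero[OF \<alpha> n] .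
  have "\<alpha> [^] n \<in> finite_subfield n"
    using primitive_in_finite_subfield[OF \<alpha> n] \<alpha>L
    by (simp add: finite_subfield_def) (metis nat_pow_pow mult.commute)
  then obtain c where c: "\<And>i. c i \<in> F" "\<alpha> [^] n = (\<Oplus>i\<in>{..<n}. c i \<otimes> \<alpha> [^] i)"
    unfolding finite_subfield_spanned[OF \<alpha> n, of "\<lambda>i. \<zero>", symmetric] spanned_def by blast
  note cL = F_carrier[OF c(1)]
  have 0: "linrec n (\<lambda>i. \<ominus> c i) (\<lambda>i. \<alpha> [^] i) = \<zero>"
  proof -
    have "(\<Oplus>i\<in>{..<n}. c i \<otimes> \<alpha> [^] i) \<oplus> (\<Oplus>i\<in>{..<n}. (\<ominus> c i) \<otimes> \<alpha> [^] i) = (\<Oplus>i\<in>{..<n}. c i \<otimes> \<alpha> [^] i \<oplus> (\<ominus> c i) \<otimes> \<alpha> [^] i)"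
      by (rule finsum_addf[symmetric]) (use cL \<alpha>L in auto)
    also have "\<dots> = (\<Oplus>i\<in>{..<n}. \<zero>)"
      by (rule finsum_cong') (use cL \<alpha>L in \<open>auto simp: l_minus r_neg\<close>)
    finally show ?thesis by (simp add: linrec_def c(2))
  qed
  have "c 0 \<noteq> \<zero>"
  proof
    assume c0: "c 0 = \<zero>"
    obtain m where m: "n = Suc m" using n by (cases n) auto
    have "\<alpha> [^] n = (\<Oplus>i\<in>{..<m}. c (Suc i) \<otimes> \<alpha> [^] Suc i)"
    proof (cases m)
      case 0
      thus ?thesis using c(2) m c0 by (simp add: lessThan_Suc)
    next
      case (Suc k)
      have "\<alpha> [^] n = (\<Oplus>i\<in>{..Suc k}. c i \<otimes> \<alpha> [^] i)" using c(2) m Suc by (simp add: lessThan_Suc_atMost)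
      also have "\<dots> = (\<Oplus>i\<in>{..k}. c (Suc i) \<otimes> \<alpha> [^] Suc i) \<oplus> c 0 \<otimes> \<alpha> [^] (0::nat)"
        by (rule finsum_Suc2) (use cL \<alpha>L in auto)
      also have "\<dots> = (\<Oplus>i\<in>{..k}. c (Suc i) \<otimes> \<alpha> [^] Suc i)" using c0 cL \<alpha>L by simp
      finally show ?thesis using Suc by (simp add: lessThan_Suc_atMost)
    qed
    also have "\<dots> = (\<Oplus>i\<in>{..<m}. \<alpha> \<otimes> (c (Suc i) \<otimes> \<alpha> [^] i))"
      by (rule finsum_cong') (use cL \<alpha>L in \<open>auto simp: m_ac\<close>)
    also have "\<dots> = \<alpha> \<otimes> (\<Oplus>i\<in>{..<m}. c (Suc i) \<otimes> \<alpha> [^] i)"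
      by (rule finsum_rdistr[symmetric]) (use cL \<alpha>L in auto)
    finally have "\<alpha> \<otimes> \<alpha> [^] m = \<alpha> \<otimes> (\<Oplus>i\<in>{..<m}. c (Suc i) \<otimes> \<alpha> [^] i)" using m \<alpha>L by (simp add: m_comm)
    moreover have "(\<Oplus>i\<in>{..<m}. c (Suc i) \<otimes> \<alpha> [^] i) \<in> carrier L" using cL \<alpha>L by (intro finsum_closed) auto
    ultimately have e: "\<alpha> [^] m = (\<Oplus>i\<in>{..<m}. c (Suc i) \<otimes> \<alpha> [^] i)" using \<alpha>L \<alpha>0 by (simp add: m_lcancel)
    have "spanned m (\<lambda>i. \<alpha> [^] i) (\<lambda>i. \<alpha> [^] i) (\<alpha> [^] m) (\<alpha> [^] m)"
      unfolding spanned_def using e c(1) by (intro exI[of _ "\<lambda>i. c (Suc i)"]) auto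
    moreover have "m < n" using m by simp
    ultimately show False using primitive_not_spanned[OF \<alpha> n] by blast
  qed
  hence "\<ominus> c 0 \<noteq> \<zero>" using cL by (simp add: add.inv_eq_1_iff)
  thus ?thesis using 0 c(1) F_ops(5) by (intro exI[of _ "\<lambda>i. \<ominus> c i"]) auto
qed

lemma pow_q_pow: "x \<in> carrier L \<Longrightarrow> (x [^] (q ^ i)) [^] (q ^ j) = x [^] (q ^ (i + j))"
  by (simp add: nat_pow_pow power_add)

text \<open>The map \<open>\<alpha>\<^sup>j \<mapsto> y\<^bsup>q^j\<^esup>\<close> is well defined and linear on the field with \<open>q\<^sup>n\<close> elements, and
  injective because a nonzero kernel element would be a power of \<open>\<alpha>\<close>.\<close>

theorem singer_cycle:
  assumes \<alpha>: "primitive n \<alpha>" and n: "n > 0" and b: "\<And>i. i < n \<Longrightarrow> b i \<in> F" "b 0 \<noteq> \<zero>"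
    and rel: "linrec n b (\<lambda>i. \<alpha> [^] i) = \<zero>"
    and x: "x \<in> additive_zeros q n b - {\<zero>}" and y: "y \<in> additive_zeros q n b - {\<zero>}"
  shows "\<exists>j. x [^] (q ^ j) = y"
proof -
  have \<alpha>L: "\<alpha> \<in> carrier L" using \<alpha> by (simp add: primitive_def)
  have \<alpha>n0: "\<alpha> [^] j \<noteq> \<zero>" for j :: nat using primitive_nonzero[OF \<alpha> n] \<alpha>L by (induction j) (auto simp: integral_iff)
  have bL: "i < n \<Longrightarrow> b i \<in> carrier L" for i using b(1) F_carrier by simp
  have xL: "x \<in> carrier L" and x0: "x \<noteq> \<zero>" and xr: "linrec n b (\<lambda>i. x [^] (q ^ i)) = \<zero>"
    using x by (auto simp: additive_zeros_def additive_eval_linrec)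
  define s1 where "s1 i = \<alpha> [^] (i::nat)" for i
  define s2 where "s2 i = x [^] (q ^ i)" for i
  have s: "\<And>i. s1 i \<in> carrier L" "\<And>i. s2 i \<in> carrier L" using \<alpha>L xL by (auto simp: s1_def s2_def)
  define b' where "b' i = (if i < n then \<ominus> b i else \<zero>)" for i
  have b'F: "b' i \<in> F" for i using b(1) F_ops by (auto simp: b'_def)
  have top1: "s n = (\<Oplus>i\<in>{..<n}. b' i \<otimes> s i)" if "linrec n b s = \<zero>" "\<And>i. s i \<in> carrier L" for s
  proof -
    have c: "(\<Oplus>i\<in>{..<n}. b i \<otimes> s i) \<in> carrier L" using bL that(2) by (intro finsum_closed) auto
    have "(\<Oplus>i\<in>{..<n}. b i \<otimes> s i) \<oplus> (\<Oplus>i\<in>{..<n}. b' i \<otimes> s i) = (\<Oplus>i\<in>{..<n}. b i \<otimes> s i \<oplus> b' i \<otimes> s i)"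
      by (rule finsum_addf[symmetric]) (use bL that(2) F_carrier[OF b'F] in auto)
    also have "\<dots> = (\<Oplus>i\<in>{..<n}. \<zero>)"
      by (rule finsum_cong') (use bL that(2) in \<open>auto simp: b'_def l_minus r_neg\<close>)
    finally have "(\<Oplus>i\<in>{..<n}. b i \<otimes> s i) \<oplus> (\<Oplus>i\<in>{..<n}. b' i \<otimes> s i) = \<zero>" by simp
    moreover have "(\<Oplus>i\<in>{..<n}. b' i \<otimes> s i) \<in> carrier L" using F_carrier[OF b'F] that(2) by (intro finsum_closed) auto
    moreover have "s n \<oplus> (\<Oplus>i\<in>{..<n}. b i \<otimes> s i) = \<zero>" using that(1) by (simp add: linrec_def)
    ultimately have "\<ominus> (\<Oplus>i\<in>{..<n}. b i \<otimes> s i) = (\<Oplus>i\<in>{..<n}. b' i \<otimes> s i)" "\<ominus> (\<Oplus>i\<in>{..<n}. b i \<otimes> s i) = s n"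
      using c that(2)[of n] minus_equality[of "s n" "(\<Oplus>i\<in>{..<n}. b i \<otimes> s i)"]
        minus_equality[of "(\<Oplus>i\<in>{..<n}. b' i \<otimes> s i)" "(\<Oplus>i\<in>{..<n}. b i \<otimes> s i)"] by (auto simp: a_comm)
    thus ?thesis by simp
  qed
  have top: "spanned n s1 s2 (s1 n) (s2 n)"
    unfolding spanned_def using top1[of s1] top1[of s2] rel xr s b'F
    by (intro exI[of _ b']) (auto simp: s1_def[abs_def] s2_def[abs_def])
  have orbit: "spanned n s1 s2 (s1 j) (s2 j)" for j
  proof (rule spanned_orbit[where A = "\<lambda>x. \<alpha> \<otimes> x" and B = "\<lambda>x. x [^] q"])
    show "(x \<oplus> y) [^] q = x [^] q \<oplus> y [^] q" if "x \<in> carrier L" "y \<in> carrier L" for x y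
      using frobenius_q_add[OF that, of 1] by simp
    show "(c \<otimes> x) [^] q = c \<otimes> x [^] q" if "c \<in> F" "x \<in> carrier L" for c x
      using F_frobenius[OF that(1)] F_carrier[OF that(1)] that(2) by (simp add: nat_pow_distrib)
    show "s2 i [^] q = s2 (Suc i)" for i using pow_q_pow[OF xL, of i 1] by (simp add: s2_def)
    show "\<alpha> \<otimes> s1 i = s1 (Suc i)" for i using mult_by_linear(4)[OF \<alpha>L] by (simp add: s1_def)
    show "\<alpha> \<otimes> (u \<oplus> v) = \<alpha> \<otimes> u \<oplus> \<alpha> \<otimes> v" if "u \<in> carrier L" "v \<in> carrier L" for u v using mult_by_linear(2)[OF \<alpha>L that] .
    show "\<alpha> \<otimes> (c \<otimes> u) = c \<otimes> (\<alpha> \<otimes> u)" if "c \<in> F" "u \<in> carrier L" for c u using mult_by_linear(3)[OF \<alpha>L that] .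
  qed (use s \<alpha>L top in auto)
  \<comment> \<open>Independence of the powers of \<alpha> turns the correspondence into a
    map.\<close>
  have zero: "z = \<zero>" if sp: "spanned n s1 s2 \<zero> z" for z
  proof -
    obtain c where c: "\<And>i. c i \<in> F" "\<zero> = (\<Oplus>i\<in>{..<n}. c i \<otimes> s1 i)" "z = (\<Oplus>i\<in>{..<n}. c i \<otimes> s2 i)"
      using sp unfolding spanned_def by blast
    have "(\<Oplus>i\<in>{..<n}. c i \<otimes> \<alpha> [^] i) = \<zero>" using c(2) unfolding s1_def by simp
    from primitive_independent[OF \<alpha> n c(1) this] have "\<forall>i<n. c i = \<zero>" .
    hence "z = (\<Oplus>i\<in>{..<n}. \<zero>)" unfolding c(3) by (intro finsum_cong') (use s in auto)
    thus ?thesis by simp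
  qed
  have s2L: "spanned n s1 s2 u z \<Longrightarrow> u \<in> carrier L \<and> z \<in> carrier L" for u z
    unfolding spanned_def using s F_carrier by (auto intro!: finsum_closed)
  have diff: "spanned n s1 s2 (u \<ominus> u') (z \<ominus> z')" if "spanned n s1 s2 u z" "spanned n s1 s2 u' z'" for u z u' z'
  proof -
    have "spanned n s1 s2 (\<ominus> \<one> \<otimes> u') (\<ominus> \<one> \<otimes> z')" using spanned_smult[OF s that(2)] F_ops by simp
    from spanned_add[OF s that(1) this] show ?thesis using s2L[OF that(2)] by (simp add: a_minus_def l_minus)
  qed
  have fn: "z = z'" if "spanned n s1 s2 u z" "spanned n s1 s2 u z'" for u z z'
  proof -
    have "z \<ominus> z' = \<zero>" using zero diff[OF that] s2L[OF that(1)] by (simp add: a_minus_def r_neg)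
    thus ?thesis using s2L[OF that(1)] s2L[OF that(2)] by simp
  qed
  let ?N = "q ^ n - 1"
  have powers: "\<exists>l. u = s1 l" if u: "u \<in> finite_subfield n" "u \<noteq> \<zero>" for u
  proof -
    have sub: "s1 ` {..<?N} \<subseteq> finite_subfield n - {\<zero>}"
      using primitive_in_finite_subfield[OF \<alpha> n] \<alpha>L \<alpha>n0
      by (auto simp: finite_subfield_def s1_def) (metis nat_pow_pow mult.commute)
    have "\<zero> \<in> finite_subfield n" using q_ge_2 by (simp add: finite_subfield_def nat_pow_zero)
    hence "card (finite_subfield n - {\<zero>}) = ?N" using card_finite_subfield[OF n] by simp
    moreover have "card (s1 ` {..<?N}) = ?N" using \<alpha> by (simp add: primitive_def card_image s1_def[abs_def])
    ultimately have "s1 ` {..<?N} = finite_subfield n - {\<zero>}"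
      using card_finite_subfield[OF n] by (intro card_subset_eq[OF _ sub]) auto
    thus ?thesis using u by auto
  qed
  have inj: "inj_on s2 {..<?N}"
  proof (rule inj_onI)
    fix i j assume ij: "i \<in> {..<?N}" "j \<in> {..<?N}" "s2 i = s2 j"
    show "i = j"
    proof (rule ccontr)
      assume "i \<noteq> j"
      hence "s1 i \<noteq> s1 j" using \<alpha> ij by (auto simp: primitive_def inj_on_def s1_def)
      hence d0: "s1 i \<ominus> s1 j \<noteq> \<zero>" using s by simp
      have d: "spanned n s1 s2 (s1 i \<ominus> s1 j) \<zero>"
        using diff[OF orbit[of i] orbit[of j]] ij(3) s by (simp add: a_minus_def r_neg)
      hence "s1 i \<ominus> s1 j \<in> finite_subfield n"
        unfolding finite_subfield_spanned[OF \<alpha> n, of s2, symmetric] s1_def[abs_def] by blast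
      then obtain l where l: "s1 i \<ominus> s1 j = s1 l" using powers d0 by blast
      have "s2 l = \<zero>" using fn[OF orbit[of l]] d l by simp
      moreover have "u [^] (k::nat) = \<zero> \<Longrightarrow> u = \<zero>" if "u \<in> carrier L" for u k
        using that by (induction k) (auto simp: integral_iff)
      ultimately show False using x0 xL by (auto simp: s2_def)
    qed
  qed
  let ?Z = "additive_zeros q n b"
  have Z: "card ?Z = q ^ n" "finite ?Z"
    using card_additive_zeros[OF prime_p' char_p' q_pow q_ge_2 n, of b] bL b(2) by auto
  have zZ: "\<zero> \<in> ?Z" by (rule additive_zeros_zero) (use bL q_ge_2 in auto)
  have s2Z: "s2 i \<in> ?Z - {\<zero>}" for i
  proof -
    interpret h: ring_hom_cring L L "\<lambda>x. x [^] (q ^ i)"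
      by unfold_locales (use frobenius_hom[of "e * i"] in \<open>simp add: q_pow power_mult\<close>)
    have "additive_eval q n b x [^] (q ^ i) = additive_eval q n (\<lambda>j. b j [^] (q ^ i)) (x [^] (q ^ i))"
      by (rule h.hom_additive_eval) (use bL xL in auto)
    also have "\<dots> = additive_eval q n b (x [^] (q ^ i))"
      by (rule additive_eval_cong) (use F_frobenius_pow[OF b(1)] bL xL in auto)
    finally have "additive_eval q n b (s2 i) = \<zero>"
      using xr h.hom_zero by (simp add: s2_def additive_eval_linrec)
    moreover have "u [^] (k::nat) = \<zero> \<Longrightarrow> u = \<zero>" if "u \<in> carrier L" for u k
      using that by (induction k) (auto simp: integral_iff)
    hence "s2 i \<noteq> \<zero>" using x0 xL by (auto simp: s2_def)
    ultimately show ?thesis using s by (simp add: additive_zeros_def)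
  qed
  \<comment> \<open>The orbit of x has q^n - 1 distinct elements, as many as there are nonzero
    roots.\<close>
  have "s2 ` {..<?N} = ?Z - {\<zero>}"
  proof (rule card_subset_eq)
    show "finite (?Z - {\<zero>})" using Z by simp
    show "s2 ` {..<?N} \<subseteq> ?Z - {\<zero>}" using s2Z by auto
    show "card (s2 ` {..<?N}) = card (?Z - {\<zero>})" using card_image[OF inj] Z zZ by simp
  qed
  then obtain j where "y = s2 j" using y by auto
  thus ?thesis by (auto simp: s2_def)
qed

text \<open>With \<open>c\<close> the minimal polynomial of \<open>\<gamma>\<close>, the next polynomial is \<open>(X - 1) c(X)\<close>; scaling its roots
  by \<open>\<lambda>\<close> gives the coefficients of a Frobenius map with an eigenvector and a complementary cycle.\<close>

definition times_X_minus_1 :: "nat \<Rightarrow> (nat \<Rightarrow> 'k) \<Rightarrow> nat \<Rightarrow> 'k" where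
  "times_X_minus_1 m c i = (if i = 0 then \<zero> else c (i - 1)) \<ominus> (if i = m then \<one> else c i)"

lemma linrec_times_X_minus_1:
  assumes c: "\<And>i. c i \<in> carrier L" and s: "\<And>i. s i \<in> carrier L"
  shows "linrec (Suc m) (times_X_minus_1 m c) s = linrec m c (\<lambda>i. s (Suc i)) \<ominus> linrec m c s"
proof -
  have f1: "(\<Oplus>i\<in>{..<Suc m}. (if i = 0 then \<zero> else c (i - 1)) \<otimes> s i) = (\<Oplus>i\<in>{..<m}. c i \<otimes> s (Suc i))"
  proof (cases m)
    case 0 thus ?thesis using s by (simp add: lessThan_Suc)
  next
    case (Suc k)
    have "(\<Oplus>i\<in>{..Suc k}. (if i = 0 then \<zero> else c (i - 1)) \<otimes> s i) =
      (\<Oplus>i\<in>{..k}. (if Suc i = 0 then \<zero> else c (Suc i - 1)) \<otimes> s (Suc i)) \<oplus> (if (0::nat) = 0 then \<zero> else c (0 - 1)) \<otimes> s 0"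
      by (rule finsum_Suc2) (use c s in auto)
    also have "\<dots> = (\<Oplus>i\<in>{..k}. c i \<otimes> s (Suc i))" using c s by (simp add: Pi_def finsum_closed)
    finally show ?thesis using Suc by (simp add: lessThan_Suc_atMost)
  qed
  have f2: "(\<Oplus>i\<in>{..<Suc m}. (if i = m then \<one> else c i) \<otimes> s i) = s m \<oplus> (\<Oplus>i\<in>{..<m}. c i \<otimes> s i)"
  proof -
    have "(\<Oplus>i\<in>{..<Suc m}. (if i = m then \<one> else c i) \<otimes> s i) =
        (if m = m then \<one> else c m) \<otimes> s m \<oplus> (\<Oplus>i\<in>{..<m}. (if i = m then \<one> else c i) \<otimes> s i)"
      unfolding lessThan_Suc by (rule finsum_insert) (use c s in auto)
    also have "(\<Oplus>i\<in>{..<m}. (if i = m then \<one> else c i) \<otimes> s i) = (\<Oplus>i\<in>{..<m}. c i \<otimes> s i)"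
      by (rule finsum_cong') (use c s in auto)
    finally show ?thesis using s by simp
  qed
  have d: "(\<Oplus>i\<in>{..<Suc m}. (if i = 0 then \<zero> else c (i - 1)) \<otimes> s i) =
    (\<Oplus>i\<in>{..<Suc m}. times_X_minus_1 m c i \<otimes> s i) \<oplus> (\<Oplus>i\<in>{..<Suc m}. (if i = m then \<one> else c i) \<otimes> s i)"
  proof -
    have tc: "times_X_minus_1 m c i \<in> carrier L" for i using c by (simp add: times_X_minus_1_def)
    have "(\<Oplus>i\<in>{..<Suc m}. times_X_minus_1 m c i \<otimes> s i) \<oplus> (\<Oplus>i\<in>{..<Suc m}. (if i = m then \<one> else c i) \<otimes> s i)
      = (\<Oplus>i\<in>{..<Suc m}. times_X_minus_1 m c i \<otimes> s i \<oplus> (if i = m then \<one> else c i) \<otimes> s i)"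
      by (rule finsum_addf[symmetric]) (use tc c s in auto)
    also have "\<dots> = (\<Oplus>i\<in>{..<Suc m}. (if i = 0 then \<zero> else c (i - 1)) \<otimes> s i)"
    proof (rule finsum_cong')
      fix i
      have "u \<in> carrier L \<Longrightarrow> v \<in> carrier L \<Longrightarrow> (u \<ominus> v) \<otimes> s i \<oplus> v \<otimes> s i = u \<otimes> s i" for u v
        using s[of i] by algebra
      thus "times_X_minus_1 m c i \<otimes> s i \<oplus> (if i = m then \<one> else c i) \<otimes> s i = (if i = 0 then \<zero> else c (i - 1)) \<otimes> s i"
        unfolding times_X_minus_1_def using c by simp
    qed (use c s in auto)
    finally show ?thesis by simp
  qed
  have car: "(\<Oplus>i\<in>{..<Suc m}. times_X_minus_1 m c i \<otimes> s i) \<in> carrier L" "(\<Oplus>i\<in>{..<m}. c i \<otimes> s i) \<in> carrier L"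
    using c s by (auto simp: times_X_minus_1_def intro!: finsum_closed)
  have "u \<in> carrier L \<Longrightarrow> v \<in> carrier L \<Longrightarrow> w \<in> carrier L \<Longrightarrow> y \<in> carrier L \<Longrightarrow>
     u \<oplus> v = (u \<oplus> (v \<oplus> (w \<oplus> y))) \<ominus> (w \<oplus> y)" for u v w y by algebra
  from this[OF s[of "Suc m"] car(1) s[of m] car(2)] show ?thesis
    unfolding linrec_def using d[unfolded f1 f2] by simp
qed

text \<open>The coefficients l^(n-i) b i belong to the polynomial whose roots are those of the
  original multiplied by l. The further factor k serves the additive case.\<close>

lemma linrec_scale:
  assumes b: "\<And>i. b i \<in> carrier L" and s: "\<And>i. s i \<in> carrier L" and l: "l \<in> carrier L" and k: "k \<in> carrier L"
  shows "linrec n (\<lambda>i. l [^] (n - i) \<otimes> b i) (\<lambda>i. k \<otimes> (l [^] i \<otimes> s i)) = k \<otimes> (l [^] n \<otimes> linrec n b s)"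
proof -
  have "(\<Oplus>i\<in>{..<n}. (l [^] (n - i) \<otimes> b i) \<otimes> (k \<otimes> (l [^] i \<otimes> s i))) = (\<Oplus>i\<in>{..<n}. (k \<otimes> l [^] n) \<otimes> (b i \<otimes> s i))"
  proof (rule finsum_cong')
    fix i assume "i \<in> {..<n}"
    hence "l [^] (n - i) \<otimes> l [^] i = l [^] n" using nat_pow_mult[OF l, of "n - i" i] by simp
    moreover have "u \<in> carrier L \<Longrightarrow> v \<in> carrier L \<Longrightarrow> (u \<otimes> b i) \<otimes> (k \<otimes> (v \<otimes> s i)) = (k \<otimes> (u \<otimes> v)) \<otimes> (b i \<otimes> s i)" for u v
      using b[of i] s[of i] k by algebra
    ultimately show "(l [^] (n - i) \<otimes> b i) \<otimes> (k \<otimes> (l [^] i \<otimes> s i)) = (k \<otimes> l [^] n) \<otimes> (b i \<otimes> s i)"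
      using l by (metis nat_pow_closed)
  qed (use b s l k in auto)
  also have "\<dots> = (k \<otimes> l [^] n) \<otimes> (\<Oplus>i\<in>{..<n}. b i \<otimes> s i)"
    by (rule finsum_rdistr[symmetric]) (use b s l k in auto)
  finally show ?thesis
    unfolding linrec_def using b s l k by (simp add: r_distr m_assoc finsum_closed Pi_def)
qed

text \<open>For lam = 1 the polynomial is (X - 1) c(X), and its additive companion takes x to y^q -
  y, where y is the value of the additive polynomial of c at x. It vanishes on F and on the roots H
  of the latter. Multiplication by k with k^q = lam k carries this case to general lam.\<close>

theorem singer_cycle_with_eigenvector:
  assumes \<gamma>: "primitive m \<gamma>" and m: "m > 0" and lam: "lam \<in> F" "lam \<noteq> \<zero>" and q3: "q > 2"
  shows "\<exists>b. (\<forall>i. b i \<in> F) \<and> b 0 \<noteq> \<zero> \<and> linrec (Suc m) b (\<lambda>i. lam [^] i) = \<zero> \<and> linrec (Suc m) b (\<lambda>i. (lam \<otimes> \<gamma>) [^] i) = \<zero> \<and>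
    (\<exists>k H. k \<in> carrier L \<and> k \<noteq> \<zero> \<and> k [^] q = lam \<otimes> k \<and> H \<subseteq> carrier L \<and>
      (\<forall>x\<in>H. \<forall>y\<in>H. x \<oplus> y \<in> H) \<and> (\<forall>c\<in>F. \<forall>x\<in>H. c \<otimes> x \<in> H) \<and> F \<inter> H = {\<zero>} \<and> H \<noteq> {\<zero>} \<and>
      additive_zeros q (Suc m) b = {k \<otimes> (c \<oplus> h) |c h. c \<in> F \<and> h \<in> H} \<and>
      (\<forall>x\<in>H - {\<zero>}. \<forall>y\<in>H - {\<zero>}. \<exists>j. x [^] (q ^ j) = y))"
proof -
  have \<gamma>L: "\<gamma> \<in> carrier L" using \<gamma> by (simp add: primitive_def)
  obtain c where c: "\<And>i. c i \<in> F" "linrec m c (\<lambda>i. \<gamma> [^] i) = \<zero>" "c 0 \<noteq> \<zero>"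
    using primitive_minimal_polynomial[OF \<gamma> m] by blast
  note cL = F_carrier[OF c(1)]
  note lamL = F_carrier[OF lam(1)]
  let ?n = "Suc m"
  define e' where "e' = times_X_minus_1 m c"
  have e'F: "e' i \<in> F" for i using c(1) F_ops by (simp add: e'_def times_X_minus_1_def a_minus_def)
  have e'L: "e' i \<in> carrier L" for i using F_carrier[OF e'F] .
  have e0: "e' 0 \<noteq> \<zero>" using m c(3) cL by (simp add: e'_def times_X_minus_1_def a_minus_def add.inv_eq_1_iff)
  define b where "b i = lam [^] (?n - i) \<otimes> e' i" for i
  have lampF: "lam [^] i \<in> F" for i :: nat using pow_in_subring[OF F_subring lam(1)] .
  have lamp0: "lam [^] i \<noteq> \<zero>" for i :: nat using lam lamL by (induction i) (auto simp: integral_iff)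
  have bF: "b i \<in> F" for i using lampF e'F F_ops(4) by (simp add: b_def)
  have bL: "b i \<in> carrier L" for i using F_carrier[OF bF] .
  have b0: "b 0 \<noteq> \<zero>" using e0 lamp0[of "?n"] lamL e'L by (simp only: b_def) (simp add: integral_iff)
  have recb: "linrec ?n b (\<lambda>i. k \<otimes> (lam [^] i \<otimes> s i)) = k \<otimes> (lam [^] ?n \<otimes> linrec ?n e' s)"
    if "k \<in> carrier L" "\<And>i. s i \<in> carrier L" for k s
    unfolding b_def[abs_def] by (rule linrec_scale) (use e'L that lamL in auto)
  have rece: "linrec ?n e' s = linrec m c (\<lambda>i. s (Suc i)) \<ominus> linrec m c s" if "\<And>i. s i \<in> carrier L" for s
    unfolding e'_def by (rule linrec_times_X_minus_1[OF cL that])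
  have root1: "linrec ?n b (\<lambda>i. lam [^] i) = \<zero>"
  proof -
    have "linrec ?n b (\<lambda>i. \<one> \<otimes> (lam [^] i \<otimes> \<one>)) = \<zero>"
      using recb[of "\<one>" "\<lambda>i. \<one>"] rece[of "\<lambda>i. \<one>"] linrec_closed[of m c "\<lambda>i. \<one>"] cL lamL by (simp add: a_minus_def r_neg)
    thus ?thesis using lamL by simp
  qed
  have root2: "linrec ?n b (\<lambda>i. (lam \<otimes> \<gamma>) [^] i) = \<zero>"
  proof -
    have "linrec m c (\<lambda>i. \<gamma> [^] Suc i) = \<gamma> \<otimes> linrec m c (\<lambda>i. \<gamma> [^] i)"
    proof -
      have "linrec m (\<lambda>i. \<one> [^] (m - i) \<otimes> c i) (\<lambda>i. \<gamma> \<otimes> (\<one> [^] i \<otimes> \<gamma> [^] i)) = \<gamma> \<otimes> (\<one> [^] m \<otimes> linrec m c (\<lambda>i. \<gamma> [^] i))"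
        by (rule linrec_scale) (use cL \<gamma>L in auto)
      thus ?thesis using cL \<gamma>L linrec_closed[of m c "\<lambda>i. \<gamma> [^] i"] by (simp add: m_comm)
    qed
    hence "linrec ?n e' (\<lambda>i. \<gamma> [^] i) = \<zero>" using rece[of "\<lambda>i. \<gamma> [^] i"] c(2) \<gamma>L by (simp add: a_minus_def)
    hence "linrec ?n b (\<lambda>i. \<one> \<otimes> (lam [^] i \<otimes> \<gamma> [^] i)) = \<zero>"
      using recb[of "\<one>" "\<lambda>i. \<gamma> [^] i"] \<gamma>L lamL by simp
    thus ?thesis using lamL \<gamma>L by (simp add: nat_pow_distrib)
  qed
  define H where "H = additive_zeros q m c"
  have HL: "H \<subseteq> carrier L" by (auto simp: H_def additive_zeros_def)
  have Hadd: "x \<oplus> y \<in> H" if "x \<in> H" "y \<in> H" for x y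
    using additive_zeros_add[of m c q e x y] cL q_pow that by (auto simp: H_def)
  have Hsmult: "d \<otimes> x \<in> H" if "d \<in> F" "x \<in> H" for d x
    using additive_zeros_smult[of m c d q x] cL F_carrier F_frobenius that by (auto simp: H_def)
  have Hz: "\<zero> \<in> H" unfolding H_def by (rule additive_zeros_zero) (use cL q_ge_2 in auto)
  have Hc: "card H = q ^ m" "finite H"
    using card_additive_zeros[OF prime_p' char_p' q_pow q_ge_2 m, of c] cL c(3) by (auto simp: H_def)
  have Hcyc: "\<exists>j. x [^] (q ^ j) = y" if "x \<in> H - {\<zero>}" "y \<in> H - {\<zero>}" for x y
    using singer_cycle[OF \<gamma> m, of c x y] c that by (auto simp: H_def)
  have qm: "q ^ m \<ge> q" using m q_ge_2 self_le_power[of q m] by simp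
  have Hne: "H \<noteq> {\<zero>}" using Hc qm q3 by auto
  \<comment> \<open>The Frobenius map fixes F pointwise but is transitive on the nonzero elements of
    H. A common nonzero element would leave H with at most two elements, which q > 2
    excludes.\<close>
  have FH: "F \<inter> H = {\<zero>}"
  proof -
    have False if x: "x \<in> F" "x \<in> H" "x \<noteq> \<zero>" for x
    proof -
      have "H \<subseteq> {\<zero>, x}"
      proof
        fix y assume y: "y \<in> H"
        show "y \<in> {\<zero>, x}"
        proof (cases "y = \<zero>")
          case False
          then obtain j where "x [^] (q ^ j) = y" using Hcyc[of x y] x y by blast
          thus ?thesis using F_frobenius_pow[OF x(1), of j] by simp
        qed simp
      qed
      hence "card H \<le> card {\<zero>, x}" by (intro card_mono) auto
      also have "\<dots> \<le> 2" by (simp add: card_insert_if)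
      finally show False using Hc qm q3 by simp
    qed
    thus ?thesis using Hz F_ops by auto
  qed
  \<comment> \<open>A nonzero root of the additive polynomial X^q - lam X.\<close>
  obtain k where k: "k \<in> carrier L" "k \<noteq> \<zero>" "k [^] q = lam \<otimes> k"
  proof -
    let ?Z = "additive_zeros q 1 (\<lambda>_. \<ominus> lam)"
    have "card ?Z = q ^ 1" "finite ?Z"
      using card_additive_zeros[OF prime_p' char_p' q_pow q_ge_2, of 1 "\<lambda>_. \<ominus> lam"] lamL lam by (auto simp: add.inv_eq_1_iff)
    hence "\<not> ?Z \<subseteq> {\<zero>}" using q_ge_2 card_mono[of "{\<zero>}" ?Z] by auto
    then obtain k where "k \<in> ?Z" "k \<noteq> \<zero>" by auto
    hence k: "k \<in> carrier L" "k \<noteq> \<zero>" "k [^] q \<oplus> (\<ominus> lam) \<otimes> k = \<zero>"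
      using lamL by (auto simp: additive_zeros_def additive_eval_def lessThan_Suc)
    have "u \<in> carrier L \<Longrightarrow> u = (u \<oplus> (\<ominus> lam) \<otimes> k) \<oplus> lam \<otimes> k" for u using k(1) lamL by algebra
    from this[of "k [^] q"] k lamL have "k [^] q = lam \<otimes> k" by simp
    thus ?thesis using that k by blast
  qed
  have kq: "k [^] (q ^ i) = lam [^] i \<otimes> k" for i
  proof (induction i)
    case (Suc i)
    have "k [^] (q ^ Suc i) = (k [^] (q ^ i)) [^] q" using pow_q_pow[OF k(1), of i 1] by simp
    also have "\<dots> = lam [^] i \<otimes> (lam \<otimes> k)"
      using Suc k lamL F_frobenius[OF lampF] by (simp add: nat_pow_distrib)
    finally show ?case using lamL k by (simp add: m_assoc)
  qed (use k in simp)
  have ek: "additive_eval q ?n b (k \<otimes> x) = k \<otimes> (lam [^] ?n \<otimes> additive_eval q ?n e' x)" if x: "x \<in> carrier L" for x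
  proof -
    have "linrec ?n b (\<lambda>i. (k \<otimes> x) [^] (q ^ i)) = linrec ?n b (\<lambda>i. k \<otimes> (lam [^] i \<otimes> x [^] (q ^ i)))"
      by (rule linrec_cong) (use k x lamL kq bL in \<open>auto simp: nat_pow_distrib m_ac\<close>)
    thus ?thesis unfolding additive_eval_linrec using recb[of k "\<lambda>i. x [^] (q ^ i)"] k x by simp
  qed
  have ee: "additive_eval q ?n e' x = (additive_eval q m c x) [^] q \<ominus> additive_eval q m c x" if x: "x \<in> carrier L" for x
  proof -
    interpret h: ring_hom_cring L L "\<lambda>x. x [^] q"
      by unfold_locales (use frobenius_hom[of e] in \<open>simp add: q_pow\<close>)
    have "additive_eval q m c x [^] q = additive_eval q m (\<lambda>i. c i [^] q) (x [^] q)"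
      by (rule h.hom_additive_eval) (use cL x in auto)
    also have "\<dots> = linrec m c (\<lambda>i. x [^] (q ^ Suc i))"
      unfolding additive_eval_linrec using pow_q_pow[OF x, of 1]
      by (intro linrec_cong) (use F_frobenius[OF c(1)] cL x in auto)
    finally show ?thesis using rece[of "\<lambda>i. x [^] (q ^ i)"] x by (simp add: additive_eval_linrec)
  qed
  have zF: "additive_eval q ?n e' x = \<zero>" if "x \<in> F" for x
  proof -
    have "additive_eval q m c x \<in> F"
      unfolding additive_eval_def using F_frobenius_pow[OF that] that c(1) F_ops
      by (auto intro!: F_ops(3) finsum_in_subring[OF F_subring])
    thus ?thesis using ee[OF F_carrier[OF that]] F_frobenius F_carrier by (simp add: a_minus_def r_neg)
  qed
  have zH: "additive_eval q ?n e' x = \<zero>" if "x \<in> H" for x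
    using ee[of x] that q_ge_2 by (simp add: H_def additive_zeros_def nat_pow_zero a_minus_def)
  let ?W = "{k \<otimes> (c \<oplus> h) |c h. c \<in> F \<and> h \<in> H}"
  have W: "?W = (\<lambda>(c, h). k \<otimes> (c \<oplus> h)) ` (F \<times> H)" by auto
  have "?W \<subseteq> additive_zeros q ?n b"
  proof
    fix w assume "w \<in> ?W"
    then obtain f h where w: "w = k \<otimes> (f \<oplus> h)" "f \<in> F" "h \<in> H" by auto
    have fh: "f \<in> carrier L" "h \<in> carrier L" using w F_carrier HL by auto
    have "additive_eval q ?n e' (f \<oplus> h) = \<zero>"
      using additive_eval_add[OF e'L q_pow fh, of ?n] zF[OF w(2)] zH[OF w(3)] by simp
    thus "w \<in> additive_zeros q ?n b" using ek[of "f \<oplus> h"] w fh k lamL by (simp add: additive_zeros_def)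
  qed
  \<comment> \<open>Since F and H meet only in zero, their sums are q times q^m distinct elements,
    which exhausts the roots.\<close>
  moreover have "card ?W = q ^ ?n"
  proof -
    have "inj_on (\<lambda>(c, h). k \<otimes> (c \<oplus> h)) (F \<times> H)"
    proof (rule inj_onI)
      fix z z' assume z: "z \<in> F \<times> H" "z' \<in> F \<times> H" and eq: "(\<lambda>(c, h). k \<otimes> (c \<oplus> h)) z = (\<lambda>(c, h). k \<otimes> (c \<oplus> h)) z'"
      obtain f h f' h' where zz: "z = (f, h)" "z' = (f', h')" by (cases z, cases z') auto
      have mem: "f \<in> F" "f' \<in> F" "h \<in> H" "h' \<in> H" using z zz by auto
      have car: "f \<in> carrier L" "f' \<in> carrier L" "h \<in> carrier L" "h' \<in> carrier L" using mem F_carrier HL by auto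
      have e: "f \<oplus> h = f' \<oplus> h'" using eq zz k car by (simp add: m_lcancel)
      have "f \<ominus> f' = (f \<oplus> h) \<ominus> f' \<ominus> h" using car by algebra
      also have "\<dots> = h' \<oplus> (\<ominus> \<one>) \<otimes> h" unfolding e using car by algebra
      finally have "f \<ominus> f' \<in> H" using Hadd Hsmult[of "\<ominus> \<one>" h] mem F_ops by auto
      moreover have "f \<ominus> f' \<in> F" using mem F_ops by (simp add: a_minus_def)
      ultimately have "f \<ominus> f' = \<zero>" using FH by auto
      hence "f = f'" using car by simp
      moreover have "h = h'" using e car \<open>f = f'\<close> by simp
      ultimately show "z = z'" using zz by simp
    qed
    thus ?thesis unfolding W using card_constants Hc by (simp add: card_image card_cartesian_product)
  qed
  moreover have "card (additive_zeros q ?n b) = q ^ ?n" "finite (additive_zeros q ?n b)"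
    using card_additive_zeros[OF prime_p' char_p' q_pow q_ge_2, of ?n b] bL b0 by auto
  ultimately have ZW: "additive_zeros q ?n b = ?W" using card_subset_eq[of "additive_zeros q ?n b" ?W] by simp
  have all: "\<forall>i. b i \<in> F" "\<forall>x\<in>H. \<forall>y\<in>H. x \<oplus> y \<in> H" "\<forall>c\<in>F. \<forall>x\<in>H. c \<otimes> x \<in> H"
    "\<forall>x\<in>H - {\<zero>}. \<forall>y\<in>H - {\<zero>}. \<exists>j. x [^] (q ^ j) = y"
    using bF Hadd Hsmult Hcyc by blast+
  show ?thesis
    by (intro exI[of _ b] conjI exI[of _ k] exI[of _ H]) (fact all b0 root1 root2 k HL FH Hne ZW)+
qed

end

section \<open>The Galois group as a linear group\<close>

context rational_function_setup
begin

text \<open>Two kinds of specialized polynomials: the Frobenius map is a Singer cycle on the roots, or it has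
  the eigenvector \<open>k\<close> and is, up to the factor \<open>lam\<close>, a Singer cycle on the hyperplane \<open>k H\<close>.\<close>

definition singer_type :: "nat \<Rightarrow> (nat \<Rightarrow> 'k) \<Rightarrow> bool" where
  "singer_type n b \<longleftrightarrow> b 0 \<noteq> \<zero> \<and>
     (\<forall>x\<in>additive_zeros q n b - {\<zero>}. \<forall>y\<in>additive_zeros q n b - {\<zero>}. \<exists>j. x [^] (q ^ j) = y)"

definition split_type :: "nat \<Rightarrow> (nat \<Rightarrow> 'k) \<Rightarrow> bool" where
  "split_type n b \<longleftrightarrow> b 0 \<noteq> \<zero> \<and>
     (\<exists>lam k H. lam \<in> F \<and> lam \<noteq> \<zero> \<and> k \<in> carrier L \<and> k \<noteq> \<zero> \<and> k [^] q = lam \<otimes> k \<and> H \<subseteq> carrier L \<and>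
      (\<forall>x\<in>H. \<forall>y\<in>H. x \<oplus> y \<in> H) \<and> (\<forall>c\<in>F. \<forall>x\<in>H. c \<otimes> x \<in> H) \<and> F \<inter> H = {\<zero>} \<and> H \<noteq> {\<zero>} \<and>
      additive_zeros q n b = {k \<otimes> (c \<oplus> h) |c h. c \<in> F \<and> h \<in> H} \<and>
      (\<forall>x\<in>H - {\<zero>}. \<forall>y\<in>H - {\<zero>}. \<exists>j. x [^] (q ^ j) = y))"

context
  fixes n :: nat and a :: "nat \<Rightarrow> 'k"
  assumes aK: "\<And>i. i < n \<Longrightarrow> a i \<in> K" and a0: "a 0 \<noteq> \<zero>" and n: "n > 0"
begin

abbreviation (input) "V \<equiv> additive_zeros q n a"
abbreviation (input) "E \<equiv> splitting_field K (additive_poly K q n a)"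

lemma K_L: "x \<in> K \<Longrightarrow> x \<in> carrier L"
  using subfieldE(3)[OF subfield_axioms] by auto

lemma aL: "i < n \<Longrightarrow> a i \<in> carrier L"
  using aK K_L by auto

lemma zero_set_V: "zero_set (additive_poly K q n a) = V"
  by (rule zero_set_additive_poly[OF K_subring aK q_ge_2])

lemma V_L: "x \<in> V \<Longrightarrow> x \<in> carrier L"
  by (simp add: additive_zeros_def)

lemma E_subfield: "subfield E L"
  unfolding splitting_field_def zero_set_V by (rule generate_field_is_subfield) (use K_L V_L in auto)

lemma E_subring: "subring E L" by (rule subfieldE(1)[OF E_subfield])

lemma K_E: "x \<in> K \<Longrightarrow> x \<in> E" and V_E: "x \<in> V \<Longrightarrow> x \<in> E"
  unfolding splitting_field_def zero_set_V by (auto intro: generate_field.incl)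

lemma carrier_galois_group:
  "carrier (galois_group K (additive_poly K q n a)) =
    {s \<in> Bij E. (\<forall>x\<in>E. \<forall>y\<in>E. s (x \<otimes> y) = s x \<otimes> s y \<and> s (x \<oplus> y) = s x \<oplus> s y) \<and> (\<forall>x\<in>K. s x = x)}"
proof -
  have "s \<in> ring_hom (L\<lparr>carrier := E\<rparr>) (L\<lparr>carrier := E\<rparr>) \<longleftrightarrow>
      (\<forall>x\<in>E. \<forall>y\<in>E. s (x \<otimes> y) = s x \<otimes> s y \<and> s (x \<oplus> y) = s x \<oplus> s y)"
    if "s \<in> Bij E" "\<forall>x\<in>K. s x = x" for s
    using Bij_imp_funcset[OF that(1)] that(2) subringE(3)[OF K_subring]
    by (auto simp: ring_hom_def)
  thus ?thesis unfolding galois_group_def Let_def by auto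
qed

lemma galois_group_closed: "s \<in> carrier (galois_group K (additive_poly K q n a)) \<Longrightarrow> x \<in> E \<Longrightarrow> s x \<in> E"
  using Bij_imp_funcset unfolding carrier_galois_group by blast

lemma galois_group_maps_roots:
  assumes s: "s \<in> carrier (galois_group K (additive_poly K q n a))" and x: "x \<in> V"
  shows "s x \<in> V"
proof -
  interpret E: domain "L\<lparr>carrier := E\<rparr>" by (rule subring_is_domain[OF E_subring])
  have KK: "s c = c" if "c \<in> K" for c using s that unfolding carrier_galois_group by auto
  have h: "s \<in> ring_hom (L\<lparr>carrier := E\<rparr>) L"
    using s KK[OF subringE(3)[OF K_subring]] subringE(1)[OF E_subring] galois_group_closed[OF s]
    unfolding carrier_galois_group by (intro ring_hom_memI) auto
  interpret h: ring_hom_cring "L\<lparr>carrier := E\<rparr>" L s by unfold_locales (rule h)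
  have pw: "y [^]\<^bsub>L\<lparr>carrier := E\<rparr>\<^esub> (m::nat) = y [^] m" for y m by (simp add: nat_pow_def)
  have id: "id \<in> ring_hom (L\<lparr>carrier := E\<rparr>) L"
    by (rule ring_hom_memI) (use subringE(1)[OF E_subring] in auto)
  interpret id: ring_hom_cring "L\<lparr>carrier := E\<rparr>" L id by unfold_locales (rule id)
  have "E.additive_eval q n a x = additive_eval q n a x"
    using id.hom_additive_eval[of n a x q] K_E aK V_E[OF x] by simp
  also have "\<dots> = \<zero>" using x by (simp add: additive_zeros_def)
  finally have "\<zero> = additive_eval q n (\<lambda>i. s (a i)) (s x)"
    using h.hom_additive_eval[of n a x q] K_E aK V_E[OF x] h.hom_zero by simp
  also have "\<dots> = additive_eval q n a (s x)"
    by (rule additive_eval_cong) (use KK aK aL h.hom_closed V_E[OF x] in auto)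
  finally show ?thesis using h.hom_closed V_E[OF x] by (simp add: additive_zeros_def)
qed

lemma galois_group_compose:
  assumes s: "s \<in> carrier (galois_group K (additive_poly K q n a))"
    and s': "s' \<in> carrier (galois_group K (additive_poly K q n a))"
  shows "compose E s s' \<in> carrier (galois_group K (additive_poly K q n a))"
  using s s' compose_Bij[of s E s'] galois_group_closed[OF s'] K_E subringE(6,7)[OF E_subring]
  unfolding carrier_galois_group by (auto simp: compose_eq)

lemma galois_group_inverse:
  assumes s: "s \<in> carrier (galois_group K (additive_poly K q n a))"
  shows "restrict (inv_into E s) E \<in> carrier (galois_group K (additive_poly K q n a))"
proof -
  have sB: "s \<in> Bij E" and bij: "bij_betw s E E" using s unfolding carrier_galois_group Bij_def by auto
  have m: "inv_into E s (x \<otimes> y) = inv_into E s x \<otimes> inv_into E s y" if "x \<in> E" "y \<in> E" for x y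
    by (rule Bij_inv_into_lemma[OF _ sB _ that])
      (use s subringE(6)[OF E_subring] in \<open>auto simp: carrier_galois_group\<close>)
  have ad: "inv_into E s (x \<oplus> y) = inv_into E s x \<oplus> inv_into E s y" if "x \<in> E" "y \<in> E" for x y
    by (rule Bij_inv_into_lemma[OF _ sB _ that])
      (use s subringE(7)[OF E_subring] in \<open>auto simp: carrier_galois_group\<close>)
  have "inv_into E s x = x" if x: "x \<in> K" for x
  proof -
    have "s x = x" using s x unfolding carrier_galois_group by auto
    thus ?thesis using bij_betw_inv_into_left[OF bij K_E[OF x]] by simp
  qed
  thus ?thesis unfolding carrier_galois_group
    using restrict_inv_into_Bij[OF sB] m ad K_E subringE(6,7)[OF E_subring] by auto
qed

lemma galois_group_identity: "(\<lambda>x\<in>E. x) \<in> carrier (galois_group K (additive_poly K q n a))"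
  unfolding carrier_galois_group using id_Bij K_E subringE(6,7)[OF E_subring] by auto

text \<open>Automorphisms live on the splitting field; G collects all functions that agree with one
  of them on the roots, in the saturated form that \<open>linear_group\<close> demands.\<close>

abbreviation (input) "G \<equiv> {g. \<exists>s\<in>carrier (galois_group K (additive_poly K q n a)). \<forall>x\<in>V. g x = s x}"

lemma galois_linear_group: "linear_group L F V G"
proof -
  have sm: "c \<otimes> x \<in> V" if "c \<in> F" "x \<in> V" for c x
    by (rule additive_zeros_smult[OF aL F_carrier[OF that(1)] F_frobenius[OF that(1)] that(2)])
  have FK: "c \<in> K" if "c \<in> F" for c using F_t_in_K(1) that by auto
  show ?thesis
  proof (intro linear_group.intro linear_group_axioms.intro)
    show "field L" by unfold_locales
    show "subfield F L" by (rule constants)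
    show "finite V" using card_additive_zeros(2)[where b = a, OF prime_p' char_p' q_pow q_ge_2 n aL a0] .
    show "V \<subseteq> carrier L" using V_L by auto
    show "\<zero> \<in> V" by (rule additive_zeros_zero[OF aL]) (use q_ge_2 in auto)
    show "\<And>x y. x \<in> V \<Longrightarrow> y \<in> V \<Longrightarrow> x \<oplus> y \<in> V" by (rule additive_zeros_add[OF aL q_pow])
    show "\<And>c x. c \<in> F \<Longrightarrow> x \<in> V \<Longrightarrow> c \<otimes> x \<in> V" by (rule sm)
    show "\<And>g x. g \<in> G \<Longrightarrow> x \<in> V \<Longrightarrow> g x \<in> V" using galois_group_maps_roots by auto
  next
    fix g x y assume g: "g \<in> G" and xy: "x \<in> V" "y \<in> V"
    then obtain s where s: "s \<in> carrier (galois_group K (additive_poly K q n a))" "\<forall>x\<in>V. g x = s x" by blast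
    show "g (x \<oplus> y) = g x \<oplus> g y"
      using s(1) V_E[OF xy(1)] V_E[OF xy(2)] s(2) xy additive_zeros_add[OF aL q_pow xy] unfolding carrier_galois_group by auto
  next
    fix g c x assume g: "g \<in> G" and cx: "c \<in> F" "x \<in> V"
    then obtain s where s: "s \<in> carrier (galois_group K (additive_poly K q n a))" "\<forall>x\<in>V. g x = s x" by blast
    show "g (c \<otimes> x) = c \<otimes> g x"
      using s(1) V_E[OF cx(2)] K_E[OF FK[OF cx(1)]] FK[OF cx(1)] s(2) cx sm[OF cx] unfolding carrier_galois_group by auto
  next
    fix g h assume "g \<in> G" "h \<in> G"
    then obtain s s' where s: "s \<in> carrier (galois_group K (additive_poly K q n a))" "\<forall>x\<in>V. g x = s x"
      and s': "s' \<in> carrier (galois_group K (additive_poly K q n a))" "\<forall>x\<in>V. h x = s' x" by blast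
    have "\<forall>x\<in>V. g (h x) = compose E s s' x"
      using s(2) s'(2) galois_group_maps_roots[OF s'(1)] V_E by (auto simp: compose_def)
    thus "(\<lambda>x. g (h x)) \<in> G" using galois_group_compose[OF s(1) s'(1)] by blast
  next
    fix g assume "g \<in> G"
    then obtain s where s: "s \<in> carrier (galois_group K (additive_poly K q n a))" "\<forall>x\<in>V. g x = s x" by blast
    have bij: "bij_betw s E E" using s(1) unfolding carrier_galois_group Bij_def by auto
    let ?h = "restrict (inv_into E s) E"
    have hG: "?h \<in> G" using galois_group_inverse[OF s(1)] by blast
    have "?h (g x) = x \<and> g (?h x) = x" if x: "x \<in> V" for x
      using bij_betw_inv_into_left[OF bij V_E[OF x]] bij_betw_inv_into_right[OF bij V_E[OF x]] s(2) x
        galois_group_closed[OF s(1) V_E[OF x]] galois_group_maps_roots[OF galois_group_inverse[OF s(1)] x] V_E[OF x] by simp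
    thus "\<exists>h\<in>G. \<forall>x\<in>V. h (g x) = x \<and> g (h x) = x" using hG by blast
  next
    show "\<And>g h. g \<in> G \<Longrightarrow> (\<And>x. x \<in> V \<Longrightarrow> h x = g x) \<Longrightarrow> h \<in> G" by auto
  next
    show "(\<lambda>x. x) \<in> G"
      using V_E by (intro CollectI bexI[OF _ galois_group_identity]) auto
  qed
qed

lemma galois_group_is_GL_if_all_linear:
  assumes all: "\<And>\<gamma>. bij_betw \<gamma> V V \<Longrightarrow> (\<And>x y. x \<in> V \<Longrightarrow> y \<in> V \<Longrightarrow> \<gamma> (x \<oplus> y) = \<gamma> x \<oplus> \<gamma> y)
      \<Longrightarrow> (\<And>c x. c \<in> F \<Longrightarrow> x \<in> V \<Longrightarrow> \<gamma> (c \<otimes> x) = c \<otimes> \<gamma> x) \<Longrightarrow> \<gamma> \<in> G"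
  shows "galois_group_is_GL K F q n a"
proof -
  interpret lg: linear_group L F V G by (rule galois_linear_group)
  have "galois_image K (additive_poly K q n a) = carrier (general_linear_group F V)"
  proof (intro equalityI subsetI)
    fix g assume "g \<in> galois_image K (additive_poly K q n a)"
    then obtain s where s: "s \<in> carrier (galois_group K (additive_poly K q n a))" "g = restrict s V"
      by (auto simp: galois_image_def zero_set_V)
    have gG: "g \<in> G" using s by auto
    have bij: "bij_betw g V V"
    proof -
      obtain h where h: "h \<in> G" "\<forall>x\<in>V. h (g x) = x \<and> g (h x) = x" using lg.G_inv[OF gG] by blast
      show ?thesis
        by (rule bij_betwI[where g = h]) (use h lg.G_closed[OF gG] lg.G_closed[OF h(1)] in auto)
    qed
    have "g \<in> extensional V" using s(2) by simp
    thus "g \<in> carrier (general_linear_group F V)"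
      using bij lg.G_add[OF gG] lg.G_smult[OF gG] by (simp add: general_linear_group_def Bij_def)
  next
    fix g assume "g \<in> carrier (general_linear_group F V)"
    hence g: "bij_betw g V V" "g \<in> extensional V" "\<And>x y. x \<in> V \<Longrightarrow> y \<in> V \<Longrightarrow> g (x \<oplus> y) = g x \<oplus> g y"
      "\<And>c x. c \<in> F \<Longrightarrow> x \<in> V \<Longrightarrow> g (c \<otimes> x) = c \<otimes> g x"
      by (auto simp: general_linear_group_def Bij_def)
    have "g \<in> G" by (rule all[OF g(1,3,4)])
    then obtain s where s: "s \<in> carrier (galois_group K (additive_poly K q n a))" "\<forall>x\<in>V. g x = s x" by blast
    have "g = restrict s V" by (rule extensionalityI[OF g(2)]) (use s(2) in auto)
    thus "g \<in> galois_image K (additive_poly K q n a)" using s(1) by (auto simp: galois_image_def zero_set_V)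
  qed
  thus ?thesis using a0 by (simp add: galois_group_is_GL_def zero_set_V)
qed

section \<open>Frobenius elements of both kinds in the Galois group\<close>

lemma frobenius_conjugate_funpow:
  assumes "\<And>x. x \<in> V \<Longrightarrow> r x \<in> V \<and> \<theta> (r x) = \<theta> x [^] q" "\<And>x. x \<in> V \<Longrightarrow> \<theta> x \<in> carrier L" "x \<in> V"
  shows "(r ^^ j) x \<in> V" "\<theta> ((r ^^ j) x) = \<theta> x [^] (q ^ j)"
  using assms by (induction j) (auto simp: nat_pow_pow mult.commute)

lemma frobenius_on_roots:
  assumes sp: "\<tau> \<in> F" "\<forall>i<n. specializes \<tau> (a i) (b i)" and b0: "b 0 \<noteq> \<zero>"
  shows "\<exists>r \<theta>. r \<in> carrier (galois_group K (additive_poly K q n a)) \<and> bij_betw \<theta> V (additive_zeros q n b) \<and>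
    (\<forall>x\<in>V. \<forall>y\<in>V. \<theta> (x \<oplus> y) = \<theta> x \<oplus> \<theta> y) \<and> (\<forall>c\<in>F. \<forall>x\<in>V. \<theta> (c \<otimes> x) = c \<otimes> \<theta> x) \<and>
    (\<forall>x\<in>V. r x \<in> V \<and> \<theta> (r x) = \<theta> x [^] q)"
  by (rule frobenius_element[where b = b, OF sp(1) n _ b0]) (use sp(2) in simp)

text \<open>The identification \<theta> turns the action of r into the q-th power map, so
  transitivity on the specialized roots is transitivity on V.\<close>

lemma singer_element:
  assumes sp: "\<tau> \<in> F" "\<forall>i<n. specializes \<tau> (a i) (b i)" and b: "singer_type n b"
  shows "\<exists>s\<in>G. \<forall>x\<in>V - {\<zero>}. \<forall>y\<in>V - {\<zero>}. \<exists>j. (s ^^ j) x = y"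
proof -
  interpret lg: linear_group L F V G by (rule galois_linear_group)
  let ?Z = "additive_zeros q n b"
  have b0: "b 0 \<noteq> \<zero>" using b by (simp add: singer_type_def)
  obtain r \<theta> where r': "r \<in> carrier (galois_group K (additive_poly K q n a))" "bij_betw \<theta> V ?Z"
    "\<forall>x\<in>V. \<forall>y\<in>V. \<theta> (x \<oplus> y) = \<theta> x \<oplus> \<theta> y"
    "\<forall>c\<in>F. \<forall>x\<in>V. \<theta> (c \<otimes> x) = c \<otimes> \<theta> x" "\<forall>x\<in>V. r x \<in> V \<and> \<theta> (r x) = \<theta> x [^] q"
    using frobenius_on_roots[where b = b, OF sp b0] by (elim exE conjE)
  note r = r'(1,2) bspec[OF bspec[OF r'(3)]] bspec[OF bspec[OF r'(4)]] bspec[OF r'(5)]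
  have ZL: "?Z \<subseteq> carrier L" unfolding additive_zeros_def by (rule Collect_restrict)
  have Z: "\<theta> x \<in> ?Z" "\<theta> x \<in> carrier L" if "x \<in> V" for x
    using bij_betw_apply[OF r(2) that] ZL by blast+
  have inj: "inj_on \<theta> V" using r(2) by (rule bij_betw_imp_inj_on)
  have "\<theta> (\<zero> \<otimes> \<zero>) = \<zero> \<otimes> \<theta> \<zero>" by (rule r(4)) (use F_ops lg.zero_V in auto)
  hence \<theta>0: "\<theta> \<zero> = \<zero>" using Z(2)[OF lg.zero_V] by simp
  have nz: "\<theta> x \<in> ?Z - {\<zero>}" if "x \<in> V - {\<zero>}" for x
    using Z(1)[of x] inj_onD[OF inj, of x "\<zero>"] that lg.zero_V \<theta>0 by fastforce
  have "\<exists>j. (r ^^ j) x = y" if x: "x \<in> V - {\<zero>}" and y: "y \<in> V - {\<zero>}" for x y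
  proof -
    obtain j where "\<theta> x [^] (q ^ j) = \<theta> y" using b nz[OF x] nz[OF y] unfolding singer_type_def by blast
    hence "\<theta> ((r ^^ j) x) = \<theta> y" "(r ^^ j) x \<in> V" using frobenius_conjugate_funpow[OF r(5) Z(2)] x by auto
    thus ?thesis using inj y by (auto dest: inj_onD)
  qed
  thus ?thesis using r(1) by blast
qed

theorem galois_group_is_GL_line:
  assumes sp: "\<tau> \<in> F" "\<forall>i<n. specializes \<tau> (a i) (b i)" and b: "singer_type n b" and n1: "n = 1"
  shows "galois_group_is_GL K F q n a"
proof -
  interpret lg: linear_group L F V G by (rule galois_linear_group)
  obtain s where s: "s \<in> G" "\<And>x y. x \<in> V - {\<zero>} \<Longrightarrow> y \<in> V - {\<zero>} \<Longrightarrow> \<exists>j. (s ^^ j) x = y"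
    using singer_element[OF sp b] by blast
  have cV: "card V = q" using card_additive_zeros(1)[where b = a, OF prime_p' char_p' q_pow q_ge_2 n aL a0] n1 by simp
  have "V \<noteq> {\<zero>}" using cV q_ge_2 by auto
  then obtain p where p: "p \<in> V - {\<zero>}" using lg.zero_V by auto
  have "inj_on (\<lambda>c. c \<otimes> p) F"
    by (rule inj_onI) (use p V_L F_carrier m_rcancel in auto)
  hence "card ((\<lambda>c. c \<otimes> p) ` F) = q" using card_constants by (simp add: card_image)
  hence "(\<lambda>c. c \<otimes> p) ` F = V"
    using cV lg.smult_V p by (intro card_subset_eq[OF lg.finite_V]) auto
  hence line: "\<exists>c\<in>F. x = c \<otimes> p" if "x \<in> V" for x using that by (metis (no_types, lifting) imageE)
  show ?thesis
    by (rule galois_group_is_GL_if_all_linear) (rule lg.singer_imp_all_linear_line[OF s p line])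
qed

text \<open>Through \<theta> the space V becomes k (F + H). The center p corresponds to k, the axis
  to k H, and the functional \<phi> is the coordinate in F. The two constants enter with separate
  identifications, and only the one for \<tau>' is used explicitly here.\<close>

theorem galois_group_is_GL_split:
  assumes q5: "q > 5"
    and sp: "\<tau> \<in> F" "\<forall>i<n. specializes \<tau> (a i) (b i)" "singer_type n b"
    and sp': "\<tau>' \<in> F" "\<forall>i<n. specializes \<tau>' (a i) (b' i)" and b': "split_type n b'"
  shows "galois_group_is_GL K F q n a"
proof -
  interpret lg: linear_group L F V G by (rule galois_linear_group)
  obtain s where s: "s \<in> G" "\<And>x y. x \<in> V - {\<zero>} \<Longrightarrow> y \<in> V - {\<zero>} \<Longrightarrow> \<exists>j. (s ^^ j) x = y"
    using singer_element[OF sp] by blast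
  let ?Z = "additive_zeros q n b'"
  obtain lam k H where lam: "lam \<in> F" "lam \<noteq> \<zero>" and k: "k \<in> carrier L" "k \<noteq> \<zero>" "k [^] q = lam \<otimes> k"
    and H': "H \<subseteq> carrier L" "\<forall>x\<in>H. \<forall>y\<in>H. x \<oplus> y \<in> H" "\<forall>c\<in>F. \<forall>x\<in>H. c \<otimes> x \<in> H"
      "F \<inter> H = {\<zero>}" "H \<noteq> {\<zero>}" "?Z = {k \<otimes> (c \<oplus> h) |c h. c \<in> F \<and> h \<in> H}"
      "\<forall>x\<in>H - {\<zero>}. \<forall>y\<in>H - {\<zero>}. \<exists>j. x [^] (q ^ j) = y"
    using b' unfolding split_type_def by (elim exE conjE)
  note H = H'(1) bspec[OF bspec[OF H'(2)]] bspec[OF bspec[OF H'(3)]] H'(4-6) bspec[OF bspec[OF H'(7)]]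
  have b0: "b' 0 \<noteq> \<zero>" using b' by (simp add: split_type_def)
  obtain r \<theta> where r': "r \<in> carrier (galois_group K (additive_poly K q n a))" "bij_betw \<theta> V ?Z"
    "\<forall>x\<in>V. \<forall>y\<in>V. \<theta> (x \<oplus> y) = \<theta> x \<oplus> \<theta> y"
    "\<forall>c\<in>F. \<forall>x\<in>V. \<theta> (c \<otimes> x) = c \<otimes> \<theta> x" "\<forall>x\<in>V. r x \<in> V \<and> \<theta> (r x) = \<theta> x [^] q"
    using frobenius_on_roots[where b = b', OF sp' b0] by (elim exE conjE)
  note r = r'(1,2) bspec[OF bspec[OF r'(3)]] bspec[OF bspec[OF r'(4)]] bspec[OF r'(5)]
  have ZL: "?Z \<subseteq> carrier L" unfolding additive_zeros_def by (rule Collect_restrict)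
  have Z: "\<theta> x \<in> ?Z" "\<theta> x \<in> carrier L" if "x \<in> V" for x
    using bij_betw_apply[OF r(2) that] ZL by blast+
  have \<theta>inj: "x = y" if "\<theta> x = \<theta> y" "x \<in> V" "y \<in> V" for x y
    using bij_betw_imp_inj_on[OF r(2)] that by (auto dest: inj_onD)
  have \<theta>sur: "\<exists>x\<in>V. \<theta> x = k \<otimes> (c \<oplus> h)" if "c \<in> F" "h \<in> H" for c h
  proof -
    have "k \<otimes> (c \<oplus> h) \<in> ?Z" unfolding H(6) using that by blast
    thus ?thesis using bij_betw_imp_surj_on[OF r(2)] by (metis imageE)
  qed
  have HL: "h \<in> carrier L" if "h \<in> H" for h using H(1) that by auto
  have H0: "\<zero> \<in> H" using H(4) by auto
  have uniq: "c = c' \<and> h = h'"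
    if e: "k \<otimes> (c \<oplus> h) = k \<otimes> (c' \<oplus> h')" and m: "c \<in> F" "c' \<in> F" "h \<in> H" "h' \<in> H" for c c' h h'
  proof -
    note car = F_carrier[OF m(1)] F_carrier[OF m(2)] HL[OF m(3)] HL[OF m(4)]
    have e: "c \<oplus> h = c' \<oplus> h'" using e k car m_lcancel by simp
    have "c \<ominus> c' = (c \<oplus> h) \<ominus> c' \<ominus> h" using car by algebra
    also have "\<dots> = h' \<oplus> (\<ominus> \<one>) \<otimes> h" unfolding e using car by algebra
    finally have "c \<ominus> c' \<in> H" using H(2)[OF m(4) H(3)[of "\<ominus> \<one>" h]] m F_ops by auto
    moreover have "c \<ominus> c' \<in> F" using m F_ops by (simp add: a_minus_def)
    ultimately have "c \<ominus> c' = \<zero>" using H(4) by blast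
    hence "c = c'" using car by simp
    thus ?thesis using e car by simp
  qed
  \<comment> \<open>F and H meet only in zero, so the two coordinates are unique and depend linearly
    on x.\<close>
  define coords where "coords x c h \<longleftrightarrow> c \<in> F \<and> h \<in> H \<and> \<theta> x = k \<otimes> (c \<oplus> h)" for x c h
  define \<phi> where "\<phi> x = (THE c. \<exists>h. coords x c h)" for x
  have \<phi>I: "\<phi> x = c" if "coords x c h" for x c h
    unfolding \<phi>_def
  proof (rule the_equality)
    show "\<exists>h. coords x c h" using that by blast
  next
    fix c' assume "\<exists>h. coords x c' h"
    then obtain h' where c': "coords x c' h'" by blast
    have "k \<otimes> (c' \<oplus> h') = k \<otimes> (c \<oplus> h)" using that c' by (simp add: coords_def)
    thus "c' = c" using uniq[of c' h' c h] that c' by (simp add: coords_def)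
  qed
  have coords: "\<exists>c h. coords x c h" if "x \<in> V" for x
    using Z(1)[OF that] unfolding H(6) coords_def by auto
  have cadd: "coords (x \<oplus> y) (c \<oplus> c') (h \<oplus> h')"
    if "x \<in> V" "y \<in> V" "coords x c h" "coords y c' h'" for x y c c' h h'
  proof -
    have m: "c \<in> F" "c' \<in> F" "h \<in> H" "h' \<in> H" using that(3,4) by (auto simp: coords_def)
    note car = F_carrier[OF m(1)] F_carrier[OF m(2)] HL[OF m(3)] HL[OF m(4)] k(1)
    have "k \<otimes> (c \<oplus> h) \<oplus> k \<otimes> (c' \<oplus> h') = k \<otimes> (c \<oplus> c' \<oplus> (h \<oplus> h'))" using car by algebra
    thus ?thesis using r(3)[OF that(1,2)] that(3,4) F_ops(3) H(2) by (simp add: coords_def)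
  qed
  have csm: "coords (d \<otimes> x) (d \<otimes> c) (d \<otimes> h)" if "x \<in> V" "d \<in> F" "coords x c h" for d x c h
  proof -
    have m: "c \<in> F" "h \<in> H" using that(3) by (auto simp: coords_def)
    note car = F_carrier[OF m(1)] F_carrier[OF that(2)] HL[OF m(2)] k(1)
    have "d \<otimes> (k \<otimes> (c \<oplus> h)) = k \<otimes> (d \<otimes> c \<oplus> d \<otimes> h)" using car by algebra
    thus ?thesis using r(4)[OF that(2,1)] that F_ops(4) H(3) by (simp add: coords_def)
  qed
  have fun\<phi>: "lg.functional \<phi>" unfolding lg.functional_def
  proof (intro conjI ballI)
    fix x assume x: "x \<in> V"
    then obtain c h where c: "coords x c h" using coords by blast
    thus "\<phi> x \<in> F" using \<phi>I[OF c] by (simp add: coords_def)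
    show "\<phi> (x \<oplus> y) = \<phi> x \<oplus> \<phi> y" if y: "y \<in> V" for y
    proof -
      obtain c' h' where c': "coords y c' h'" using coords[OF y] by blast
      show ?thesis using \<phi>I[OF c] \<phi>I[OF c'] \<phi>I[OF cadd[OF x y c c']] by simp
    qed
  next
    fix d x assume d: "d \<in> F" and x: "x \<in> V"
    then obtain c h where c: "coords x c h" using coords by blast
    show "\<phi> (d \<otimes> x) = d \<otimes> \<phi> x" using \<phi>I[OF c] \<phi>I[OF csm[OF x d c]] by simp
  qed
  obtain p where p: "p \<in> V" "\<theta> p = k \<otimes> (\<one> \<oplus> \<zero>)" using \<theta>sur[OF F_ops(2) H0] by blast
  have \<phi>p: "\<phi> p = \<one>" by (rule \<phi>I[of p "\<one>" "\<zero>"]) (use p H0 F_ops in \<open>simp add: coords_def\<close>)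
  obtain h1 where h1: "h1 \<in> H" "h1 \<noteq> \<zero>" using H(5) H0 by auto
  obtain h0 where h0: "h0 \<in> V" "\<theta> h0 = k \<otimes> (\<zero> \<oplus> h1)" using \<theta>sur[OF F_ops(1) h1(1)] by blast
  have \<phi>h0: "\<phi> h0 = \<zero>" by (rule \<phi>I[of h0 "\<zero>" h1]) (use h0 h1 F_ops in \<open>simp add: coords_def\<close>)
  have "\<theta> (\<zero> \<otimes> \<zero>) = \<zero> \<otimes> \<theta> \<zero>" by (rule r(4)) (use F_ops lg.zero_V in auto)
  hence \<theta>0: "\<theta> \<zero> = \<zero>" using Z(2)[OF lg.zero_V] by simp
  have h0nz: "h0 \<noteq> \<zero>" using \<theta>0 h0(2) h1 k HL[OF h1(1)] by (auto simp: integral_iff)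
  have "lam \<in> Units L" using lam F_carrier field_Units by auto
  hence il: "inv lam \<otimes> lam = \<one>" "lam \<otimes> inv lam = \<one>" "inv lam \<in> carrier L" by auto
  have ilF: "inv lam \<in> F" using subfield_m_inv(1)[OF constants, of lam] lam by auto
  have lamL: "lam \<in> carrier L" by (rule F_carrier[OF lam(1)])
  \<comment> \<open>As k^q = lam k and elements of F are fixed, division by lam turns the Frobenius
    map into k (c + h) going to k (c + h^q): it fixes p and is cyclic on the nonzero vectors of the
    axis.\<close>
  define w where "w x = inv lam \<otimes> r x" for x
  have wV: "w x \<in> V" if "x \<in> V" for x using lg.smult_V[OF ilF] r(5)[OF that] by (simp add: w_def)
  have w\<theta>: "\<theta> (w x) = k \<otimes> (c \<oplus> h [^] q)"
    if x: "x \<in> V" and c: "c \<in> F" "h \<in> carrier L" "\<theta> x = k \<otimes> (c \<oplus> h)" for x c h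
  proof -
    note cL = F_carrier[OF c(1)]
    have hq: "h [^] q \<in> carrier L" using c by simp
    have "\<theta> (w x) = inv lam \<otimes> \<theta> x [^] q" using r(4)[OF ilF] r(5)[OF x] by (simp add: w_def)
    also have "\<theta> x [^] q = lam \<otimes> k \<otimes> (c \<oplus> h [^] q)"
      using c cL k frobenius_q_add[OF cL c(2), of 1] F_frobenius[OF c(1)] by (simp add: nat_pow_distrib)
    also have "inv lam \<otimes> (lam \<otimes> k \<otimes> (c \<oplus> h [^] q)) = (inv lam \<otimes> lam) \<otimes> (k \<otimes> (c \<oplus> h [^] q))"
      using il(3) lamL k(1) cL hq by algebra
    finally show ?thesis using il(1) k(1) cL hq by simp
  qed
  have lw: "(\<lambda>x. lam \<otimes> w x) \<in> G"
  proof -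
    have "lam \<otimes> w x = r x" if "x \<in> V" for x
      using il lamL r(5)[OF that] V_L[of "r x"] by (simp add: w_def m_assoc[symmetric])
    thus ?thesis using r(1) by blast
  qed
  have wp: "w p = p"
    by (rule \<theta>inj[OF _ wV[OF p(1)] p(1)]) (use w\<theta>[OF p(1) F_ops(2) _ p(2)] p(2) q_ge_2 in \<open>simp add: nat_pow_zero\<close>)
  have wH: "(w ^^ j) x \<in> V \<and> \<theta> ((w ^^ j) x) = k \<otimes> h [^] (q ^ j)"
    if "x \<in> V" "h \<in> carrier L" "\<theta> x = k \<otimes> h" for x h j
  proof (induction j)
    case (Suc j)
    have "\<theta> (w ((w ^^ j) x)) = k \<otimes> (\<zero> \<oplus> (h [^] (q ^ j)) [^] q)"
      by (rule w\<theta>) (use Suc that F_ops in auto)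
    thus ?case using Suc wV that(2) by (simp add: nat_pow_pow mult.commute)
  qed (use that in auto)
  have wtrans: "\<exists>j. (w ^^ j) x = y" if x: "x \<in> V - {\<zero>}" "\<phi> x = \<zero>" and y: "y \<in> V - {\<zero>}" "\<phi> y = \<zero>" for x y
  proof -
    have form: "\<exists>h\<in>H - {\<zero>}. \<theta> z = k \<otimes> h" if z: "z \<in> V - {\<zero>}" "\<phi> z = \<zero>" for z
    proof -
      have zV: "z \<in> V" using z by simp
      obtain c h where c: "coords z c h" using coords[OF zV] by blast
      have "c = \<zero>" using \<phi>I[OF c] z(2) by simp
      hence h: "h \<in> H" "\<theta> z = k \<otimes> h" using c HL by (auto simp: coords_def)
      have "h \<noteq> \<zero>" using \<theta>inj[of z "\<zero>"] \<theta>0 h z lg.zero_V k by auto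
      thus ?thesis using h by blast
    qed
    obtain h h' where h: "h \<in> H - {\<zero>}" "\<theta> x = k \<otimes> h" "h' \<in> H - {\<zero>}" "\<theta> y = k \<otimes> h'"
      using form[OF x] form[OF y] by blast
    obtain j where "h [^] (q ^ j) = h'" using H(7)[OF h(1,3)] by blast
    thus ?thesis using wH[of x h j] x y h HL \<theta>inj[of "(w ^^ j) x" y] by auto
  qed
  show ?thesis
  proof (rule galois_group_is_GL_if_all_linear)
    fix \<gamma> assume g: "bij_betw \<gamma> V V" "\<And>x y. x \<in> V \<Longrightarrow> y \<in> V \<Longrightarrow> \<gamma> (x \<oplus> y) = \<gamma> x \<oplus> \<gamma> y"
      "\<And>c x. c \<in> F \<Longrightarrow> x \<in> V \<Longrightarrow> \<gamma> (c \<otimes> x) = c \<otimes> \<gamma> x"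
    show "\<gamma> \<in> G"
    proof (rule lg.singer_and_homology_imp_all_linear[where s = s and \<phi> = \<phi> and p = p and ?h0.0 = h0 and lam = lam and w = w and \<gamma> = \<gamma>])
      show "finite F" "card F > 5" using card_constants q5 by auto
      show "h0 \<in> V - {\<zero>}" using h0(1) h0nz by simp
    qed (fact s fun\<phi> p \<phi>p \<phi>h0 lam lw wV wp wtrans g | (rule wtrans; assumption))+
  qed
qed

end

lemma specializes_nonzero:
  assumes "\<tau> \<in> F" "specializes \<tau> x y" "y \<noteq> \<zero>"
  shows "x \<noteq> \<zero>"
proof
  assume x: "x = \<zero>"
  obtain c d where c: "\<And>j. c j \<in> F" "x = (\<Oplus>j\<in>{..d::nat}. c j \<otimes> t [^] j)" "y = (\<Oplus>j\<in>{..d}. c j \<otimes> \<tau> [^] j)"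
    using assms(2) by (auto simp: specializes_def)
  \<comment> \<open>Writing t as t - 0 makes the absence of relations for shifted variables
    applicable.\<close>
  have "(\<Oplus>j\<in>{..d}. c j \<otimes> (t \<ominus> \<zero>) [^] j) = \<zero>" unfolding a_minus_def minus_zero r_zero[OF t_carrier] c(2)[symmetric] by (rule x)
  hence "c j = \<zero>" if "j \<le> d" for j using shifted_variable_no_relation[where c = c, OF F_ops(1) c(1) _ that] by blast
  hence "y = (\<Oplus>j\<in>{..d}. \<zero>)" unfolding c(3) using F_carrier[OF assms(1)] by (intro finsum_cong') auto
  thus False using assms(3) by simp
qed

end

section \<open>Counting specializations\<close>

text \<open>The product is smallest when P is the interval from 2 to k + 1, where it telescopes to 1
  / (k + 1). The induction removes the largest element, which is at least the cardinality plus
  one.\<close>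

lemma prod_one_minus_inverse_ge:
  fixes P :: "nat set"
  assumes "finite P" "\<And>p. p \<in> P \<Longrightarrow> p \<ge> 2"
  shows "(\<Prod>p\<in>P. 1 - 1 / real p) \<ge> 1 / (card P + 1)"
  using assms
proof (induction "card P" arbitrary: P)
  case (Suc k)
  define m where "m = Max P"
  have ne: "P \<noteq> {}" using Suc(2) by auto
  have m: "m \<in> P" "\<And>p. p \<in> P \<Longrightarrow> p \<le> m" using Suc(3) ne by (auto simp: m_def)
  have "P \<subseteq> {2..m}" using m Suc(4) by auto
  hence "card P \<le> card {2..m}" by (intro card_mono) auto
  hence mk: "real m \<ge> k + 2" using Suc(2) by simp
  have c: "card (P - {m}) = k" using Suc(2,3) m by simp
  have "1 / (card P + 1) = 1 / (real k + 1) * (1 - 1 / (real k + 2))"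
    using Suc(2)[symmetric] by (simp add: field_simps)
  also have "\<dots> \<le> (\<Prod>p\<in>P - {m}. 1 - 1 / real p) * (1 - 1 / real m)"
  proof (intro mult_mono)
    show "1 / (real k + 1) \<le> (\<Prod>p\<in>P - {m}. 1 - 1 / real p)" using Suc(1)[of "P - {m}"] c Suc(3,4) by (simp add: add.commute)
    show "1 - 1 / (real k + 2) \<le> 1 - 1 / real m" using mk by (simp add: frac_le)
    show "(\<Prod>p\<in>P - {m}. 1 - 1 / real p) \<ge> 0" using Suc(4) by (intro prod_nonneg) force
  qed simp
  also have "\<dots> = (\<Prod>p\<in>P. 1 - 1 / real p)" using m(1) Suc(3) by (simp add: prod.remove mult.commute)
  finally show ?case .
qed simp

text \<open>With k distinct prime factors N is at least 2^k, so k is at most log 2 N; the Euler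
  product for the totient is at least 1 / (k + 1).\<close>

lemma totient_ge:
  assumes "N > 0" shows "real N \<le> real (totient N) * (log 2 N + 1)"
proof -
  let ?P = "prime_factors N"
  have P2: "p \<ge> 2" if "p \<in> ?P" for p using that by (intro prime_ge_2_nat) auto
  have "2 ^ card ?P = (\<Prod>p\<in>?P. 2::nat)" by simp
  also have "\<dots> \<le> (\<Prod>p\<in>?P. p ^ multiplicity p N)"
  proof (rule prod_mono)
    fix p assume p: "p \<in> ?P"
    have "multiplicity p N > 0" using p by (simp add: prime_factors_multiplicity)
    hence "p ^ 1 \<le> p ^ multiplicity p N" using P2[OF p] by (intro power_increasing) auto
    thus "0 \<le> (2::nat) \<and> 2 \<le> p ^ multiplicity p N" using P2[OF p] by simp
  qed
  also have "\<dots> = N" using assms by (simp add: prod_prime_factors)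
  finally have "log 2 (real (2 ^ card ?P)) \<le> log 2 (real N)" using assms by (intro log_mono) auto
  hence k: "real (card ?P) \<le> log 2 N" by (simp add: log_nat_power)
  have "real N * 1 = real N * (1 / (card ?P + 1)) * (card ?P + 1)" by simp
  also have "\<dots> \<le> real (totient N) * (card ?P + 1)"
    unfolding totient_formula2
    by (intro mult_right_mono mult_left_mono prod_one_minus_inverse_ge) (use P2 in auto)
  also have "\<dots> \<le> real (totient N) * (log 2 N + 1)" using k by (intro mult_left_mono) auto
  finally show ?thesis by simp
qed

section \<open>Counting coefficient vectors of both kinds\<close>

context rational_function_setup
begin

lemma finite_subfield_subfield:
  assumes n: "n > 0" shows "subfield (finite_subfield n) L"
proof (rule subfieldI')
  have neg: "(\<ominus> x) [^] (q ^ n) = \<ominus> x" if "x \<in> carrier L" "x [^] (q ^ n) = x" for x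
  proof -
    have "\<zero> = (\<ominus> x \<oplus> x) [^] (q ^ n)" using that q_ge_2 by (simp add: l_neg nat_pow_zero)
    also have "\<dots> = (\<ominus> x) [^] (q ^ n) \<oplus> x" using frobenius_q_add[of "\<ominus> x" x n] that by simp
    finally have "(\<ominus> x) [^] (q ^ n) \<oplus> x = \<zero>" by simp
    thus ?thesis using that minus_equality[of "(\<ominus> x) [^] (q ^ n)" x] by simp
  qed
  show "subring (finite_subfield n) L"
    by (rule subringI) (auto simp: finite_subfield_def neg nat_pow_distrib frobenius_q_add)
  fix x assume x: "x \<in> finite_subfield n - {\<zero>}"
  hence xU: "x \<in> Units L" and xL: "x \<in> carrier L" by (auto simp: finite_subfield_def field_Units)
  have "inv x \<otimes> x = \<one>" and iL: "inv x \<in> carrier L" using xU by auto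
  hence "(inv x) [^] (q ^ n) \<otimes> x [^] (q ^ n) = \<one>" using xL nat_pow_distrib[of "inv x" x "q ^ n"] by simp
  hence "(inv x) [^] (q ^ n) \<otimes> x = \<one>" using x by (simp add: finite_subfield_def)
  hence "inv x = (inv x) [^] (q ^ n)" using inv_char[of x "(inv x) [^] (q ^ n)"] xL iL by (simp add: m_comm)
  thus "inv x \<in> finite_subfield n" using iL by (simp add: finite_subfield_def)
qed

text \<open>The nonzero elements of the field with q^n elements form a cyclic group, and the
  elements of full order are primitive; their number is the totient of the group order.\<close>

lemma card_primitive_ge:
  assumes n: "n > 0"
  shows "totient (q ^ n - 1) \<le> card {\<alpha>. primitive n \<alpha>}" "finite {\<alpha>. primitive n \<alpha>}"
proof -
  let ?M = "L\<lparr>carrier := finite_subfield n\<rparr>"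
  interpret M: field ?M by (rule subfield_iff(2)[OF finite_subfield_subfield[OF n]])
  have fin: "finite (carrier ?M)" using card_finite_subfield[OF n] by simp
  let ?N = "q ^ n - 1"
  have ord: "Coset.order (Multiplicative_Group.mult_of ?M) = ?N"
    using M.order_mult_of[OF fin] card_finite_subfield[OF n] by (simp add: Coset.order_def)
  have qn: "q ^ n \<ge> 2" using q_ge_2 self_le_power[of q n] n by linarith
  interpret G: group "Multiplicative_Group.mult_of ?M" by (rule M.field_mult_group)
  have finG: "finite (carrier (Multiplicative_Group.mult_of ?M))" using fin by simp
  have pw: "x [^]\<^bsub>Multiplicative_Group.mult_of ?M\<^esub> (j::nat) = x [^] j" for x j by (simp add: nat_pow_def)
  have sub: "{a \<in> carrier (Multiplicative_Group.mult_of ?M). G.ord a = ?N} \<subseteq> {\<alpha>. primitive n \<alpha>}"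
  proof
    fix a assume a: "a \<in> {a \<in> carrier (Multiplicative_Group.mult_of ?M). G.ord a = ?N}"
    have "inj_on (\<lambda>x::nat. a [^]\<^bsub>Multiplicative_Group.mult_of ?M\<^esub> x) {0..G.ord a - 1}"
      using a by (intro G.ord_inj) auto
    moreover have "{..<?N} = {0..G.ord a - 1}" using a qn by auto
    ultimately have "inj_on (\<lambda>j::nat. a [^] j) {..<?N}" using pw by simp
    moreover have "a [^] ?N = \<one>" using G.pow_ord_eq_1[of a] a pw by simp
    ultimately show "a \<in> {\<alpha>. primitive n \<alpha>}" using a by (simp add: primitive_def finite_subfield_def)
  qed
  show fP: "finite {\<alpha>. primitive n \<alpha>}"
    by (rule finite_subset[of _ "finite_subfield n"]) (use primitive_in_finite_subfield[OF _ n] card_finite_subfield[OF n] in \<open>auto simp: finite_subfield_def primitive_def\<close>)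
  obtain a where a: "a \<in> carrier (Multiplicative_Group.mult_of ?M)"
    "carrier (Multiplicative_Group.mult_of ?M) = {a [^]\<^bsub>?M\<^esub> i | i::nat . i \<in> UNIV}"
    using M.finite_field_mult_group_has_gen[OF fin] by auto
  have "card {a \<in> carrier (Multiplicative_Group.mult_of ?M). G.ord a = ?N} = phi' ?N"
  proof (rule M.num_elems_of_ord_eq_phi'[OF fin])
    show "?N dvd Coset.order (Multiplicative_Group.mult_of ?M)" using ord by simp
    have "G.ord a = ?N"
    proof -
      have "carrier (Multiplicative_Group.mult_of ?M) \<subseteq> {a [^]\<^bsub>Multiplicative_Group.mult_of ?M\<^esub> i | i::nat. i \<in> {0..G.ord a - 1}}"
        using G.ord_elems[OF finG a(1)] a(2) by (auto simp: nat_pow_def)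
      also have "\<dots> = (\<lambda>i::nat. a [^]\<^bsub>Multiplicative_Group.mult_of ?M\<^esub> i) ` {0..G.ord a - 1}" by auto
      finally have "?N \<le> card \<dots>" using ord by (metis Coset.order_def card_mono finite_atLeastAtMost finite_imageI)
      also have "\<dots> \<le> card {0..G.ord a - 1}" by (rule card_image_le) simp
      finally have "?N \<le> G.ord a" using G.ord_ge_1[OF finG a(1)] by simp
      thus ?thesis using G.ord_dvd_group_order[OF a(1)] ord dvd_imp_le[of "G.ord a" ?N] qn by simp
    qed
    thus "\<exists>a\<in>carrier (Multiplicative_Group.mult_of ?M). G.ord a = ?N" using a(1) by blast
  qed
  also have "phi' ?N = totient ?N"
    unfolding phi'_def totient_def totatives_def by (rule arg_cong[where f = card]) auto
  finally show "totient ?N \<le> card {\<alpha>. primitive n \<alpha>}" using card_mono[OF fP sub] by simp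
qed

lemma card_linrec_roots:
  assumes b: "\<And>i. i < n \<Longrightarrow> b i \<in> carrier L" and n: "n > 0"
  shows "finite {x \<in> carrier L. linrec n b (\<lambda>i. x [^] i) = \<zero>}" "card {x \<in> carrier L. linrec n b (\<lambda>i. x [^] i) = \<zero>} \<le> n"
proof -
  \<comment> \<open>The value at index n is the leading coefficient, which \<open>linrec\<close>
    leaves implicit.\<close>
  define c where "c i = (if i < n then b i else \<one>)" for i
  let ?l = "map c (rev [0..<Suc n])"
  have c: "c i \<in> carrier L" for i using b by (simp add: c_def)
  have "polynomial (carrier L) ?l" unfolding polynomial_def using b by (auto simp: c_def)
  hence l: "?l \<in> carrier (poly_ring L)" by (simp add: univ_poly_carrier)
  have ev: "eval ?l x = linrec n b (\<lambda>i. x [^] i)" if x: "x \<in> carrier L" for x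
  proof -
    have "eval ?l x = (\<Oplus>i\<in>{..<Suc n}. c i \<otimes> x [^] i)" by (rule eval_coeff_list) (use c x in auto)
    also have "\<dots> = c n \<otimes> x [^] n \<oplus> (\<Oplus>i\<in>{..<n}. c i \<otimes> x [^] i)"
      using c x by (simp add: lessThan_Suc finsum_insert)
    also have "(\<Oplus>i\<in>{..<n}. c i \<otimes> x [^] i) = (\<Oplus>i\<in>{..<n}. b i \<otimes> x [^] i)"
      by (rule finsum_cong') (use b x in \<open>auto simp: c_def\<close>)
    finally have "eval ?l x = c n \<otimes> x [^] n \<oplus> (\<Oplus>i\<in>{..<n}. b i \<otimes> x [^] i)" .
    moreover have "c n = \<one>" by (simp add: c_def)
    ultimately show ?thesis using x by (simp only: linrec_def l_one nat_pow_closed)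
  qed
  have ne: "?l \<noteq> []" by simp
  have "{x \<in> carrier L. linrec n b (\<lambda>i. x [^] i) = \<zero>} = {x. is_root ?l x}"
    using ev ne by (auto simp: is_root_def)
  also have "\<dots> = set_mset (roots ?l)" using roots_mem_iff_is_root[OF l] by auto
  finally have eq: "{x \<in> carrier L. linrec n b (\<lambda>i. x [^] i) = \<zero>} = set_mset (roots ?l)" .
  show "finite {x \<in> carrier L. linrec n b (\<lambda>i. x [^] i) = \<zero>}" unfolding eq by simp
  have "card (set_mset (roots ?l)) \<le> size (roots ?l)" 
    unfolding size_multiset_overloaded_eq card_eq_sum by (intro sum_mono) (simp add: Suc_le_eq)
  also have "\<dots> \<le> Polynomials.degree ?l" by (rule size_roots_le_degree[OF l])
  finally show "card {x \<in> carrier L. linrec n b (\<lambda>i. x [^] i) = \<zero>} \<le> n" unfolding eq by simp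
qed

text \<open>The value zero from index n on makes the set finite and matches the default value of the
  random coefficients. \<open>truncate\<close> brings coefficient functions into this form.\<close>

abbreviation vectors :: "nat \<Rightarrow> (nat \<Rightarrow> 'k) set" where
  "vectors n \<equiv> PiE_dflt {..<n} \<zero> (\<lambda>_. F)"

lemma vectors_D: "b \<in> vectors n \<Longrightarrow> i < n \<Longrightarrow> b i \<in> F"
  by (auto simp: PiE_dflt_def)

lemma finite_vectors: "finite (vectors n)"
  using card_constants by (intro finite_PiE_dflt) auto

lemma card_vectors: "card (vectors n) = q ^ n"
  using card_constants by (simp add: card_PiE_dflt)

definition truncate :: "nat \<Rightarrow> (nat \<Rightarrow> 'k) \<Rightarrow> nat \<Rightarrow> 'k" where
  "truncate n b i = (if i < n then b i else \<zero>)"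

lemma truncate_vectors: "(\<And>i. b i \<in> F) \<Longrightarrow> truncate n b \<in> vectors n"
  by (auto simp: PiE_dflt_def truncate_def)

lemma linrec_truncate: "(\<And>i. b i \<in> F) \<Longrightarrow> (\<And>i. s i \<in> carrier L) \<Longrightarrow> linrec n (truncate n b) s = linrec n b s"
  unfolding linrec_def by (rule arg_cong2[where f = "(\<oplus>)", OF refl], rule finsum_cong')
    (auto simp: truncate_def F_carrier)

lemma additive_zeros_truncate: "(\<And>i. b i \<in> F) \<Longrightarrow> additive_zeros q n (truncate n b) = additive_zeros q n b"
  by (rule additive_zeros_cong) (auto simp: truncate_def F_carrier)

text \<open>Every primitive element is a root of the polynomial of some vector of this type, and a
  polynomial of degree n has at most n roots.\<close>

theorem card_singer_type_ge:
  assumes n: "n > 0"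
  shows "totient (q ^ n - 1) \<le> n * card {b \<in> vectors n. singer_type n b}"
proof -
  let ?C = "{b \<in> vectors n. singer_type n b}"
  let ?R = "\<lambda>b. {x \<in> carrier L. linrec n b (\<lambda>i. x [^] i) = \<zero>}"
  have fC: "finite ?C" using finite_vectors by simp
  have bL: "i < n \<Longrightarrow> b i \<in> carrier L" if "b \<in> ?C" for b i using that vectors_D F_carrier by blast
  have "{\<alpha>. primitive n \<alpha>} \<subseteq> (\<Union>b\<in>?C. ?R b)"
  proof
    fix \<alpha> assume "\<alpha> \<in> {\<alpha>. primitive n \<alpha>}"
    hence \<alpha>: "primitive n \<alpha>" by simp
    hence \<alpha>L: "\<alpha> \<in> carrier L" by (simp add: primitive_def)
    obtain b where b: "\<And>i. b i \<in> F" "linrec n b (\<lambda>i. \<alpha> [^] i) = \<zero>" "b 0 \<noteq> \<zero>"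
      using primitive_minimal_polynomial[OF \<alpha> n] by blast
    have "singer_type n b" unfolding singer_type_def using singer_cycle[where b = b, OF \<alpha> n b(1,3,2)] b(3) by blast
    hence "singer_type n (truncate n b)"
      using n unfolding singer_type_def additive_zeros_truncate[OF b(1)] by (simp add: truncate_def)
    hence C: "truncate n b \<in> ?C" using truncate_vectors[OF b(1)] by simp
    have "\<alpha> \<in> ?R (truncate n b)" using linrec_truncate[OF b(1), of "\<lambda>i. \<alpha> [^] i" n] b(2) \<alpha>L by simp
    thus "\<alpha> \<in> (\<Union>b\<in>?C. ?R b)" by (rule UN_I[OF C])
  qed
  hence "card {\<alpha>. primitive n \<alpha>} \<le> card (\<Union>b\<in>?C. ?R b)"
    by (intro card_mono finite_UN_I fC card_linrec_roots(1)[OF bL n])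
  also have "\<dots> \<le> (\<Sum>b\<in>?C. card (?R b))" by (rule card_UN_le[OF fC])
  also have "\<dots> \<le> (\<Sum>b\<in>?C. n)" by (intro sum_mono card_linrec_roots(2)[OF bL n])
  finally show ?thesis using card_primitive_ge(1)[OF n] by (simp add: mult.commute)
qed

text \<open>Each pair of a nonzero lam and a primitive \<gamma> gives two roots lam and lam \<gamma>
  of one polynomial of this type, from which the pair can be recovered. A polynomial of degree n has
  at most n^2 pairs of roots.\<close>

theorem card_split_type_ge:
  assumes m: "m > 0" and q: "q > 2"
  shows "(q - 1) * totient (q ^ m - 1) \<le> (Suc m)\<^sup>2 * card {b \<in> vectors (Suc m). split_type (Suc m) b}"
proof -
  let ?n = "Suc m"
  let ?C = "{b \<in> vectors ?n. split_type ?n b}"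
  let ?R = "\<lambda>b. {x \<in> carrier L. linrec ?n b (\<lambda>i. x [^] i) = \<zero>}"
  let ?P = "(F - {\<zero>}) \<times> {\<alpha>. primitive m \<alpha>}"
  let ?f = "\<lambda>(lam, \<gamma>). (lam, lam \<otimes> \<gamma>)"
  have fC: "finite ?C" using finite_vectors by simp
  have bL: "i < ?n \<Longrightarrow> b i \<in> carrier L" if "b \<in> ?C" for b i using that vectors_D F_carrier by blast
  have fP: "finite ?P" using card_constants card_primitive_ge(2)[OF m] by simp
  have inj: "inj_on ?f ?P"
    using F_carrier m_lcancel by (auto simp: inj_on_def primitive_def)
  have "?f ` ?P \<subseteq> (\<Union>b\<in>?C. ?R b \<times> ?R b)"
  proof
    fix z assume "z \<in> ?f ` ?P"
    then obtain lam \<gamma> where z: "z = (lam, lam \<otimes> \<gamma>)" and lam: "lam \<in> F" "lam \<noteq> \<zero>" and \<gamma>: "primitive m \<gamma>" by auto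
    have car: "lam \<in> carrier L" "\<gamma> \<in> carrier L" "lam \<otimes> \<gamma> \<in> carrier L"
      using F_carrier[OF lam(1)] \<gamma> by (auto simp: primitive_def)
    obtain b where B: "(\<forall>i. b i \<in> F) \<and> b 0 \<noteq> \<zero> \<and> linrec ?n b (\<lambda>i. lam [^] i) = \<zero> \<and>
      linrec ?n b (\<lambda>i. (lam \<otimes> \<gamma>) [^] i) = \<zero> \<and> (\<exists>k H. k \<in> carrier L \<and> k \<noteq> \<zero> \<and> k [^] q = lam \<otimes> k \<and> H \<subseteq> carrier L \<and>
      (\<forall>x\<in>H. \<forall>y\<in>H. x \<oplus> y \<in> H) \<and> (\<forall>c\<in>F. \<forall>x\<in>H. c \<otimes> x \<in> H) \<and> F \<inter> H = {\<zero>} \<and> H \<noteq> {\<zero>} \<and>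
      additive_zeros q (Suc m) b = {k \<otimes> (c \<oplus> h) |c h. c \<in> F \<and> h \<in> H} \<and>
      (\<forall>x\<in>H - {\<zero>}. \<forall>y\<in>H - {\<zero>}. \<exists>j. x [^] (q ^ j) = y))"
      using singer_cycle_with_eigenvector[OF \<gamma> m lam q] by (elim exE)
    note b = conjunct1[OF B] and b0 = conjunct1[OF conjunct2[OF B]]
      and l = conjunct1[OF conjunct2[OF conjunct2[OF B]]] conjunct1[OF conjunct2[OF conjunct2[OF conjunct2[OF B]]]]
      and ex = conjunct2[OF conjunct2[OF conjunct2[OF conjunct2[OF B]]]]
    have bF: "b i \<in> F" for i using b by blast
    have "split_type ?n (truncate ?n b)"
      unfolding split_type_def additive_zeros_truncate[OF bF]
      by (rule conjI, simp add: truncate_def b0, rule exI[of _ lam]) (use ex lam in simp)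
    hence C: "truncate ?n b \<in> ?C" using truncate_vectors[OF bF] by simp
    have "z \<in> ?R (truncate ?n b) \<times> ?R (truncate ?n b)"
      using linrec_truncate[OF bF, of "\<lambda>i. lam [^] i" ?n] linrec_truncate[OF bF, of "\<lambda>i. (lam \<otimes> \<gamma>) [^] i" ?n] l car z
      by simp
    thus "z \<in> (\<Union>b\<in>?C. ?R b \<times> ?R b)" by (rule UN_I[OF C])
  qed
  hence "card (?f ` ?P) \<le> card (\<Union>b\<in>?C. ?R b \<times> ?R b)"
    by (intro card_mono finite_UN_I fC finite_cartesian_product card_linrec_roots(1)[OF bL]) simp_all
  also have "\<dots> \<le> (\<Sum>b\<in>?C. card (?R b \<times> ?R b))" by (rule card_UN_le[OF fC])
  also have "\<dots> \<le> (\<Sum>b\<in>?C. ?n * ?n)"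
    unfolding card_cartesian_product by (intro sum_mono mult_mono card_linrec_roots(2)[OF bL]) simp_all
  finally have "card ?P \<le> ?n\<^sup>2 * card ?C"
    unfolding card_image[OF inj] by (simp add: power2_eq_square mult.commute mult.left_commute)
  moreover have "card ?P = (q - 1) * card {\<alpha>. primitive m \<alpha>}"
    using card_constants F_ops(1) by (simp add: card_cartesian_product)
  moreover have "(q - 1) * totient (q ^ m - 1) \<le> (q - 1) * card {\<alpha>. primitive m \<alpha>}"
    using card_primitive_ge(1)[OF m] by simp
  ultimately show ?thesis by linarith
qed

end

section \<open>Random specializations\<close>

text \<open>The second moment method: if \<open>hits a\<close> is the number of \<open>\<tau>\<close> with \<open>ev \<tau> a \<in> C\<close>, then
  the variance of \<open>hits\<close> is at most its mean, by pairwise independence of the variables \<open>ev \<tau>\<close>.\<close>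

lemma second_moment_count:
  fixes ev :: "'t \<Rightarrow> 'x \<Rightarrow> 'y"
  assumes fin: "finite A" "finite T" "finite B" and C: "C \<subseteq> B" and ev: "\<And>u a. u \<in> T \<Longrightarrow> a \<in> A \<Longrightarrow> ev u a \<in> B"
    and two: "card T \<ge> 2"
    and pairs: "\<And>u v b c. u \<in> T \<Longrightarrow> v \<in> T \<Longrightarrow> u \<noteq> v \<Longrightarrow> b \<in> B \<Longrightarrow> c \<in> B \<Longrightarrow>
      card {a \<in> A. ev u a = b \<and> ev v a = c} * (card B)\<^sup>2 = card A"
  shows "card {a \<in> A. \<forall>u\<in>T. ev u a \<notin> C} * (card T * card C) \<le> card A * card B"
proof (cases "card T * card C = 0")
  case True
  show ?thesis unfolding True by simp
next
  case False
  define \<beta> where "\<beta> = real (card B)"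
  define c where "c = real (card C)"
  define N where "N = real (card A)"
  define T' where "T' = real (card T)"
  define ind where "ind u a = (if ev u a \<in> C then 1 else 0 :: real)" for u a
  define hits where "hits a = (\<Sum>u\<in>T. ind u a)" for a
  have finC: "finite C" using C fin(3) finite_subset by blast
  have "card C \<le> card B" by (rule card_mono[OF fin(3) C])
  hence \<beta>0: "\<beta> > 0" using False by (simp add: \<beta>_def)
  have T0: "T' > 0" and c0: "c > 0" using False by (auto simp: T'_def c_def)
  have cB: "c \<le> \<beta>" using card_mono[OF fin(3) C] by (simp add: c_def \<beta>_def)
  have cnt: "(\<Sum>a\<in>A. ind u a) = real (\<Sum>b\<in>C. card {a \<in> A. ev u a = b})" for u
  proof -
    have "(\<Sum>a\<in>A. ind u a) = real (card {a \<in> A. ev u a \<in> C})"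
      unfolding ind_def using fin(1) by (simp add: sum.If_cases Int_def)
    also have "{a \<in> A. ev u a \<in> C} = (\<Union>b\<in>C. {a \<in> A. ev u a = b})" by auto
    also have "card \<dots> = (\<Sum>b\<in>C. card {a \<in> A. ev u a = b})" using finC fin(1) by (intro card_UN_disjoint) auto
    finally show ?thesis .
  qed
  \<comment> \<open>Summing the pair counts over the values at a second point gives the distribution
    at one point; a second point exists because T has two elements.\<close>
  have single: "card {a \<in> A. ev u a = b} * card B = card A" if u: "u \<in> T" and b: "b \<in> B" for u b
  proof -
    have "\<exists>v\<in>T. v \<noteq> u"
    proof (rule ccontr)
      assume "\<not> ?thesis"
      hence "card T \<le> card {u}" by (intro card_mono) auto
      thus False using two by simp
    qed
    then obtain v where v: "v \<in> T" "u \<noteq> v" by blast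
    have "{a \<in> A. ev u a = b} = (\<Union>c\<in>B. {a \<in> A. ev u a = b \<and> ev v a = c})" using ev[OF v(1)] by auto
    also have "card \<dots> = (\<Sum>c\<in>B. card {a \<in> A. ev u a = b \<and> ev v a = c})"
      using fin by (intro card_UN_disjoint) auto
    finally have "card {a \<in> A. ev u a = b} * (card B)\<^sup>2 = (\<Sum>c\<in>B. card A)"
      using pairs[OF u v b] by (simp add: sum_distrib_right)
    moreover have "card B > 0" using b fin(3) card_gt_0_iff by blast
    ultimately show ?thesis by (simp add: power2_eq_square)
  qed
  have m1: "(\<Sum>a\<in>A. ind u a) = N * c / \<beta>" if u: "u \<in> T" for u
  proof -
    have "real (card {a \<in> A. ev u a = b}) = N / \<beta>" if "b \<in> C" for b
    proof -
      have "card {a \<in> A. ev u a = b} * card B = card A" using single[OF u, of b] that C by blast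
      hence "real (card {a \<in> A. ev u a = b} * card B) = N" by (simp only: N_def)
      thus ?thesis using \<beta>0 by (simp add: \<beta>_def field_simps)
    qed
    thus ?thesis unfolding cnt by (simp add: c_def)
  qed
  have m2: "(\<Sum>a\<in>A. ind u a * ind v a) = N * c\<^sup>2 / \<beta>\<^sup>2" if uv: "u \<in> T" "v \<in> T" "u \<noteq> v" for u v
  proof -
    have "(\<Sum>a\<in>A. ind u a * ind v a) = (\<Sum>a\<in>A. if ev u a \<in> C \<and> ev v a \<in> C then 1 else 0)"
      by (rule sum.cong) (auto simp: ind_def)
    also have "\<dots> = real (card {a \<in> A. ev u a \<in> C \<and> ev v a \<in> C})"
      using fin(1) by (simp add: sum.If_cases Int_def)
    also have "{a \<in> A. ev u a \<in> C \<and> ev v a \<in> C} = (\<Union>(b, b')\<in>C \<times> C. {a \<in> A. ev u a = b \<and> ev v a = b'})" by auto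
    also have "card \<dots> = (\<Sum>(b, b')\<in>C \<times> C. card {a \<in> A. ev u a = b \<and> ev v a = b'})"
      using finC fin(1) by (subst card_UN_disjoint) (auto simp: case_prod_beta)
    also have "real \<dots> = (\<Sum>(b, b')\<in>C \<times> C. N / \<beta>\<^sup>2)"
      unfolding of_nat_sum
    proof (rule sum.cong[OF refl], clarify)
      fix b b' assume bb: "b \<in> C" "b' \<in> C"
      have "card {a \<in> A. ev u a = b \<and> ev v a = b'} * (card B)\<^sup>2 = card A"
        using pairs[OF uv, of b b'] bb C by blast
      hence "real (card {a \<in> A. ev u a = b \<and> ev v a = b'} * (card B)\<^sup>2) = N" by (simp only: N_def)
      thus "real (card {a \<in> A. ev u a = b \<and> ev v a = b'}) = N / \<beta>\<^sup>2" using \<beta>0 by (simp add: \<beta>_def field_simps)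
    qed
    also have "\<dots> = N * c\<^sup>2 / \<beta>\<^sup>2" by (simp add: c_def power2_eq_square card_cartesian_product)
    finally show ?thesis .
  qed
  define \<mu> where "\<mu> = T' * c / \<beta>"
  have EX: "(\<Sum>a\<in>A. hits a) = N * \<mu>"
    unfolding hits_def by (subst sum.swap) (simp add: m1 \<mu>_def T'_def)
  have EX2: "(\<Sum>a\<in>A. (hits a)\<^sup>2) \<le> N * \<mu> + N * \<mu>\<^sup>2"
  proof -
    have "(\<Sum>a\<in>A. (hits a)\<^sup>2) = (\<Sum>a\<in>A. \<Sum>u\<in>T. \<Sum>v\<in>T. ind u a * ind v a)"
      unfolding hits_def power2_eq_square by (simp add: sum_product)
    also have "\<dots> = (\<Sum>u\<in>T. \<Sum>v\<in>T. \<Sum>a\<in>A. ind u a * ind v a)"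
      by (subst sum.swap, rule sum.cong[OF refl], subst sum.swap, rule refl)
    \<comment> \<open>Off the diagonal the terms multiply by pairwise independence; on it an
      indicator equals its square, which contributes the mean.\<close>
    also have "\<dots> \<le> (\<Sum>u\<in>T. \<Sum>v\<in>T. (if u = v then N * c / \<beta> else 0) + N * c\<^sup>2 / \<beta>\<^sup>2)"
    proof (intro sum_mono)
      fix u v assume uv: "u \<in> T" "v \<in> T"
      have "(\<Sum>a\<in>A. ind u a * ind u a) = (\<Sum>a\<in>A. ind u a)" by (rule sum.cong) (auto simp: ind_def)
      moreover have "0 \<le> N * c\<^sup>2 / \<beta>\<^sup>2" by (simp add: N_def)
      ultimately show "(\<Sum>a\<in>A. ind u a * ind v a) \<le> (if u = v then N * c / \<beta> else 0) + N * c\<^sup>2 / \<beta>\<^sup>2"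
        using m1[OF uv(1)] m2[OF uv] by auto
    qed
    also have "\<dots> = T' * (N * c / \<beta>) + T' * (T' * (N * c\<^sup>2 / \<beta>\<^sup>2))"
      using fin(2) by (simp add: sum.distrib T'_def distrib_left)
    also have "\<dots> = N * \<mu> + N * \<mu>\<^sup>2"
      using \<beta>0 by (simp add: \<mu>_def power2_eq_square field_simps)
    finally show ?thesis .
  qed
  \<comment> \<open>Chebyshev at distance \<mu>: a point without hits deviates from the mean by
    exactly \<mu>.\<close>
  have "real (card {a \<in> A. hits a = 0}) * \<mu>\<^sup>2 = (\<Sum>a\<in>{a \<in> A. hits a = 0}. (hits a - \<mu>)\<^sup>2)" by simp
  also have "\<dots> \<le> (\<Sum>a\<in>A. (hits a - \<mu>)\<^sup>2)" using fin(1) by (intro sum_mono2) auto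
  also have "\<dots> = (\<Sum>a\<in>A. (hits a)\<^sup>2 - 2 * \<mu> * hits a + \<mu>\<^sup>2)"
    by (rule sum.cong) (simp_all add: power2_diff)
  also have "\<dots> = (\<Sum>a\<in>A. (hits a)\<^sup>2) - 2 * \<mu> * (\<Sum>a\<in>A. hits a) + N * \<mu>\<^sup>2"
    by (simp add: sum.distrib sum_subtractf sum_distrib_left N_def)
  also have "\<dots> \<le> N * \<mu>" using EX EX2 by (simp add: power2_eq_square algebra_simps)
  finally have 1: "real (card {a \<in> A. hits a = 0}) * \<mu>\<^sup>2 \<le> N * \<mu>" .
  have \<mu>0: "\<mu> > 0" using T0 c0 \<beta>0 by (simp add: \<mu>_def)
  have "real (card {a \<in> A. hits a = 0}) * \<mu> \<le> N"
    using 1 \<mu>0 by (simp add: power2_eq_square mult.assoc[symmetric])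
  hence "real (card {a \<in> A. hits a = 0}) * (T' * c) \<le> N * \<beta>"
    using \<beta>0 by (simp add: \<mu>_def field_simps)
  moreover have "{a \<in> A. hits a = 0} = {a \<in> A. \<forall>u\<in>T. ev u a \<notin> C}"
    using fin(2) by (auto simp: hits_def ind_def sum_nonneg_eq_0_iff)
  ultimately have "real (card {a \<in> A. \<forall>u\<in>T. ev u a \<notin> C} * (card T * card C)) \<le> real (card A * card B)"
    by (simp add: T'_def c_def N_def \<beta>_def)
  thus ?thesis by (simp only: of_nat_le_iff)
qed

section \<open>Values of a random polynomial at two constants\<close>

context rational_function_setup
begin

text \<open>Coefficient functions may have zero leading terms, unlike the normalized lists of
  \<open>F[X]\<close>, so sums are formed pointwise and the bound d stays fixed.\<close>

definition polynomial_value :: "nat \<Rightarrow> (nat \<Rightarrow> 'k) \<Rightarrow> 'k \<Rightarrow> 'k" where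
  "polynomial_value d c x = (\<Oplus>j\<in>{..d}. c j \<otimes> x [^] j)"

lemma polynomial_value_closed: "(\<And>j. c j \<in> F) \<Longrightarrow> x \<in> carrier L \<Longrightarrow> polynomial_value d c x \<in> carrier L"
  unfolding polynomial_value_def using F_carrier by (intro finsum_closed) auto

lemma polynomial_value_add:
  assumes "\<And>j. c j \<in> F" "\<And>j. c' j \<in> F" "x \<in> carrier L"
  shows "polynomial_value d (\<lambda>j. c j \<oplus> c' j) x = polynomial_value d c x \<oplus> polynomial_value d c' x"
proof -
  have "polynomial_value d (\<lambda>j. c j \<oplus> c' j) x = (\<Oplus>j\<in>{..d}. c j \<otimes> x [^] j \<oplus> c' j \<otimes> x [^] j)"
    unfolding polynomial_value_def by (rule finsum_cong') (use assms F_carrier in \<open>auto simp: l_distr\<close>)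
  also have "\<dots> = polynomial_value d c x \<oplus> polynomial_value d c' x"
    unfolding polynomial_value_def by (rule finsum_addf) (use assms F_carrier in auto)
  finally show ?thesis .
qed

lemma polynomial_value_linear:
  assumes "u \<in> F" "m \<in> F" "x \<in> carrier L" "d > 0"
  shows "polynomial_value d (\<lambda>j. if j = 0 then u else if j = 1 then m else \<zero>) x = u \<oplus> m \<otimes> x"
proof -
  have "polynomial_value d (\<lambda>j. if j = 0 then u else if j = 1 then m else \<zero>) x =
      (\<Oplus>j\<in>{..d}. (if 0 = j then u else \<zero>) \<oplus> (if 1 = j then m \<otimes> x else \<zero>))"
    unfolding polynomial_value_def by (rule finsum_cong') (use assms F_carrier in auto)
  also have "\<dots> = (\<Oplus>j\<in>{..d}. if 0 = j then u else \<zero>) \<oplus> (\<Oplus>j\<in>{..d}. if 1 = j then m \<otimes> x else \<zero>)"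
    by (rule finsum_addf) (use assms F_carrier in auto)
  also have "\<dots> = u \<oplus> m \<otimes> x"
    using add.finprod_singleton[of 0 "{..d}" "\<lambda>_. u"] add.finprod_singleton[of 1 "{..d}" "\<lambda>_. m \<otimes> x"] assms F_carrier by simp
  finally show ?thesis .
qed

lemma polynomial_value_inject:
  assumes c: "\<And>j. c j \<in> F" "\<And>j. c' j \<in> F" and e: "polynomial_value d c t = polynomial_value d c' t" and j: "j \<le> d"
  shows "c j = c' j"
proof -
  define g where "g j = c j \<ominus> c' j" for j
  have g: "g j \<in> F" for j using c F_ops by (simp add: g_def a_minus_def)
  have cg: "(\<lambda>j. c' j \<oplus> g j) = c"
  proof
    fix j show "c' j \<oplus> g j = c j" unfolding g_def using F_carrier[OF c(1)[of j]] F_carrier[OF c(2)[of j]] by algebra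
  qed
  have "polynomial_value d c' t = polynomial_value d c' t \<oplus> polynomial_value d g t"
    using polynomial_value_add[where c = c' and c' = g and d = d, OF c(2) g t_carrier] e unfolding cg by simp
  hence "polynomial_value d g t = \<zero>"
    by (rule add_self_cancel[OF polynomial_value_closed[OF c(2) t_carrier] polynomial_value_closed[OF g t_carrier]])
  hence "(\<Oplus>j\<in>{..d}. g j \<otimes> (t \<ominus> \<zero>) [^] j) = \<zero>"
    unfolding polynomial_value_def a_minus_def minus_zero r_zero[OF t_carrier] .
  hence "g j = \<zero>" using shifted_variable_no_relation[where c = g, OF F_ops(1) g _ j] by blast
  thus ?thesis using F_carrier[OF c(1)[of j]] F_carrier[OF c(2)[of j]] by (simp add: g_def)
qed

lemma polys_upto_iff: "x \<in> polys_upto F t d \<longleftrightarrow> (\<exists>c. (\<forall>j. c j \<in> F) \<and> x = polynomial_value d c t)"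
proof
  assume "x \<in> polys_upto F t d"
  then obtain p where p: "p \<in> carrier (F[X])" "Polynomials.degree p \<le> d" "x = eval p t" unfolding polys_upto_def by blast
  have pF: "set p \<subseteq> F" using p(1) by (auto simp: univ_poly_carrier[symmetric] polynomial_def)
  define c where "c j = (if j < length p then rev p ! j else \<zero>)" for j
  have cF: "c j \<in> F" for j using pF nth_mem[of j "rev p"] F_ops by (auto simp: c_def)
  have "p = map c (rev [0..<length p])"
    by (rule nth_equalityI) (auto simp: c_def rev_nth)
  hence "x = (\<Oplus>j\<in>{..<length p}. c j \<otimes> t [^] j)"
    using eval_coeff_list[of "length p" c t] F_carrier[OF cF] t_carrier p(3) by metis
  also have "\<dots> = polynomial_value d c t"
    unfolding polynomial_value_def
  proof (rule add.finprod_mono_neutral_cong_left)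
    show "{..<length p} \<subseteq> {..d}" using p(2) by auto
  qed (use F_carrier[OF cF] t_carrier in \<open>auto simp: c_def\<close>)
  finally show "\<exists>c. (\<forall>j. c j \<in> F) \<and> x = polynomial_value d c t" using cF by blast
next
  assume "\<exists>c. (\<forall>j. c j \<in> F) \<and> x = polynomial_value d c t"
  then obtain c where c: "\<And>j. c j \<in> F" "x = polynomial_value d c t" by blast
  define l where "l = normalize (map c (rev [0..<Suc d]))"
  have "polynomial F l" unfolding l_def by (rule normalize_gives_polynomial) (use c in auto)
  hence "l \<in> carrier (F[X])" by (simp add: univ_poly_carrier)
  moreover have "Polynomials.degree l \<le> d"
    using normalize_length_le[of "map c (rev [0..<Suc d])"] by (simp add: l_def)
  moreover have "eval l t = x"
  proof -
    have "eval l t = eval (map c (rev [0..<Suc d])) t"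
      unfolding l_def by (rule eval_normalize) (use F_carrier[OF c(1)] t_carrier in auto)
    thus ?thesis using eval_coeff_list[of "Suc d" c t] F_carrier[OF c(1)] t_carrier c(2)
      by (simp add: polynomial_value_def lessThan_Suc_atMost)
  qed
  ultimately show "x \<in> polys_upto F t d" unfolding polys_upto_def by blast
qed

definition value_at :: "nat \<Rightarrow> 'k \<Rightarrow> 'k \<Rightarrow> 'k" where
  "value_at d \<tau> x = (THE y. \<exists>c. (\<forall>j. c j \<in> F) \<and> x = polynomial_value d c t \<and> y = polynomial_value d c \<tau>)"

lemma value_at_polynomial_value:
  assumes "\<And>j. c j \<in> F" "\<tau> \<in> F"
  shows "value_at d \<tau> (polynomial_value d c t) = polynomial_value d c \<tau>"
  unfolding value_at_def
proof (rule the_equality)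
  show "\<exists>c'. (\<forall>j. c' j \<in> F) \<and> polynomial_value d c t = polynomial_value d c' t \<and> polynomial_value d c \<tau> = polynomial_value d c' \<tau>"
    using assms by blast
next
  fix y assume "\<exists>c'. (\<forall>j. c' j \<in> F) \<and> polynomial_value d c t = polynomial_value d c' t \<and> y = polynomial_value d c' \<tau>"
  then obtain c' where c': "\<And>j. c' j \<in> F" "polynomial_value d c t = polynomial_value d c' t" "y = polynomial_value d c' \<tau>" by blast
  have "c' j = c j" if "j \<le> d" for j using polynomial_value_inject[OF c'(1) assms(1) c'(2)[symmetric] that] .
  thus "y = polynomial_value d c \<tau>" unfolding c'(3) polynomial_value_def
    using F_carrier[OF assms(1)] F_carrier[OF assms(2)] by (intro finsum_cong') auto
qed

lemma value_at_specializes: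
  assumes "x \<in> polys_upto F t d" "\<tau> \<in> F" shows "specializes \<tau> x (value_at d \<tau> x)"
proof -
  obtain c where "\<And>j. c j \<in> F" "x = polynomial_value d c t" using assms(1) polys_upto_iff by blast
  thus ?thesis using value_at_polynomial_value[of c \<tau> d] assms(2) unfolding specializes_def polynomial_value_def by auto
qed

lemma polys_upto_closed: "x \<in> polys_upto F t d \<Longrightarrow> x \<in> carrier L"
  using polynomial_value_closed t_carrier by (auto simp: polys_upto_iff)

lemma polys_upto_add:
  assumes "x \<in> polys_upto F t d" "y \<in> polys_upto F t d" "\<tau> \<in> F"
  shows "x \<oplus> y \<in> polys_upto F t d" "value_at d \<tau> (x \<oplus> y) = value_at d \<tau> x \<oplus> value_at d \<tau> y"
proof -
  obtain c c' where c: "\<And>j. c j \<in> F" "x = polynomial_value d c t" "\<And>j. c' j \<in> F" "y = polynomial_value d c' t"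
    using assms(1,2) polys_upto_iff by metis
  have cc: "c j \<oplus> c' j \<in> F" for j using c F_ops by simp
  have xy: "x \<oplus> y = polynomial_value d (\<lambda>j. c j \<oplus> c' j) t"
    using polynomial_value_add[OF c(1,3) t_carrier] c by simp
  show "x \<oplus> y \<in> polys_upto F t d" unfolding polys_upto_iff xy
    using cc by (intro exI[of _ "\<lambda>j. c j \<oplus> c' j"] conjI allI refl)
  show "value_at d \<tau> (x \<oplus> y) = value_at d \<tau> x \<oplus> value_at d \<tau> y"
    unfolding xy unfolding c(2,4) value_at_polynomial_value[OF cc assms(3)] value_at_polynomial_value[OF c(1) assms(3)]
      value_at_polynomial_value[OF c(3) assms(3)]
    by (rule polynomial_value_add[OF c(1,3) F_carrier[OF assms(3)]])
qed

text \<open>The line through the two prescribed values. Its degree is one, which is where d > 0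
  enters.\<close>

lemma polys_upto_interpolate:
  assumes d: "d > 0" and \<tau>: "\<tau> \<in> F" "\<tau>' \<in> F" "\<tau> \<noteq> \<tau>'" and y: "y \<in> F" "y' \<in> F"
  shows "\<exists>x\<in>polys_upto F t d. value_at d \<tau> x = y \<and> value_at d \<tau>' x = y'"
proof -
  note car = F_carrier[OF \<tau>(1)] F_carrier[OF \<tau>(2)] F_carrier[OF y(1)] F_carrier[OF y(2)]
  have nz: "\<tau>' \<ominus> \<tau> \<noteq> \<zero>" using \<tau> car by auto
  have D: "\<tau>' \<ominus> \<tau> \<in> F" using \<tau> F_ops by (simp add: a_minus_def)
  let ?i = "inv (\<tau>' \<ominus> \<tau>)"
  have iF: "?i \<in> F" using subfield_m_inv(1)[OF constants, of "\<tau>' \<ominus> \<tau>"] D nz by auto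
  have i1: "?i \<otimes> (\<tau>' \<ominus> \<tau>) = \<one>" using nz F_carrier[OF D] field_Units by auto
  define m where "m = (y' \<ominus> y) \<otimes> ?i"
  define u where "u = y \<ominus> m \<otimes> \<tau>"
  have mF: "m \<in> F" using y iF F_ops by (simp add: m_def a_minus_def)
  have uF: "u \<in> F" using y mF \<tau> F_ops by (simp add: u_def a_minus_def)
  note mL = F_carrier[OF mF]
  let ?c = "\<lambda>j::nat. if j = 0 then u else if j = 1 then m else \<zero>"
  have cF: "?c j \<in> F" for j using uF mF F_ops by simp
  have 1: "value_at d \<tau> (polynomial_value d ?c t) = y"
    unfolding value_at_polynomial_value[OF cF \<tau>(1)] polynomial_value_linear[OF uF mF car(1) d] unfolding u_def using car mL by algebra
  have "m \<otimes> (\<tau>' \<ominus> \<tau>) = (y' \<ominus> y) \<otimes> (?i \<otimes> (\<tau>' \<ominus> \<tau>))"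
    unfolding m_def using car F_carrier[OF iF] by algebra
  hence mm: "m \<otimes> (\<tau>' \<ominus> \<tau>) = y' \<ominus> y" using i1 car by simp
  have "u \<oplus> m \<otimes> \<tau>' = y \<oplus> m \<otimes> (\<tau>' \<ominus> \<tau>)" unfolding u_def using car mL by algebra
  also have "\<dots> = y'" unfolding mm using car by algebra
  finally have 2: "value_at d \<tau>' (polynomial_value d ?c t) = y'"
    unfolding value_at_polynomial_value[OF cF \<tau>(2)] polynomial_value_linear[OF uF mF car(2) d] .
  have "polynomial_value d ?c t \<in> polys_upto F t d"
    unfolding polys_upto_iff using cF by (intro exI[of _ ?c] conjI allI refl)
  thus ?thesis using 1 2 by blast
qed

lemma finite_polys_upto: "finite (polys_upto F t d)"
proof -
  have "polys_upto F t d \<subseteq> (\<lambda>c. polynomial_value d c t) ` ({..d} \<rightarrow>\<^sub>E F)"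
  proof
    fix x assume "x \<in> polys_upto F t d"
    then obtain c where c: "\<And>j. c j \<in> F" "x = polynomial_value d c t" using polys_upto_iff by blast
    have "x = polynomial_value d (restrict c {..d}) t"
      unfolding c(2) polynomial_value_def using F_carrier[OF c(1)] t_carrier by (intro finsum_cong') auto
    thus "x \<in> (\<lambda>c. polynomial_value d c t) ` ({..d} \<rightarrow>\<^sub>E F)" using c(1) by (intro image_eqI) (auto split: if_splits)
  qed
  thus ?thesis by (rule finite_subset) (use card_constants in \<open>auto intro: finite_PiE\<close>)
qed

text \<open>Adding a polynomial with suitable values at the two points maps one fiber injectively
  into another, so all q^2 fibers have the same size.\<close>

lemma card_value_fiber:
  assumes d: "d > 0" and \<tau>: "\<tau> \<in> F" "\<tau>' \<in> F" "\<tau> \<noteq> \<tau>'" and y: "y \<in> F" "y' \<in> F"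
  shows "card {x \<in> polys_upto F t d. value_at d \<tau> x = y \<and> value_at d \<tau>' x = y'} * q\<^sup>2 = card (polys_upto F t d)"
proof -
  let ?P = "polys_upto F t d"
  let ?S = "\<lambda>y y'. {x \<in> ?P. value_at d \<tau> x = y \<and> value_at d \<tau>' x = y'}"
  have le: "card (?S y y') \<le> card (?S z z')" if m: "y \<in> F" "y' \<in> F" "z \<in> F" "z' \<in> F" for y y' z z'
  proof -
    have zy: "z \<ominus> y \<in> F" "z' \<ominus> y' \<in> F" using m F_ops by (auto simp: a_minus_def)
    obtain l where l: "l \<in> ?P" "value_at d \<tau> l = z \<ominus> y" "value_at d \<tau>' l = z' \<ominus> y'"
      using polys_upto_interpolate[OF d \<tau> zy] by blast
    have r: "y \<oplus> (z \<ominus> y) = z" "y' \<oplus> (z' \<ominus> y') = z'"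
      using F_carrier[OF m(1)] F_carrier[OF m(2)] F_carrier[OF m(3)] F_carrier[OF m(4)] by algebra+
    show ?thesis
    proof (rule card_inj_on_le[where f = "\<lambda>x. x \<oplus> l"])
      show "inj_on (\<lambda>x. x \<oplus> l) (?S y y')"
      proof (rule inj_onI)
        fix x x' assume m: "x \<in> ?S y y'" "x' \<in> ?S y y'" and e: "x \<oplus> l = x' \<oplus> l"
        have car: "x \<in> carrier L" "x' \<in> carrier L" "l \<in> carrier L" using m polys_upto_closed l(1) by auto
        have "x = (x \<oplus> l) \<ominus> l" using car by algebra
        also have "\<dots> = x'" unfolding e using car by algebra
        finally show "x = x'" .
      qed
      show "(\<lambda>x. x \<oplus> l) ` ?S y y' \<subseteq> ?S z z'"
        using polys_upto_add[OF _ l(1) \<tau>(1)] polys_upto_add[OF _ l(1) \<tau>(2)] l(2,3) r by auto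
    qed (use finite_polys_upto in auto)
  qed
  have eq: "card (?S z z') = card (?S y y')" if "z \<in> F" "z' \<in> F" for z z'
    using le[OF y that] le[OF that y] by simp
  have valF: "value_at d u x \<in> F" if "x \<in> ?P" "u \<in> F" for x u
    using specializes_in_F[OF that(2) value_at_specializes[OF that]] .
  have "?P = (\<Union>(z, z')\<in>F \<times> F. ?S z z')" using valF \<tau> by auto
  hence "card ?P = card (\<Union>(z, z')\<in>F \<times> F. ?S z z')" by simp
  also have "\<dots> = (\<Sum>(z, z')\<in>F \<times> F. card (?S z z'))"
    using card_constants finite_polys_upto by (subst card_UN_disjoint) (auto simp: case_prod_beta)
  also have "\<dots> = (\<Sum>(z, z')\<in>F \<times> F. card (?S y y'))"
    by (rule sum.cong) (auto simp: eq)
  also have "\<dots> = card (?S y y') * q\<^sup>2" using card_constants by (simp add: card_cartesian_product power2_eq_square)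
  finally show ?thesis by simp
qed

end

section \<open>Probability estimates\<close>

context rational_function_setup
begin

context
  fixes d n :: nat
  assumes d: "d > 0" and n: "n > 0"
begin

abbreviation (input) "coefficient_vectors \<equiv> PiE_dflt {..<n} \<zero> (\<lambda>_. polys_upto F t d)"

definition values_at :: "'k \<Rightarrow> (nat \<Rightarrow> 'k) \<Rightarrow> nat \<Rightarrow> 'k" where
  "values_at \<tau> a i = (if i < n then value_at d \<tau> (a i) else \<zero>)"

lemma zero_in_polys_upto: "\<zero> \<in> polys_upto F t d"
proof -
  have "polynomial_value d (\<lambda>j. \<zero>) t = (\<Oplus>j\<in>{..d}. \<zero>)"
    unfolding polynomial_value_def by (rule finsum_cong') (use t_carrier in auto)
  hence "\<zero> = polynomial_value d (\<lambda>j. \<zero>) t" by simp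
  thus ?thesis unfolding polys_upto_iff using F_ops(1) by (intro exI[of _ "\<lambda>_. \<zero>"] conjI allI)
qed

lemma finite_coefficient_vectors: "finite coefficient_vectors"
  using finite_polys_upto by (intro finite_PiE_dflt) auto

lemma random_coeffs_eq: "random_coeffs F t d n = pmf_of_set coefficient_vectors"
  unfolding random_coeffs_def
  by (rule Pi_pmf_of_set) (use finite_polys_upto zero_in_polys_upto in auto)

lemma coefficient_vectors_nonempty: "coefficient_vectors \<noteq> {}"
  using zero_in_polys_upto by (auto simp: PiE_dflt_def intro!: exI[of _ "\<lambda>_. \<zero>"])

lemma coefficient_vectors_D: "a \<in> coefficient_vectors \<Longrightarrow> i < n \<Longrightarrow> a i \<in> polys_upto F t d"
  by (auto simp: PiE_dflt_def)

lemma values_at_vectors: "a \<in> coefficient_vectors \<Longrightarrow> \<tau> \<in> F \<Longrightarrow> values_at \<tau> a \<in> vectors n"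
  using specializes_in_F[OF _ value_at_specializes] by (auto simp: PiE_dflt_def values_at_def)

text \<open>Values are taken coordinate by coordinate, so a fiber is a product of n fibers for
  single polynomials. This is the pairwise independence and uniformity of the specialized
  vectors.\<close>

lemma card_values_fiber:
  assumes \<tau>: "\<tau> \<in> F" "\<tau>' \<in> F" "\<tau> \<noteq> \<tau>'" and b: "b \<in> vectors n" "b' \<in> vectors n"
  shows "card {a \<in> coefficient_vectors. values_at \<tau> a = b \<and> values_at \<tau>' a = b'} * (card (vectors n))\<^sup>2 = card coefficient_vectors"
proof -
  let ?S = "\<lambda>i. {x \<in> polys_upto F t d. value_at d \<tau> x = b i \<and> value_at d \<tau>' x = b' i}"
  have "{a \<in> coefficient_vectors. values_at \<tau> a = b \<and> values_at \<tau>' a = b'} = PiE_dflt {..<n} \<zero> ?S"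
  proof (intro equalityI subsetI)
    fix a assume a: "a \<in> {a \<in> coefficient_vectors. values_at \<tau> a = b \<and> values_at \<tau>' a = b'}"
    hence "b i = value_at d \<tau> (a i) \<and> b' i = value_at d \<tau>' (a i)" if "i < n" for i
      using that by (auto simp: values_at_def)
    thus "a \<in> PiE_dflt {..<n} \<zero> ?S" using a by (simp add: PiE_dflt_def)
  next
    fix a assume a: "a \<in> PiE_dflt {..<n} \<zero> ?S"
    have "values_at \<tau> a = b" "values_at \<tau>' a = b'"
      using a b by (auto simp: values_at_def PiE_dflt_def fun_eq_iff)
    thus "a \<in> {a \<in> coefficient_vectors. values_at \<tau> a = b \<and> values_at \<tau>' a = b'}"
      using a by (simp add: PiE_dflt_def)
  qed
  hence "card {a \<in> coefficient_vectors. values_at \<tau> a = b \<and> values_at \<tau>' a = b'} = (\<Prod>i<n. card (?S i))"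
    using finite_polys_upto by (simp add: card_PiE_dflt)
  moreover have "(card (vectors n))\<^sup>2 = (\<Prod>i<n. q\<^sup>2)"
    by (simp add: card_vectors power_mult[symmetric] mult.commute)
  moreover have "card coefficient_vectors = (\<Prod>i<n. card (polys_upto F t d))"
    using finite_polys_upto by (subst card_PiE_dflt) auto
  moreover have "(\<Prod>i<n. card (?S i)) * (\<Prod>i<n. q\<^sup>2) = (\<Prod>i<n. card (polys_upto F t d))"
    unfolding prod.distrib[symmetric]
    by (rule prod.cong[OF refl], rule card_value_fiber[OF d \<tau>]) (use b vectors_D in auto)
  ultimately show ?thesis by simp
qed

text \<open>Here \<delta> bounds the proportion of good vectors from below. The expected number of
  hits among the q constants is at least q \<delta>, and the second moment method bounds the
  probability of no hit by the inverse of this mean.\<close>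

lemma prob_all_specializations_avoid:
  fixes \<delta> :: real
  assumes C: "C \<subseteq> vectors n" and N: "real (card C) \<ge> \<delta> * q ^ n" and \<delta>: "\<delta> > 0"
  shows "measure_pmf.prob (random_coeffs F t d n) {a \<in> coefficient_vectors. \<forall>\<tau>\<in>F. values_at \<tau> a \<notin> C} \<le> 1 / (q * \<delta>)"
proof -
  let ?A = coefficient_vectors
  let ?S = "{a \<in> ?A. \<forall>\<tau>\<in>F. values_at \<tau> a \<notin> C}"
  have fA: "finite ?A" by (rule finite_coefficient_vectors)
  have A0: "card ?A > 0" using fA coefficient_vectors_nonempty card_gt_0_iff by blast
  have q0: "real q > 0" using q_ge_2 by simp
  have "card ?S * (card F * card C) \<le> card ?A * card (vectors n)"
    by (rule second_moment_count[where ev = values_at])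
      (use fA card_constants finite_vectors C values_at_vectors q_ge_2 card_values_fiber in auto)
  hence "real (card ?S * (q * card C)) \<le> real (card ?A * q ^ n)"
    unfolding card_vectors card_constants(2) of_nat_le_iff .
  hence 1: "real (card ?S) * real q * real (card C) \<le> real (card ?A) * real q ^ n" by (simp add: mult.assoc)
  have "real (card ?S) * real q * (\<delta> * real q ^ n) \<le> real (card ?S) * real q * real (card C)"
    using N by (intro mult_left_mono) auto
  with 1 have "(real (card ?S) * real q * \<delta>) * real q ^ n \<le> real (card ?A) * real q ^ n" by (simp add: mult.assoc)
  hence 2: "real (card ?S) * real q * \<delta> \<le> real (card ?A)" using q0 by simp
  have "measure_pmf.prob (random_coeffs F t d n) ?S = real (card (?A \<inter> ?S)) / card ?A"
    unfolding random_coeffs_eq using measure_pmf_of_set[OF coefficient_vectors_nonempty fA] by simp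
  also have "?A \<inter> ?S = ?S" by auto
  also have "real (card ?S) / card ?A \<le> 1 / (q * \<delta>)"
    using 2 A0 q0 \<delta> by (simp add: field_simps)
  finally show ?thesis .
qed

lemma galois_group_is_GL_if_specializations:
  assumes q: "q > 5" and a: "a \<in> coefficient_vectors"
    and 1: "\<tau> \<in> F" "singer_type n (values_at \<tau> a)"
    and 2: "n \<noteq> 1 \<Longrightarrow> \<exists>\<tau>'\<in>F. split_type n (values_at \<tau>' a)"
  shows "galois_group_is_GL K F q n a"
proof -
  have sp: "\<forall>i<n. specializes u (a i) (values_at u a i)" if "u \<in> F" for u
    using value_at_specializes[OF coefficient_vectors_D[OF a] that] by (simp add: values_at_def)
  have aK: "a i \<in> K" if "i < n" for i using specializes_in_K sp[OF 1(1)] that by blast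
  have "values_at \<tau> a 0 \<noteq> \<zero>" using 1(2) by (simp add: singer_type_def)
  hence a0: "a 0 \<noteq> \<zero>" using specializes_nonzero[OF 1(1)] sp[OF 1(1)] n by blast
  show ?thesis
  proof (cases "n = 1")
    case True
    show ?thesis by (rule galois_group_is_GL_line[OF aK a0 n 1(1) sp[OF 1(1)] 1(2) True])
  next
    case False
    then obtain \<tau>' where \<tau>': "\<tau>' \<in> F" "split_type n (values_at \<tau>' a)" using 2 by blast
    show ?thesis
      by (rule galois_group_is_GL_split[OF aK a0 n q 1(1) sp[OF 1(1)] 1(2) \<tau>'(1) sp[OF \<tau>'(1)] \<tau>'(2)])
  qed
qed

theorem prob_galois_group_is_GL_ge:
  assumes q: "q > 5"
  shows "measure_pmf.prob (random_coeffs F t d n) {a. galois_group_is_GL K F q n a}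
    \<ge> 1 - 6 * real n ^ 2 * (real n * log 2 q + 1) / q"
proof -
  let ?A = coefficient_vectors
  let ?pr = "measure_pmf.prob (random_coeffs F t d n)"
  define l where "l = real n * log 2 q + 1"
  define C1 where "C1 = {b \<in> vectors n. singer_type n b}"
  define C2 where "C2 = {b \<in> vectors n. split_type n b}"
  define S1 where "S1 = {a \<in> ?A. \<forall>\<tau>\<in>F. values_at \<tau> a \<notin> C1}"
  \<comment> \<open>For n = 1 no element of the second kind is called for, so nothing can fail
    there.\<close>
  define S2 where "S2 = (if n = 1 then {} else {a \<in> ?A. \<forall>\<tau>\<in>F. values_at \<tau> a \<notin> C2})"
  have q0: "real q > 0" "real q \<ge> 2" using q by auto
  have lq: "log 2 (real q) > 0" using q by simp
  have l0: "l > 0" using lq n by (simp add: l_def add_pos_nonneg)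
  \<comment> \<open>For all m up to n, l is an upper bound of log 2 (q^m - 1) + 1; the factor 1/2
    accounts for the -1 in q^m - 1.\<close>
  have tot: "real (totient (q ^ m - 1)) \<ge> real q ^ m / 2 / l" if m: "m > 0" "m \<le> n" for m
  proof -
    have qm: "q ^ m \<ge> q" using m q self_le_power[of q m] by simp
    let ?N = "q ^ m - 1"
    have N0: "?N > 0" using qm q by simp
    have N1: "real ?N > 0" using N0 by (simp only: of_nat_0_less_iff)
    have N2: "real ?N \<le> real (q ^ m)" unfolding of_nat_le_iff by simp
    have "log 2 (real ?N) \<le> log 2 (real (q ^ m))" by (rule log_mono[OF _ N1 N2]) simp
    also have "\<dots> = real m * log 2 q" using q by (simp add: log_nat_power)
    also have "\<dots> \<le> real n * log 2 q" using m lq by (intro mult_right_mono) auto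
    finally have "log 2 (real ?N) + 1 \<le> l" by (simp add: l_def)
    hence "real ?N \<le> real (totient ?N) * l"
      using totient_ge[OF N0] by (smt (verit) mult_left_mono of_nat_0_le_iff)
    moreover have "real q ^ m / 2 \<le> real ?N"
    proof -
      have "real (q ^ m) \<ge> 2" using qm q by (metis le_trans nat_less_le numeral_le_real_of_nat_iff q_ge_2)
      thus ?thesis using N0 by (simp add: of_nat_diff)
    qed
    ultimately have "real q ^ m / 2 \<le> real (totient ?N) * l" by linarith
    thus ?thesis using l0 by (simp add: pos_divide_le_eq)
  qed
  have n0: "real n > 0" using n by simp
  have p1: "?pr S1 \<le> 2 * real n * l / q"
  proof -
    have "real (totient (q ^ n - 1)) \<le> real (n * card C1)"
      unfolding of_nat_le_iff C1_def by (rule card_singer_type_ge[OF n])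
    hence "real q ^ n / 2 / l \<le> real n * real (card C1)" using tot[OF n order_refl] by simp
    \<comment> \<open>The proportion of the first kind: n for the roots of one polynomial, 2 l from
      the totient bound.\<close>
    hence N: "1 / (2 * real n * l) * q ^ n \<le> real (card C1)" using l0 n0 by (simp add: field_simps)
    have "?pr S1 \<le> 1 / (q * (1 / (2 * real n * l)))"
      unfolding S1_def by (rule prob_all_specializations_avoid[OF _ N]) (use l0 n0 in \<open>auto simp: C1_def\<close>)
    thus ?thesis by (simp add: field_simps)
  qed
  have p2: "?pr S2 \<le> 4 * real n ^ 2 * l / q"
  proof (cases "n = 1")
    case True
    thus ?thesis using l0 q0 by (simp add: S2_def)
  next
    case False
    then obtain m where m: "n = Suc m" "m > 0" using n by (cases n) auto
    have "real ((q - 1) * totient (q ^ m - 1)) \<le> real (n\<^sup>2 * card C2)"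
      unfolding of_nat_le_iff C2_def m(1) by (rule card_split_type_ge[OF m(2)]) (use q in simp)
    hence 1: "(real q - 1) * real (totient (q ^ m - 1)) \<le> real n ^ 2 * real (card C2)"
      using q by (simp add: of_nat_diff)
    have "real q / 2 * (real q ^ m / 2 / l) \<le> (real q - 1) * real (totient (q ^ m - 1))"
      by (rule mult_mono) (use tot[of m] m q0 l0 in auto)
    with 1 have "real q / 2 * (real q ^ m / 2 / l) \<le> real n ^ 2 * real (card C2)" by linarith
    hence "real q ^ n / (4 * l) \<le> real n ^ 2 * real (card C2)" by (simp add: m(1))
    \<comment> \<open>The proportion of the second kind: n^2 for pairs of roots, 2 l from the
      totient bound, and another 2 because q - 1 is at least q / 2.\<close>
    hence N: "1 / (4 * real n ^ 2 * l) * q ^ n \<le> real (card C2)" using l0 n0 by (simp add: field_simps)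
    have "?pr {a \<in> ?A. \<forall>\<tau>\<in>F. values_at \<tau> a \<notin> C2} \<le> 1 / (q * (1 / (4 * real n ^ 2 * l)))"
      by (rule prob_all_specializations_avoid[OF _ N]) (use l0 n0 in \<open>auto simp: C2_def\<close>)
    thus ?thesis using False by (simp add: S2_def field_simps)
  qed
  have sub: "?A - S1 - S2 \<subseteq> {a. galois_group_is_GL K F q n a}"
  proof
    fix a assume a: "a \<in> ?A - S1 - S2"
    hence aA: "a \<in> ?A" by blast
    obtain \<tau> where \<tau>: "\<tau> \<in> F" "values_at \<tau> a \<in> C1" using a by (auto simp: S1_def)
    have "\<exists>\<tau>'\<in>F. split_type n (values_at \<tau>' a)" if "n \<noteq> 1"
      using a that by (auto simp: S2_def C2_def)
    thus "a \<in> {a. galois_group_is_GL K F q n a}"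
      using galois_group_is_GL_if_specializations[OF q aA \<tau>(1)] \<tau>(2) by (simp add: C1_def)
  qed
  have A1: "?pr ?A = 1"
    unfolding random_coeffs_eq
    using measure_pmf_of_set[OF coefficient_vectors_nonempty finite_coefficient_vectors, of coefficient_vectors]
      finite_coefficient_vectors coefficient_vectors_nonempty by simp
  have "?pr ?A \<le> ?pr ((?A - S1 - S2) \<union> (S1 \<union> S2))" by (rule measure_pmf.finite_measure_mono) auto
  also have "\<dots> \<le> ?pr (?A - S1 - S2) + ?pr (S1 \<union> S2)" by (rule measure_subadditive) (auto simp: measure_pmf.emeasure_eq_measure)
  also have "\<dots> \<le> ?pr (?A - S1 - S2) + (?pr S1 + ?pr S2)"
    by (intro add_left_mono measure_subadditive) (auto simp: measure_pmf.emeasure_eq_measure)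
  finally have "1 - (?pr S1 + ?pr S2) \<le> ?pr (?A - S1 - S2)" using A1 by simp
  also have "\<dots> \<le> ?pr {a. galois_group_is_GL K F q n a}"
    by (rule measure_pmf.finite_measure_mono[OF sub]) simp
  finally have "1 - (?pr S1 + ?pr S2) \<le> ?pr {a. galois_group_is_GL K F q n a}" .
  \<comment> \<open>The constant 6 is 2 + 4, since n is at most n^2.\<close>
  moreover have "2 * real n * l / q + 4 * real n ^ 2 * l / q \<le> 6 * real n ^ 2 * l / q"
  proof -
    have "real n \<le> real n ^ 2" using n self_le_power[of "real n" 2] by simp
    hence "2 * real n * l \<le> 2 * real n ^ 2 * l" using l0 by (intro mult_right_mono) auto
    hence "2 * real n * l + 4 * real n ^ 2 * l \<le> 6 * real n ^ 2 * l" by linarith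
    thus ?thesis using q0 by (simp add: divide_right_mono add_divide_distrib[symmetric])
  qed
  ultimately show ?thesis using p1 p2 unfolding l_def by linarith
qed

end

end

theorem theorem10p3:
  fixes d n :: nat
    and L :: "nat \<Rightarrow> 'k ring" and K F :: "nat \<Rightarrow> 'k set" and t :: "nat \<Rightarrow> 'k"
  assumes "d > 0" and "n > 0"
    and "\<And>q. primepow q \<Longrightarrow> rational_function_field_closure (L q) (K q) (F q) (t q) q"
  shows "((\<lambda>q. measure_pmf.prob (ring.random_coeffs (L q) (F q) (t q) d n)
                 {a. ring.galois_group_is_GL (L q) (K q) (F q) q n a}) \<longlongrightarrow> 1)
           (inf sequentially (principal {q. primepow q}))"
proof (rule tendsto_sandwich)
  \<comment> \<open>The bound involves only n and q, so it is uniform over all choices of the fields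
    and of t; the finitely many q up to 5 do not affect the limit.\<close>
  let ?\<epsilon> = "\<lambda>q::nat. 1 - 6 * real n ^ 2 * (real n * log 2 q + 1) / q"
  have "?\<epsilon> \<longlonglongrightarrow> 1" by real_asymp
  thus "(?\<epsilon> \<longlongrightarrow> 1) (inf sequentially (principal {q. primepow q}))" by (rule tendsto_mono[OF inf_le1])
  show "\<forall>\<^sub>F q in inf sequentially (principal {q. primepow q}).
      ?\<epsilon> q \<le> measure_pmf.prob (ring.random_coeffs (L q) (F q) (t q) d n) {a. ring.galois_group_is_GL (L q) (K q) (F q) q n a}"
    unfolding eventually_inf_principal
  proof (rule eventually_mono[OF eventually_gt_at_top[of 5]], intro impI)
    fix q :: nat assume q: "q > 5" "q \<in> {q. primepow q}"
    then obtain p e where pe: "prime p" "q = p ^ e" by (auto simp: primepow_def)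
    interpret rational_function_setup "L q" "K q" "F q" "t q" q p e
      by (rule rational_function_setup.intro[OF assms(3)]) (use q pe in \<open>auto intro: rational_function_setup_axioms.intro\<close>)
    show "?\<epsilon> q \<le> measure_pmf.prob (ring.random_coeffs (L q) (F q) (t q) d n) {a. ring.galois_group_is_GL (L q) (K q) (F q) q n a}"
      by (rule prob_galois_group_is_GL_ge[OF assms(1,2) q(1)])
  qed
qed (auto intro!: always_eventually measure_pmf.prob_le_1)

end
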